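(* Let $N\ge3$ and $k>0$. Suppose that $V$ satisfies $(V)$ and $f$ satisfies $(f_2)$ and $(f_3)$ (conditions listed in the context). If $f$ is odd, then the equation $$-\Delta u+V(x)u+\frac{k}{2}\Delta(u^2)u=f(u)\quad\text{in }\mathbb{R}^N$$ has a sequence of solutions $\{u_n\}$ such that $\mathcal{I}(u_n)\to\infty$ as $n\to\infty$, where $$\mathcal{I}(u)=\frac12\int_{\mathbb{R}^N}\left((1-ku^2)|\nabla u|^2+V(x)u^2\right)-\int_{\mathbb{R}^N}F(u),\qquad F(t)=\int_0^tf(s)\,ds.$$
   Context: Conditions on $V:\mathbb{R}^N\to\mathbb{R}$ and $f:\mathbb{R}\to\mathbb{R}$, with $F(t)=\int_0^t f(s)\,ds$ and $2^*=\frac{2N}{N-2}$: $(V)$ $V\in C(\mathbb{R}^N)$, $\inf_{\mathbb{R}^N}V>-\infty$, and $\lim_{|x|\to\infty}V(x)=+\infty$. $(f_2)$ $f\in C(\mathbb{R})$ and $\limsup_{|s|\to\infty}\frac{|f(s)|}{|s|^{p-1}}=0$ for some $p\in(2,2^* )$. $(f_3)$ There exists $\mu>\frac83$ such that $0<\mu F(s)\le s f(s)$ for all $s\ne0$. Space: $E=\{u\in H^1(\mathbb{R}^N):\int_{\mathbb{R}^N}V(x)u^2<\infty\}$. Solutions: a (weak) solution of the equation is a function $u\in E$ with $\int_{\mathbb{R}^N}u^2|\nabla u|^2<\infty$ such that for all $\varphi\in C_c^\infty(\mathbb{R}^N)$ $$\int_{\mathbb{R}^N}\left[(1-ku^2)\nabla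 u\cdot\nabla\varphi-ku|\nabla u|^2\varphi+V(x)u\varphi\right]=\int_{\mathbb{R}^N}f(u)\varphi.$$ *)

theory Defs
  imports "HOL-Analysis.Analysis"
begin

text \<open>Euclidean space of dimension \<open>N\<close> is \<^typ>\<open>real ^ 'n\<close> with \<open>N = CARD('n)\<close>. Elements of Lebesgue
  and Sobolev spaces are represented by functions; two representatives that agree almost everywhere
  stand for the same element.\<close>

definition grad :: "(real ^ 'n \<Rightarrow> real) \<Rightarrow> real ^ 'n \<Rightarrow> real ^ 'n" where
  "grad \<phi> x = (\<chi> i. frechet_derivative \<phi> (at x) (axis i 1))"

primrec Ck :: "nat \<Rightarrow> (real ^ 'n \<Rightarrow> real) \<Rightarrow> bool" where
  "Ck 0 \<phi> \<longleftrightarrow> continuous_on UNIV \<phi>"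
| "Ck (Suc m) \<phi> \<longleftrightarrow> (\<forall>x. \<phi> differentiable (at x)) \<and> (\<forall>i. Ck m (\<lambda>x. grad \<phi> x $ i))"

definition test_functions :: "(real ^ 'n \<Rightarrow> real) set" where
  "test_functions = {\<phi>. (\<forall>m. Ck m \<phi>) \<and> compact (closure {x. \<phi> x \<noteq> 0})}"

definition L2 :: "(real ^ 'n \<Rightarrow> 'b::euclidean_space) set" where
  "L2 = {u \<in> borel_measurable lebesgue. integrable lebesgue (\<lambda>x. (norm (u x))\<^sup>2)}"

definition locally_integrable :: "(real ^ 'n \<Rightarrow> 'b::euclidean_space) \<Rightarrow> bool" where
  "locally_integrable u \<longleftrightarrow> (\<forall>K. compact K \<longrightarrow> set_integrable lebesgue K u)"

definition has_weak_gradient :: "(real ^ 'n \<Rightarrow> real) \<Rightarrow> (real ^ 'n \<Rightarrow> real ^ 'n) \<Rightarrow> bool" where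
  "has_weak_gradient u g \<longleftrightarrow> locally_integrable u \<and> locally_integrable g \<and>
     (\<forall>\<phi>\<in>test_functions. \<forall>i.
        (LINT x|lebesgue. u x * (grad \<phi> x $ i)) = - (LINT x|lebesgue. (g x $ i) * \<phi> x))"

text \<open>The weak gradient is unique up to a null set, so the choice does not affect any integral
  below.\<close>

definition weak_grad :: "(real ^ 'n \<Rightarrow> real) \<Rightarrow> real ^ 'n \<Rightarrow> real ^ 'n" where
  "weak_grad u = (SOME g. has_weak_gradient u g)"

definition H1 :: "(real ^ 'n \<Rightarrow> real) set" where
  "H1 = {u \<in> L2. \<exists>g\<in>L2. has_weak_gradient u g}"

text \<open>If \<open>V\<close> is continuous and bounded below and \<open>u\<close> is square integrable, the negative part of
  \<open>V u\<^sup>2\<close> is integrable, so \<open>\<integral> V u\<^sup>2 < \<infinity>\<close> says exactly that \<open>V u\<^sup>2\<close> is integrable.\<close>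

definition E_space :: "(real ^ 'n \<Rightarrow> real) \<Rightarrow> (real ^ 'n \<Rightarrow> real) set" where
  "E_space V = {u \<in> H1. integrable lebesgue (\<lambda>x. V x * (u x)\<^sup>2)}"

definition cond_V :: "(real ^ 'n \<Rightarrow> real) \<Rightarrow> bool" where
  "cond_V V \<longleftrightarrow> continuous_on UNIV V \<and> bdd_below (range V) \<and> filterlim V at_top at_infinity"

definition critical_exponent :: "nat \<Rightarrow> real" where
  "critical_exponent N = 2 * real N / (real N - 2)"

definition cond_f2 :: "nat \<Rightarrow> (real \<Rightarrow> real) \<Rightarrow> bool" where
  "cond_f2 N f \<longleftrightarrow> continuous_on UNIV f \<and>
     (\<exists>p. 2 < p \<and> p < critical_exponent N \<and>
        Limsup at_infinity (\<lambda>s. ereal (\<bar>f s\<bar> / \<bar>s\<bar> powr (p - 1))) = 0)"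

text \<open>The interval integral is oriented, so \<open>primitive f t = - \<integral>\<^sub>t\<^sup>0 f(s) ds\<close> for \<open>t < 0\<close>.\<close>

definition primitive :: "(real \<Rightarrow> real) \<Rightarrow> real \<Rightarrow> real" where
  "primitive f t = (LBINT s=ereal 0..ereal t. f s)"

definition cond_f3 :: "(real \<Rightarrow> real) \<Rightarrow> bool" where
  "cond_f3 f \<longleftrightarrow>
     (\<exists>\<mu>>8/3. \<forall>s. s \<noteq> 0 \<longrightarrow> 0 < \<mu> * primitive f s \<and> \<mu> * primitive f s \<le> s * f s)"

text \<open>Weak solutions of \<open>-\<Delta>u + V u + (k/2) \<Delta>(u\<^sup>2) u = f(u)\<close>. The two integrability conditions make
  explicit that the integrals in the identity exist (the Bochner integral of a non-integrable
  function is 0); under the hypotheses on \<open>V\<close> and \<open>f\<close> they follow from the other conditions on \<open>u\<close>.\<close>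

definition weak_solution ::
    "real \<Rightarrow> (real ^ 'n \<Rightarrow> real) \<Rightarrow> (real \<Rightarrow> real) \<Rightarrow> (real ^ 'n \<Rightarrow> real) \<Rightarrow> bool" where
  "weak_solution k V f u \<longleftrightarrow>
     u \<in> E_space V \<and>
     integrable lebesgue (\<lambda>x. (u x)\<^sup>2 * (norm (weak_grad u x))\<^sup>2) \<and>
     (\<forall>\<phi>\<in>test_functions.
        integrable lebesgue (\<lambda>x. (1 - k * (u x)\<^sup>2) * (weak_grad u x \<bullet> grad \<phi> x)
            - k * u x * (norm (weak_grad u x))\<^sup>2 * \<phi> x + V x * u x * \<phi> x) \<and>
        integrable lebesgue (\<lambda>x. f (u x) * \<phi> x) \<and>
        (LINT x|lebesgue. (1 - k * (u x)\<^sup>2) * (weak_grad u x \<bullet> grad \<phi> x)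
            - k * u x * (norm (weak_grad u x))\<^sup>2 * \<phi> x + V x * u x * \<phi> x)
        = (LINT x|lebesgue. f (u x) * \<phi> x))"

text \<open>For weak solutions, both integrands are integrable under the hypotheses on \<open>V\<close> and \<open>f\<close>:
  they give \<open>0 \<le> F(s) \<le> C (s\<^sup>2 + \<bar>s\<bar>\<^sup>p)\<close>, and \<open>H1\<close> embeds into \<open>L\<^sup>p\<close>.\<close>

definition energy ::
    "real \<Rightarrow> (real ^ 'n \<Rightarrow> real) \<Rightarrow> (real \<Rightarrow> real) \<Rightarrow> (real ^ 'n \<Rightarrow> real) \<Rightarrow> real" where
  "energy k V f u =
     1/2 * (LINT x|lebesgue. (1 - k * (u x)\<^sup>2) * (norm (weak_grad u x))\<^sup>2 + V x * (u x)\<^sup>2)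
     - (LINT x|lebesgue. primitive f (u x))"

end

theory Submission
  imports Defs
begin

text \<open>After scaling, \<open>k = 1\<close> and the operator degenerates where \<open>\<bar>u\<bar> = 1\<close>. Put \<open>u = sin \<theta>\<close> and
  \<open>w = \<theta> / 2 + sin (2 \<theta>) / 4\<close>, so that \<open>(1 - u\<^sup>2) \<bar>\<nabla>u\<bar>\<^sup>2 = \<bar>\<nabla>w\<bar>\<^sup>2\<close>. As a function of \<open>w\<close>, \<open>u\<close> is periodic
  and turns back at the values \<open>w = \<pi>/4 + n \<pi>/2\<close>, where \<open>cos \<theta> = 0\<close>. The weak equation for \<open>u\<close> is the
  Euler-Lagrange equation of \<open>w\<close> tested with \<open>cos \<theta>\<close> times a test function. These variations vanish at
  the turning values, so the flux of \<open>w\<close> may jump there: it suffices to minimise the energy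
  under the constraint that \<open>w\<close> runs through consecutive intervals between turning values on
  consecutive layers, namely a core, \<open>m\<close> thin concentric shells and an exterior.
  Core and exterior lie where \<open>V\<close> is large and the shells are thin, so comparison with
  explicit barriers shows that the minimiser takes turning values only on a null set; testing with \<open>u\<close>
  then gives \<open>\<nabla>u \<in> L\<^sup>2\<close>. Since \<open>w\<close> has to climb by \<open>m \<pi>/2\<close> within a fixed annulus, the energy tends to
  infinity with \<open>m\<close>.\<close>

section \<open>Square integrable fields\<close>

text \<open>The obstacle is the singular pull of the potential. At distance y from a turning value,
  1 - |u| is of order y^(2/3), so in terms of w the potential has slope of order y^(-1/3). In the
  shells the sign of V - f(1) is unknown, and this unbounded force may drag w onto the turning
  value. A barrier c r^(3/2), r being the distance from the interface in squared radius, has the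
  power at which both sides scale alike: its second derivative and the slope of the potential at its
  height are of order r^(-1/2). Thinness keeps it low and its first order terms small. In core and
  exterior the potential falls on leaving a turning value, and any small smooth bump is a barrier.
  The potential is not convex in w, so minimising sequences must converge pointwise. This comes from
  order, not from compactness: the energy is additive under maximum and minimum, and the constraint
  bounds all competitors. The set where V is small may meet shells only. The layers are therefore
  centred away from it, with the core beside it and the outermost sphere around it.\<close>

definition sq_integrable :: "('a::euclidean_space \<Rightarrow> 'b::euclidean_space) \<Rightarrow> bool" where
  "sq_integrable F \<longleftrightarrow> F \<in> borel_measurable lborel \<and> integrable lborel (\<lambda>x. (norm (F x))\<^sup>2)"

text \<open>The square of the L2 norm, kept without the root; the price is a factor 2 in the
  triangle inequality. The functions are Borel, so that compositions with continuous functions stay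
  measurable; the passage to \<open>lebesgue\<close> happens at the very end.\<close>

definition sq_norm :: "('a::euclidean_space \<Rightarrow> 'b::euclidean_space) \<Rightarrow> real" where
  "sq_norm F = (\<integral>x. (norm (F x))\<^sup>2 \<partial>lborel)"

lemma sq_integrable_measurable [measurable_dest]: "sq_integrable F \<Longrightarrow> F \<in> borel_measurable lborel"
  by (simp add: sq_integrable_def)

lemma sq_integrable_measurable_borel: "sq_integrable F \<Longrightarrow> F \<in> borel_measurable borel"
  by (simp add: sq_integrable_def)

lemma sq_integrableD: "sq_integrable F \<Longrightarrow> integrable lborel (\<lambda>x. (norm (F x))\<^sup>2)"
  by (simp add: sq_integrable_def)

lemma sq_norm_nonneg [simp]: "0 \<le> sq_norm F"
  by (simp add: sq_norm_def)

lemma sq_norm_AE_cong: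
  assumes "F \<in> borel_measurable lborel" "G \<in> borel_measurable lborel" "AE x in lborel. F x = G x"
  shows "sq_norm F = sq_norm G" "sq_integrable F \<Longrightarrow> sq_integrable G"
proof -
  have *: "AE x in lborel. (norm (F x))\<^sup>2 = (norm (G x))\<^sup>2"
    using assms(3) by eventually_elim simp
  show "sq_norm F = sq_norm G"
    unfolding sq_norm_def using assms * by (intro integral_cong_AE) auto
  show "sq_integrable F \<Longrightarrow> sq_integrable G"
    using integrable_cong_AE[THEN iffD1, OF _ _ *] assms by (auto simp: sq_integrable_def)
qed

lemma sq_integrable_bound:
  assumes "F \<in> borel_measurable lborel" "sq_integrable G" "AE x in lborel. norm (F x) \<le> C * norm (G x)"
  shows "sq_integrable F" "sq_norm F \<le> C\<^sup>2 * sq_norm G"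
proof -
  have G: "integrable lborel (\<lambda>x. C\<^sup>2 * (norm (G x))\<^sup>2)"
    using assms(2) by (auto simp: sq_integrable_def)
  have le: "AE x in lborel. (norm (F x))\<^sup>2 \<le> C\<^sup>2 * (norm (G x))\<^sup>2"
    using assms(3)
  proof eventually_elim
    case (elim x)
    have "(norm (F x))\<^sup>2 \<le> (C * norm (G x))\<^sup>2"
      using elim by (intro power_mono) auto
    then show ?case by (simp add: power_mult_distrib)
  qed
  show 1: "sq_integrable F"
    unfolding sq_integrable_def using assms(1) le
    by (auto intro!: Bochner_Integration.integrable_bound[OF G] simp: elim!: eventually_mono)
  show "sq_norm F \<le> C\<^sup>2 * sq_norm G"
    unfolding sq_norm_def using G 1 le
    by (subst integral_mult_right_zero[symmetric], intro integral_mono_AE)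
      (auto simp: sq_integrable_def)
qed

lemma sq_integrable_scaleR: "sq_integrable F \<Longrightarrow> sq_integrable (\<lambda>x. c *\<^sub>R F x)"
  by (rule sq_integrable_bound(1)[where G = F and C = "\<bar>c\<bar>"]) (auto simp: sq_integrable_def)

lemma sq_norm_scaleR: "sq_norm (\<lambda>x. c *\<^sub>R F x) = c\<^sup>2 * sq_norm F"
  by (simp add: sq_norm_def power_mult_distrib)

lemma norm_add_sq_le: "(norm (a + b))\<^sup>2 \<le> 2 * (norm a)\<^sup>2 + 2 * (norm (b::'b::real_inner))\<^sup>2"
  using zero_le_power2[of "norm (a - b)"]
  by (simp add: power2_norm_eq_inner algebra_simps inner_commute)

lemma sq_integrable_add:
  assumes "sq_integrable F" "sq_integrable G"
  shows "sq_integrable (\<lambda>x. F x + G x)" "sq_norm (\<lambda>x. F x + G x) \<le> 2 * sq_norm F + 2 * sq_norm G"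
proof -
  have I: "integrable lborel (\<lambda>x. 2 * (norm (F x))\<^sup>2 + 2 * (norm (G x))\<^sup>2)"
    using assms by (auto simp: sq_integrable_def)
  show 1: "sq_integrable (\<lambda>x. F x + G x)"
    unfolding sq_integrable_def using assms norm_add_sq_le
    by (auto intro!: Bochner_Integration.integrable_bound[OF I] AE_I2 simp: sq_integrable_def abs_of_nonneg)
  have "sq_norm (\<lambda>x. F x + G x) \<le> (\<integral>x. 2 * (norm (F x))\<^sup>2 + 2 * (norm (G x))\<^sup>2 \<partial>lborel)"
    unfolding sq_norm_def using 1 I norm_add_sq_le
    by (intro integral_mono) (auto simp: sq_integrable_def)
  also have "\<dots> = 2 * sq_norm F + 2 * sq_norm G"
    using assms by (simp add: sq_integrable_def sq_norm_def)
  finally show "sq_norm (\<lambda>x. F x + G x) \<le> 2 * sq_norm F + 2 * sq_norm G" .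
qed

lemma sq_integrable_diff:
  assumes "sq_integrable F" "sq_integrable G"
  shows "sq_integrable (\<lambda>x. F x - G x)" "sq_norm (\<lambda>x. F x - G x) \<le> 2 * sq_norm F + 2 * sq_norm G"
  using sq_integrable_add[OF assms(1) sq_integrable_scaleR[OF assms(2), of "-1"]]
    sq_norm_scaleR[of "-1" G] by simp_all

lemma sq_norm_diff_commute: "sq_norm (\<lambda>x. F x - G x) = sq_norm (\<lambda>x. G x - F x)"
  by (simp add: sq_norm_def norm_minus_commute)

lemma sq_norm_triangle:
  assumes "sq_integrable F" "sq_integrable G" "sq_integrable H"
  shows "sq_norm (\<lambda>x. F x - H x) \<le> 2 * sq_norm (\<lambda>x. F x - G x) + 2 * sq_norm (\<lambda>x. G x - H x)"
  using sq_integrable_add(2)[OF sq_integrable_diff(1)[OF assms(1,2)] sq_integrable_diff(1)[OF assms(2,3)]]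
  by simp

lemma sq_norm_parallelogram:
  assumes "sq_integrable F" "sq_integrable G"
  shows "sq_norm (\<lambda>x. F x + G x) + sq_norm (\<lambda>x. F x - G x) = 2 * sq_norm F + 2 * sq_norm G"
proof -
  have "sq_norm (\<lambda>x. F x + G x) + sq_norm (\<lambda>x. F x - G x)
      = (\<integral>x. (norm (F x + G x))\<^sup>2 + (norm (F x - G x))\<^sup>2 \<partial>lborel)"
    unfolding sq_norm_def using sq_integrable_add(1)[OF assms] sq_integrable_diff(1)[OF assms]
    by (simp add: sq_integrable_def)
  also have "\<dots> = (\<integral>x. 2 * (norm (F x))\<^sup>2 + 2 * (norm (G x))\<^sup>2 \<partial>lborel)"
    by (intro Bochner_Integration.integral_cong)
       (auto simp: power2_norm_eq_inner algebra_simps inner_commute)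
  finally show ?thesis
    using assms by (simp add: sq_integrable_def sq_norm_def)
qed

lemma abs_inner_le_AMGM: "e > 0 \<Longrightarrow> \<bar>a \<bullet> b\<bar> \<le> e * (norm a)\<^sup>2 + (norm (b::'b::real_inner))\<^sup>2 / e"
proof -
  assume e: "e > 0"
  have "0 \<le> (sqrt e * norm a - norm b / sqrt e)\<^sup>2" by simp
  also have "\<dots> = e * (norm a)\<^sup>2 + (norm b)\<^sup>2 / e - 2 * (norm a * norm b)"
    using e by (simp add: power2_diff power_mult_distrib power_divide)
  finally have "2 * (norm a * norm b) \<le> e * (norm a)\<^sup>2 + (norm b)\<^sup>2 / e" by simp
  moreover have "0 \<le> norm a * norm b" by simp
  ultimately show ?thesis using Cauchy_Schwarz_ineq2[of a b] by linarith
qed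

lemma sq_integrable_inner:
  assumes "sq_integrable F" "sq_integrable G"
  shows "integrable lborel (\<lambda>x. F x \<bullet> G x)"
proof -
  have I: "integrable lborel (\<lambda>x. (norm (F x))\<^sup>2 + (norm (G x))\<^sup>2)"
    using assms by (auto simp: sq_integrable_def)
  show ?thesis
    using assms abs_inner_le_AMGM[of 1]
    by (intro Bochner_Integration.integrable_bound[OF I]) (auto simp: sq_integrable_def)
qed

text \<open>Young's inequality with a free weight stands in for Cauchy-Schwarz, so that no roots of
  integrals appear and the caller can tune \<open>e\<close>.\<close>

lemma sq_norm_inner_le:
  assumes "sq_integrable F" "sq_integrable G" "e > 0"
  shows "\<bar>\<integral>x. F x \<bullet> G x \<partial>lborel\<bar> \<le> e * sq_norm F + sq_norm G / e"
proof -
  have "\<bar>\<integral>x. F x \<bullet> G x \<partial>lborel\<bar> \<le> (\<integral>x. \<bar>F x \<bullet> G x\<bar> \<partial>lborel)"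
    by simp
  also have "\<dots> \<le> (\<integral>x. e * (norm (F x))\<^sup>2 + (norm (G x))\<^sup>2 / e \<partial>lborel)"
    using assms sq_integrable_inner[OF assms(1,2)] abs_inner_le_AMGM[OF assms(3)]
    by (intro integral_mono) (auto simp: sq_integrable_def)
  also have "\<dots> = e * sq_norm F + sq_norm G / e"
    using assms by (simp add: sq_integrable_def sq_norm_def)
  finally show ?thesis .
qed

lemma sq_norm_add_eq:
  assumes "sq_integrable F" "sq_integrable G"
  shows "sq_norm (\<lambda>x. F x + t *\<^sub>R G x)
    = sq_norm F + 2 * t * (\<integral>x. F x \<bullet> G x \<partial>lborel) + t\<^sup>2 * sq_norm G"
proof -
  have "sq_norm (\<lambda>x. F x + t *\<^sub>R G x)
    = (\<integral>x. (norm (F x))\<^sup>2 + 2 * t * (F x \<bullet> G x) + t\<^sup>2 * (norm (G x))\<^sup>2 \<partial>lborel)"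
    unfolding sq_norm_def
    by (intro Bochner_Integration.integral_cong)
       (auto simp: power2_norm_eq_inner algebra_simps inner_commute power2_eq_square[of t])
  also have "\<dots> = sq_norm F + 2 * t * (\<integral>x. F x \<bullet> G x \<partial>lborel) + t\<^sup>2 * sq_norm G"
    using assms sq_integrable_inner[OF assms] by (simp add: sq_integrable_def sq_norm_def)
  finally show ?thesis .
qed

lemma sq_norm_tendsto_inner:
  assumes F: "\<And>n. sq_integrable (F n)" and G: "sq_integrable G" and L: "sq_integrable L"
    and lim: "(\<lambda>n. sq_norm (\<lambda>x. F n x - L x)) \<longlonglongrightarrow> 0"
  shows "(\<lambda>n. \<integral>x. F n x \<bullet> G x \<partial>lborel) \<longlonglongrightarrow> (\<integral>x. L x \<bullet> G x \<partial>lborel)"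
proof (rule LIMSEQ_I)
  fix r :: real assume r: "r > 0"
  \<comment> \<open>The weight makes the fixed term \<open>sq_norm G / e\<close> at most
    \<open>r / 2\<close>; the \<open>+ 1\<close> avoids a separate case for vanishing
    \<open>sq_norm G\<close>.\<close>
  define e where "e = 2 * (sq_norm G + 1) / r"
  have e: "e > 0" using r sq_norm_nonneg[of G] by (simp add: e_def add_nonneg_pos)
  have "sq_norm G / e = r / 2 * (sq_norm G / (sq_norm G + 1))"
    using r by (simp add: e_def)
  also have "\<dots> \<le> r / 2 * 1"
    using r sq_norm_nonneg[of G] by (intro mult_left_mono) (simp_all add: divide_le_eq_1 add_nonneg_pos)
  finally have "sq_norm G / e \<le> r / 2" by simp
  have "\<forall>\<^sub>F n in sequentially. sq_norm (\<lambda>x. F n x - L x) < r / (2 * e)"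
    using order_tendstoD(2)[OF lim, of "r / (2 * e)"] r e by simp
  then obtain N where N: "\<And>n. n \<ge> N \<Longrightarrow> sq_norm (\<lambda>x. F n x - L x) < r / (2 * e)"
    by (auto simp: eventually_sequentially)
  show "\<exists>no. \<forall>n\<ge>no. norm ((\<integral>x. F n x \<bullet> G x \<partial>lborel) - (\<integral>x. L x \<bullet> G x \<partial>lborel)) < r"
  proof (intro exI[of _ N] allI impI)
    fix n assume n: "n \<ge> N"
    have "(\<integral>x. F n x \<bullet> G x \<partial>lborel) - (\<integral>x. L x \<bullet> G x \<partial>lborel) = (\<integral>x. (F n x - L x) \<bullet> G x \<partial>lborel)"
      using sq_integrable_inner[OF F G] sq_integrable_inner[OF L G] by (simp add: inner_diff_left)
    also have "\<bar>\<dots>\<bar> \<le> e * sq_norm (\<lambda>x. F n x - L x) + sq_norm G / e"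
      by (rule sq_norm_inner_le[OF sq_integrable_diff(1)[OF F L] G e])
    also have "\<dots> < e * (r / (2 * e)) + r / 2"
      using N[OF n] e \<open>sq_norm G / e \<le> r / 2\<close> by (intro add_less_le_mono mult_strict_left_mono) auto
    also have "\<dots> = r" using e by simp
    finally show "norm ((\<integral>x. F n x \<bullet> G x \<partial>lborel) - (\<integral>x. L x \<bullet> G x \<partial>lborel)) < r" by simp
  qed
qed

lemma sq_norm_tendsto_AE_subseq:
  assumes "\<And>n. sq_integrable (F n)" "sq_integrable L"
    and "(\<lambda>n. sq_norm (\<lambda>x. F n x - L x)) \<longlonglongrightarrow> 0"
  obtains r :: "nat \<Rightarrow> nat" where "strict_mono r" "AE x in lborel. (\<lambda>n. F (r n) x) \<longlonglongrightarrow> L x"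
proof -
  have "\<exists>r::nat\<Rightarrow>nat. strict_mono r \<and> (AE x in lborel. (\<lambda>n. (norm (F (r n) x - L x))\<^sup>2) \<longlonglongrightarrow> 0)"
    using assms sq_integrable_diff(1)[OF assms(1,2)]
    by (intro tendsto_L1_AE_subseq[where u = "\<lambda>n x. (norm (F n x - L x))\<^sup>2"])
       (auto simp: sq_norm_def sq_integrable_def)
  then obtain r where r: "strict_mono r" "AE x in lborel. (\<lambda>n. (norm (F (r n) x - L x))\<^sup>2) \<longlonglongrightarrow> 0"
    by blast
  have "AE x in lborel. (\<lambda>n. F (r n) x) \<longlonglongrightarrow> L x"
    using r(2)
  proof eventually_elim
    case (elim x)
    have "(\<lambda>n. sqrt ((norm (F (r n) x - L x))\<^sup>2)) \<longlonglongrightarrow> sqrt 0"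
      by (intro tendsto_real_sqrt elim)
    then show ?case by (simp add: tendsto_norm_zero_iff LIM_zero_iff)
  qed
  with r(1) that show ?thesis by blast
qed

text \<open>Adding the integrable minorant \<open>\<beta>\<close> makes the integrands nonnegative,
  so Fatou applies. Integrability of the limit is part of the conclusion; this is how finiteness of
  the gradient energy is obtained later.\<close>

lemma Fatou_lower_bound:
  fixes F :: "nat \<Rightarrow> 'a::euclidean_space \<Rightarrow> real"
  assumes F: "\<And>n. integrable lborel (F n)" and L: "L \<in> borel_measurable lborel"
    and lim: "AE x in lborel. (\<lambda>n. F n x) \<longlonglongrightarrow> L x"
    and \<beta>: "integrable lborel \<beta>" and lb: "\<And>n. AE x in lborel. - \<beta> x \<le> F n x"
    and r: "\<And>n. (\<integral>x. F n x \<partial>lborel) \<le> r n" "r \<longlonglongrightarrow> R"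
  shows "integrable lborel L" "(\<integral>x. L x \<partial>lborel) \<le> R"
proof -
  have lb': "AE x in lborel. \<forall>n. - \<beta> x \<le> F n x"
    using lb by (simp add: AE_all_countable)
  have Lpos: "AE x in lborel. 0 \<le> L x + \<beta> x"
    using lb' lim
  proof eventually_elim
    case (elim x)
    then have "- \<beta> x \<le> L x" by (intro LIMSEQ_le_const[OF elim(2)]) auto
    then show ?case by simp
  qed
  have "(\<integral>\<^sup>+x. ennreal (L x + \<beta> x) \<partial>lborel) = (\<integral>\<^sup>+x. liminf (\<lambda>n. ennreal (F n x + \<beta> x)) \<partial>lborel)"
  proof (intro nn_integral_cong_AE)
    show "AE x in lborel. ennreal (L x + \<beta> x) = liminf (\<lambda>n. ennreal (F n x + \<beta> x))"
      using lim
    proof eventually_elim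
      case (elim x)
      have "(\<lambda>n. ennreal (F n x + \<beta> x)) \<longlonglongrightarrow> ennreal (L x + \<beta> x)"
        by (intro tendsto_ennrealI tendsto_add elim tendsto_const)
      from lim_imp_Liminf[OF _ this] show ?case by simp
    qed
  qed
  also have "\<dots> \<le> liminf (\<lambda>n. \<integral>\<^sup>+x. ennreal (F n x + \<beta> x) \<partial>lborel)"
    using F \<beta> by (intro nn_integral_liminf) auto
  also have "\<dots> = liminf (\<lambda>n. ennreal (\<integral>x. F n x + \<beta> x \<partial>lborel))"
  proof -
    have "AE x in lborel. 0 \<le> F n x + \<beta> x" for n
      using lb[of n] by eventually_elim simp
    then have "(\<integral>\<^sup>+x. ennreal (F n x + \<beta> x) \<partial>lborel) = ennreal (\<integral>x. F n x + \<beta> x \<partial>lborel)" for n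
      using F[of n] \<beta> by (intro nn_integral_eq_integral) auto
    then show ?thesis by simp
  qed
  also have "\<dots> \<le> liminf (\<lambda>n. ennreal (r n + (\<integral>x. \<beta> x \<partial>lborel)))"
    using F \<beta> r(1) by (intro Liminf_mono always_eventually) (auto intro!: ennreal_leI)
  also have "\<dots> = ennreal (R + (\<integral>x. \<beta> x \<partial>lborel))"
    by (intro lim_imp_Liminf tendsto_ennrealI tendsto_add r(2)) auto
  finally have le: "(\<integral>\<^sup>+x. ennreal (L x + \<beta> x) \<partial>lborel) \<le> ennreal (R + (\<integral>x. \<beta> x \<partial>lborel))" .
  have int: "integrable lborel (\<lambda>x. L x + \<beta> x)"
    using L \<beta> Lpos le
    by (intro integrableI_nonneg) (auto simp: le_less_trans[OF _ ennreal_less_top])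
  then have "integrable lborel (\<lambda>x. (L x + \<beta> x) - \<beta> x)"
    using \<beta> by (intro Bochner_Integration.integrable_diff)
  then show Li: "integrable lborel L" by simp
  have Rpos: "0 \<le> R + (\<integral>x. \<beta> x \<partial>lborel)"
  proof -
    have "0 \<le> r n + (\<integral>x. \<beta> x \<partial>lborel)" for n
    proof -
      have "0 \<le> (\<integral>x. F n x + \<beta> x \<partial>lborel)"
        using lb[of n] by (intro integral_nonneg_AE) (auto elim!: eventually_mono)
      then show ?thesis using r(1)[of n] F[of n] \<beta> by simp
    qed
    then show ?thesis
      by (intro LIMSEQ_le_const[OF tendsto_add[OF r(2) tendsto_const]]) auto
  qed
  have "ennreal (\<integral>x. L x + \<beta> x \<partial>lborel) \<le> ennreal (R + (\<integral>x. \<beta> x \<partial>lborel))"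
    using le nn_integral_eq_integral[OF int Lpos] by simp
  then have "(\<integral>x. L x + \<beta> x \<partial>lborel) \<le> R + (\<integral>x. \<beta> x \<partial>lborel)"
    using Rpos by (simp add: ennreal_le_iff)
  then show "(\<integral>x. L x \<partial>lborel) \<le> R" using Li \<beta> by simp
qed

text \<open>Riesz-Fischer: a fast subsequence converges almost everywhere, and Fatou in the second
  index turns the Cauchy property into norm convergence of the whole sequence.\<close>

lemma sq_norm_complete:
  fixes F :: "nat \<Rightarrow> 'a::euclidean_space \<Rightarrow> 'b::euclidean_space"
  assumes F: "\<And>n. sq_integrable (F n)"
    and Cauchy: "\<And>e. e > 0 \<Longrightarrow> \<exists>N. \<forall>m\<ge>N. \<forall>n\<ge>N. sq_norm (\<lambda>x. F m x - F n x) < e"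
  obtains L where "sq_integrable L" "(\<lambda>n. sq_norm (\<lambda>x. F n x - L x)) \<longlonglongrightarrow> 0"
proof -
  \<comment> \<open>The rate 4^-k leaves room for the weight 2^k by which the squared increments are
    multiplied below.\<close>
  have "\<exists>N. \<forall>m\<ge>N. \<forall>n\<ge>N. sq_norm (\<lambda>x. F m x - F n x) < (1/4)^k" for k
    by (intro Cauchy) auto
  then obtain M where M: "\<And>k m n. m \<ge> M k \<Longrightarrow> n \<ge> M k \<Longrightarrow> sq_norm (\<lambda>x. F m x - F n x) < (1/4)^k"
    by metis
  define r where "r k = (\<Sum>i\<le>k. M i + 1)" for k
  have r_ge: "r k \<ge> M k" for k
    by (cases k) (auto simp: r_def)
  have r_mono: "strict_mono r"
    by (rule strict_monoI_Suc) (simp add: r_def)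
  define d where "d k x = F (r (Suc k)) x - F (r k) x" for k x
  have d_sq: "sq_integrable (d k)" for k
    unfolding d_def[abs_def] by (rule sq_integrable_diff(1)[OF F F])
  have d_le: "sq_norm (d k) \<le> (1/4)^k" for k
    using M[of k "r (Suc k)" "r k"] r_ge[of k] r_ge[of "Suc k"] strict_monoD[OF r_mono, of k "Suc k"]
    by (auto simp: d_def[abs_def])
  have [measurable]: "d k \<in> borel_measurable lborel" for k using d_sq by (rule sq_integrable_measurable)
  have "(\<integral>\<^sup>+x. (\<Sum>k. ennreal (2^k * (norm (d k x))\<^sup>2)) \<partial>lborel)
      = (\<Sum>k. \<integral>\<^sup>+x. ennreal (2^k * (norm (d k x))\<^sup>2) \<partial>lborel)"
    by (intro nn_integral_suminf) auto
  also have "\<dots> \<le> (\<Sum>k. ennreal ((1/2)^k))"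
  proof (intro suminf_le allI)
    fix k
    have "(\<integral>\<^sup>+x. ennreal (2^k * (norm (d k x))\<^sup>2) \<partial>lborel) = ennreal (\<integral>x. 2^k * (norm (d k x))\<^sup>2 \<partial>lborel)"
      using sq_integrableD[OF d_sq[of k]] by (intro nn_integral_eq_integral) auto
    also have "\<dots> = ennreal (2^k * sq_norm (d k))"
      by (simp add: sq_norm_def)
    also have "\<dots> \<le> ennreal (2^k * (1/4)^k)"
      using d_le[of k] by (intro ennreal_leI mult_left_mono) auto
    also have "2^k * (1/4)^k = (1/2::real)^k"
      by (simp flip: power_mult_distrib)
    finally show "(\<integral>\<^sup>+x. ennreal (2^k * (norm (d k x))\<^sup>2) \<partial>lborel) \<le> ennreal ((1/2)^k)" .
  qed auto
  also have "\<dots> < \<infinity>"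
    by (subst suminf_ennreal2) (auto intro!: summable_geometric)
  finally have "AE x in lborel. (\<Sum>k. ennreal (2^k * (norm (d k x))\<^sup>2)) \<noteq> \<infinity>"
    by (intro nn_integral_noteq_infinite) auto
  then have conv: "AE x in lborel. (\<lambda>k. F (r k) x) \<longlonglongrightarrow> lim (\<lambda>k. F (r k) x)"
  proof eventually_elim
    case (elim x)
    have "summable (\<lambda>k. 2^k * (norm (d k x))\<^sup>2)"
      using elim by (intro summable_suminf_not_top) auto
    then have "summable (\<lambda>k. 2^k * (norm (d k x))\<^sup>2 + (1/2)^k)"
      by (intro summable_add summable_geometric) auto
    \<comment> \<open>By the arithmetic-geometric inequality 2 |d| \<le> 2^k |d|^2 + 2^-k, the
      weighted sum of squares controls the sum of the norms.\<close>
    then have "summable (\<lambda>k. norm (d k x))"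
    proof (rule summable_comparison_test[rotated], intro exI[of _ 0] allI impI)
      fix k :: nat
      have "(sqrt (2^k) * norm (d k x) - 1 / sqrt (2^k))\<^sup>2
          = 2^k * (norm (d k x))\<^sup>2 + (1/2)^k - 2 * norm (d k x)"
        by (simp add: power2_diff power_mult_distrib power_divide power_one_over)
      then have "2 * norm (d k x) \<le> 2^k * (norm (d k x))\<^sup>2 + (1/2)^k"
        using zero_le_power2[of "sqrt (2^k) * norm (d k x) - 1 / sqrt (2^k)"] by linarith
      then show "norm (norm (d k x)) \<le> 2^k * (norm (d k x))\<^sup>2 + (1/2)^k"
        using norm_ge_zero[of "d k x"] by (smt (verit) real_norm_def)
    qed
    then have "summable (\<lambda>k. d k x)" by (rule summable_norm_cancel)
    then have "(\<lambda>n. \<Sum>k<n. d k x) \<longlonglongrightarrow> (\<Sum>k. d k x)" by (rule summable_LIMSEQ)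
    then have "(\<lambda>n. F (r 0) x + (\<Sum>k<n. d k x)) \<longlonglongrightarrow> F (r 0) x + (\<Sum>k. d k x)"
      by (intro tendsto_add tendsto_const)
    moreover have "F (r 0) x + (\<Sum>k<n. d k x) = F (r n) x" for n
      using sum_lessThan_telescope[of "\<lambda>k. F (r k) x" n] by (simp add: d_def)
    ultimately have "convergent (\<lambda>k. F (r k) x)" by (auto simp: convergent_def)
    then show ?case by (simp add: convergent_LIMSEQ_iff)
  qed
  define L where "L x = lim (\<lambda>k. F (r k) x)" for x
  have [measurable]: "F n \<in> borel_measurable lborel" for n using F by (rule sq_integrable_measurable)
  have L_meas [measurable]: "L \<in> borel_measurable lborel"
    unfolding L_def[abs_def] by measurable
  have key: "integrable lborel (\<lambda>x. (norm (F n x - L x))\<^sup>2) \<and> sq_norm (\<lambda>x. F n x - L x) \<le> e"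
    if N: "\<forall>m\<ge>N. \<forall>n\<ge>N. sq_norm (\<lambda>x. F m x - F n x) < e" and n: "n \<ge> N" for N n e
  proof -
    let ?G = "\<lambda>k x. (norm (F n x - F (r (k + N)) x))\<^sup>2"
    have 1: "AE x in lborel. (\<lambda>k. ?G k x) \<longlonglongrightarrow> (norm (F n x - L x))\<^sup>2"
      using conv
    proof eventually_elim
      case (elim x)
      show ?case unfolding L_def
        by (intro tendsto_power tendsto_norm tendsto_diff tendsto_const LIMSEQ_ignore_initial_segment elim)
    qed
    have rN: "r (k + N) \<ge> N" for k
      using seq_suble[OF r_mono, of "k + N"] by simp
    have 2: "(\<integral>x. ?G k x \<partial>lborel) \<le> e" for k
      using N n rN[of k] by (auto simp: sq_norm_def less_imp_le)
    have 3: "integrable lborel (?G k)" for k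
      using sq_integrable_diff(1)[OF F F] by (simp add: sq_integrable_def)
    show ?thesis
      using Fatou_lower_bound[where F = ?G and L = "\<lambda>x. (norm (F n x - L x))\<^sup>2" and \<beta> = "\<lambda>_. 0" and r = "\<lambda>_. e" and R = e,
          OF 3 _ 1 _ _ 2]
      by (simp add: sq_norm_def)
  qed
  have L_sq: "sq_integrable L"
  proof -
    obtain N where N: "\<forall>m\<ge>N. \<forall>n\<ge>N. sq_norm (\<lambda>x. F m x - F n x) < 1"
      using Cauchy[of 1] by auto
    have "sq_integrable (\<lambda>x. F N x - L x)"
      using key[OF N, of N] by (simp add: sq_integrable_def)
    from sq_integrable_diff(1)[OF F[of N] this] show ?thesis by simp
  qed
  have "(\<lambda>n. sq_norm (\<lambda>x. F n x - L x)) \<longlonglongrightarrow> 0"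
  proof (rule LIMSEQ_I)
    fix e :: real assume e: "e > 0"
    obtain N where N: "\<forall>m\<ge>N. \<forall>n\<ge>N. sq_norm (\<lambda>x. F m x - F n x) < e/2"
      using Cauchy[of "e/2"] e by auto
    show "\<exists>no. \<forall>n\<ge>no. norm (sq_norm (\<lambda>x. F n x - L x) - 0) < e"
    proof (intro exI[of _ N] allI impI)
      fix n assume "n \<ge> N"
      from key[OF N this] e show "norm (sq_norm (\<lambda>x. F n x - L x) - 0) < e" by simp
    qed
  qed
  with L_sq that show ?thesis by blast
qed

section \<open>Compactly supported C1 functions\<close>

text \<open>Carrying the gradient field along with the function turns every calculus rule into an
  explicit formula for a pair and avoids chosen derivatives.\<close>

definition C1 :: "('a::euclidean_space \<Rightarrow> real) \<Rightarrow> ('a \<Rightarrow> 'a) \<Rightarrow> bool" where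
  "C1 q Q \<longleftrightarrow> (\<forall>x. (q has_derivative (\<lambda>h. Q x \<bullet> h)) (at x)) \<and> continuous_on UNIV Q"

definition C1c :: "('a::euclidean_space \<Rightarrow> real) \<Rightarrow> ('a \<Rightarrow> 'a) \<Rightarrow> bool" where
  "C1c q Q \<longleftrightarrow> C1 q Q \<and> (\<exists>R. \<forall>x. R \<le> norm x \<longrightarrow> q x = 0 \<and> Q x = 0)"

lemma C1_has_derivative: "C1 q Q \<Longrightarrow> (q has_derivative (\<lambda>h. Q x \<bullet> h)) (at x)"
  by (simp add: C1_def)

lemma C1_continuous: "C1 q Q \<Longrightarrow> continuous_on UNIV q"
  by (meson C1_has_derivative continuous_at_imp_continuous_on has_derivative_continuous)

lemma C1_continuous_grad: "C1 q Q \<Longrightarrow> continuous_on UNIV Q"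
  by (simp add: C1_def)

lemma C1_const: "C1 (\<lambda>x. c) (\<lambda>x. 0)"
  by (simp add: C1_def)

lemma C1_add: "C1 q Q \<Longrightarrow> C1 p P \<Longrightarrow> C1 (\<lambda>x. q x + p x) (\<lambda>x. Q x + P x)"
  by (auto simp: C1_def inner_add_left intro!: continuous_intros derivative_eq_intros)

lemma C1_mult:
  assumes "C1 q Q" "C1 p P"
  shows "C1 (\<lambda>x. q x * p x) (\<lambda>x. q x *\<^sub>R P x + p x *\<^sub>R Q x)"
  using assms C1_continuous[OF assms(1)] C1_continuous[OF assms(2)]
  by (auto simp: C1_def inner_add_left algebra_simps
      intro!: continuous_intros derivative_eq_intros)

lemma C1_scale: "C1 q Q \<Longrightarrow> C1 (\<lambda>x. c * q x) (\<lambda>x. c *\<^sub>R Q x)"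
  using C1_mult[OF C1_const[of c]] by simp

lemma C1_comp:
  assumes "C1 q Q" "\<And>t. (\<Phi> has_real_derivative \<Phi>' t) (at t)" "continuous_on UNIV \<Phi>'"
  shows "C1 (\<lambda>x. \<Phi> (q x)) (\<lambda>x. \<Phi>' (q x) *\<^sub>R Q x)"
  unfolding C1_def
proof (intro conjI allI)
  fix x
  have "((\<lambda>x. \<Phi> (q x)) has_derivative (\<lambda>h. \<Phi>' (q x) * (Q x \<bullet> h))) (at x)"
    using has_derivative_compose[OF C1_has_derivative[OF assms(1), of x], of \<Phi> "\<lambda>h. \<Phi>' (q x) * h"] assms(2)[of "q x"]
    by (simp add: has_field_derivative_def)
  then show "((\<lambda>x. \<Phi> (q x)) has_derivative (\<lambda>h. (\<Phi>' (q x) *\<^sub>R Q x) \<bullet> h)) (at x)" by simp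
  show "continuous_on UNIV (\<lambda>x. \<Phi>' (q x) *\<^sub>R Q x)"
    by (intro continuous_on_scaleR C1_continuous_grad[OF assms(1)]
        continuous_on_compose2[OF assms(3) C1_continuous[OF assms(1)]]) auto
qed

lemma C1c_C1: "C1c q Q \<Longrightarrow> C1 q Q" by (simp add: C1c_def)

lemma C1c_bound:
  assumes "C1c q Q"
  obtains R where "\<And>x. R \<le> norm x \<Longrightarrow> q x = 0" "\<And>x. R \<le> norm x \<Longrightarrow> Q x = 0"
  using assms by (auto simp: C1c_def)

lemma C1c_add: assumes "C1c q Q" "C1c p P" shows "C1c (\<lambda>x. q x + p x) (\<lambda>x. Q x + P x)"
proof -
  obtain R S where "\<And>x. R \<le> norm x \<Longrightarrow> q x = 0 \<and> Q x = 0" "\<And>x. S \<le> norm x \<Longrightarrow> p x = 0 \<and> P x = 0"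
    using assms by (auto simp: C1c_def)
  then show ?thesis
    using C1_add[of q Q p P] assms by (auto simp: C1c_def intro!: exI[of _ "max R S"])
qed

lemma C1c_mult:
  assumes "C1c q Q" "C1 p P"
  shows "C1c (\<lambda>x. q x * p x) (\<lambda>x. q x *\<^sub>R P x + p x *\<^sub>R Q x)"
  using C1_mult[of q Q p P] assms by (auto simp: C1c_def)

lemma C1c_scale: "C1c q Q \<Longrightarrow> C1c (\<lambda>x. c * q x) (\<lambda>x. c *\<^sub>R Q x)"
  using C1c_mult[OF _ C1_const[of c]] by (simp add: mult.commute)

lemma C1c_comp:
  assumes "C1c q Q" "\<And>t. (\<Phi> has_real_derivative \<Phi>' t) (at t)" "continuous_on UNIV \<Phi>'" "\<Phi> 0 = 0"
  shows "C1c (\<lambda>x. \<Phi> (q x)) (\<lambda>x. \<Phi>' (q x) *\<^sub>R Q x)"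
  using C1_comp[OF _ assms(2,3)] assms by (fastforce simp: C1c_def)

lemma continuous_compact_support:
  fixes f :: "'a::euclidean_space \<Rightarrow> 'b::euclidean_space"
  assumes "continuous_on UNIV f" "\<And>x. R \<le> norm x \<Longrightarrow> f x = 0"
  shows "integrable lborel f" "\<exists>B. \<forall>x. norm (f x) \<le> B"
proof -
  have c: "continuous_on (cball 0 R) f" using assms(1) continuous_on_subset by blast
  have "integrable lborel (\<lambda>x. indicator (cball 0 R) x *\<^sub>R f x)"
    by (intro borel_integrable_compact c) auto
  moreover have "indicator (cball 0 R) x *\<^sub>R f x = f x" for x
    using assms(2)[of x] by (auto simp: indicator_def)
  ultimately show "integrable lborel f" by simp
  obtain B where B: "\<And>x. x \<in> cball 0 R \<Longrightarrow> norm (f x) \<le> B"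
    using compact_imp_bounded[OF compact_continuous_image[OF c compact_cball]] unfolding bounded_iff by blast
  have "norm (f x) \<le> max B 0" for x
  proof (cases "norm x \<le> R")
    case True then show ?thesis using B[of x] by simp
  next
    case False then show ?thesis using assms(2)[of x] by simp
  qed
  then show "\<exists>B. \<forall>x. norm (f x) \<le> B" by blast
qed

lemma continuous_compact_support_sq_integrable:
  fixes f :: "'a::euclidean_space \<Rightarrow> 'b::euclidean_space"
  assumes "continuous_on UNIV f" "\<And>x. R \<le> norm x \<Longrightarrow> f x = 0"
  shows "sq_integrable f"
  unfolding sq_integrable_def
  using assms(2) by (auto intro!: continuous_compact_support(1)[where R = R] continuous_intros assms(1)
      borel_measurable_continuous_onI)

lemma C1c_sq_integrable: assumes "C1c q Q" shows "sq_integrable q" "sq_integrable Q"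
proof -
  obtain R where R: "\<And>x. R \<le> norm x \<Longrightarrow> q x = 0" "\<And>x. R \<le> norm x \<Longrightarrow> Q x = 0"
    using C1c_bound[OF assms] by blast
  show "sq_integrable q" "sq_integrable Q"
    by (rule continuous_compact_support_sq_integrable[OF C1_continuous[OF C1c_C1[OF assms]] R(1)] ,assumption)
       (rule continuous_compact_support_sq_integrable[OF C1_continuous_grad[OF C1c_C1[OF assms]] R(2)])
qed

lemma C1c_bounded: assumes "C1c q Q" obtains B where "\<And>x. \<bar>q x\<bar> \<le> B" "\<And>x. norm (Q x) \<le> B" "0 \<le> B"
proof -
  obtain R where R: "\<And>x. R \<le> norm x \<Longrightarrow> q x = 0" "\<And>x. R \<le> norm x \<Longrightarrow> Q x = 0"
    using C1c_bound[OF assms] by blast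
  obtain B1 B2 where "\<forall>x. norm (q x) \<le> B1" "\<forall>x. norm (Q x) \<le> B2"
    using continuous_compact_support(2)[OF C1_continuous[OF C1c_C1[OF assms]] R(1)]
      continuous_compact_support(2)[OF C1_continuous_grad[OF C1c_C1[OF assms]] R(2)] by meson
  then show ?thesis
    by (intro that[of "max 0 (max B1 B2)"]) (auto simp: max.coboundedI1 max.coboundedI2)
qed

lemma integrable_indicator_cball: "integrable lborel (indicator (cball (c::'a::euclidean_space) R) :: 'a \<Rightarrow> real)"
  using emeasure_bounded_finite[of "cball c R"] by (intro integrable_real_indicator) simp_all

lemma integral_translation:
  fixes f :: "'a::euclidean_space \<Rightarrow> real"
  assumes "f \<in> borel_measurable borel"
  shows "(\<integral>x. f (c + x) \<partial>lborel) = (\<integral>x. f x \<partial>lborel)"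
  using integral_distr[of "(+) c" lborel borel f] assms lborel_distr_plus[of c] by simp

lemma integrable_translation:
  fixes f :: "'a::euclidean_space \<Rightarrow> real"
  assumes "integrable lborel f"
  shows "integrable lborel (\<lambda>x. f (c + x))"
  using integrable_distr_eq[of "(+) c" lborel borel f] assms lborel_distr_plus[of c]
  by (simp add: borel_measurable_integrable)

text \<open>By translation invariance all difference quotients of \<open>q\<close> have integral zero.\<close>

lemma C1c_integral_grad:
  assumes "C1c q Q"
  shows "(\<integral>x. Q x \<bullet> b \<partial>lborel) = 0"
proof -
  obtain B where B: "\<And>x. \<bar>q x\<bar> \<le> B" "\<And>x. norm (Q x) \<le> B" "0 \<le> B" using C1c_bounded[OF assms] by blast
  obtain R where R: "\<And>x. R \<le> norm x \<Longrightarrow> q x = 0" using C1c_bound[OF assms] by blast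
  have C: "C1 q Q" using assms by (rule C1c_C1)
  define t where "t n = 1 / (real n + 1)" for n
  have t: "t n > 0" "t n \<le> 1" for n by (auto simp: t_def)
  have t0: "t \<longlonglongrightarrow> 0" unfolding t_def using LIMSEQ_inverse_real_of_nat by (simp add: inverse_eq_divide add.commute)
  define D where "D n x = (q (t n *\<^sub>R b + x) - q x) / t n" for n x
  have qm [measurable]: "q \<in> borel_measurable borel"
    by (rule borel_measurable_continuous_onI[OF C1_continuous[OF C]])
  have qi: "integrable lborel q"
    by (rule continuous_compact_support(1)[OF C1_continuous[OF C] R])
  have "(\<integral>x. D n x \<partial>lborel) = 0" for n
    unfolding D_def using integrable_translation[OF qi] qi integral_translation[OF qm] by simp
  moreover have "(\<lambda>n. \<integral>x. D n x \<partial>lborel) \<longlonglongrightarrow> (\<integral>x. Q x \<bullet> b \<partial>lborel)"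
  proof (rule integral_dominated_convergence)
    show "(\<lambda>x. Q x \<bullet> b) \<in> borel_measurable lborel"
      using C1_continuous_grad[OF C] by (auto intro!: borel_measurable_continuous_onI continuous_intros)
    show "D n \<in> borel_measurable lborel" for n unfolding D_def[abs_def] by measurable
    \<comment> \<open>Steps of size at most 1 in direction \<open>b\<close> keep all difference
      quotients supported in one ball, and the mean value inequality bounds them by
      \<open>B * norm b\<close>.\<close>
    show "integrable lborel (\<lambda>x. B * norm b * indicator (cball 0 (R + norm b)) x)"
      by (rule Bochner_Integration.integrable_mult_right[OF integrable_indicator_cball])
    show "AE x in lborel. (\<lambda>n. D n x) \<longlonglongrightarrow> Q x \<bullet> b"
    proof (rule AE_I2)
      fix x
      have lin: "((\<lambda>h. x + h *\<^sub>R b) has_derivative (\<lambda>h. h *\<^sub>R b)) (at 0)"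
        by (auto intro!: derivative_eq_intros)
      have "((\<lambda>h. q (x + h *\<^sub>R b)) has_derivative (\<lambda>h. Q x \<bullet> (h *\<^sub>R b))) (at 0)"
        using has_derivative_compose[OF lin, of q "\<lambda>h. Q x \<bullet> h"] C1_has_derivative[OF C, of x] by simp
      then have "((\<lambda>h. q (x + h *\<^sub>R b)) has_real_derivative (Q x \<bullet> b)) (at 0)"
        by (simp add: has_field_derivative_def mult.commute[of _ "Q x \<bullet> b"] mult_commute_abs)
      then have "((\<lambda>h. (q (x + h *\<^sub>R b) - q x) / h) \<longlongrightarrow> Q x \<bullet> b) (at 0)"
        by (simp add: DERIV_def)
      then have "(\<lambda>n. (q (x + t n *\<^sub>R b) - q x) / t n) \<longlonglongrightarrow> Q x \<bullet> b"
        by (rule filterlim_compose)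
           (use t0 t(1) in \<open>auto simp: filterlim_at intro!: always_eventually less_imp_neq[THEN not_sym]\<close>)
      then show "(\<lambda>n. D n x) \<longlonglongrightarrow> Q x \<bullet> b" by (simp add: D_def add.commute)
    qed
    show "AE x in lborel. norm (D n x) \<le> B * norm b * indicator (cball 0 (R + norm b)) x" for n
    proof (rule AE_I2)
      fix x
      show "norm (D n x) \<le> B * norm b * indicator (cball 0 (R + norm b)) x"
      proof (cases "x \<in> cball 0 (R + norm b)")
        case True
        have "norm (q (t n *\<^sub>R b + x) - q x) \<le> B * norm ((t n *\<^sub>R b + x) - x)"
        proof (rule differentiable_bound[of UNIV q "\<lambda>x h. Q x \<bullet> h"])
          show "onorm (\<lambda>h. Q y \<bullet> h) \<le> B" for y
          proof (rule onorm_le)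
            fix z show "norm (Q y \<bullet> z) \<le> B * norm z"
              using Cauchy_Schwarz_ineq2[of "Q y" z] mult_right_mono[OF B(2)[of y] norm_ge_zero[of z]] by simp
          qed
        qed (use C1_has_derivative[OF C] in \<open>auto intro: has_derivative_at_withinI\<close>)
        then show ?thesis using True t[of n] by (simp add: D_def divide_le_eq mult.assoc mult.commute[of "norm b"])
      next
        case False
        have "norm (t n *\<^sub>R b) \<le> norm b"
          using t[of n] by (simp add: mult_left_le_one_le)
        moreover have "norm x > R + norm b" using False by simp
        ultimately have "norm (t n *\<^sub>R b + x) \<ge> R" "norm x \<ge> R"
          using norm_triangle_ineq2[of x "- (t n *\<^sub>R b)"] norm_ge_zero[of b]
          unfolding norm_minus_cancel by (simp_all only: diff_minus_eq_add add.commute[of x])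
        then show ?thesis using R B(3) by (simp add: D_def)
      qed
    qed
  qed
  ultimately show ?thesis using LIMSEQ_unique by (simp add: LIMSEQ_const_iff)
qed

lemma C1c_ibp:
  assumes "C1c q Q" "C1 p P"
  shows "(\<integral>x. q x * (P x \<bullet> b) \<partial>lborel) = - (\<integral>x. (Q x \<bullet> b) * p x \<partial>lborel)"
proof -
  obtain R where R: "\<And>x. R \<le> norm x \<Longrightarrow> q x = 0" "\<And>x. R \<le> norm x \<Longrightarrow> Q x = 0" using C1c_bound[OF assms(1)] by blast
  note c = C1_continuous[OF C1c_C1[OF assms(1)]] C1_continuous_grad[OF C1c_C1[OF assms(1)]]
     C1_continuous[OF assms(2)] C1_continuous_grad[OF assms(2)]
  have i1: "integrable lborel (\<lambda>x. q x * (P x \<bullet> b))"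
    by (intro continuous_compact_support(1)[where R = R] continuous_intros c) (simp add: R)
  have i2: "integrable lborel (\<lambda>x. (Q x \<bullet> b) * p x)"
    by (intro continuous_compact_support(1)[where R = R] continuous_intros c) (simp add: R)
  have "0 = (\<integral>x. (q x *\<^sub>R P x + p x *\<^sub>R Q x) \<bullet> b \<partial>lborel)"
    using C1c_integral_grad[OF C1c_mult[OF assms]] by simp
  also have "\<dots> = (\<integral>x. q x * (P x \<bullet> b) + (Q x \<bullet> b) * p x \<partial>lborel)"
    by (simp add: inner_add_left mult.commute)
  also have "\<dots> = (\<integral>x. q x * (P x \<bullet> b) \<partial>lborel) + (\<integral>x. (Q x \<bullet> b) * p x \<partial>lborel)"
    using i1 i2 by simp
  finally show ?thesis by simp
qed

section \<open>Sobolev functions\<close>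

text \<open>The H^1 closure of compactly supported C1 functions, with \<open>g\<close> the limit of
  the gradients. Each rule below is proved for smooth functions and passed to the limit;
  \<open>sobolev_H1\<close> later connects this with weak gradients.\<close>

definition sobolev :: "('a::euclidean_space \<Rightarrow> real) \<Rightarrow> ('a \<Rightarrow> 'a) \<Rightarrow> bool" where
  "sobolev w g \<longleftrightarrow> sq_integrable w \<and> sq_integrable g \<and>
     (\<forall>e>0. \<exists>q Q. C1c q Q \<and> sq_norm (\<lambda>x. w x - q x) < e \<and> sq_norm (\<lambda>x. g x - Q x) < e)"

lemma sobolev_sq_integrable: "sobolev w g \<Longrightarrow> sq_integrable w" "sobolev w g \<Longrightarrow> sq_integrable g"
  by (auto simp: sobolev_def)

lemma sobolev_measurable [measurable_dest]:
  "sobolev w g \<Longrightarrow> w \<in> borel_measurable lborel" "sobolev w g \<Longrightarrow> g \<in> borel_measurable lborel"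
  by (auto simp: sobolev_def sq_integrable_def)

lemma sobolev_approxE:
  assumes "sobolev w g" "e > 0"
  obtains q Q where "C1c q Q" "sq_norm (\<lambda>x. w x - q x) < e" "sq_norm (\<lambda>x. g x - Q x) < e"
  using assms unfolding sobolev_def by auto

lemma sobolev_approxI:
  assumes "sq_integrable w" "sq_integrable g"
    and "\<And>e. e > 0 \<Longrightarrow> \<exists>v h. sobolev v h \<and> sq_norm (\<lambda>x. w x - v x) < e \<and> sq_norm (\<lambda>x. g x - h x) < e"
  shows "sobolev w g"
  unfolding sobolev_def
proof (intro conjI allI impI assms(1,2))
  fix e :: real assume e: "e > 0"
  obtain v h where vh: "sobolev v h" "sq_norm (\<lambda>x. w x - v x) < e/4" "sq_norm (\<lambda>x. g x - h x) < e/4"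
    using assms(3)[of "e/4"] e by auto
  obtain q Q where q: "C1c q Q" "sq_norm (\<lambda>x. v x - q x) < e/4" "sq_norm (\<lambda>x. h x - Q x) < e/4"
    using sobolev_approxE[OF vh(1), of "e/4"] e by auto
  have "sq_norm (\<lambda>x. w x - q x) < e"
    using sq_norm_triangle[of w v q] assms(1) sobolev_sq_integrable[OF vh(1)] C1c_sq_integrable[OF q(1)] vh q by linarith
  moreover have "sq_norm (\<lambda>x. g x - Q x) < e"
    using sq_norm_triangle[of g h Q] assms(2) sobolev_sq_integrable[OF vh(1)] C1c_sq_integrable[OF q(1)] vh q by linarith
  ultimately show "\<exists>q Q. C1c q Q \<and> sq_norm (\<lambda>x. w x - q x) < e \<and> sq_norm (\<lambda>x. g x - Q x) < e"
    by (intro exI conjI) (rule q(1))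
qed

text \<open>Closedness under norm convergence of functions and gradients. This is how all
  constructions below (products, compositions, positive parts, lower semicontinuity) reach the
  space.\<close>

lemma sobolev_limit:
  assumes "\<And>n::nat. sobolev (v n) (h n)" "sq_integrable w" "sq_integrable g"
    and "(\<lambda>n. sq_norm (\<lambda>x. v n x - w x)) \<longlonglongrightarrow> 0" "(\<lambda>n. sq_norm (\<lambda>x. h n x - g x)) \<longlonglongrightarrow> 0"
  shows "sobolev w g"
proof (rule sobolev_approxI[OF assms(2,3)])
  fix e :: real assume e: "e > 0"
  have a: "\<forall>\<^sub>F n in sequentially. sq_norm (\<lambda>x. v n x - w x) < e"
    by (rule order_tendstoD(2)[OF assms(4) e])
  have b: "\<forall>\<^sub>F n in sequentially. sq_norm (\<lambda>x. h n x - g x) < e"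
    by (rule order_tendstoD(2)[OF assms(5) e])
  obtain n where n: "sq_norm (\<lambda>x. v n x - w x) < e" "sq_norm (\<lambda>x. h n x - g x) < e"
    using eventually_happens'[OF sequentially_bot eventually_conj[OF a b]] by blast
  show "\<exists>v h. sobolev v h \<and> sq_norm (\<lambda>x. w x - v x) < e \<and> sq_norm (\<lambda>x. g x - h x) < e"
    unfolding sq_norm_diff_commute[of w] sq_norm_diff_commute[of g]
    by (intro exI conjI) (rule assms(1), rule n, rule n)
qed

lemma C1c_sobolev: "C1c q Q \<Longrightarrow> sobolev q Q"
  unfolding sobolev_def using C1c_sq_integrable[of q Q]
  by (intro conjI allI impI exI[of _ q] exI[of _ Q]) (simp_all add: sq_norm_def)

lemma sq_norm_tendsto_0_le:
  assumes "\<And>n. sq_norm (F n) \<le> r n" "r \<longlonglongrightarrow> 0"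
  shows "(\<lambda>n. sq_norm (F n)) \<longlonglongrightarrow> 0"
  by (rule tendsto_sandwich[OF always_eventually always_eventually tendsto_const assms(2)])
    (simp_all add: assms(1))

text \<open>Norm convergence says nothing about continuous functions of \<open>q n\<close>; the
  almost everywhere convergence along a subsequence is added for the chain rule.\<close>

lemma sobolev_approx_seq:
  assumes "sobolev w g"
  obtains q Q where "\<And>n::nat. C1c (q n) (Q n)"
    "(\<lambda>n. sq_norm (\<lambda>x. q n x - w x)) \<longlonglongrightarrow> 0" "(\<lambda>n. sq_norm (\<lambda>x. Q n x - g x)) \<longlonglongrightarrow> 0"
    "AE x in lborel. (\<lambda>n. q n x) \<longlonglongrightarrow> w x"
proof -
  have "\<exists>q. C1c (fst q) (snd q) \<and> sq_norm (\<lambda>x. w x - fst q x) < inverse (real (Suc n)) \<and> sq_norm (\<lambda>x. g x - snd q x) < inverse (real (Suc n))" for n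
  proof -
    have "0 < inverse (real (Suc n))" by simp
    from sobolev_approxE[OF assms this] show ?thesis by (metis fst_conv snd_conv)
  qed
  then obtain r where q': "\<And>n. C1c (fst (r n)) (snd (r n)) \<and> sq_norm (\<lambda>x. w x - fst (r n) x) < inverse (real (Suc n)) \<and> sq_norm (\<lambda>x. g x - snd (r n) x) < inverse (real (Suc n))"
    by metis
  define Q where "Q n = snd (r n)" for n
  define q where "q n = fst (r n)" for n
  have q: "\<And>n. C1c (q n) (Q n)" "\<And>n. sq_norm (\<lambda>x. w x - q n x) < inverse (real (Suc n))"
    "\<And>n. sq_norm (\<lambda>x. g x - Q n x) < inverse (real (Suc n))" 
    using q' by (simp_all add: q_def Q_def)
  have 1: "(\<lambda>n. sq_norm (\<lambda>x. q n x - w x)) \<longlonglongrightarrow> 0"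
  proof (rule sq_norm_tendsto_0_le[OF _ LIMSEQ_inverse_real_of_nat])
    show "sq_norm (\<lambda>x. q n x - w x) \<le> inverse (real (Suc n))" for n
      unfolding sq_norm_diff_commute[of "q n" w] by (rule less_imp_le[OF q(2)])
  qed
  have 2: "(\<lambda>n. sq_norm (\<lambda>x. Q n x - g x)) \<longlonglongrightarrow> 0"
  proof (rule sq_norm_tendsto_0_le[OF _ LIMSEQ_inverse_real_of_nat])
    show "sq_norm (\<lambda>x. Q n x - g x) \<le> inverse (real (Suc n))" for n
      unfolding sq_norm_diff_commute[of "Q n" g] by (rule less_imp_le[OF q(3)])
  qed
  obtain r where r: "strict_mono r" "AE x in lborel. (\<lambda>n. q (r n) x) \<longlonglongrightarrow> w x"
    by (rule sq_norm_tendsto_AE_subseq[OF C1c_sq_integrable(1)[OF q(1)] sobolev_sq_integrable(1)[OF assms] 1])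
  show ?thesis
  proof (rule that[of "\<lambda>n. q (r n)" "\<lambda>n. Q (r n)"])
    show "(\<lambda>n. sq_norm (\<lambda>x. q (r n) x - w x)) \<longlonglongrightarrow> 0"
      using LIMSEQ_subseq_LIMSEQ[OF 1 r(1)] by (simp add: comp_def)
    show "(\<lambda>n. sq_norm (\<lambda>x. Q (r n) x - g x)) \<longlonglongrightarrow> 0"
      using LIMSEQ_subseq_LIMSEQ[OF 2 r(1)] by (simp add: comp_def)
  qed (use q(1) r(2) in auto)
qed

lemma sobolev_add:
  assumes "sobolev w g" "sobolev v h"
  shows "sobolev (\<lambda>x. w x + v x) (\<lambda>x. g x + h x)"
  unfolding sobolev_def
proof (intro conjI allI impI)
  have s: "sq_integrable w" "sq_integrable g" "sq_integrable v" "sq_integrable h"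
    using assms by (simp_all add: sobolev_def)
  show "sq_integrable (\<lambda>x. w x + v x)" "sq_integrable (\<lambda>x. g x + h x)"
    by (rule sq_integrable_add(1)[OF s(1,3)], rule sq_integrable_add(1)[OF s(2,4)])
  fix e :: real assume e: "e > 0"
  obtain q Q where q: "C1c q Q" "sq_norm (\<lambda>x. w x - q x) < e/4" "sq_norm (\<lambda>x. g x - Q x) < e/4"
    using sobolev_approxE[OF assms(1), of "e/4"] e by auto
  obtain p P where p: "C1c p P" "sq_norm (\<lambda>x. v x - p x) < e/4" "sq_norm (\<lambda>x. h x - P x) < e/4"
    using sobolev_approxE[OF assms(2), of "e/4"] e by auto
  have "sq_norm (\<lambda>x. (w x - q x) + (v x - p x)) \<le> 2 * sq_norm (\<lambda>x. w x - q x) + 2 * sq_norm (\<lambda>x. v x - p x)"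
    using s C1c_sq_integrable[OF q(1)] C1c_sq_integrable[OF p(1)]
    by (intro sq_integrable_add(2) sq_integrable_diff(1))
  moreover have "sq_norm (\<lambda>x. (g x - Q x) + (h x - P x)) \<le> 2 * sq_norm (\<lambda>x. g x - Q x) + 2 * sq_norm (\<lambda>x. h x - P x)"
    using s C1c_sq_integrable[OF q(1)] C1c_sq_integrable[OF p(1)]
    by (intro sq_integrable_add(2) sq_integrable_diff(1))
  ultimately have "sq_norm (\<lambda>x. (w x + v x) - (q x + p x)) < e" "sq_norm (\<lambda>x. (g x + h x) - (Q x + P x)) < e"
    using q p by (simp_all add: algebra_simps)
  then show "\<exists>q Q. C1c q Q \<and> sq_norm (\<lambda>x. w x + v x - q x) < e \<and> sq_norm (\<lambda>x. g x + h x - Q x) < e"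
    by (intro exI conjI) (rule C1c_add[OF q(1) p(1)])
qed

lemma sobolev_mult_C1:
  assumes "sobolev w g" "C1 p P" "\<And>x. \<bar>p x\<bar> \<le> B" "\<And>x. norm (P x) \<le> B"
  shows "sobolev (\<lambda>x. w x * p x) (\<lambda>x. w x *\<^sub>R P x + p x *\<^sub>R g x)"
proof -
  obtain q Q where q: "\<And>n::nat. C1c (q n) (Q n)"
    "(\<lambda>n. sq_norm (\<lambda>x. q n x - w x)) \<longlonglongrightarrow> 0" "(\<lambda>n. sq_norm (\<lambda>x. Q n x - g x)) \<longlonglongrightarrow> 0"
    "AE x in lborel. (\<lambda>n. q n x) \<longlonglongrightarrow> w x"
    by (rule sobolev_approx_seq[OF assms(1)]) (rule that, assumption+)
  have pm [measurable]: "p \<in> borel_measurable borel" "P \<in> borel_measurable borel"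
    using C1_continuous[OF assms(2)] C1_continuous_grad[OF assms(2)] by (auto intro: borel_measurable_continuous_onI)
  note s = sobolev_sq_integrable[OF assms(1)]
  have a: "sq_integrable (\<lambda>x. v x * p x)" "sq_norm (\<lambda>x. v x * p x) \<le> B\<^sup>2 * sq_norm v" if "sq_integrable v" for v
  proof -
    have m: "v \<in> borel_measurable borel" using that by (rule sq_integrable_measurable_borel)
    have "norm (v x * p x) \<le> B * norm (v x)" for x
      using mult_right_mono[OF assms(3)[of x], of "\<bar>v x\<bar>"] by (simp add: abs_mult mult.commute)
    then have "AE x in lborel. norm (v x * p x) \<le> B * norm (v x)" by simp
    note * = sq_integrable_bound[OF _ that this]
    show "sq_integrable (\<lambda>x. v x * p x)" "sq_norm (\<lambda>x. v x * p x) \<le> B\<^sup>2 * sq_norm v" by (rule *; use m in measurable)+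
  qed
  have b: "sq_integrable (\<lambda>x. v x *\<^sub>R P x)" "sq_norm (\<lambda>x. v x *\<^sub>R P x) \<le> B\<^sup>2 * sq_norm v" if "sq_integrable v" for v :: "'a \<Rightarrow> real"
  proof -
    have m: "v \<in> borel_measurable borel" using that by (rule sq_integrable_measurable_borel)
    have "norm (v x *\<^sub>R P x) \<le> B * norm (v x)" for x
      using mult_right_mono[OF assms(4)[of x], of "\<bar>v x\<bar>"] by (simp add: mult.commute)
    then have "AE x in lborel. norm (v x *\<^sub>R P x) \<le> B * norm (v x)" by simp
    note * = sq_integrable_bound[OF _ that this]
    show "sq_integrable (\<lambda>x. v x *\<^sub>R P x)" "sq_norm (\<lambda>x. v x *\<^sub>R P x) \<le> B\<^sup>2 * sq_norm v" by (rule *; use m in measurable)+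
  qed
  have c: "sq_integrable (\<lambda>x. p x *\<^sub>R v x)" "sq_norm (\<lambda>x. p x *\<^sub>R v x) \<le> B\<^sup>2 * sq_norm v" if "sq_integrable v" for v :: "'a \<Rightarrow> 'a"
  proof -
    have m: "v \<in> borel_measurable borel" using that by (rule sq_integrable_measurable_borel)
    have "norm (p x *\<^sub>R v x) \<le> B * norm (v x)" for x
      using mult_right_mono[OF assms(3)[of x], of "norm (v x)"] by simp
    then have "AE x in lborel. norm (p x *\<^sub>R v x) \<le> B * norm (v x)" by simp
    note * = sq_integrable_bound[OF _ that this]
    show "sq_integrable (\<lambda>x. p x *\<^sub>R v x)" "sq_norm (\<lambda>x. p x *\<^sub>R v x) \<le> B\<^sup>2 * sq_norm v" by (rule *; use m in measurable)+
  qed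
  note qs = C1c_sq_integrable[OF q(1)]
  show ?thesis
  proof (rule sobolev_limit[where v = "\<lambda>n x. q n x * p x" and h = "\<lambda>n x. q n x *\<^sub>R P x + p x *\<^sub>R Q n x"])
    show "sobolev (\<lambda>x. q n x * p x) (\<lambda>x. q n x *\<^sub>R P x + p x *\<^sub>R Q n x)" for n
      by (rule C1c_sobolev[OF C1c_mult[OF q(1) assms(2)]])
    show "sq_integrable (\<lambda>x. w x * p x)" "sq_integrable (\<lambda>x. w x *\<^sub>R P x + p x *\<^sub>R g x)"
      using s a b c by (auto intro!: sq_integrable_add(1))
    have "(\<lambda>n. B\<^sup>2 * sq_norm (\<lambda>x. q n x - w x)) \<longlonglongrightarrow> B\<^sup>2 * 0"
      by (intro tendsto_mult q tendsto_const)
    then have t1: "(\<lambda>n. B\<^sup>2 * sq_norm (\<lambda>x. q n x - w x)) \<longlonglongrightarrow> 0" by simp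
    show "(\<lambda>n. sq_norm (\<lambda>x. q n x * p x - w x * p x)) \<longlonglongrightarrow> 0"
      by (rule sq_norm_tendsto_0_le[OF _ t1])
         (use a(2)[OF sq_integrable_diff(1)[OF qs(1) s(1)]] in \<open>simp add: left_diff_distrib\<close>)
    have "(\<lambda>n. 2 * (B\<^sup>2 * sq_norm (\<lambda>x. q n x - w x)) + 2 * (B\<^sup>2 * sq_norm (\<lambda>x. Q n x - g x))) \<longlonglongrightarrow> 2 * (B\<^sup>2 * 0) + 2 * (B\<^sup>2 * 0)"
      by (intro tendsto_mult tendsto_add q tendsto_const)
    then have t2: "(\<lambda>n. 2 * (B\<^sup>2 * sq_norm (\<lambda>x. q n x - w x)) + 2 * (B\<^sup>2 * sq_norm (\<lambda>x. Q n x - g x))) \<longlonglongrightarrow> 0" by simp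
    have "sq_norm (\<lambda>x. (q n x *\<^sub>R P x + p x *\<^sub>R Q n x) - (w x *\<^sub>R P x + p x *\<^sub>R g x))
      \<le> 2 * (B\<^sup>2 * sq_norm (\<lambda>x. q n x - w x)) + 2 * (B\<^sup>2 * sq_norm (\<lambda>x. Q n x - g x))" for n
    proof -
      have "(\<lambda>x. (q n x *\<^sub>R P x + p x *\<^sub>R Q n x) - (w x *\<^sub>R P x + p x *\<^sub>R g x))
        = (\<lambda>x. (q n x - w x) *\<^sub>R P x + p x *\<^sub>R (Q n x - g x))" by (simp add: algebra_simps)
      then show ?thesis
        using sq_integrable_add(2)[OF b(1)[OF sq_integrable_diff(1)[OF qs(1) s(1)]] c(1)[OF sq_integrable_diff(1)[OF qs(2) s(2)]], of n n]
          b(2)[OF sq_integrable_diff(1)[OF qs(1)[of n] s(1)]] c(2)[OF sq_integrable_diff(1)[OF qs(2)[of n] s(2)]] by simp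
    qed
    then show "(\<lambda>n. sq_norm (\<lambda>x. (q n x *\<^sub>R P x + p x *\<^sub>R Q n x) - (w x *\<^sub>R P x + p x *\<^sub>R g x))) \<longlonglongrightarrow> 0"
      by (rule sq_norm_tendsto_0_le[OF _ t2])
  qed
qed

lemma sobolev_scale: "sobolev w g \<Longrightarrow> sobolev (\<lambda>x. c * w x) (\<lambda>x. c *\<^sub>R g x)"
  using sobolev_mult_C1[OF _ C1_const[of c], of w g "\<bar>c\<bar>"] by (simp add: mult.commute[of _ c])

lemma sobolev_diff: "sobolev w g \<Longrightarrow> sobolev v h \<Longrightarrow> sobolev (\<lambda>x. w x - v x) (\<lambda>x. g x - h x)"
  using sobolev_add[OF _ sobolev_scale[of v h "-1"]] by simp

lemma sq_norm_dominated:
  fixes F :: "nat \<Rightarrow> 'a::euclidean_space \<Rightarrow> 'b::euclidean_space" and G :: "'a \<Rightarrow> 'c::euclidean_space"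
  assumes "\<And>n. F n \<in> borel_measurable lborel" "sq_integrable G"
    and "AE x in lborel. (\<lambda>n. F n x) \<longlonglongrightarrow> 0" "\<And>n. AE x in lborel. norm (F n x) \<le> C * norm (G x)"
  shows "(\<lambda>n. sq_norm (F n)) \<longlonglongrightarrow> 0"
proof -
  have "(\<lambda>n. \<integral>x. (norm (F n x))\<^sup>2 \<partial>lborel) \<longlonglongrightarrow> (\<integral>x. 0 \<partial>(lborel :: 'a measure))"
  proof (rule integral_dominated_convergence)
    show "(\<lambda>x. (norm (F n x))\<^sup>2) \<in> borel_measurable lborel" for n using assms(1)[of n] by measurable
    show "integrable lborel (\<lambda>x. C\<^sup>2 * (norm (G x))\<^sup>2)" using sq_integrableD[OF assms(2)] by simp
    show "AE x in lborel. (\<lambda>n. (norm (F n x))\<^sup>2) \<longlonglongrightarrow> 0"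
      using assms(3)
    proof eventually_elim
      case (elim x)
      from tendsto_power[OF tendsto_norm_zero[OF this], of 2] show ?case by simp
    qed
    show "AE x in lborel. norm ((norm (F n x))\<^sup>2) \<le> C\<^sup>2 * (norm (G x))\<^sup>2" for n
      using assms(4)[of n]
    proof eventually_elim
      case (elim x)
      then have "(norm (F n x))\<^sup>2 \<le> (C * norm (G x))\<^sup>2" by (intro power_mono) auto
      then show ?case by (simp add: power_mult_distrib)
    qed
  qed auto
  then show ?thesis by (simp add: sq_norm_def)
qed

lemma sobolev_comp:
  assumes w: "sobolev w g" and \<Phi>: "\<And>t. (\<Phi> has_real_derivative \<Phi>' t) (at t)" "continuous_on UNIV \<Phi>'" "\<Phi> 0 = 0"
    and L: "\<And>t. \<bar>\<Phi>' t\<bar> \<le> L"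
  shows "sobolev (\<lambda>x. \<Phi> (w x)) (\<lambda>x. \<Phi>' (w x) *\<^sub>R g x)"
proof -
  have Lip: "\<bar>\<Phi> a - \<Phi> b\<bar> \<le> L * \<bar>a - b\<bar>" for a b
  proof -
    have "norm (\<Phi> a - \<Phi> b) \<le> L * norm (a - b)"
      by (rule field_differentiable_bound[of UNIV \<Phi> \<Phi>'])
         (use L \<Phi>(1) in \<open>auto intro: has_field_derivative_at_within\<close>)
    then show ?thesis by simp
  qed
  have L0: "L \<ge> 0" using L[of 0] by linarith
  have \<Phi>c: "continuous_on UNIV \<Phi>"
    by (meson DERIV_isCont \<Phi>(1) continuous_at_imp_continuous_on)
  have [measurable]: "\<Phi> \<in> borel_measurable borel" "\<Phi>' \<in> borel_measurable borel"
    using \<Phi>c \<Phi>(2) by (auto intro: borel_measurable_continuous_onI)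
  note s = sobolev_sq_integrable[OF w]
  have [measurable]: "w \<in> borel_measurable borel" "g \<in> borel_measurable borel"
    using s by (auto simp: sq_integrable_def)
  obtain q Q where q: "\<And>n::nat. C1c (q n) (Q n)"
    "(\<lambda>n. sq_norm (\<lambda>x. q n x - w x)) \<longlonglongrightarrow> 0" "(\<lambda>n. sq_norm (\<lambda>x. Q n x - g x)) \<longlonglongrightarrow> 0"
    "AE x in lborel. (\<lambda>n. q n x) \<longlonglongrightarrow> w x"
    by (rule sobolev_approx_seq[OF w]) (rule that, assumption+)
  note qs = C1c_sq_integrable[OF q(1)]
  have [measurable]: "q n \<in> borel_measurable borel" "Q n \<in> borel_measurable borel" for n
    using qs[of n] by (auto simp: sq_integrable_def)
  show ?thesis
  proof (rule sobolev_limit[where v = "\<lambda>n x. \<Phi> (q n x)" and h = "\<lambda>n x. \<Phi>' (q n x) *\<^sub>R Q n x"])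
    show "sobolev (\<lambda>x. \<Phi> (q n x)) (\<lambda>x. \<Phi>' (q n x) *\<^sub>R Q n x)" for n
      by (rule C1c_sobolev[OF C1c_comp[OF q(1) \<Phi>]])
    show "sq_integrable (\<lambda>x. \<Phi> (w x))"
      using Lip[of _ 0] \<Phi>(3) by (intro sq_integrable_bound(1)[OF _ s(1), of _ L]) auto
    show "sq_integrable (\<lambda>x. \<Phi>' (w x) *\<^sub>R g x)"
      using L by (intro sq_integrable_bound(1)[OF _ s(2), of _ L]) (auto intro!: mult_right_mono)
    have "(\<lambda>n. L\<^sup>2 * sq_norm (\<lambda>x. q n x - w x)) \<longlonglongrightarrow> L\<^sup>2 * 0"
      by (intro tendsto_mult q tendsto_const)
    then have t1: "(\<lambda>n. L\<^sup>2 * sq_norm (\<lambda>x. q n x - w x)) \<longlonglongrightarrow> 0" by simp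
    have "sq_norm (\<lambda>x. \<Phi> (q n x) - \<Phi> (w x)) \<le> L\<^sup>2 * sq_norm (\<lambda>x. q n x - w x)" for n
      using Lip by (intro sq_integrable_bound(2)[OF _ sq_integrable_diff(1)[OF qs(1) s(1)]]) auto
    then show "(\<lambda>n. sq_norm (\<lambda>x. \<Phi> (q n x) - \<Phi> (w x))) \<longlonglongrightarrow> 0"
      by (rule sq_norm_tendsto_0_le[OF _ t1])
    \<comment> \<open>The derivative of the outer function is only continuous, so \<open>?A\<close>
      tends to 0 by dominated convergence, without a rate; \<open>?B\<close> uses the norm
      convergence of the gradients.\<close>
    let ?A = "\<lambda>n x. (\<Phi>' (q n x) - \<Phi>' (w x)) *\<^sub>R g x" and ?B = "\<lambda>n x. \<Phi>' (q n x) *\<^sub>R (Q n x - g x)"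
    have Ab: "norm (?A n x) \<le> 2 * L * norm (g x)" for n x
    proof -
      have "\<bar>\<Phi>' (q n x) - \<Phi>' (w x)\<bar> \<le> 2 * L" using L[of "q n x"] L[of "w x"] by linarith
      then show "norm (?A n x) \<le> 2 * L * norm (g x)" by (simp add: mult_right_mono)
    qed
    have A: "(\<lambda>n. sq_norm (?A n)) \<longlonglongrightarrow> 0"
    proof (rule sq_norm_dominated[where G = g and C = "2 * L"])
      show "AE x in lborel. (\<lambda>n. ?A n x) \<longlonglongrightarrow> 0"
        using q(4)
      proof eventually_elim
        case (elim x)
        have "(\<lambda>n. \<Phi>' (q n x)) \<longlonglongrightarrow> \<Phi>' (w x)"
          by (rule continuous_on_tendsto_compose[OF \<Phi>(2) elim]) auto
        then have "(\<lambda>n. ?A n x) \<longlonglongrightarrow> (\<Phi>' (w x) - \<Phi>' (w x)) *\<^sub>R g x"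
          by (intro tendsto_intros)
        then show ?case by simp
      qed
      show "AE x in lborel. norm (?A n x) \<le> 2 * L * norm (g x)" for n
        using Ab by (rule AE_I2)
    qed (use s in auto)
    have Asq: "sq_integrable (?A n)" for n
      by (rule sq_integrable_bound(1)[OF _ s(2), of _ "2 * L"]) (measurable, use Ab in \<open>rule AE_I2\<close>)
    have B: "sq_integrable (?B n)" "sq_norm (?B n) \<le> L\<^sup>2 * sq_norm (\<lambda>x. Q n x - g x)" for n
    proof -
      have "AE x in lborel. norm (?B n x) \<le> L * norm (Q n x - g x)"
        using L by (intro AE_I2) (simp add: mult_right_mono)
      note * = sq_integrable_bound[OF _ sq_integrable_diff(1)[OF qs(2)[of n] s(2)] this]
      show "sq_integrable (?B n)" "sq_norm (?B n) \<le> L\<^sup>2 * sq_norm (\<lambda>x. Q n x - g x)"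
        by (rule *, measurable)+
    qed
    have "(\<lambda>n. 2 * sq_norm (?A n) + 2 * (L\<^sup>2 * sq_norm (\<lambda>x. Q n x - g x))) \<longlonglongrightarrow> 2 * 0 + 2 * (L\<^sup>2 * 0)"
      by (rule tendsto_add[OF tendsto_mult[OF tendsto_const A] tendsto_mult[OF tendsto_const tendsto_mult[OF tendsto_const q(3)]]])
    then have t2: "(\<lambda>n. 2 * sq_norm (?A n) + 2 * (L\<^sup>2 * sq_norm (\<lambda>x. Q n x - g x))) \<longlonglongrightarrow> 0" by simp
    have "sq_norm (\<lambda>x. \<Phi>' (q n x) *\<^sub>R Q n x - \<Phi>' (w x) *\<^sub>R g x)
       \<le> 2 * sq_norm (?A n) + 2 * (L\<^sup>2 * sq_norm (\<lambda>x. Q n x - g x))" for n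
    proof -
      have "(\<lambda>x. \<Phi>' (q n x) *\<^sub>R Q n x - \<Phi>' (w x) *\<^sub>R g x) = (\<lambda>x. ?A n x + ?B n x)"
        by (simp add: algebra_simps)
      then show ?thesis using sq_integrable_add(2)[OF Asq B(1), of n n] B(2)[of n] by simp
    qed
    then show "(\<lambda>n. sq_norm (\<lambda>x. \<Phi>' (q n x) *\<^sub>R Q n x - \<Phi>' (w x) *\<^sub>R g x)) \<longlonglongrightarrow> 0"
      by (rule sq_norm_tendsto_0_le[OF _ t2])
  qed
qed

lemma DERIV_max0_power:
  "((\<lambda>t::real. (max 0 t) ^ (n + 2)) has_real_derivative real (n + 2) * (max 0 t) ^ (n + 1)) (at t)"
proof -
  consider "t > 0" | "t < 0" | "t = 0" by linarith
  then show ?thesis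
  proof cases
    case 1
    have "((\<lambda>t::real. t ^ (n + 2)) has_real_derivative real (n + 2) * t ^ (n + 1)) (at t)"
      by (rule DERIV_cong[OF DERIV_pow]) simp
    then have "((\<lambda>t::real. (max 0 t) ^ (n + 2)) has_real_derivative real (n + 2) * t ^ (n + 1)) (at t)"
      by (rule has_field_derivative_transform_within_open[of _ _ _ "{0<..}"]) (use 1 in auto)
    then show ?thesis using 1 by simp
  next
    case 2
    have "((\<lambda>t::real. 0) has_real_derivative 0) (at t)" by simp
    then have "((\<lambda>t::real. (max 0 t) ^ (n + 2)) has_real_derivative 0) (at t)"
      by (rule has_field_derivative_transform_within_open[of _ _ _ "{..<0}"]) (use 2 in auto)
    then show ?thesis using 2 by simp
  next
    case 3
    have "((\<lambda>h. (max 0 h) ^ (n + 2) / h) \<longlongrightarrow> 0) (at (0::real))"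
    proof (rule tendsto_0_le[where K = 1])
      show "((\<lambda>h. \<bar>h\<bar> ^ (n + 1)) \<longlongrightarrow> 0) (at (0::real))"
        by (auto intro!: tendsto_eq_intros)
      have "\<bar>max 0 h\<bar> ^ (n + 2) \<le> \<bar>h\<bar> ^ (n + 2)" for h :: real by (intro power_mono) auto
      then have "norm ((max 0 h) ^ (n + 2) / h) \<le> norm (\<bar>h\<bar> ^ (n + 1)) * 1" for h :: real
        by (cases "h = 0") (auto simp: power_abs divide_le_eq mult_ac)
      then show "\<forall>\<^sub>F h in at (0::real). norm ((max 0 h) ^ (n + 2) / h) \<le> norm (\<bar>h\<bar> ^ (n + 1)) * 1"
        by (intro always_eventually) auto
    qed
    then show ?thesis using 3 by (simp add: DERIV_def)
  qed
qed

text \<open>The C1 functions sqrt (max(0,t)^2 + e^2) - e have slopes between 0 and 1 that vanish for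
  t \<le> 0 and tend to 1 for t > 0. Hence the limiting gradient is \<open>g\<close> exactly on the
  open condition \<open>w x > 0\<close>.\<close>

lemma sobolev_pos_part:
  assumes w: "sobolev w g"
  shows "sobolev (\<lambda>x. max 0 (w x)) (\<lambda>x. if w x > 0 then g x else 0)"
proof -
  define e where "e n = inverse (real (Suc n))" for n
  have e: "e n > 0" for n by (simp add: e_def)
  have e0: "e \<longlonglongrightarrow> 0" unfolding e_def by (rule LIMSEQ_inverse_real_of_nat)
  define \<Phi> where "\<Phi> n t = sqrt ((max 0 t)\<^sup>2 + (e n)\<^sup>2) - e n" for n and t :: real
  define \<Phi>' where "\<Phi>' n t = max 0 t / sqrt ((max 0 t)\<^sup>2 + (e n)\<^sup>2)" for n and t :: real
  have pos: "(max 0 t)\<^sup>2 + (e n)\<^sup>2 > 0" for n t using e[of n] by (simp add: add_nonneg_pos)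
  have d2: "((\<lambda>t::real. (max 0 t)\<^sup>2) has_real_derivative 2 * max 0 t) (at t)" for t
    using DERIV_max0_power[of 0 t] by (simp add: numeral_2_eq_2)
  have d: "(\<Phi> n has_real_derivative \<Phi>' n t) (at t)" for n t
  proof -
    have "((\<lambda>t. (max 0 t)\<^sup>2 + (e n)\<^sup>2) has_real_derivative 2 * max 0 t + 0) (at t)"
      by (rule DERIV_add[OF d2 DERIV_const])
    from DERIV_diff[OF DERIV_chain2[OF DERIV_real_sqrt[OF pos] this] DERIV_const[of "e n"]]
    show ?thesis unfolding \<Phi>_def[abs_def] \<Phi>'_def by (rule DERIV_cong) (simp add: field_simps)
  qed
  have c: "continuous_on UNIV (\<Phi>' n)" for n
    unfolding \<Phi>'_def[abs_def] using pos[of _ n] by (intro continuous_intros) (metis less_irrefl real_sqrt_eq_zero_cancel_iff)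
  have b: "\<bar>\<Phi>' n t\<bar> \<le> 1" for n t
  proof -
    have "max 0 t \<le> sqrt ((max 0 t)\<^sup>2 + (e n)\<^sup>2)" by (rule real_le_rsqrt) simp
    then show ?thesis using pos[of t n] by (simp add: \<Phi>'_def divide_le_eq)
  qed
  have b2: "\<bar>\<Phi> n t - max 0 t\<bar> \<le> \<bar>t\<bar>" "\<bar>\<Phi> n t - max 0 t\<bar> \<le> e n" for n t
  proof -
    have 1: "sqrt ((max 0 t)\<^sup>2 + (e n)\<^sup>2) \<le> max 0 t + e n"
      by (rule real_le_lsqrt) (use e[of n] in \<open>auto simp: power2_sum\<close>)
    have 2: "max 0 t \<le> sqrt ((max 0 t)\<^sup>2 + (e n)\<^sup>2)" "e n \<le> sqrt ((max 0 t)\<^sup>2 + (e n)\<^sup>2)"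
      by (rule real_le_rsqrt, simp)+
    have 3: "0 \<le> max 0 t" "max 0 t \<le> \<bar>t\<bar>" by auto
    show "\<bar>\<Phi> n t - max 0 t\<bar> \<le> \<bar>t\<bar>" "\<bar>\<Phi> n t - max 0 t\<bar> \<le> e n"
      using 1 2 3 e[of n] unfolding \<Phi>_def abs_le_iff by linarith+
  qed
  note s = sobolev_sq_integrable[OF w]
  have [measurable]: "w \<in> borel_measurable borel" "g \<in> borel_measurable borel"
    using s by (auto simp: sq_integrable_def)
  have [measurable]: "\<Phi> n \<in> borel_measurable borel" "\<Phi>' n \<in> borel_measurable borel" for n
    unfolding \<Phi>_def[abs_def] \<Phi>'_def[abs_def] by measurable
  show ?thesis
  proof (rule sobolev_limit[where v = "\<lambda>n x. \<Phi> n (w x)" and h = "\<lambda>n x. \<Phi>' n (w x) *\<^sub>R g x"])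
    show "sobolev (\<lambda>x. \<Phi> n (w x)) (\<lambda>x. \<Phi>' n (w x) *\<^sub>R g x)" for n
      by (rule sobolev_comp[OF w d c _ b]) (use e[of n] in \<open>simp add: \<Phi>_def\<close>)
    show "sq_integrable (\<lambda>x. max 0 (w x))"
      by (rule sq_integrable_bound(1)[OF _ s(1), of _ 1]) auto
    show "sq_integrable (\<lambda>x. if w x > 0 then g x else 0)"
      by (rule sq_integrable_bound(1)[OF _ s(2), of _ 1]) auto
    show "(\<lambda>n. sq_norm (\<lambda>x. \<Phi> n (w x) - max 0 (w x))) \<longlonglongrightarrow> 0"
    proof (rule sq_norm_dominated[OF _ s(1), where C = 1])
      have "(\<lambda>n. \<Phi> n t - max 0 t) \<longlonglongrightarrow> 0" for t
        by (rule tendsto_0_le[OF e0, where K = 1]) (use b2(2) e in \<open>auto intro!: always_eventually simp: abs_of_pos\<close>)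
      then show "AE x in lborel. (\<lambda>n. \<Phi> n (w x) - max 0 (w x)) \<longlonglongrightarrow> 0" by simp
    qed (use b2(1) in auto)
    show "(\<lambda>n. sq_norm (\<lambda>x. \<Phi>' n (w x) *\<^sub>R g x - (if w x > 0 then g x else 0))) \<longlonglongrightarrow> 0"
    proof (rule sq_norm_dominated[OF _ s(2), where C = 2])
      have "(\<lambda>n. \<Phi>' n t) \<longlonglongrightarrow> (if t > 0 then 1 else 0)" for t
      proof (cases "t > 0")
        case True
        have "(\<lambda>n. \<Phi>' n t) \<longlonglongrightarrow> max 0 t / sqrt ((max 0 t)\<^sup>2 + 0\<^sup>2)"
          unfolding \<Phi>'_def using True by (intro tendsto_intros e0) auto
        then show ?thesis using True by simp
      qed (simp add: \<Phi>'_def max_def)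
      then have "(\<lambda>n. \<Phi>' n (w x) *\<^sub>R g x - (if w x > 0 then g x else 0)) \<longlonglongrightarrow>
          (if w x > 0 then 1 else 0) *\<^sub>R g x - (if w x > 0 then g x else 0)" for x
        by (intro tendsto_intros)
      moreover have "(if w x > 0 then 1 else 0) *\<^sub>R g x - (if w x > 0 then g x else 0) = 0" for x by simp
      ultimately show "AE x in lborel. (\<lambda>n. \<Phi>' n (w x) *\<^sub>R g x - (if w x > 0 then g x else 0)) \<longlonglongrightarrow> 0"
        by simp
      have "norm (\<Phi>' n (w x) *\<^sub>R g x - (if w x > 0 then g x else 0)) \<le> 2 * norm (g x)" for n x
      proof -
        have "norm (\<Phi>' n (w x) *\<^sub>R g x - (if w x > 0 then g x else 0)) \<le> norm (\<Phi>' n (w x) *\<^sub>R g x) + norm (if w x > 0 then g x else 0)"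
          by (rule norm_triangle_ineq4)
        also have "\<dots> \<le> 1 * norm (g x) + norm (g x)"
          using b by (intro add_mono) (auto intro!: mult_left_le_one_le)
        finally show ?thesis by simp
      qed
      then show "AE x in lborel. norm (\<Phi>' n (w x) *\<^sub>R g x - (if w x > 0 then g x else 0)) \<le> 2 * norm (g x)" for n
        by simp
    qed measurable
  qed
qed

text \<open>Writing max(0,w) = w + max(0,-w) moves the level \<open>w x = 0\<close> to the other
  side, so that \<open>g\<close> is kept there. In \<open>comparison\<close> this gives the right
  gradient where the minimiser sits on the turning value.\<close>

lemma sobolev_pos_part':
  assumes w: "sobolev w g"
  shows "sobolev (\<lambda>x. max 0 (w x)) (\<lambda>x. if w x \<ge> 0 then g x else 0)"
proof -
  have "sobolev (\<lambda>x. w x + max 0 (- w x)) (\<lambda>x. g x + (if - w x > 0 then - g x else 0))"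
    using sobolev_add[OF w sobolev_pos_part[OF sobolev_scale[OF w, of "-1"]]] by (simp cong: if_cong)
  moreover have "(\<lambda>x. w x + max 0 (- w x)) = (\<lambda>x. max 0 (w x))" by auto
  moreover have "(\<lambda>x. g x + (if - w x > 0 then - g x else 0)) = (\<lambda>x. if w x \<ge> 0 then g x else 0)" by auto
  ultimately show ?thesis by simp
qed

lemma sobolev_max:
  assumes "sobolev w g" "sobolev v h"
  shows "sobolev (\<lambda>x. max (w x) (v x)) (\<lambda>x. if v x > w x then h x else g x)"
    "sobolev (\<lambda>x. min (w x) (v x)) (\<lambda>x. if v x > w x then g x else h x)"
proof -
  have p: "sobolev (\<lambda>x. max 0 (v x - w x)) (\<lambda>x. if v x - w x > 0 then h x - g x else 0)"
    by (rule sobolev_pos_part[OF sobolev_diff[OF assms(2,1)]])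
  have "(\<lambda>x. w x + max 0 (v x - w x)) = (\<lambda>x. max (w x) (v x))"
    "(\<lambda>x. g x + (if v x - w x > 0 then h x - g x else 0)) = (\<lambda>x. if v x > w x then h x else g x)"
    "(\<lambda>x. v x - max 0 (v x - w x)) = (\<lambda>x. min (w x) (v x))"
    "(\<lambda>x. h x - (if v x - w x > 0 then h x - g x else 0)) = (\<lambda>x. if v x > w x then g x else h x)"
    by (auto simp: max_def min_def)
  with sobolev_add[OF assms(1) p] sobolev_diff[OF assms(2) p] show
    "sobolev (\<lambda>x. max (w x) (v x)) (\<lambda>x. if v x > w x then h x else g x)"
    "sobolev (\<lambda>x. min (w x) (v x)) (\<lambda>x. if v x > w x then g x else h x)"
    by simp_all
qed

lemma sobolev_ibp:
  assumes w: "sobolev w g" and p: "C1c p P"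
  shows "(\<integral>x. w x * (P x \<bullet> b) \<partial>lborel) = - (\<integral>x. (g x \<bullet> b) * p x \<partial>lborel)"
proof -
  obtain q Q where q: "\<And>n::nat. C1c (q n) (Q n)"
    "(\<lambda>n. sq_norm (\<lambda>x. q n x - w x)) \<longlonglongrightarrow> 0" "(\<lambda>n. sq_norm (\<lambda>x. Q n x - g x)) \<longlonglongrightarrow> 0"
    "AE x in lborel. (\<lambda>n. q n x) \<longlonglongrightarrow> w x"
    by (rule sobolev_approx_seq[OF w]) (rule that, assumption+)
  note qs = C1c_sq_integrable[OF q(1)] and ps = C1c_sq_integrable[OF p] and s = sobolev_sq_integrable[OF w]
  have 1: "sq_integrable (\<lambda>x. P x \<bullet> b)"
    using sq_integrable_measurable[OF ps(2)] Cauchy_Schwarz_ineq2[of _ b]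
    by (intro sq_integrable_bound(1)[OF _ ps(2), of _ "norm b"] AE_I2) (auto simp: mult.commute[of "norm b"])
  have 2: "sq_integrable (\<lambda>x. p x *\<^sub>R b)"
    using sq_integrable_measurable[OF ps(1)]
    by (intro sq_integrable_bound(1)[OF _ ps(1), of _ "norm b"]) (auto simp: mult.commute)
  have "(\<lambda>n. \<integral>x. q n x \<bullet> (P x \<bullet> b) \<partial>lborel) \<longlonglongrightarrow> (\<integral>x. w x \<bullet> (P x \<bullet> b) \<partial>lborel)"
    by (rule sq_norm_tendsto_inner[OF qs(1) 1 s(1) q(2)])
  moreover have "(\<lambda>n. - (\<integral>x. Q n x \<bullet> (p x *\<^sub>R b) \<partial>lborel)) \<longlonglongrightarrow> - (\<integral>x. g x \<bullet> (p x *\<^sub>R b) \<partial>lborel)"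
    by (intro tendsto_minus sq_norm_tendsto_inner[OF qs(2) 2 s(2) q(3)])
  moreover have "(\<integral>x. q n x \<bullet> (P x \<bullet> b) \<partial>lborel) = - (\<integral>x. Q n x \<bullet> (p x *\<^sub>R b) \<partial>lborel)" for n
    using C1c_ibp[OF q(1) C1c_C1[OF p], of n b] by (simp add: mult.commute)
  ultimately have "(\<integral>x. w x \<bullet> (P x \<bullet> b) \<partial>lborel) = - (\<integral>x. g x \<bullet> (p x *\<^sub>R b) \<partial>lborel)"
    using LIMSEQ_unique by simp
  then show ?thesis by (simp add: mult.commute)
qed

lemma sq_norm_tendsto:
  assumes F: "\<And>n. sq_integrable (F n)" and L: "sq_integrable L"
    and lim: "(\<lambda>n. sq_norm (\<lambda>x. F n x - L x)) \<longlonglongrightarrow> 0"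
  shows "(\<lambda>n. sq_norm (F n)) \<longlonglongrightarrow> sq_norm L"
proof -
  have eq: "sq_norm (F n) = sq_norm L + 2 * ((\<integral>x. F n x \<bullet> L x \<partial>lborel) - (\<integral>x. L x \<bullet> L x \<partial>lborel))
      + sq_norm (\<lambda>x. F n x - L x)" for n
  proof -
    have "(\<integral>x. L x \<bullet> (F n x - L x) \<partial>lborel) = (\<integral>x. F n x \<bullet> L x \<partial>lborel) - (\<integral>x. L x \<bullet> L x \<partial>lborel)"
      using sq_integrable_inner[OF L F[of n]] sq_integrable_inner[OF L L]
      by (simp add: inner_diff_right inner_commute)
    then show ?thesis
      using sq_norm_add_eq[OF L sq_integrable_diff(1)[OF F[of n] L], of 1] by simp
  qed
  have "(\<lambda>n. sq_norm L + 2 * ((\<integral>x. F n x \<bullet> L x \<partial>lborel) - (\<integral>x. L x \<bullet> L x \<partial>lborel))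
      + sq_norm (\<lambda>x. F n x - L x)) \<longlonglongrightarrow> sq_norm L + 2 * ((\<integral>x. L x \<bullet> L x \<partial>lborel) - (\<integral>x. L x \<bullet> L x \<partial>lborel)) + 0"
    by (intro tendsto_add tendsto_mult tendsto_diff tendsto_const lim sq_norm_tendsto_inner[OF F L L lim])
  then show ?thesis unfolding eq by simp
qed

text \<open>Functions with values in the convex hulls of the tails still converge to the limit, so an
  approximately norm-minimal choice is a Cauchy sequence by the parallelogram law.\<close>

lemma sobolev_lsc:
  assumes sob: "\<And>n::nat. sobolev (w n) (g n)"
    and conv: "AE x in lborel. (\<lambda>n. w n x) \<longlonglongrightarrow> v x" and v: "v \<in> borel_measurable lborel"
    and r: "\<And>n. sq_norm (w n) + sq_norm (g n) \<le> r n" "r \<longlonglongrightarrow> R"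
  shows "\<exists>h. sobolev v h \<and> sq_norm v + sq_norm h \<le> R"
proof -
  define N :: "('a \<Rightarrow> real) \<times> ('a \<Rightarrow> 'a) \<Rightarrow> real" where "N p = sq_norm (fst p) + sq_norm (snd p)" for p
  define S where "S n = {p. sobolev (fst p) (snd p) \<and>
     (AE x in lborel. fst p x \<in> convex hull (range (\<lambda>k. w (n + k) x)))}" for n
  define d where "d n = Inf (N ` S n)" for n
  have N0: "0 \<le> N p" for p by (simp add: N_def)
  have bdd: "bdd_below (N ` A)" for A by (rule bdd_belowI[of _ 0]) (auto simp: N0)
  have S_mono: "S n \<subseteq> S m" if "m \<le> n" for m n
  proof
    fix p assume p: "p \<in> S n"
    have sub: "convex hull (range (\<lambda>k. w (n + k) x)) \<subseteq> convex hull (range (\<lambda>k. w (m + k) x))" for x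
    proof (rule hull_mono, rule image_subsetI)
      fix k show "w (n + k) x \<in> range (\<lambda>k. w (m + k) x)"
        using that by (intro image_eqI[of _ _ "n - m + k"]) auto
    qed
    show "p \<in> S m"
      using p sub unfolding S_def by (auto elim!: eventually_mono)
  qed
  have wS: "(w n, g n) \<in> S m" if "m \<le> n" for m n
  proof -
    have "w n x \<in> convex hull (range (\<lambda>k. w (m + k) x))" for x
      by (rule hull_inc, rule image_eqI[of _ _ "n - m"]) (use that in auto)
    then show ?thesis using sob by (simp add: S_def)
  qed
  have d_le: "d n \<le> N p" if "p \<in> S n" for n p
    unfolding d_def using that by (intro cInf_lower bdd) auto
  have d_mono: "d m \<le> d n" if "m \<le> n" for m n
    unfolding d_def using S_mono[OF that] wS[of n n] by (intro cInf_superset_mono bdd) auto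
  have d_R: "d n \<le> R" for n
  proof (rule LIMSEQ_le_const[OF r(2)], intro exI[of _ n] allI impI)
    fix k assume "n \<le> k"
    from d_le[OF wS[OF this]] r(1)[of k] show "d n \<le> r k" by (simp add: N_def)
  qed
  \<comment> \<open>\<open>d\<close> grows as the tails shrink and is bounded by \<open>R\<close>,
    so the gaps \<open>D - d K\<close> tend to 0; by the parallelogram law they bound the distance
    between near-minimal elements.\<close>
  define D where "D = (SUP n. d n)"
  have bddD: "bdd_above (range d)" using d_R by (auto intro!: bdd_aboveI[of _ R])
  have dD: "d n \<le> D" for n unfolding D_def by (rule cSUP_upper[OF _ bddD]) simp
  have DR: "D \<le> R" unfolding D_def by (rule cSUP_least) (use d_R in auto)
  have "\<exists>p\<in>S n. N p < d n + inverse (real (Suc n))" for n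
  proof -
    have "d n < d n + inverse (real (Suc n))" by simp
    then have "\<exists>y\<in>N ` S n. y < d n + inverse (real (Suc n))"
      unfolding d_def using wS[of n n] by (subst (asm) cInf_less_iff[OF _ bdd]) auto
    then show ?thesis by auto
  qed
  then obtain p where p: "\<And>n. p n \<in> S n" "\<And>n. N (p n) < d n + inverse (real (Suc n))" by metis
  define c where "c n = fst (p n)" for n
  define h where "h n = snd (p n)" for n
  have sobc: "sobolev (c n) (h n)" for n using p(1)[of n] by (simp add: S_def c_def h_def)
  note cs = sobolev_sq_integrable(1)[OF sobc] and hs = sobolev_sq_integrable(2)[OF sobc]
  have key: "sq_norm (\<lambda>x. c m x - c n x) + sq_norm (\<lambda>x. h m x - h n x) \<le> 4 * (D - d K + inverse (real (Suc K)))"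
    if mn: "m \<ge> K" "n \<ge> K" for m n K
  proof -
    define q where "q = ((\<lambda>x. (1/2) * (c m x + c n x)), (\<lambda>x. (1/2) *\<^sub>R (h m x + h n x)))"
    have pS: "p m \<in> S K" "p n \<in> S K" using S_mono mn p(1) by blast+
    have "q \<in> S K"
    proof -
      have "AE x in lborel. c m x \<in> convex hull (range (\<lambda>k. w (K + k) x))"
         "AE x in lborel. c n x \<in> convex hull (range (\<lambda>k. w (K + k) x))"
        using pS by (auto simp: S_def c_def)
      then have "AE x in lborel. (1/2) * (c m x + c n x) \<in> convex hull (range (\<lambda>k. w (K + k) x))"
      proof eventually_elim
        case (elim x)
        from convexD[OF convex_convex_hull elim, of "1/2" "1/2"] show ?case by (simp add: algebra_simps)
      qed
      then show ?thesis
        using sobolev_scale[OF sobolev_add[OF sobc sobc], of "1/2" m n] by (simp add: S_def q_def)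
    qed
    then have "d K \<le> N q" by (rule d_le)
    also have "N q = (1/4) * (sq_norm (\<lambda>x. c m x + c n x) + sq_norm (\<lambda>x. h m x + h n x))"
      using sq_norm_scaleR[of "1/2" "\<lambda>x. c m x + c n x"] sq_norm_scaleR[of "1/2" "\<lambda>x. h m x + h n x"]
      by (simp add: N_def q_def power2_eq_square)
    finally have mid: "4 * d K \<le> sq_norm (\<lambda>x. c m x + c n x) + sq_norm (\<lambda>x. h m x + h n x)" by simp
    have pk: "N (p k) \<le> D + inverse (real (Suc K))" if "k \<ge> K" for k
    proof -
      have "inverse (real (Suc k)) \<le> inverse (real (Suc K))" using that by (intro le_imp_inverse_le) auto
      then show ?thesis using p(2)[of k] dD[of k] by linarith
    qed
    have "sq_norm (c m) + sq_norm (h m) \<le> D + inverse (real (Suc K))"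
      "sq_norm (c n) + sq_norm (h n) \<le> D + inverse (real (Suc K))"
      using pk[OF mn(1)] pk[OF mn(2)] by (simp_all add: N_def c_def h_def)
    then show ?thesis
      using mid sq_norm_parallelogram[OF cs[of m] cs[of n]] sq_norm_parallelogram[OF hs[of m] hs[of n]]
      unfolding distrib_left right_diff_distrib by linarith
  qed
  have small: "\<exists>K. 4 * (D - d K + inverse (real (Suc K))) < e" if e: "e > 0" for e
  proof -
    obtain K1 where K1: "D - e/8 < d K1"
      using less_cSUP_iff[OF UNIV_not_empty bddD, of "D - e/8"] e unfolding D_def by auto
    obtain K2 where K2: "inverse (real (Suc K2)) < e/8" using reals_Archimedean[of "e/8"] e by auto
    define K where "K = max K1 K2"
    have "inverse (real (Suc K)) \<le> inverse (real (Suc K2))" by (intro le_imp_inverse_le) (auto simp: K_def)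
    moreover have "d K1 \<le> d K" by (rule d_mono) (simp add: K_def)
    ultimately have "4 * (D - d K + inverse (real (Suc K))) < e" using K1 K2 by argo
    then show ?thesis by blast
  qed
  have ce: "\<exists>K. \<forall>m\<ge>K. \<forall>n\<ge>K. sq_norm (\<lambda>x. c m x - c n x) < e" if e: "e > 0" for e
  proof -
    obtain K where K: "4 * (D - d K + inverse (real (Suc K))) < e" using small[OF e] by blast
    show ?thesis
    proof (intro exI[of _ K] allI impI)
      fix m n assume "K \<le> m" "K \<le> n"
      from key[OF this] K sq_norm_nonneg[of "\<lambda>x. h m x - h n x"]
      show "sq_norm (\<lambda>x. c m x - c n x) < e" by linarith
    qed
  qed
  have he: "\<exists>K. \<forall>m\<ge>K. \<forall>n\<ge>K. sq_norm (\<lambda>x. h m x - h n x) < e" if e: "e > 0" for e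
  proof -
    obtain K where K: "4 * (D - d K + inverse (real (Suc K))) < e" using small[OF e] by blast
    show ?thesis
    proof (intro exI[of _ K] allI impI)
      fix m n assume "K \<le> m" "K \<le> n"
      from key[OF this] K sq_norm_nonneg[of "\<lambda>x. c m x - c n x"]
      show "sq_norm (\<lambda>x. h m x - h n x) < e" by linarith
    qed
  qed
  obtain c' where c': "sq_integrable c'" "(\<lambda>n. sq_norm (\<lambda>x. c n x - c' x)) \<longlonglongrightarrow> 0"
    using sq_norm_complete[OF cs ce] by blast
  obtain h' where h': "sq_integrable h'" "(\<lambda>n. sq_norm (\<lambda>x. h n x - h' x)) \<longlonglongrightarrow> 0"
    using sq_norm_complete[OF hs he] by blast
  obtain s where s: "strict_mono s" "AE x in lborel. (\<lambda>n. c (s n) x) \<longlonglongrightarrow> c' x"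
    by (rule sq_norm_tendsto_AE_subseq[OF cs c'])
  have hull: "AE x in lborel. \<forall>n. c n x \<in> convex hull (range (\<lambda>k. w (n + k) x))"
    unfolding AE_all_countable using p(1) by (auto simp: S_def c_def)
  have eq: "AE x in lborel. c' x = v x"
    using hull conv s(2)
  proof eventually_elim
    case (elim x)
    \<comment> \<open>Balls are convex: a ball around \<open>v x\<close> that contains a tail of the
      values also contains the convex hull of that tail.\<close>
    have "(\<lambda>n. c n x) \<longlonglongrightarrow> v x"
    proof (rule LIMSEQ_I)
      fix e :: real assume "e > 0"
      then obtain K where K: "\<And>n. n \<ge> K \<Longrightarrow> norm (w n x - v x) < e"
        using LIMSEQ_D[OF elim(2)] by blast
      have "c n x \<in> ball (v x) e" if "n \<ge> K" for n
      proof -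
        have "convex hull (range (\<lambda>k. w (n + k) x)) \<subseteq> ball (v x) e"
          by (rule hull_minimal) (use K that in \<open>auto simp: dist_norm abs_minus_commute\<close>)
        then show ?thesis using elim(1) by blast
      qed
      then show "\<exists>K. \<forall>n\<ge>K. norm (c n x - v x) < e" by (auto simp: dist_norm abs_minus_commute)
    qed
    then have "(\<lambda>n. c (s n) x) \<longlonglongrightarrow> v x"
      using LIMSEQ_subseq_LIMSEQ[OF _ s(1)] by (fastforce simp: comp_def)
    then show ?case using elim(3) LIMSEQ_unique by blast
  qed
  have c'm: "c' \<in> borel_measurable lborel" using c'(1) by (simp add: sq_integrable_def)
  have vs: "sq_integrable v" "sq_norm c' = sq_norm v"
    using sq_norm_AE_cong[OF c'm v eq] c'(1) by auto
  have sobv: "sobolev v h'"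
  proof (rule sobolev_limit[where v = c and h = h])
    have "sq_norm (\<lambda>x. c n x - c' x) = sq_norm (\<lambda>x. c n x - v x)" for n
      using cs[of n] c'm v eq by (intro sq_norm_AE_cong(1)) (auto simp: sq_integrable_def)
    then show "(\<lambda>n. sq_norm (\<lambda>x. c n x - v x)) \<longlonglongrightarrow> 0" using c'(2) by simp
  qed (use sobc vs h' in auto)
  have "(\<lambda>n. sq_norm (c n) + sq_norm (h n)) \<longlonglongrightarrow> sq_norm c' + sq_norm h'"
    by (intro tendsto_add sq_norm_tendsto cs hs c' h')
  moreover have "(\<lambda>n. R + inverse (real (Suc n))) \<longlonglongrightarrow> R + 0"
    by (intro tendsto_add tendsto_const LIMSEQ_inverse_real_of_nat)
  moreover have "sq_norm (c n) + sq_norm (h n) \<le> R + inverse (real (Suc n))" for n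
    using p(2)[of n] d_R[of n] by (simp add: N_def c_def h_def)
  ultimately have "sq_norm c' + sq_norm h' \<le> R + 0" by (intro LIMSEQ_le) auto
  then show ?thesis using sobv vs by auto
qed

text \<open>Letting \<open>k\<close> and then \<open>n\<close> tend to infinity gives the pointwise
  limes superior of \<open>s\<close>, reached through finite maxima so that energies can be tracked
  at each step.\<close>

primrec tail_max :: "(nat \<Rightarrow> 'a \<Rightarrow> real) \<Rightarrow> nat \<Rightarrow> nat \<Rightarrow> 'a \<Rightarrow> real" where
  "tail_max s n 0 = s n"
| "tail_max s n (Suc k) = (\<lambda>x. max (tail_max s n k x) (s (n + Suc k) x))"

lemma tail_max_shift: "tail_max s (Suc n) k x \<le> tail_max s n (Suc k) x"
  by (induction k) auto

section \<open>Obstacle problems\<close>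

text \<open>\<open>P x\<close> is merely continuous, not convex in the second argument, so
  competitors have to converge pointwise. The obstacles serve twice: coercivity is asked only
  between them, and they bound monotone sequences of competitors.\<close>

locale obstacle_problem =
  fixes P :: "'a::euclidean_space \<Rightarrow> real \<Rightarrow> real" and lo hi \<beta> :: "'a \<Rightarrow> real"
  assumes P_measurable: "\<And>w. w \<in> borel_measurable borel \<Longrightarrow> (\<lambda>x. P x (w x)) \<in> borel_measurable borel"
    and P_continuous: "\<And>x. continuous_on UNIV (P x)"
    and P_lower: "\<And>x v. lo x \<le> v \<Longrightarrow> v \<le> hi x \<Longrightarrow> v\<^sup>2 / 2 - \<beta> x \<le> P x v"
    and \<beta>_integrable: "integrable lborel \<beta>"
begin

definition admissible :: "('a \<Rightarrow> real) \<Rightarrow> ('a \<Rightarrow> 'a) \<Rightarrow> bool" where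
  "admissible w g \<longleftrightarrow> sobolev w g \<and> (AE x in lborel. lo x \<le> w x \<and> w x \<le> hi x)
     \<and> integrable lborel (\<lambda>x. P x (w x))"

definition J :: "('a \<Rightarrow> real) \<Rightarrow> ('a \<Rightarrow> 'a) \<Rightarrow> real" where
  "J w g = sq_norm g / 2 + (\<integral>x. P x (w x) \<partial>lborel)"

text \<open>Half of w^2 is moved from the potential into the quadratic part. The latter becomes the
  full H^1 norm, to which \<open>sobolev_lsc\<close> applies, and the remainder is bounded below by
  an integrable function, as Fatou requires.\<close>

lemma J_split:
  assumes "admissible w g"
  shows "integrable lborel (\<lambda>x. P x (w x) - (w x)\<^sup>2 / 2)"
    "J w g = (sq_norm w + sq_norm g) / 2 + (\<integral>x. P x (w x) - (w x)\<^sup>2 / 2 \<partial>lborel)"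
    "AE x in lborel. - \<beta> x \<le> P x (w x) - (w x)\<^sup>2 / 2"
    "sq_norm w + sq_norm g \<le> 2 * (J w g + (\<integral>x. \<beta> x \<partial>lborel))"
proof -
  have w2: "integrable lborel (\<lambda>x. (w x)\<^sup>2)"
    using assms sq_integrableD[OF sobolev_sq_integrable(1)] by (fastforce simp: admissible_def)
  have wP: "integrable lborel (\<lambda>x. P x (w x))" using assms by (simp add: admissible_def)
  show 1: "integrable lborel (\<lambda>x. P x (w x) - (w x)\<^sup>2 / 2)" using w2 wP by simp
  show 2: "J w g = (sq_norm w + sq_norm g) / 2 + (\<integral>x. P x (w x) - (w x)\<^sup>2 / 2 \<partial>lborel)"
    using w2 wP by (simp add: J_def sq_norm_def field_simps)
  have "AE x in lborel. lo x \<le> w x \<and> w x \<le> hi x" using assms by (simp add: admissible_def)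
  then show 3: "AE x in lborel. - \<beta> x \<le> P x (w x) - (w x)\<^sup>2 / 2"
  proof eventually_elim
    case (elim x) then show ?case using P_lower[of x "w x"] by simp
  qed
  have "(\<integral>x. - \<beta> x \<partial>lborel) \<le> (\<integral>x. P x (w x) - (w x)\<^sup>2 / 2 \<partial>lborel)"
    using 1 3 \<beta>_integrable by (intro integral_mono_AE) auto
  then show "sq_norm w + sq_norm g \<le> 2 * (J w g + (\<integral>x. \<beta> x \<partial>lborel))" using 2 by (simp only: Bochner_Integration.integral_minus) argo
qed

text \<open>Only the sum of the two parts of \<open>J\<close> is controlled. Passing to a
  subsequence along which the H^1 norms converge to some \<open>A\<close> splits the bound:
  \<open>sobolev_lsc\<close> handles the norms and Fatou the rest, and the two occurrences of
  \<open>A\<close> cancel.\<close>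

lemma admissible_limit:
  assumes adm: "\<And>n::nat. admissible (w n) (g n)"
    and conv: "AE x in lborel. (\<lambda>n. w n x) \<longlonglongrightarrow> v x" and v [measurable]: "v \<in> borel_measurable borel"
    and r: "\<And>n. J (w n) (g n) \<le> r n" "r \<longlonglongrightarrow> R"
  shows "\<exists>h. admissible v h \<and> J v h \<le> R"
proof -
  define N where "N n = sq_norm (w n) + sq_norm (g n)" for n
  have "Bseq r" using r(2) by (rule convergent_imp_Bseq[OF convergentI])
  then obtain B where B: "\<And>n. \<bar>r n\<bar> \<le> B" by (auto simp: Bseq_def)
  have "\<bar>N n\<bar> \<le> 2 * (B + (\<integral>x. \<beta> x \<partial>lborel))" for n
    using J_split(4)[OF adm[of n]] r(1)[of n] B[of n] by (simp add: N_def)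
  then have "bounded (range N)" by (auto simp: bounded_iff)
  then obtain A s where s: "strict_mono s" and A: "(N \<circ> s) \<longlonglongrightarrow> A"
    using bounded_imp_convergent_subsequence[of N] by blast
  have conv': "AE x in lborel. (\<lambda>n. w (s n) x) \<longlonglongrightarrow> v x"
    using conv
  proof eventually_elim
    case (elim x) then show ?case using LIMSEQ_subseq_LIMSEQ[OF elim s] by (simp add: comp_def)
  qed
  have "\<exists>h. sobolev v h \<and> sq_norm v + sq_norm h \<le> A"
  proof (rule sobolev_lsc[OF _ conv' _ _ A])
    show "sobolev (w (s n)) (g (s n))" for n using adm by (simp add: admissible_def)
    show "sq_norm (w (s n)) + sq_norm (g (s n)) \<le> (N \<circ> s) n" for n by (simp add: N_def)
  qed simp
  then obtain h where h: "sobolev v h" "sq_norm v + sq_norm h \<le> A" by blast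
  have c: "AE x in lborel. lo x \<le> v x \<and> v x \<le> hi x"
  proof -
    have "AE x in lborel. \<forall>n. lo x \<le> w n x \<and> w n x \<le> hi x"
      unfolding AE_all_countable using adm by (simp add: admissible_def)
    with conv show ?thesis
    proof eventually_elim
      case (elim x)
      then show ?case by (intro conjI LIMSEQ_le_const[OF elim(1)] LIMSEQ_le_const2[OF elim(1)]) auto
    qed
  qed
  have lim: "AE x in lborel. (\<lambda>n. P x (w (s n) x) - (w (s n) x)\<^sup>2 / 2) \<longlonglongrightarrow> P x (v x) - (v x)\<^sup>2 / 2"
    using conv'
  proof eventually_elim
    case (elim x)
    show ?case
      by (intro tendsto_intros elim continuous_on_tendsto_compose[OF P_continuous elim]) auto
  qed
  have rs: "(\<lambda>n. r (s n) - N (s n) / 2) \<longlonglongrightarrow> R - A / 2"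
    using LIMSEQ_subseq_LIMSEQ[OF r(2) s] A by (intro tendsto_intros) (auto simp: comp_def)
  have le: "(\<integral>x. P x (w (s n) x) - (w (s n) x)\<^sup>2 / 2 \<partial>lborel) \<le> r (s n) - N (s n) / 2" for n
    using J_split(2)[OF adm[of "s n"]] r(1)[of "s n"] by (simp add: N_def)
  have meas: "(\<lambda>x. P x (v x) - (v x)\<^sup>2 / 2) \<in> borel_measurable lborel"
    using P_measurable[OF v] by simp
  note F = Fatou_lower_bound[OF J_split(1)[OF adm] meas lim \<beta>_integrable J_split(3)[OF adm] le rs]
  have v2: "integrable lborel (\<lambda>x. (v x)\<^sup>2 / 2)"
    using sq_integrableD[OF sobolev_sq_integrable(1)[OF h(1)]] by simp
  have Pv: "integrable lborel (\<lambda>x. P x (v x))"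
    using Bochner_Integration.integrable_add[OF F(1) v2] by simp
  have "admissible v h" using h(1) c Pv by (simp add: admissible_def)
  moreover from this have "J v h \<le> R"
    using J_split(2)[of v h] F(2) h(2) by argo
  ultimately show ?thesis by blast
qed

text \<open>At each point maximum and minimum merely permute the two values and the two gradients,
  so both parts of \<open>J\<close> are preserved in sum.\<close>

lemma admissible_max_min:
  assumes "admissible w g" "admissible v h"
  shows "\<exists>g1 g2. admissible (\<lambda>x. max (w x) (v x)) g1 \<and> admissible (\<lambda>x. min (w x) (v x)) g2
    \<and> J (\<lambda>x. max (w x) (v x)) g1 + J (\<lambda>x. min (w x) (v x)) g2 = J w g + J v h"
proof -
  have sob: "sobolev w g" "sobolev v h" using assms by (auto simp: admissible_def)
  define g1 where "g1 x = (if v x > w x then h x else g x)" for x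
  define g2 where "g2 x = (if v x > w x then g x else h x)" for x
  have s12: "sobolev (\<lambda>x. max (w x) (v x)) g1" "sobolev (\<lambda>x. min (w x) (v x)) g2"
    unfolding g1_def[abs_def] g2_def[abs_def] by (rule sobolev_max[OF sob])+
  have bd: "AE x in lborel. lo x \<le> w x \<and> w x \<le> hi x" "AE x in lborel. lo x \<le> v x \<and> v x \<le> hi x"
    using assms by (auto simp: admissible_def)
  have i: "integrable lborel (\<lambda>x. P x (w x))" "integrable lborel (\<lambda>x. P x (v x))"
    using assms by (auto simp: admissible_def)
  have [measurable]: "w \<in> borel_measurable borel" "v \<in> borel_measurable borel"
    using sob by (auto simp: sobolev_def sq_integrable_def)
  have I: "integrable lborel (\<lambda>x. \<bar>P x (w x)\<bar> + \<bar>P x (v x)\<bar>)" using i by simp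
  have i1: "integrable lborel (\<lambda>x. P x (max (w x) (v x)))"
    by (rule Bochner_Integration.integrable_bound[OF I])
      (use P_measurable[of "\<lambda>x. max (w x) (v x)"] in \<open>auto simp: max_def\<close>)
  have i2: "integrable lborel (\<lambda>x. P x (min (w x) (v x)))"
    by (rule Bochner_Integration.integrable_bound[OF I])
      (use P_measurable[of "\<lambda>x. min (w x) (v x)"] in \<open>auto simp: min_def\<close>)
  have a1: "admissible (\<lambda>x. max (w x) (v x)) g1"
    unfolding admissible_def using s12 i1 bd by (auto elim!: eventually_elim2)
  have a2: "admissible (\<lambda>x. min (w x) (v x)) g2"
    unfolding admissible_def using s12 i2 bd by (auto elim!: eventually_elim2)
  have "sq_norm g1 + sq_norm g2 = (\<integral>x. (norm (g1 x))\<^sup>2 + (norm (g2 x))\<^sup>2 \<partial>lborel)"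
    unfolding sq_norm_def using sobolev_sq_integrable(2)[OF s12(1)] sobolev_sq_integrable(2)[OF s12(2)]
    by (simp add: sq_integrable_def)
  also have "\<dots> = (\<integral>x. (norm (g x))\<^sup>2 + (norm (h x))\<^sup>2 \<partial>lborel)"
    by (intro Bochner_Integration.integral_cong) (auto simp: g1_def g2_def)
  also have "\<dots> = sq_norm g + sq_norm h"
    unfolding sq_norm_def using sobolev_sq_integrable(2)[OF sob(1)] sobolev_sq_integrable(2)[OF sob(2)]
    by (simp add: sq_integrable_def)
  finally have e1: "sq_norm g1 + sq_norm g2 = sq_norm g + sq_norm h" .
  have "(\<integral>x. P x (max (w x) (v x)) \<partial>lborel) + (\<integral>x. P x (min (w x) (v x)) \<partial>lborel)
     = (\<integral>x. P x (max (w x) (v x)) + P x (min (w x) (v x)) \<partial>lborel)"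
    using i1 i2 by simp
  also have "\<dots> = (\<integral>x. P x (w x) + P x (v x) \<partial>lborel)"
    by (intro Bochner_Integration.integral_cong) (auto simp: max_def min_def)
  also have "\<dots> = (\<integral>x. P x (w x) \<partial>lborel) + (\<integral>x. P x (v x) \<partial>lborel)" using i by simp
  finally have e2: "(\<integral>x. P x (max (w x) (v x)) \<partial>lborel) + (\<integral>x. P x (min (w x) (v x)) \<partial>lborel)
     = (\<integral>x. P x (w x) \<partial>lborel) + (\<integral>x. P x (v x) \<partial>lborel)" .
  have "J (\<lambda>x. max (w x) (v x)) g1 + J (\<lambda>x. min (w x) (v x)) g2 = J w g + J v h"
    using e1 e2 by (simp add: J_def field_simps)
  with a1 a2 show ?thesis by blast
qed

text \<open>Since \<open>J (max u v) + J (min u v) = J u + J v\<close>, the maxima over the tails of a fast minimising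
  sequence are again minimising, and they converge pointwise by monotonicity.\<close>

theorem minimiser_exists:
  assumes ne: "admissible w0 g0"
  shows "\<exists>w g. admissible w g \<and> (\<forall>w' g'. admissible w' g' \<longrightarrow> J w g \<le> J w' g')"
proof -
  define A where "A = {J w g | w g. admissible w g}"
  have bdd: "bdd_below A"
  proof (rule bdd_belowI)
    fix y assume "y \<in> A"
    then obtain w g where "admissible w g" "y = J w g" by (auto simp: A_def)
    then show "- (\<integral>x. \<beta> x \<partial>lborel) \<le> y"
      using J_split(4)[of w g] sq_norm_nonneg[of w] sq_norm_nonneg[of g] by argo
  qed
  define I where "I = Inf A"
  have I_le: "I \<le> J w g" if "admissible w g" for w g
    unfolding I_def using that by (intro cInf_lower bdd) (auto simp: A_def)
  have Ane: "A \<noteq> {}" using ne by (auto simp: A_def)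
  have "\<exists>w. \<exists>g. admissible w g \<and> J w g < I + (1/2)^n" for n
  proof -
    have "I < I + (1/2)^n" by simp
    then have "\<exists>y\<in>A. y < I + (1/2)^n" unfolding I_def using cInf_less_iff[OF Ane bdd] by blast
    then show ?thesis by (auto simp: A_def)
  qed
  then obtain s where s: "\<And>n. \<exists>g. admissible (s n) g \<and> J (s n) g < I + (1/2)^n" by metis
  \<comment> \<open>The factor \<open>2 - (1/2)^k\<close> adds up the excesses over the infimum:
    taking one more maximum costs at most (1/2)^(n+k+1), because the discarded minimum still has
    energy at least \<open>I\<close>.\<close>
  have tm: "\<exists>g. admissible (tail_max s n k) g \<and> J (tail_max s n k) g \<le> I + (1/2)^n * (2 - (1/2)^k)" for n k
  proof (induction k)
    case 0
    then show ?case using s[of n] by (auto intro: less_imp_le)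
  next
    case (Suc k)
    then obtain g where g: "admissible (tail_max s n k) g" "J (tail_max s n k) g \<le> I + (1/2)^n * (2 - (1/2)^k)" by blast
    obtain h where h: "admissible (s (n + Suc k)) h" "J (s (n + Suc k)) h < I + (1/2)^(n + Suc k)" using s by blast
    obtain g1 g2 where g1: "admissible (\<lambda>x. max (tail_max s n k x) (s (n + Suc k) x)) g1"
      and g2: "admissible (\<lambda>x. min (tail_max s n k x) (s (n + Suc k) x)) g2"
      and eq: "J (\<lambda>x. max (tail_max s n k x) (s (n + Suc k) x)) g1 + J (\<lambda>x. min (tail_max s n k x) (s (n + Suc k) x)) g2
         = J (tail_max s n k) g + J (s (n + Suc k)) h"
      using admissible_max_min[OF g(1) h(1)] by blast
    have "(1/2)^n * (2 - (1/2)^k) + (1/2)^(n + Suc k) = (1/2::real)^n * (2 - (1/2)^Suc k)"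
      by (simp add: power_add algebra_simps)
    then show ?case
      using g1 eq I_le[OF g2] g(2) h(2) by (intro exI[of _ g1]) auto
  qed
  have bdd_s: "AE x in lborel. \<forall>n. lo x \<le> s n x \<and> s n x \<le> hi x"
    unfolding AE_all_countable
  proof
    fix n
    obtain g where "admissible (s n) g" using s[of n] by blast
    then show "AE x in lborel. lo x \<le> s n x \<and> s n x \<le> hi x" unfolding admissible_def by blast
  qed
  define z where "z n x = lim (\<lambda>k. tail_max s n k x)" for n x
  define y where "y x = lim (\<lambda>n. z n x)" for x
  have bds: "AE x in lborel. (\<forall>n. (\<lambda>k. tail_max s n k x) \<longlonglongrightarrow> z n x) \<and> (\<lambda>n. z n x) \<longlonglongrightarrow> y x"
    using bdd_s
  proof eventually_elim
    case (elim x)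
    have tb: "lo x \<le> tail_max s n k x \<and> tail_max s n k x \<le> hi x" for n k
      by (induction k) (use elim in \<open>auto simp: le_max_iff_disj\<close>)
    have c1: "(\<lambda>k. tail_max s n k x) \<longlonglongrightarrow> z n x" for n
    proof -
      have "incseq (\<lambda>k. tail_max s n k x)" by (rule incseq_SucI) simp
      then obtain L where "(\<lambda>k. tail_max s n k x) \<longlonglongrightarrow> L"
        using incseq_convergent[of "\<lambda>k. tail_max s n k x" "hi x"] tb by blast
      then show ?thesis by (simp add: z_def limI)
    qed
    have "decseq (\<lambda>n. z n x)"
    proof (rule decseq_SucI)
      fix n
      have "(\<lambda>k. tail_max s n (Suc k) x) \<longlonglongrightarrow> z n x" by (rule LIMSEQ_Suc[OF c1])
      then show "z (Suc n) x \<le> z n x" by (rule LIMSEQ_le[OF c1]) (intro exI[of _ 0] allI impI tail_max_shift)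
    qed
    moreover have "lo x \<le> z n x" for n using tb by (intro LIMSEQ_le_const[OF c1]) auto
    ultimately obtain L where "(\<lambda>n. z n x) \<longlonglongrightarrow> L" using decseq_convergent[of "\<lambda>n. z n x" "lo x"] by blast
    then have "(\<lambda>n. z n x) \<longlonglongrightarrow> y x" by (simp add: y_def limI)
    with c1 show ?case by blast
  qed
  have [measurable]: "tail_max s n k \<in> borel_measurable borel" for n k
    using tm[of n k] by (auto simp: admissible_def sobolev_def sq_integrable_def)
  have zm [measurable]: "z n \<in> borel_measurable borel" for n unfolding z_def[abs_def] by measurable
  have ym [measurable]: "y \<in> borel_measurable borel" unfolding y_def[abs_def] by measurable
  have z: "\<exists>h. admissible (z n) h \<and> J (z n) h \<le> I + (1/2)^n * 2" for n
  proof -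
    have "\<exists>g. \<forall>k. admissible (tail_max s n k) (g k) \<and> J (tail_max s n k) (g k) \<le> I + (1/2)^n * (2 - (1/2)^k)"
      using tm[of n] by metis
    then obtain g where g: "\<And>k. admissible (tail_max s n k) (g k)" "\<And>k. J (tail_max s n k) (g k) \<le> I + (1/2)^n * (2 - (1/2)^k)"
      by blast
    have "(\<lambda>k. I + (1/2)^n * (2 - (1/2)^k)) \<longlonglongrightarrow> I + (1/2)^n * (2 - 0)"
      by (intro tendsto_intros LIMSEQ_power_zero) auto
    then have "\<exists>h. admissible (z n) h \<and> J (z n) h \<le> I + (1/2)^n * (2 - 0)"
      using bds by (intro admissible_limit[OF g(1) _ zm g(2)]) (auto elim!: eventually_mono)
    then show ?thesis by simp
  qed
  then obtain h where h: "\<And>n. admissible (z n) (h n)" "\<And>n. J (z n) (h n) \<le> I + (1/2)^n * 2" by metis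
  have "(\<lambda>n. I + (1/2)^n * 2) \<longlonglongrightarrow> I + 0 * 2"
    by (intro tendsto_intros LIMSEQ_power_zero) auto
  then have "\<exists>h. admissible y h \<and> J y h \<le> I + 0 * 2"
    using bds by (intro admissible_limit[OF h(1) _ ym h(2)]) (auto elim!: eventually_mono)
  then obtain g where g: "admissible y g" "J y g \<le> I" by auto
  then show ?thesis using I_le by (intro exI[of _ y] exI[of _ g]) force
qed

end

section \<open>The change of variables\<close>

text \<open>Substituting \<open>u = sin \<theta>\<close> and \<open>w = kirchhoff \<theta>\<close> turns \<open>(1 - u\<^sup>2) |\<nabla>u|\<^sup>2\<close> into \<open>|\<nabla>w|\<^sup>2\<close>.\<close>

definition kirchhoff :: "real \<Rightarrow> real" where "kirchhoff \<theta> = \<theta> / 2 + sin (2 * \<theta>) / 4"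
definition angle :: "real \<Rightarrow> real" where "angle = inv kirchhoff"
definition sn :: "real \<Rightarrow> real" where "sn w = sin (angle w)"
definition cs :: "real \<Rightarrow> real" where "cs w = cos (angle w)"

lemma sn_cs: "(sn w)\<^sup>2 + (cs w)\<^sup>2 = 1" by (simp add: sn_def cs_def)

lemma sn_le: "\<bar>sn w\<bar> \<le> 1" and cs_le: "\<bar>cs w\<bar> \<le> 1" by (simp_all add: sn_def cs_def)

lemma DERIV_kirchhoff: "(kirchhoff has_real_derivative (cos \<theta>)\<^sup>2) (at \<theta>)"
  unfolding kirchhoff_def[abs_def]
  by (rule DERIV_cong[OF DERIV_add[OF DERIV_cdivide[OF DERIV_ident] DERIV_cdivide[OF DERIV_chain2[OF DERIV_sin DERIV_cmult_Id]]]])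
     (simp add: cos_double_cos diff_divide_distrib)

lemma abs_sin_less:
  fixes t :: real
  assumes "0 < t" shows "\<bar>sin t\<bar> < t"
proof (cases "t \<le> 1")
  case False
  then show ?thesis using abs_sin_le_one[of t] by linarith
next
  case True
  obtain z where z: "0 < z" "z < t" "sin t - sin 0 = (t - 0) * cos z"
    using MVT2[of 0 t sin cos] assms by auto
  have "cos z < cos 0" using z True pi_gt3 by (intro cos_monotone_0_pi) auto
  then have "sin t < t" using z assms by (simp add: mult_less_cancel_left2)
  moreover have "0 < sin t" using assms True pi_gt3 by (intro sin_gt_zero) auto
  ultimately show ?thesis by simp
qed

text \<open>The derivative cos^2 has zeros, so its sign gives only weak monotonicity; strictness
  comes from |sin t| < t after writing the difference of the sines as a product.\<close>

lemma kirchhoff_strict_mono: "strict_mono kirchhoff"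
proof (rule strict_monoI)
  fix a b :: real assume ab: "a < b"
  have "sin (2 * a) - sin (2 * b) = 2 * (sin (a - b) * cos (a + b))"
  proof -
    have h: "(2 * a - 2 * b) / 2 = a - b" "(2 * a + 2 * b) / 2 = a + b" by simp_all
    show ?thesis using sin_diff_sin[of "2 * a" "2 * b"] unfolding h by simp
  qed
  moreover have "- (sin (a - b) * cos (a + b)) \<ge> - \<bar>sin (b - a)\<bar>"
  proof -
    have "\<bar>sin (a - b) * cos (a + b)\<bar> \<le> \<bar>sin (a - b)\<bar> * 1"
      unfolding abs_mult by (intro mult_left_mono) auto
    moreover have "\<bar>sin (a - b)\<bar> = \<bar>sin (b - a)\<bar>" by (metis abs_minus_cancel minus_diff_eq sin_minus)
    ultimately show ?thesis by linarith
  qed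
  moreover have "\<bar>sin (b - a)\<bar> < b - a"
    using abs_sin_less[of "b - a"] ab by simp
  ultimately show "kirchhoff a < kirchhoff b" unfolding kirchhoff_def by argo
qed

lemma kirchhoff_less_iff [simp]: "kirchhoff a < kirchhoff b \<longleftrightarrow> a < b" and kirchhoff_le_iff [simp]: "kirchhoff a \<le> kirchhoff b \<longleftrightarrow> a \<le> b"
  using strict_mono_less[OF kirchhoff_strict_mono] strict_mono_less_eq[OF kirchhoff_strict_mono] by auto

lemma continuous_kirchhoff: "continuous_on UNIV kirchhoff"
  unfolding kirchhoff_def[abs_def] by (intro continuous_intros) auto

lemma kirchhoff_surj: "\<exists>\<theta>. kirchhoff \<theta> = w"
proof -
  have b: "\<theta> / 2 - 1/4 \<le> kirchhoff \<theta>" "kirchhoff \<theta> \<le> \<theta> / 2 + 1/4" for \<theta>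
    using sin_ge_minus_one[of "2 * \<theta>"] sin_le_one[of "2 * \<theta>"] unfolding kirchhoff_def by argo+
  have "\<exists>\<theta>\<ge>2 * w - 1. \<theta> \<le> 2 * w + 1 \<and> kirchhoff \<theta> = w"
  proof (rule IVT')
    show "kirchhoff (2 * w - 1) \<le> w" using b(2)[of "2 * w - 1"] by argo
    show "w \<le> kirchhoff (2 * w + 1)" using b(1)[of "2 * w + 1"] by argo
  qed (use continuous_on_subset[OF continuous_kirchhoff] in auto)
  then show ?thesis by blast
qed

lemma kirchhoff_angle [simp]: "kirchhoff (angle w) = w"
  unfolding angle_def using kirchhoff_surj[of w] by (metis f_inv_into_f rangeI)

lemma angle_kirchhoff [simp]: "angle (kirchhoff \<theta>) = \<theta>"
  unfolding angle_def using strict_mono_imp_inj_on[OF kirchhoff_strict_mono] by simp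

lemma angle_less_iff [simp]: "angle a < angle b \<longleftrightarrow> a < b" and angle_le_iff [simp]: "angle a \<le> angle b \<longleftrightarrow> a \<le> b"
  using kirchhoff_less_iff[of "angle a" "angle b"] kirchhoff_le_iff[of "angle a" "angle b"] by auto

lemma continuous_angle: "continuous_on UNIV angle"
proof (rule continuous_onI_mono)
  have "range angle = UNIV" by (metis angle_kirchhoff surj_def)
  then show "open (range angle)" by simp
qed simp

lemma continuous_sn: "continuous_on UNIV sn" and continuous_cs: "continuous_on UNIV cs"
  unfolding sn_def[abs_def] cs_def[abs_def] by (intro continuous_intros continuous_angle)+

lemma measurable_sn [measurable]: "sn \<in> borel_measurable borel"
  and measurable_cs [measurable]: "cs \<in> borel_measurable borel"
  using continuous_sn continuous_cs by (auto intro: borel_measurable_continuous_onI)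

text \<open>A Cauchy type mean value estimate: both G and \<open>kirchhoff\<close> carry the factor
  cos^2, so if the remaining factor h stays within e of c, so does the quotient of increments. Zeros
  of the cosine do no harm.\<close>

lemma kirchhoff_increment:
  assumes G: "\<And>\<theta>. (G has_real_derivative (cos \<theta>)\<^sup>2 * h \<theta>) (at \<theta>)"
    and ab: "a \<le> b" and h: "\<And>\<theta>. a \<le> \<theta> \<Longrightarrow> \<theta> \<le> b \<Longrightarrow> \<bar>h \<theta> - c\<bar> \<le> e"
  shows "\<bar>G b - G a - c * (kirchhoff b - kirchhoff a)\<bar> \<le> e * (kirchhoff b - kirchhoff a)"
proof -
  have "(c + e) * kirchhoff a - G a \<le> (c + e) * kirchhoff b - G b"
  proof (rule DERIV_nonneg_imp_nondecreasing[OF ab])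
    fix t assume t: "a \<le> t" "t \<le> b"
    have "((\<lambda>t. (c + e) * kirchhoff t - G t) has_real_derivative (c + e) * (cos t)\<^sup>2 - (cos t)\<^sup>2 * h t) (at t)"
      by (intro DERIV_diff DERIV_cmult DERIV_kirchhoff G)
    moreover have "(c + e) * (cos t)\<^sup>2 - (cos t)\<^sup>2 * h t = (cos t)\<^sup>2 * (c + e - h t)" by (simp add: algebra_simps)
    moreover have "0 \<le> (cos t)\<^sup>2 * (c + e - h t)" using h[OF t] by (intro mult_nonneg_nonneg) auto
    ultimately show "\<exists>y. ((\<lambda>t. (c + e) * kirchhoff t - G t) has_real_derivative y) (at t) \<and> 0 \<le> y" by auto
  qed
  moreover have "G a - (c - e) * kirchhoff a \<le> G b - (c - e) * kirchhoff b"
  proof (rule DERIV_nonneg_imp_nondecreasing[OF ab])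
    fix t assume t: "a \<le> t" "t \<le> b"
    have "((\<lambda>t. G t - (c - e) * kirchhoff t) has_real_derivative (cos t)\<^sup>2 * h t - (c - e) * (cos t)\<^sup>2) (at t)"
      by (intro DERIV_diff DERIV_cmult DERIV_kirchhoff G)
    moreover have "(cos t)\<^sup>2 * h t - (c - e) * (cos t)\<^sup>2 = (cos t)\<^sup>2 * (h t - c + e)" by (simp add: algebra_simps)
    moreover have "0 \<le> (cos t)\<^sup>2 * (h t - c + e)" using h[OF t] by (intro mult_nonneg_nonneg) auto
    ultimately show "\<exists>y. ((\<lambda>t. G t - (c - e) * kirchhoff t) has_real_derivative y) (at t) \<and> 0 \<le> y" by auto
  qed
  ultimately show ?thesis by (simp add: abs_le_iff algebra_simps)
qed

text \<open>\<open>angle\<close> has infinite slope at turning values, but a function of the angle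
  whose derivative contains cos^2 is still C1 in w. All derivatives at turning values are obtained
  this way.\<close>

lemma DERIV_comp_angle:
  assumes G: "\<And>\<theta>. (G has_real_derivative (cos \<theta>)\<^sup>2 * h \<theta>) (at \<theta>)" and h: "continuous_on UNIV h"
  shows "((\<lambda>w. G (angle w)) has_real_derivative h (angle w)) (at w)"
  unfolding DERIV_def
proof (rule LIM_I)
  fix e :: real assume e: "e > 0"
  have "continuous_on UNIV (\<lambda>w. h (angle w))"
    by (intro continuous_on_compose2[OF h continuous_angle]) auto
  then have "isCont (\<lambda>w. h (angle w)) w" by (simp add: continuous_on_eq_continuous_at)
  then obtain d where d: "d > 0" "\<And>v. \<bar>v - w\<bar> < d \<Longrightarrow> \<bar>h (angle v) - h (angle w)\<bar> < e/2"
    using e unfolding continuous_at_eps_delta dist_real_def by (metis half_gt_zero)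
  show "\<exists>s>0. \<forall>k. k \<noteq> 0 \<and> norm (k - 0) < s \<longrightarrow>
      norm ((G (angle (w + k)) - G (angle w)) / k - h (angle w)) < e"
  proof (intro exI[of _ d] conjI d allI impI)
    fix k :: real assume k: "k \<noteq> 0 \<and> norm (k - 0) < d"
    let ?a = "angle (min w (w + k))" and ?b = "angle (max w (w + k))"
    have "\<bar>G ?b - G ?a - h (angle w) * (kirchhoff ?b - kirchhoff ?a)\<bar> \<le> e/2 * (kirchhoff ?b - kirchhoff ?a)"
    proof (rule kirchhoff_increment[OF G])
      show "?a \<le> ?b" by simp
      fix \<theta> assume "?a \<le> \<theta>" "\<theta> \<le> ?b"
      then have "min w (w + k) \<le> kirchhoff \<theta>" "kirchhoff \<theta> \<le> max w (w + k)"
        using kirchhoff_le_iff[of ?a \<theta>] kirchhoff_le_iff[of \<theta> ?b] by (simp_all only: kirchhoff_angle)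
      then have "\<bar>kirchhoff \<theta> - w\<bar> < d" using k by auto
      from d(2)[OF this] show "\<bar>h \<theta> - h (angle w)\<bar> \<le> e/2" by simp
    qed
    then have "\<bar>G (angle (w + k)) - G (angle w) - h (angle w) * k\<bar> \<le> e/2 * \<bar>k\<bar>"
      by (cases "k > 0") (simp_all add: min_def max_def abs_if algebra_simps split: if_splits)
    then have "\<bar>(G (angle (w + k)) - G (angle w)) / k - h (angle w)\<bar> \<le> e/2"
      using k by (simp add: field_simps abs_if split: if_splits)
    then show "norm ((G (angle (w + k)) - G (angle w)) / k - h (angle w)) < e" using e by simp
  qed
qed

lemma DERIV_angle:
  assumes "cs w \<noteq> 0"
  shows "(angle has_real_derivative inverse ((cs w)\<^sup>2)) (at w)"
proof (rule DERIV_inverse_function[where f = kirchhoff and a = "w - 1" and b = "w + 1"])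
  show "(kirchhoff has_real_derivative (cs w)\<^sup>2) (at (angle w))" using DERIV_kirchhoff by (simp add: cs_def)
  show "isCont angle w" using continuous_angle by (simp add: continuous_on_eq_continuous_at)
qed (use assms in auto)

text \<open>The slope is unbounded near the zeros of \<open>cs\<close>; this is the source of all
  singular behaviour of the potential in the variable w.\<close>

lemma DERIV_sn: "cs w \<noteq> 0 \<Longrightarrow> (sn has_real_derivative 1 / cs w) (at w)"
  unfolding sn_def[abs_def]
  by (rule DERIV_cong[OF DERIV_chain2[OF DERIV_sin DERIV_angle]]) (auto simp: cs_def power2_eq_square field_simps)

text \<open>At a turning value \<open>cs\<close> behaves like the cube root of the distance; its
  cube has derivative \<open>- 3 * sn\<close>. This is why variations are measured against
  |cs|^3.\<close>

lemma cs_cube_Lipschitz: "\<bar>(cs v)^3 - (cs w)^3\<bar> \<le> 3 * \<bar>v - w\<bar>"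
proof -
  have D: "((\<lambda>w. (cs w)^3) has_real_derivative - 3 * sn w) (at w)" for w
    unfolding cs_def[abs_def] sn_def
    by (rule DERIV_comp_angle) (auto intro!: derivative_eq_intros continuous_intros simp: power2_eq_square)
  have "norm ((cs v)^3 - (cs w)^3) \<le> 3 * norm (v - w)"
    by (rule field_differentiable_bound[of UNIV _ "\<lambda>w. - 3 * sn w"])
       (use D sn_le in \<open>auto intro: has_field_derivative_at_within simp: abs_mult\<close>)
  then show ?thesis by simp
qed

lemma cs_eq_0_iff: "cs w = 0 \<longleftrightarrow> (\<exists>n::int. w = of_int n * (pi / 2) + pi / 4)"
proof -
  have "cs w = 0 \<longleftrightarrow> (\<exists>n::int. angle w = of_int n * pi + pi / 2)"
    unfolding cs_def cos_zero_iff_int2 ..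
  also have "\<dots> \<longleftrightarrow> (\<exists>n::int. w = kirchhoff (of_int n * pi + pi / 2))"
    by (metis kirchhoff_angle angle_kirchhoff)
  also have "(\<lambda>n::int. kirchhoff (of_int n * pi + pi / 2)) = (\<lambda>n. of_int n * (pi / 2) + pi / 4)"
  proof
    fix n :: int
    have "sin (2 * (of_int n * pi + pi / 2)) = sin (2 * pi * of_int n + pi)" by (simp add: algebra_simps)
    also have "\<dots> = 0" by (simp add: sin_add)
    finally show "kirchhoff (of_int n * pi + pi / 2) = of_int n * (pi / 2) + pi / 4"
      by (simp add: kirchhoff_def field_simps)
  qed
  finally show ?thesis by metis
qed

lemma cs_nonzero_between:
  assumes "cs a = 0" "a < w" "w < a + pi / 2" shows "cs w \<noteq> 0"
proof
  assume "cs w = 0"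
  then obtain m where m: "w = of_int m * (pi / 2) + pi / 4" using cs_eq_0_iff by blast
  obtain n where n: "a = of_int n * (pi / 2) + pi / 4" using assms cs_eq_0_iff by blast
  have "of_int n * (pi / 2) < of_int m * (pi / 2)" "of_int m * (pi / 2) < (of_int n + 1) * (pi / 2)"
    using assms m n by (simp_all add: algebra_simps)
  then have "real_of_int n < of_int m" "real_of_int m < of_int n + 1"
    using pi_gt_zero by (simp_all add: mult_less_cancel_right_pos)
  then have "n < m" "real_of_int m < real_of_int (n + 1)" by simp_all
  then have "n < m" "m < n + 1" unfolding of_int_less_iff by simp_all
  then show False by linarith
qed

lemma kirchhoff_minus: "kirchhoff (- \<theta>) = - kirchhoff \<theta>" by (simp add: kirchhoff_def)
lemma angle_minus: "angle (- w) = - angle w" by (metis angle_kirchhoff kirchhoff_angle kirchhoff_minus)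
lemma sn_minus: "sn (- w) = - sn w" by (simp add: sn_def angle_minus)

text \<open>On the branch through 0, which is the range allowed in the exterior, u and w are
  comparable, so square integrability passes between them. By oddness only 0 \<le> w has to be
  treated.\<close>

lemma sn_bounds:
  assumes "\<bar>w\<bar> \<le> pi / 4"
  shows "\<bar>w\<bar> \<le> 2 * \<bar>sn w\<bar>" "\<bar>sn w\<bar> \<le> 2 * \<bar>w\<bar>"
proof -
  have pos: "w \<le> 2 * sn w \<and> 0 \<le> sn w \<and> sn w \<le> 2 * w" if w: "0 \<le> w" "w \<le> pi / 4" for w
  proof -
    define \<theta> where "\<theta> = angle w"
    have a: "kirchhoff 0 = 0" "kirchhoff (pi / 2) = pi / 4" by (simp_all add: kirchhoff_def)
    have \<theta>: "0 \<le> \<theta>" "\<theta> \<le> pi / 2"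
      using w a by (metis \<theta>_def angle_kirchhoff angle_le_iff)+
    have "2 * sin 0 - kirchhoff 0 \<le> 2 * sin \<theta> - kirchhoff \<theta>"
    proof (rule DERIV_nonneg_imp_nondecreasing[OF \<theta>(1)])
      fix t assume t: "0 \<le> t" "t \<le> \<theta>"
      have "((\<lambda>t. 2 * sin t - kirchhoff t) has_real_derivative 2 * cos t - (cos t)\<^sup>2) (at t)"
        by (intro DERIV_diff DERIV_cmult DERIV_sin DERIV_kirchhoff)
      moreover have "0 \<le> cos t" using t \<theta> by (intro cos_ge_zero) auto
      then have "0 \<le> cos t * (2 - cos t)" using cos_le_one[of t] by (intro mult_nonneg_nonneg) linarith+
      then have "0 \<le> 2 * cos t - (cos t)\<^sup>2" by (simp add: algebra_simps power2_eq_square)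
      ultimately show "\<exists>y. ((\<lambda>t. 2 * sin t - kirchhoff t) has_real_derivative y) (at t) \<and> 0 \<le> y" by blast
    qed
    then have 1: "w \<le> 2 * sn w" by (simp add: a \<theta>_def sn_def)
    have 2: "0 \<le> sn w" using \<theta> by (simp add: sn_def \<theta>_def[symmetric] sin_ge_zero)
    have "0 \<le> sin (2 * \<theta>)" using \<theta> by (intro sin_ge_zero) auto
    then have "\<theta> \<le> 2 * kirchhoff \<theta>" by (simp add: kirchhoff_def)
    moreover have "sin \<theta> \<le> \<theta>" using \<theta> abs_sin_less[of \<theta>] by (cases "\<theta> = 0") auto
    ultimately have "sn w \<le> 2 * w" by (simp add: \<theta>_def sn_def)
    with 1 2 show ?thesis by blast
  qed
  show "\<bar>w\<bar> \<le> 2 * \<bar>sn w\<bar>" "\<bar>sn w\<bar> \<le> 2 * \<bar>w\<bar>"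
    using pos[of w] pos[of "- w"] assms sn_minus[of w] by (cases "0 \<le> w"; force)+
qed

text \<open>With \<delta> the angular distance from the turning point and \<open>e\<close> the side,
  cos^2 becomes sin^2, so y is the integral of sin^2 from 0 to \<delta>, while |sn| = cos \<delta>.
  Thus y is of order \<delta>^3 and 1 - |sn| of order \<delta>^2. The height \<pi>/4 corresponds to
  \<delta> = \<pi>/2, where \<open>sn\<close> vanishes.\<close>

lemma turning_parametrisation:
  assumes \<tau>: "cs \<tau> = 0" and e: "e = 1 \<or> e = -1" and y: "0 \<le> y" "y \<le> pi / 4"
  obtains \<delta> where "0 \<le> \<delta>" "\<delta> \<le> pi / 2" "y = \<delta> / 2 - sin (2 * \<delta>) / 4" "\<bar>sn (\<tau> + e * y)\<bar> = cos \<delta>"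
    "\<delta> = e * (angle (\<tau> + e * y) - angle \<tau>)"
proof -
  define \<theta> where "\<theta> = angle \<tau>"
  have c0: "cos \<theta> = 0" using \<tau> by (simp add: cs_def \<theta>_def)
  have s1: "\<bar>sin \<theta>\<bar> = 1" using c0 sin_cos_squared_add[of \<theta>] by (auto simp: power2_eq_1_iff)
  have kirchhoff: "kirchhoff (\<theta> + e * \<delta>) = \<tau> + e * (\<delta> / 2 - sin (2 * \<delta>) / 4)" for \<delta>
  proof -
    have "sin (2 * (\<theta> + e * \<delta>)) = sin (2 * \<theta> + e * (2 * \<delta>))" by (simp add: algebra_simps)
    also have "\<dots> = - e * sin (2 * \<delta>)"
      using e c0 by (auto simp: sin_add sin_double cos_double_cos)
    finally have "kirchhoff (\<theta> + e * \<delta>) = \<theta> / 2 + e * (\<delta> / 2 - sin (2 * \<delta>) / 4)"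
      by (simp add: kirchhoff_def algebra_simps add_divide_distrib)
    moreover have "kirchhoff \<theta> = \<theta> / 2" using c0 by (simp add: kirchhoff_def sin_double)
    moreover have "kirchhoff \<theta> = \<tau>" by (simp add: \<theta>_def)
    ultimately show ?thesis by simp
  qed
  define \<delta> where "\<delta> = e * (angle (\<tau> + e * y) - \<theta>)"
  have ee: "e * e = 1" using e by auto
  have ed: "e * \<delta> = angle (\<tau> + e * y) - \<theta>" using ee by (simp add: \<delta>_def mult.assoc[symmetric])
  then have "kirchhoff (\<theta> + e * \<delta>) = \<tau> + e * y" by simp
  then have yy: "y = \<delta> / 2 - sin (2 * \<delta>) / 4" using kirchhoff[of \<delta>] e by auto
  have d0: "0 \<le> \<delta>"
    using e y(1) angle_le_iff[of \<tau> "\<tau> + y"] angle_le_iff[of "\<tau> - y" \<tau>] by (auto simp: \<delta>_def \<theta>_def)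
  have dl: "\<delta> \<le> pi / 2"
  proof -
    have "kirchhoff (\<theta> + e * (pi / 2)) = \<tau> + e * (pi / 4)" using kirchhoff[of "pi / 2"] by simp
    then have "angle (\<tau> + e * (pi / 4)) = \<theta> + e * (pi / 2)" by (metis angle_kirchhoff)
    moreover have "e * angle (\<tau> + e * y) \<le> e * angle (\<tau> + e * (pi / 4))" using e y(2) by auto
    ultimately show ?thesis using e by (auto simp: \<delta>_def)
  qed
  have "sn (\<tau> + e * y) = sin \<theta> * cos \<delta>"
  proof -
    have "sn (\<tau> + e * y) = sin (\<theta> + e * \<delta>)" using ed by (simp add: sn_def)
    also have "\<dots> = sin \<theta> * cos \<delta>" using e c0 by (auto simp: sin_add sin_diff)
    finally show ?thesis .
  qed
  then have sc: "\<bar>sn (\<tau> + e * y)\<bar> = cos \<delta>"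
    using s1 d0 dl by (simp add: abs_mult cos_ge_zero)
  show ?thesis by (rule that[OF d0 dl yy sc]) (simp add: \<delta>_def \<theta>_def)
qed

text \<open>The first bound, that |sn| falls at least at unit rate, compares sin with sin^2. For the
  second put s = sin (t/2) and c = cos (t/2): cos t = 1 - 2 s^2, and y has derivative 4 s^2 c^2 with
  c between 1/2 and 1, which traps it between the derivatives of 4/3 s^3 and 8/3 s^3. So |sn| falls
  at most at rate 3/(2q) once q \<le> s, that is, like y^(-1/3).\<close>

lemma turning_estimates:
  assumes \<tau>: "cs \<tau> = 0" and e: "e = 1 \<or> e = -1" and yz: "0 \<le> z" "z < y" "y \<le> pi / 4"
  shows "y - z \<le> \<bar>sn (\<tau> + e * z)\<bar> - \<bar>sn (\<tau> + e * y)\<bar>"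
    "\<And>q. 0 < q \<Longrightarrow> 8/3 * q^3 \<le> y \<Longrightarrow> \<bar>sn (\<tau> + e * z)\<bar> - \<bar>sn (\<tau> + e * y)\<bar> \<le> 3/2 * (y - z) / q"
proof -
  have zb: "0 \<le> z" "z \<le> pi / 4" and yb: "0 \<le> y" "y \<le> pi / 4" using yz by auto
  obtain a where a: "0 \<le> a" "a \<le> pi / 2" "z = a / 2 - sin (2 * a) / 4" "\<bar>sn (\<tau> + e * z)\<bar> = cos a"
    "a = e * (angle (\<tau> + e * z) - angle \<tau>)"
    by (rule turning_parametrisation[OF \<tau> e zb])
  obtain b where b: "0 \<le> b" "b \<le> pi / 2" "y = b / 2 - sin (2 * b) / 4" "\<bar>sn (\<tau> + e * y)\<bar> = cos b"
    "b = e * (angle (\<tau> + e * y) - angle \<tau>)"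
    by (rule turning_parametrisation[OF \<tau> e yb])
  have ab: "a < b"
    using e yz(2) unfolding a(5) b(5) by auto
  let ?Y = "\<lambda>t. t / 2 - sin (2 * t) / 4" and ?s = "\<lambda>t. sin (t / 2)" and ?c = "\<lambda>t. cos (t / 2)"
  have DY: "(?Y has_real_derivative (sin t)\<^sup>2) (at t)" for t
    by (rule DERIV_cong[OF DERIV_diff[OF DERIV_cdivide[OF DERIV_ident] DERIV_cdivide[OF DERIV_chain2[OF DERIV_sin DERIV_cmult_Id]]]])
       (simp add: cos_double_sin diff_divide_distrib)
  have Ds: "((\<lambda>t. (?s t)^3) has_real_derivative 3/2 * (?s t)\<^sup>2 * ?c t) (at t)" for t
    by (auto intro!: derivative_eq_intros simp: power2_eq_square field_simps)
  have sq: "(sin t)\<^sup>2 = 4 * (?s t)\<^sup>2 * (?c t)\<^sup>2" for t :: real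
    using sin_double[of "t / 2"] by (simp add: power_mult_distrib)
  have c_half: "1/2 \<le> ?c t" if "0 \<le> t" "t \<le> pi / 2" for t
  proof -
    have "cos (pi / 3) \<le> cos (t / 2)" using that pi_gt_zero by (intro cos_monotone_0_pi_le) auto
    then show ?thesis by (simp add: cos_60)
  qed
  have "- cos a - ?Y a \<le> - cos b - ?Y b"
  proof (rule DERIV_nonneg_imp_nondecreasing[where f = "\<lambda>t. - cos t - ?Y t"])
    fix t assume t: "a \<le> t" "t \<le> b"
    have "((\<lambda>t. - cos t - ?Y t) has_real_derivative sin t - (sin t)\<^sup>2) (at t)"
      using DERIV_diff[OF DERIV_minus[OF DERIV_cos] DY] by simp
    moreover have "0 \<le> sin t" using t a(1,2) b(1,2) by (intro sin_ge_zero) auto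
    then have "0 \<le> sin t * (1 - sin t)" by (intro mult_nonneg_nonneg) auto
    then have "0 \<le> sin t - (sin t)\<^sup>2" by (simp add: algebra_simps power2_eq_square)
    ultimately show "\<exists>y. ((\<lambda>t. - cos t - ?Y t) has_real_derivative y) (at t) \<and> 0 \<le> y" by blast
  qed (use ab in simp)
  then show "y - z \<le> \<bar>sn (\<tau> + e * z)\<bar> - \<bar>sn (\<tau> + e * y)\<bar>" using a(3,4) b(3,4) by linarith
  have 1: "?Y a - 4/3 * (?s a)^3 \<le> ?Y b - 4/3 * (?s b)^3"
  proof (rule DERIV_nonneg_imp_nondecreasing[where f = "\<lambda>t. ?Y t - 4/3 * (?s t)^3"])
    fix t assume t: "a \<le> t" "t \<le> b"
    have "((\<lambda>t. ?Y t - 4/3 * (?s t)^3) has_real_derivative (sin t)\<^sup>2 - 4/3 * (3/2 * (?s t)\<^sup>2 * ?c t)) (at t)"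
      by (intro DERIV_diff DERIV_cmult DY Ds)
    moreover have "0 \<le> (sin t)\<^sup>2 - 4/3 * (3/2 * (?s t)\<^sup>2 * ?c t)"
    proof -
      have "0 \<le> 4 * (?s t)\<^sup>2 * (?c t * (?c t - 1/2))"
        using c_half[of t] t a(1,2) b(1,2) by (intro mult_nonneg_nonneg) auto
      then show ?thesis unfolding sq[of t] by (simp add: algebra_simps power2_eq_square)
    qed
    ultimately show "\<exists>y. ((\<lambda>t. ?Y t - 4/3 * (?s t)^3) has_real_derivative y) (at t) \<and> 0 \<le> y" by blast
  qed (use ab in simp)
  \<comment> \<open>This yields y \<le> 8/3 sin (b/2)^3, so the hypothesis 8/3 q^3 \<le> y forces q
    \<le> sin (b/2).\<close>
  have 2: "8/3 * (?s 0)^3 - ?Y 0 \<le> 8/3 * (?s b)^3 - ?Y b"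
  proof (rule DERIV_nonneg_imp_nondecreasing[where f = "\<lambda>t. 8/3 * (?s t)^3 - ?Y t"])
    fix t assume t: "0 \<le> t" "t \<le> b"
    have "((\<lambda>t. 8/3 * (?s t)^3 - ?Y t) has_real_derivative 8/3 * (3/2 * (?s t)\<^sup>2 * ?c t) - (sin t)\<^sup>2) (at t)"
      by (intro DERIV_diff DERIV_cmult DY Ds)
    moreover have "0 \<le> 8/3 * (3/2 * (?s t)\<^sup>2 * ?c t) - (sin t)\<^sup>2"
    proof -
      have "0 \<le> 4 * (?s t)\<^sup>2 * (?c t * (1 - ?c t))"
        using c_half[of t] t a(1,2) b(1,2) by (intro mult_nonneg_nonneg) auto
      then show ?thesis unfolding sq[of t] by (simp add: algebra_simps power2_eq_square)
    qed
    ultimately show "\<exists>y. ((\<lambda>t. 8/3 * (?s t)^3 - ?Y t) has_real_derivative y) (at t) \<and> 0 \<le> y" by blast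
  qed (use b(1) in simp)
  fix q :: real assume q: "0 < q" "8/3 * q^3 \<le> y"
  have sa: "0 \<le> ?s a" using a(1,2) by (intro sin_ge_zero) auto
  have sab: "?s a \<le> ?s b" using ab a(1,2) b(1,2) by (intro sin_monotone_2pi_le) auto
  have "q^3 \<le> (?s b)^3" using 2 q unfolding b(3)[symmetric] by simp
  then have qb: "q \<le> ?s b" using power_mono_iff[of q "?s b" 3] q sa sab by simp
  have "cos a - cos b = 2 * ((?s b)\<^sup>2 - (?s a)\<^sup>2)"
    using cos_double_sin[of "a / 2"] cos_double_sin[of "b / 2"] by simp
  also have "\<dots> * ?s b \<le> 2 * ((?s b)^3 - (?s a)^3)"
  proof -
    have "(?s a)\<^sup>2 * ?s a \<le> (?s a)\<^sup>2 * ?s b" using sab by (intro mult_left_mono) auto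
    then show ?thesis by (simp add: algebra_simps power3_eq_cube power2_eq_square)
  qed
  also have "\<dots> \<le> 3/2 * (y - z)" using 1 unfolding a(3)[symmetric] b(3)[symmetric] by simp
  finally have "(cos a - cos b) * ?s b \<le> 3/2 * (y - z)" .
  moreover have "0 \<le> cos a - cos b" using ab a(1,2) b(1,2) by (simp add: cos_monotone_0_pi_le)
  then have "(cos a - cos b) * q \<le> (cos a - cos b) * ?s b" using qb by (intro mult_left_mono)
  ultimately have "(cos a - cos b) * q \<le> 3/2 * (y - z)" by linarith
  then show "\<bar>sn (\<tau> + e * z)\<bar> - \<bar>sn (\<tau> + e * y)\<bar> \<le> 3/2 * (y - z) / q"
    unfolding a(4) b(4) using q by (simp add: pos_le_divide_eq)
qed

text \<open>Starting the upper estimate at the turning value itself with the largest admissible q,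
  the cube root p of 3y/8, gives 1 - |sn| \<le> 4 p^2. The threshold is uniform over all turning
  values and both sides.\<close>

lemma turning_near:
  assumes "s0 < 1"
  obtains y0 where "0 < y0" "y0 \<le> pi / 4"
    "\<And>\<tau> e y. cs \<tau> = 0 \<Longrightarrow> e = 1 \<or> e = -1 \<Longrightarrow> 0 \<le> y \<Longrightarrow> y \<le> y0 \<Longrightarrow> s0 \<le> \<bar>sn (\<tau> + e * y)\<bar>"
proof -
  define q where "q = min (1/2) ((1 - s0) / 2)"
  have q: "0 < q" "q \<le> 1/2" "2 * q \<le> 1 - s0" using assms by (auto simp: q_def min_def)
  define y0 where "y0 = 8/3 * q^3 / 4"
  have q3: "0 < q^3" "q^3 \<le> q\<^sup>2" "q\<^sup>2 \<le> q" using q by (auto simp: power3_eq_cube power2_eq_square mult_le_one mult_left_le)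
  have y0: "0 < y0" "y0 \<le> pi / 4" using q q3 pi_gt3 unfolding y0_def by linarith+
  have "s0 \<le> \<bar>sn (\<tau> + e * y)\<bar>" if \<tau>: "cs \<tau> = 0" and e: "e = 1 \<or> e = -1" and y: "0 \<le> y" "y \<le> y0" for \<tau> e y
  proof (rule ccontr)
    assume n: "\<not> s0 \<le> \<bar>sn (\<tau> + e * y)\<bar>"
    have s1: "\<bar>sn \<tau>\<bar> = 1" using sn_cs[of \<tau>] \<tau> by (auto simp: power2_eq_1_iff)
    have yp: "0 < y" using n s1 assms y by (cases "y = 0") auto
    define p where "p = root 3 (3/8 * y)"
    have p: "0 < p" "p^3 = 3/8 * y" using yp by (auto simp: p_def)
    have "\<bar>sn (\<tau> + e * 0)\<bar> - \<bar>sn (\<tau> + e * y)\<bar> \<le> 3/2 * (y - 0) / p"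
      by (rule turning_estimates(2)[OF \<tau> e]) (use yp y y0 p in auto)
    also have "\<dots> = 4 * p\<^sup>2" using p by (simp add: field_simps power2_eq_square power3_eq_cube)
    finally have le: "1 - \<bar>sn (\<tau> + e * y)\<bar> \<le> 4 * p\<^sup>2" using s1 by simp
    have "p^3 \<le> q^3" using p y q3 unfolding y0_def by linarith
    then have pq: "p \<le> q" using power_mono_iff[of p q 3] p q by simp
    have "p\<^sup>2 \<le> q\<^sup>2" using pq p by (intro power_mono) auto
    also have "q\<^sup>2 \<le> q * (1/2)" using q by (simp add: power2_eq_square)
    finally have "4 * p\<^sup>2 \<le> 2 * q" by simp
    then show False using le n q by linarith
  qed
  with y0 that show ?thesis by blast
qed

text \<open>A C1 substitute for \<open>cs\<close>, to which it tends as e tends to 0. The cube in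
  the numerator makes it small enough at turning values to be an admissible variation.\<close>

definition damp :: "real \<Rightarrow> real \<Rightarrow> real" where "damp e w = (cs w)^3 / ((cs w)\<^sup>2 + e)"

lemma DERIV_damp:
  assumes e: "e > 0"
  shows "(damp e has_real_derivative - sn w * ((cs w)\<^sup>2 + 3 * e) / ((cs w)\<^sup>2 + e)\<^sup>2) (at w)"
    "((\<lambda>w. sn w * damp e w) has_real_derivative
      (cs w)\<^sup>2 / ((cs w)\<^sup>2 + e) - (sn w)\<^sup>2 * ((cs w)\<^sup>2 + 3 * e) / ((cs w)\<^sup>2 + e)\<^sup>2) (at w)"
proof -
  have nz: "(cos \<theta>)\<^sup>2 + e \<noteq> 0" for \<theta> using e by (smt (verit) zero_le_power2)
  have D1: "((\<lambda>\<theta>. (cos \<theta>)^3 / ((cos \<theta>)\<^sup>2 + e)) has_real_derivative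
       (cos \<theta>)\<^sup>2 * (- sin \<theta> * ((cos \<theta>)\<^sup>2 + 3 * e) / ((cos \<theta>)\<^sup>2 + e)\<^sup>2)) (at \<theta>)" for \<theta>
  proof -
    have N: "((\<lambda>\<theta>. (cos \<theta>)^3) has_real_derivative - 3 * (cos \<theta>)\<^sup>2 * sin \<theta>) (at \<theta>)"
      by (auto intro!: derivative_eq_intros)
    have D: "((\<lambda>\<theta>. (cos \<theta>)\<^sup>2 + e) has_real_derivative - 2 * cos \<theta> * sin \<theta>) (at \<theta>)"
      by (auto intro!: derivative_eq_intros)
    have "(- 3 * (cos \<theta>)\<^sup>2 * sin \<theta>) * ((cos \<theta>)\<^sup>2 + e) - (cos \<theta>)^3 * (- 2 * cos \<theta> * sin \<theta>)
      = (cos \<theta>)\<^sup>2 * (- sin \<theta> * ((cos \<theta>)\<^sup>2 + 3 * e))"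
      by (simp add: algebra_simps power2_eq_square power3_eq_cube)
    then show ?thesis using DERIV_divide[OF N D nz] by (simp add: power2_eq_square)
  qed
  have "((\<lambda>w. (\<lambda>\<theta>. (cos \<theta>)^3 / ((cos \<theta>)\<^sup>2 + e)) (angle w)) has_real_derivative
     (\<lambda>\<theta>. - sin \<theta> * ((cos \<theta>)\<^sup>2 + 3 * e) / ((cos \<theta>)\<^sup>2 + e)\<^sup>2) (angle w)) (at w)"
  proof (rule DERIV_comp_angle)
    fix \<theta>
    show "((\<lambda>\<theta>. (cos \<theta>)^3 / ((cos \<theta>)\<^sup>2 + e)) has_real_derivative
       (cos \<theta>)\<^sup>2 * (- sin \<theta> * ((cos \<theta>)\<^sup>2 + 3 * e) / ((cos \<theta>)\<^sup>2 + e)\<^sup>2)) (at \<theta>)"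
      by (rule D1)
  qed (intro continuous_intros, use nz in auto)
  then show "(damp e has_real_derivative - sn w * ((cs w)\<^sup>2 + 3 * e) / ((cs w)\<^sup>2 + e)\<^sup>2) (at w)"
    by (simp add: damp_def[abs_def] sn_def cs_def)
  have "((\<lambda>w. (\<lambda>\<theta>. sin \<theta> * ((cos \<theta>)^3 / ((cos \<theta>)\<^sup>2 + e))) (angle w)) has_real_derivative
     (\<lambda>\<theta>. (cos \<theta>)\<^sup>2 / ((cos \<theta>)\<^sup>2 + e) - (sin \<theta>)\<^sup>2 * ((cos \<theta>)\<^sup>2 + 3 * e) / ((cos \<theta>)\<^sup>2 + e)\<^sup>2) (angle w)) (at w)"
  proof (rule DERIV_comp_angle)
    fix \<theta>
    show "((\<lambda>\<theta>. sin \<theta> * ((cos \<theta>)^3 / ((cos \<theta>)\<^sup>2 + e))) has_real_derivative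
       (cos \<theta>)\<^sup>2 * ((cos \<theta>)\<^sup>2 / ((cos \<theta>)\<^sup>2 + e) - (sin \<theta>)\<^sup>2 * ((cos \<theta>)\<^sup>2 + 3 * e) / ((cos \<theta>)\<^sup>2 + e)\<^sup>2)) (at \<theta>)"
      by (rule DERIV_cong[OF DERIV_mult[OF DERIV_sin D1]])
         (simp add: right_diff_distrib power2_eq_square power3_eq_cube mult_ac)
  qed (intro continuous_intros, use nz in auto)
  then show "((\<lambda>w. sn w * damp e w) has_real_derivative
      (cs w)\<^sup>2 / ((cs w)\<^sup>2 + e) - (sn w)\<^sup>2 * ((cs w)\<^sup>2 + 3 * e) / ((cs w)\<^sup>2 + e)\<^sup>2) (at w)"
    by (simp add: damp_def[abs_def] sn_def cs_def)
qed

section \<open>Layered minimisers\<close>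

locale film =
  fixes V :: "'a::euclidean_space \<Rightarrow> real" and f F :: "real \<Rightarrow> real" and C\<^sub>F :: real
  assumes V_continuous: "continuous_on UNIV V" and V_top: "filterlim V at_top at_infinity"
    and f_continuous: "continuous_on UNIV f" and f_odd: "\<And>s. f (- s) = - f s"
    and DERIV_F: "\<And>s. (F has_real_derivative f s) (at s)" and F_even: "\<And>s. F (- s) = F s"
    and F_nonneg: "\<And>s. 0 \<le> F s" and F_le: "\<And>s. \<bar>s\<bar> \<le> 1 \<Longrightarrow> F s \<le> C\<^sub>F * s\<^sup>2"
    and f_sign: "\<And>s. 0 \<le> s * f s"
begin

text \<open>One potential density in the two variables u and w. In \<open>P\<close> the argument of
  \<open>Q\<close> lies in [-1,1], which is why \<open>F_le\<close> is asked only there.\<close>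

definition Q :: "'a \<Rightarrow> real \<Rightarrow> real" where "Q x s = V x * s\<^sup>2 / 2 - F s"
definition P :: "'a \<Rightarrow> real \<Rightarrow> real" where "P x w = Q x (sn w)"

lemma F_continuous: "continuous_on UNIV F"
  using DERIV_F by (meson DERIV_isCont continuous_at_imp_continuous_on)

lemma measurable_V [measurable]: "V \<in> borel_measurable borel"
  and measurable_f [measurable]: "f \<in> borel_measurable borel"
  and measurable_F [measurable]: "F \<in> borel_measurable borel"
  using V_continuous f_continuous F_continuous by (auto intro: borel_measurable_continuous_onI)

lemma measurable_P: "w \<in> borel_measurable borel \<Longrightarrow> (\<lambda>x. P x (w x)) \<in> borel_measurable borel"
  unfolding P_def Q_def
  by (intro borel_measurable_diff borel_measurable_times borel_measurable_divide borel_measurable_power borel_measurable_const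
      measurable_compose[OF _ measurable_F] measurable_compose[OF _ measurable_sn] measurable_V)

lemma continuous_P: "continuous_on UNIV (P x)"
  unfolding P_def[abs_def] Q_def
  by (intro continuous_intros continuous_sn continuous_on_compose2[OF F_continuous continuous_sn]) auto

lemma CF_nonneg: "0 \<le> C\<^sub>F" using F_le[of 1] F_nonneg[of 1] by simp

lemma Q_even: "Q x (- s) = Q x s" by (simp add: Q_def F_even)
lemma Q_abs: "Q x \<bar>s\<bar> = Q x s" using Q_even[of x s] by (cases "0 \<le> s") simp_all

lemma DERIV_Q: "(Q x has_real_derivative V x * s - f s) (at s)"
proof -
  have "((\<lambda>s. V x * s\<^sup>2 / 2 - F s) has_real_derivative V x * (2 * s) / 2 - f s) (at s)"
    by (intro DERIV_diff DERIV_F DERIV_cdivide DERIV_cmult)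
       (auto intro!: derivative_eq_intros)
  then show ?thesis by (simp add: Q_def[abs_def])
qed

lemma DERIV_P: "cs w \<noteq> 0 \<Longrightarrow> (P x has_real_derivative (V x * sn w - f (sn w)) / cs w) (at w)"
  unfolding P_def[abs_def]
  by (rule DERIV_cong[OF DERIV_chain2[OF DERIV_Q DERIV_sn]]) simp_all

lemma local_bound:
  obtains M where "0 < M" "\<And>x. norm x \<le> R \<Longrightarrow> \<bar>V x\<bar> \<le> M" "\<And>s. \<bar>s\<bar> \<le> 1 \<Longrightarrow> \<bar>f s\<bar> \<le> M"
proof -
  have "bounded (V ` cball 0 R)"
    by (intro compact_imp_bounded compact_continuous_image continuous_on_subset[OF V_continuous]) auto
  then obtain M1 where M1: "\<forall>y\<in>V ` cball 0 R. norm y \<le> M1" unfolding bounded_iff by blast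
  have "bounded (f ` {-1..1})"
    by (intro compact_imp_bounded compact_continuous_image continuous_on_subset[OF f_continuous]) auto
  then obtain M2 where M2: "\<forall>y\<in>f ` {-1..1}. norm y \<le> M2" unfolding bounded_iff by blast
  show ?thesis
  proof (rule that[of "max 1 (max M1 M2)"])
    fix x :: 'a assume "norm x \<le> R"
    then have "norm (V x) \<le> M1" using M1 by auto
    then show "\<bar>V x\<bar> \<le> max 1 (max M1 M2)" by simp
  next
    fix s :: real assume "\<bar>s\<bar> \<le> 1"
    then have "norm (f s) \<le> M2" using M2 by (simp add: abs_le_iff)
    then show "\<bar>f s\<bar> \<le> max 1 (max M1 M2)" by simp
  qed simp
qed

lemma Q_Lipschitz:
  assumes "\<bar>V x\<bar> \<le> M" "\<And>s. \<bar>s\<bar> \<le> 1 \<Longrightarrow> \<bar>f s\<bar> \<le> M" "\<bar>s\<bar> \<le> 1" "\<bar>t\<bar> \<le> 1"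
  shows "\<bar>Q x s - Q x t\<bar> \<le> 2 * M * \<bar>s - t\<bar>"
proof -
  have "norm (Q x s - Q x t) \<le> (2 * M) * norm (s - t)"
  proof (rule field_differentiable_bound[of "{-1..1}" "Q x" "\<lambda>s. V x * s - f s"])
    fix z :: real assume "z \<in> {-1..1}"
    then have z: "\<bar>z\<bar> \<le> 1" by auto
    show "(Q x has_field_derivative V x * z - f z) (at z within {-1..1})"
      by (rule has_field_derivative_at_within[OF DERIV_Q])
    have "\<bar>V x * z\<bar> \<le> M * 1" unfolding abs_mult using assms(1) z by (intro mult_mono) auto
    then show "norm (V x * z - f z) \<le> 2 * M" using assms(2)[OF z] by simp
  qed (use assms(3,4) in auto)
  then show ?thesis by simp
qed

lemma Q_bound:
  assumes "\<bar>V x\<bar> \<le> M" "\<bar>s\<bar> \<le> 1"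
  shows "\<bar>Q x s\<bar> \<le> M + C\<^sub>F"
proof -
  have s2: "s\<^sup>2 \<le> 1" using assms(2) by (simp add: abs_square_le_1)
  have M0: "0 \<le> M" using assms(1) by linarith
  have "\<bar>V x * s\<^sup>2\<bar> \<le> M * 1" unfolding abs_mult using assms s2 M0 by (intro mult_mono) auto
  moreover have "F s \<le> C\<^sub>F * 1" using F_le[OF assms(2)] mult_left_mono[OF s2 CF_nonneg] by linarith
  ultimately show ?thesis using F_nonneg[of s] M0 unfolding Q_def by linarith
qed

text \<open>Variations \<open>w + s \<kappa>(w)\<close> with \<open>|\<kappa>| \<le> K |cs|\<^sup>3\<close> stay away from the turning values, where
  \<open>P\<close> fails to be differentiable.\<close>

lemma variation_estimate:
  assumes \<kappa>: "\<bar>k\<bar> \<le> K * \<bar>cs v\<bar>^3" and K: "0 < K" and s: "\<bar>s\<bar> \<le> 1 / (6 * K)"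
  shows "\<bar>sn (v + s * k) - sn v\<bar> \<le> 2 * K * \<bar>s\<bar>"
proof (cases "cs v = 0")
  case True
  then have "k = 0" using \<kappa> by simp
  then show ?thesis using K by simp
next
  case False
  define d where "d = \<bar>s * k\<bar>"
  have "d \<le> \<bar>s\<bar> * (K * \<bar>cs v\<bar>^3)" unfolding d_def abs_mult by (intro mult_left_mono \<kappa>) auto
  also have "\<dots> \<le> 1 / (6 * K) * (K * \<bar>cs v\<bar>^3)" using s K by (intro mult_right_mono) auto
  also have "\<dots> = \<bar>cs v\<bar>^3 / 6" using K by simp
  finally have d6: "d \<le> \<bar>cs v\<bar>^3 / 6" .
  \<comment> \<open>The step bound 1/(6K) keeps the displacement below |cs v|^3/6, so the cube
    changes by at most half of itself. Hence |cs| stays above |cs v|/2 along the segment, and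
    \<open>sn\<close> is Lipschitz there with constant 2/|cs v|.\<close>
  have half: "\<bar>cs v\<bar> / 2 \<le> \<bar>cs u\<bar>" if u: "\<bar>u - v\<bar> \<le> d" for u
  proof -
    have "\<bar>(cs u)^3 - (cs v)^3\<bar> \<le> 3 * d" using order_trans[OF cs_cube_Lipschitz[of u v] mult_left_mono[OF u, of 3]] by simp
    then have "\<bar>cs v\<bar>^3 / 2 \<le> \<bar>cs u\<bar>^3" using d6 unfolding power_abs[symmetric] by linarith
    moreover have "(\<bar>cs v\<bar> / 2)^3 \<le> \<bar>cs v\<bar>^3 / 2" by (simp add: power_divide)
    ultimately have "(\<bar>cs v\<bar> / 2)^3 \<le> \<bar>cs u\<bar>^3" by linarith
    then show ?thesis using power_mono_iff[of "\<bar>cs v\<bar> / 2" "\<bar>cs u\<bar>" 3] by simp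
  qed
  have c0: "\<bar>cs v\<bar> > 0" using False by simp
  have "norm (sn (v + s * k) - sn v) \<le> (2 / \<bar>cs v\<bar>) * norm ((v + s * k) - v)"
  proof (rule field_differentiable_bound[of "{v - d..v + d}" sn "\<lambda>u. 1 / cs u"])
    fix u assume "u \<in> {v - d..v + d}"
    then have "\<bar>u - v\<bar> \<le> d" by (auto simp: abs_le_iff)
    from half[OF this] have h: "\<bar>cs v\<bar> / 2 \<le> \<bar>cs u\<bar>" .
    then have nz: "cs u \<noteq> 0" using c0 by auto
    show "(sn has_field_derivative 1 / cs u) (at u within {v - d..v + d})"
      by (rule has_field_derivative_at_within[OF DERIV_sn[OF nz]])
    have "1 / \<bar>cs u\<bar> \<le> 1 / (\<bar>cs v\<bar> / 2)" using h c0 by (intro divide_left_mono) auto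
    then show "norm (1 / cs u) \<le> 2 / \<bar>cs v\<bar>" by simp
  next
    show "v + s * k \<in> {v - d..v + d}" unfolding d_def by (simp add: abs_if)
    show "v \<in> {v - d..v + d}" unfolding d_def by simp
  qed simp
  also have "\<dots> = (2 / \<bar>cs v\<bar>) * d" by (simp add: d_def)
  also have "\<dots> \<le> (2 / \<bar>cs v\<bar>) * (\<bar>s\<bar> * (K * \<bar>cs v\<bar>^3))"
    using \<open>d \<le> \<bar>s\<bar> * (K * \<bar>cs v\<bar>^3)\<close> by (intro mult_left_mono) auto
  also have "\<dots> = 2 * K * \<bar>s\<bar> * \<bar>cs v\<bar>\<^sup>2"
    using c0 by (simp add: power3_eq_cube power2_eq_square)
  also have "\<dots> \<le> 2 * K * \<bar>s\<bar> * 1"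
    using K cs_le[of v] by (intro mult_left_mono) (auto simp: abs_square_le_1)
  finally show ?thesis by simp
qed

lemma DERIV_P_variation:
  assumes "\<bar>k\<bar> \<le> K * \<bar>cs v\<bar>^3"
  shows "((\<lambda>t. P x (v + t * (c * k))) has_real_derivative c * ((V x * sn v - f (sn v)) * k / cs v)) (at 0)"
proof (cases "cs v = 0")
  \<comment> \<open>Here \<open>k\<close> vanishes too, and the quotient by \<open>cs v\<close> is 0
    by the convention for division by zero, which is the derivative of the constant
    function.\<close>
  case True
  then have "k = 0" using assms by simp
  then show ?thesis by simp
next
  case False
  have "((\<lambda>t. v + t * (c * k)) has_real_derivative c * k) (at 0)"
    by (auto intro!: derivative_eq_intros)
  from DERIV_chain2[of "P x" "(V x * sn v - f (sn v)) / cs v", OF _ this] DERIV_P[OF False, of x]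
  show ?thesis by (simp add: mult_ac)
qed

end

section \<open>Minimisers between turning values and their Euler-Lagrange identity\<close>

locale layered_film = film +
  fixes lo :: "'a \<Rightarrow> real" and R\<^sub>0 B\<^sub>0 :: real
  assumes lo_measurable [measurable]: "lo \<in> borel_measurable borel"
    and lo_turning: "\<And>x. cs (lo x) = 0" and lo_far: "\<And>x. R\<^sub>0 \<le> norm x \<Longrightarrow> lo x = - (pi / 4)"
    and lo_bounded: "\<And>x. \<bar>lo x\<bar> \<le> B\<^sub>0"
begin

definition hi :: "'a \<Rightarrow> real" where "hi x = lo x + pi / 2"

lemma hi_turning: "cs (hi x) = 0"
proof -
  obtain n :: int where "lo x = of_int n * (pi / 2) + pi / 4" using lo_turning cs_eq_0_iff by blast
  then have "hi x = of_int (n + 1) * (pi / 2) + pi / 4" by (simp add: hi_def field_simps)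
  then show ?thesis using cs_eq_0_iff by blast
qed

lemma far_radius:
  obtains R where "R\<^sub>0 \<le> R" "\<And>x. R \<le> norm x \<Longrightarrow> 2 * C\<^sub>F + 4 \<le> V x"
proof -
  have "\<forall>\<^sub>F x in at_infinity. 2 * C\<^sub>F + 4 \<le> V x" using V_top by (simp add: filterlim_at_top)
  then obtain b where b: "\<And>x. b \<le> norm x \<Longrightarrow> 2 * C\<^sub>F + 4 \<le> V x" unfolding eventually_at_infinity by blast
  show ?thesis by (rule that[of "max R\<^sub>0 b"]) (use b in auto)
qed

definition R1 :: real where "R1 = (SOME R. R\<^sub>0 \<le> R \<and> (\<forall>x. R \<le> norm x \<longrightarrow> 2 * C\<^sub>F + 4 \<le> V x))"

lemma R1: "R\<^sub>0 \<le> R1" "R1 \<le> norm x \<Longrightarrow> 2 * C\<^sub>F + 4 \<le> V x"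
proof -
  have "\<exists>R. R\<^sub>0 \<le> R \<and> (\<forall>x. R \<le> norm x \<longrightarrow> 2 * C\<^sub>F + 4 \<le> V x)" using far_radius by metis
  from someI_ex[OF this] show "R\<^sub>0 \<le> R1" "R1 \<le> norm x \<Longrightarrow> 2 * C\<^sub>F + 4 \<le> V x"
    unfolding R1_def by blast+
qed

text \<open>The constant in \<open>R1\<close> is made for this: half of V contributes
  \<open>C\<^sub>F + 2\<close> times sn^2, F takes away at most \<open>C\<^sub>F\<close> times sn^2,
  and the remaining 2 sn^2 is at least w^2/2 on the branch through 0.\<close>

lemma P_far:
  assumes "R1 \<le> norm x" "lo x \<le> w" "w \<le> hi x"
  shows "w\<^sup>2 / 2 \<le> P x w" "w\<^sup>2 \<le> 4 * (sn w)\<^sup>2" "(sn w)\<^sup>2 \<le> 4 * w\<^sup>2"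
proof -
  have "lo x = - (pi / 4)" using lo_far R1(1) assms(1) by simp
  then have w: "\<bar>w\<bar> \<le> pi / 4" using assms by (simp add: hi_def abs_le_iff)
  have "\<bar>w\<bar>\<^sup>2 \<le> (2 * \<bar>sn w\<bar>)\<^sup>2" by (intro power_mono sn_bounds(1) w) simp
  then show 1: "w\<^sup>2 \<le> 4 * (sn w)\<^sup>2" by (simp add: power_mult_distrib)
  have "\<bar>sn w\<bar>\<^sup>2 \<le> (2 * \<bar>w\<bar>)\<^sup>2" by (intro power_mono sn_bounds(2) w) simp
  then show "(sn w)\<^sup>2 \<le> 4 * w\<^sup>2" by (simp add: power_mult_distrib)
  have "(2 * C\<^sub>F + 4) * (sn w)\<^sup>2 \<le> V x * (sn w)\<^sup>2" by (intro mult_right_mono R1(2) assms) simp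
  moreover have "F (sn w) \<le> C\<^sub>F * (sn w)\<^sup>2" by (intro F_le sn_le)
  ultimately have "2 * (sn w)\<^sup>2 \<le> P x w" unfolding P_def Q_def by (simp add: algebra_simps)
  then show "w\<^sup>2 / 2 \<le> P x w" using 1 by linarith
qed

lemma lo_hi_bounded: "lo x \<le> w \<Longrightarrow> w \<le> hi x \<Longrightarrow> \<bar>w\<bar> \<le> B\<^sub>0 + pi / 2"
  using lo_bounded[of x] pi_gt_zero unfolding hi_def by linarith

definition M1 :: real where "M1 = (SOME M. 0 < M \<and> (\<forall>x. norm x \<le> R1 \<longrightarrow> \<bar>V x\<bar> \<le> M))"

lemma M1: "0 < M1" "norm x \<le> R1 \<Longrightarrow> \<bar>V x\<bar> \<le> M1"
proof -
  have "\<exists>M. 0 < M \<and> (\<forall>x. norm x \<le> R1 \<longrightarrow> \<bar>V x\<bar> \<le> M)" using local_bound[of R1] by metis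
  from someI_ex[OF this] show "0 < M1" "norm x \<le> R1 \<Longrightarrow> \<bar>V x\<bar> \<le> M1" unfolding M1_def by blast+
qed

text \<open>Outside the ball \<open>P_far\<close> dominates w^2/2 outright; inside, w and the
  potential are bounded by constants, so a multiple of the indicator suffices.\<close>

definition \<beta> :: "'a \<Rightarrow> real" where
  "\<beta> x = ((B\<^sub>0 + pi / 2)\<^sup>2 / 2 + M1 + C\<^sub>F) * indicator (cball 0 R1) x"

sublocale obstacle_problem P lo hi \<beta>
proof
  show "(\<lambda>x. P x (w x)) \<in> borel_measurable borel" if "w \<in> borel_measurable borel" for w
    using that by (rule measurable_P)
  show "continuous_on UNIV (P x)" for x by (rule continuous_P)
  show "integrable lborel \<beta>"
    unfolding \<beta>_def[abs_def] by (rule Bochner_Integration.integrable_mult_right[OF integrable_indicator_cball])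
  fix x v assume v: "lo x \<le> v" "v \<le> hi x"
  show "v\<^sup>2 / 2 - \<beta> x \<le> P x v"
  proof (cases "norm x \<le> R1")
    case True
    have "\<bar>v\<bar>\<^sup>2 \<le> (B\<^sub>0 + pi / 2)\<^sup>2" by (intro power_mono lo_hi_bounded[OF v]) simp
    moreover have "\<bar>Q x (sn v)\<bar> \<le> M1 + C\<^sub>F" by (intro Q_bound M1 True sn_le)
    ultimately show ?thesis using True unfolding \<beta>_def P_def by simp
  next
    case False
    then show ?thesis using P_far(1)[OF _ v] by (simp add: \<beta>_def)
  qed
qed

definition minimiser :: "('a \<Rightarrow> real) \<Rightarrow> ('a \<Rightarrow> 'a) \<Rightarrow> bool" where
  "minimiser w g \<longleftrightarrow> admissible w g \<and> (\<forall>w' g'. admissible w' g' \<longrightarrow> J w g \<le> J w' g')"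

lemma minimiserD:
  assumes "minimiser w g"
  shows "admissible w g" "admissible w' g' \<Longrightarrow> J w g \<le> J w' g'" "sobolev w g"
    "AE x in lborel. lo x \<le> w x \<and> w x \<le> hi x" "integrable lborel (\<lambda>x. P x (w x))"
    "w \<in> borel_measurable borel" "g \<in> borel_measurable borel" "sq_integrable g" "sq_integrable w"
  using assms by (auto simp: minimiser_def admissible_def sobolev_def sq_integrable_def)

lemma signed_increment:
  fixes e t :: real
  assumes "e = 1 \<or> e = -1" "0 < t" "j \<le> j + e * t * a + (e * t)\<^sup>2 * s / 2 + e * t * b"
  shows "0 \<le> e * (a + b) + t * s / 2"
proof -
  have "(e * t)\<^sup>2 = t * t" using assms(1) by (auto simp: power2_eq_square)
  then have "0 \<le> t * (e * (a + b) + t * s / 2)" using assms(3) by (simp add: algebra_simps)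
  then show ?thesis using assms(2) by (simp add: zero_le_mult_iff)
qed

text \<open>Compact support of \<psi> makes the change of the potential integrable. The Dirichlet
  part is expanded exactly, whereas the increment of \<open>P\<close> is left as it is, since
  \<open>P\<close> need not be differentiable.\<close>

lemma perturbation:
  assumes adm: "admissible w g" and s: "sobolev \<psi> \<gamma>" and z: "\<And>x. R \<le> norm x \<Longrightarrow> \<psi> x = 0"
    and c: "AE x in lborel. lo x \<le> w x + \<psi> x \<and> w x + \<psi> x \<le> hi x"
  shows "admissible (\<lambda>x. w x + \<psi> x) (\<lambda>x. g x + \<gamma> x)"
    "integrable lborel (\<lambda>x. P x (w x + \<psi> x) - P x (w x))"
    "J (\<lambda>x. w x + \<psi> x) (\<lambda>x. g x + \<gamma> x) = J w g + (\<integral>x. g x \<bullet> \<gamma> x \<partial>lborel) + sq_norm \<gamma> / 2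
       + (\<integral>x. P x (w x + \<psi> x) - P x (w x) \<partial>lborel)"
proof -
  have sw: "sobolev w g" and iP: "integrable lborel (\<lambda>x. P x (w x))" using adm by (auto simp: admissible_def)
  have m: "w \<in> borel_measurable borel" "\<psi> \<in> borel_measurable borel"
    using sw s by (auto simp: sobolev_def sq_integrable_def)
  obtain M where M: "0 < M" "\<And>x. norm x \<le> R \<Longrightarrow> \<bar>V x\<bar> \<le> M" "\<And>s. \<bar>s\<bar> \<le> 1 \<Longrightarrow> \<bar>f s\<bar> \<le> M"
    by (rule local_bound[of R]) (rule that, assumption+)
  have "\<bar>P x (w x + \<psi> x) - P x (w x)\<bar> \<le> 2 * (M + C\<^sub>F) * indicator (cball 0 R) x" for x
  proof (cases "norm x \<le> R")
    case True
    have "\<bar>P x v\<bar> \<le> M + C\<^sub>F" for v unfolding P_def by (rule Q_bound[OF M(2)[OF True] sn_le])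
    from this[of "w x + \<psi> x"] this[of "w x"] show ?thesis using True by simp
  next
    case False
    then show ?thesis using z[of x] by simp
  qed
  then have b: "AE x in lborel. norm (P x (w x + \<psi> x) - P x (w x)) \<le> norm (2 * (M + C\<^sub>F) * indicator (cball 0 R) x)"
    by (intro AE_I2) (metis abs_ge_self order_trans real_norm_def)
  have "(\<lambda>x. P x (w x + \<psi> x) - P x (w x)) \<in> borel_measurable lborel"
    using measurable_P[OF borel_measurable_add[OF m]] measurable_P[OF m(1)] by simp
  from Bochner_Integration.integrable_bound[OF Bochner_Integration.integrable_mult_right[OF integrable_indicator_cball] this b]
  show i: "integrable lborel (\<lambda>x. P x (w x + \<psi> x) - P x (w x))" .
  have i2: "integrable lborel (\<lambda>x. P x (w x + \<psi> x))"
    using Bochner_Integration.integrable_add[OF i iP] by simp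
  show "admissible (\<lambda>x. w x + \<psi> x) (\<lambda>x. g x + \<gamma> x)"
    unfolding admissible_def using sobolev_add[OF sw s] c i2 by blast
  have "sq_norm (\<lambda>x. g x + \<gamma> x) = sq_norm g + 2 * (\<integral>x. g x \<bullet> \<gamma> x \<partial>lborel) + sq_norm \<gamma>"
    using sq_norm_add_eq[OF sobolev_sq_integrable(2)[OF sw] sobolev_sq_integrable(2)[OF s], of 1] by simp
  then show "J (\<lambda>x. w x + \<psi> x) (\<lambda>x. g x + \<gamma> x) = J w g + (\<integral>x. g x \<bullet> \<gamma> x \<partial>lborel) + sq_norm \<gamma> / 2
       + (\<integral>x. P x (w x + \<psi> x) - P x (w x) \<partial>lborel)"
    unfolding J_def using Bochner_Integration.integral_diff[OF i2 iP] by simp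
qed

text \<open>Variations of both signs along \<phi> \<kappa>(w). The constraint survives them because
  \<kappa> vanishes at turning values and is Lipschitz, so a small multiple cannot carry w past
  either obstacle. The cubic bound on \<kappa> keeps the difference quotients of \<open>P\<close>
  bounded in spite of its infinite slope, and dominated convergence applies.\<close>

lemma euler_lagrange:
  assumes min: "minimiser w g" and \<phi>: "C1c \<phi> \<Phi>"
    and \<kappa>: "\<And>t. (\<kappa> has_real_derivative \<kappa>' t) (at t)" "continuous_on UNIV \<kappa>'"
    and L: "\<And>t. \<bar>\<kappa>' t\<bar> \<le> L" and K: "0 < K" "\<And>t. \<bar>\<kappa> t\<bar> \<le> K * \<bar>cs t\<bar>^3"
  shows "integrable lborel (\<lambda>x. \<kappa> (w x) * (\<Phi> x \<bullet> g x) + \<phi> x * \<kappa>' (w x) * (norm (g x))\<^sup>2)"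
    "integrable lborel (\<lambda>x. \<phi> x * ((V x * sn (w x) - f (sn (w x))) * \<kappa> (w x) / cs (w x)))"
    "(\<integral>x. \<kappa> (w x) * (\<Phi> x \<bullet> g x) + \<phi> x * \<kappa>' (w x) * (norm (g x))\<^sup>2 \<partial>lborel)
      + (\<integral>x. \<phi> x * ((V x * sn (w x) - f (sn (w x))) * \<kappa> (w x) / cs (w x)) \<partial>lborel) = 0"
proof -
  note w = minimiserD[OF min]
  note [measurable] = w(6,7)
  obtain B where B: "\<And>x. \<bar>\<phi> x\<bar> \<le> B" "\<And>x. norm (\<Phi> x) \<le> B" "0 \<le> B" using C1c_bounded[OF \<phi>] by blast
  obtain R where R: "\<And>x. R \<le> norm x \<Longrightarrow> \<phi> x = 0" "\<And>x. R \<le> norm x \<Longrightarrow> \<Phi> x = 0"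
    by (rule C1c_bound[OF \<phi>]) (rule that, assumption+)
  have [measurable]: "\<phi> \<in> borel_measurable borel" "\<Phi> \<in> borel_measurable borel"
    using C1_continuous[OF C1c_C1[OF \<phi>]] C1_continuous_grad[OF C1c_C1[OF \<phi>]]
    by (auto intro: borel_measurable_continuous_onI)
  have \<kappa>c: "continuous_on UNIV \<kappa>" using \<kappa>(1) by (meson DERIV_isCont continuous_at_imp_continuous_on)
  have [measurable]: "\<kappa> \<in> borel_measurable borel" "\<kappa>' \<in> borel_measurable borel"
    using \<kappa>c \<kappa>(2) by (auto intro: borel_measurable_continuous_onI)
  define \<psi> where "\<psi> x = \<phi> x * \<kappa> (w x)" for x
  define \<gamma> where "\<gamma> x = \<kappa> (w x) *\<^sub>R \<Phi> x + (\<phi> x * \<kappa>' (w x)) *\<^sub>R g x" for x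
  have sob: "sobolev \<psi> \<gamma>"
  proof -
    \<comment> \<open>The chain rule asks for a function vanishing at 0; the constant
      \<open>\<kappa> 0\<close> is restored afterwards as a multiple of \<phi>, which has compact
      support.\<close>
    have "sobolev (\<lambda>x. \<kappa> (w x) - \<kappa> 0) (\<lambda>x. \<kappa>' (w x) *\<^sub>R g x)"
    proof (rule sobolev_comp[OF w(3), of "\<lambda>t. \<kappa> t - \<kappa> 0" \<kappa>' L])
      show "((\<lambda>t. \<kappa> t - \<kappa> 0) has_real_derivative \<kappa>' t) (at t)" for t
        using DERIV_diff[OF \<kappa>(1)[of t] DERIV_const[of "\<kappa> 0"]] by simp
    qed (use \<kappa>(2) L in auto)
    from sobolev_add[OF sobolev_mult_C1[OF this C1c_C1[OF \<phi>] B(1,2)] C1c_sobolev[OF C1c_scale[OF \<phi>, of "\<kappa> 0"]]]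
    show ?thesis by (simp add: \<psi>_def[abs_def] \<gamma>_def[abs_def] algebra_simps)
  qed
  have \<psi>0: "\<psi> x = 0" if "R \<le> norm x" for x using R(1)[OF that] by (simp add: \<psi>_def)
  have Lip: "\<bar>\<kappa> t\<bar> \<le> L * \<bar>t - \<tau>\<bar>" if "cs \<tau> = 0" for t \<tau>
  proof -
    have "norm (\<kappa> t - \<kappa> \<tau>) \<le> L * norm (t - \<tau>)"
      by (rule field_differentiable_bound[of UNIV \<kappa> \<kappa>'])
         (use L \<kappa>(1) in \<open>auto intro: has_field_derivative_at_within\<close>)
    moreover have "\<kappa> \<tau> = 0" using K(2)[of \<tau>] that by simp
    ultimately show ?thesis by simp
  qed
  have L0: "0 \<le> L" using L[of 0] by linarith
  \<comment> \<open>Small enough for both purposes: \<open>\<bar>t\<bar> * B * L \<le> 1\<close>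
    preserves the constraint, and \<open>\<bar>t\<bar> * B \<le> 1 / (6 * K)\<close> is what
    \<open>variation_estimate\<close> requires.\<close>
  define t0 where "t0 = 1 / ((B + 1) * (L + 1 + 6 * K))"
  have t0: "0 < t0" unfolding t0_def using B(3) L0 K(1) by (intro divide_pos_pos mult_pos_pos) auto
  have tb: "\<bar>t\<bar> * B * L \<le> 1" "\<bar>t\<bar> * B \<le> 1 / (6 * K)" if "\<bar>t\<bar> \<le> t0" for t
  proof -
    have "\<bar>t\<bar> * ((B + 1) * (L + 1 + 6 * K)) \<le> t0 * ((B + 1) * (L + 1 + 6 * K))"
      using that B(3) L0 K(1) by (intro mult_right_mono) auto
    also have "\<dots> = 1" unfolding t0_def using B(3) L0 K(1) by simp
    finally have 1: "\<bar>t\<bar> * ((B + 1) * (L + 1 + 6 * K)) \<le> 1" .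
    have "B * L \<le> (B + 1) * (L + 1 + 6 * K)" using B(3) L0 K(1) by (intro mult_mono) simp_all
    then have "\<bar>t\<bar> * (B * L) \<le> \<bar>t\<bar> * ((B + 1) * (L + 1 + 6 * K))" by (intro mult_left_mono) simp_all
    then show "\<bar>t\<bar> * B * L \<le> 1" using 1 by simp
    have "B * (6 * K) \<le> (B + 1) * (L + 1 + 6 * K)" using B(3) L0 K(1) by (intro mult_mono) simp_all
    then have "\<bar>t\<bar> * (B * (6 * K)) \<le> \<bar>t\<bar> * ((B + 1) * (L + 1 + 6 * K))" by (intro mult_left_mono) simp_all
    then have "\<bar>t\<bar> * B * (6 * K) \<le> 1" using 1 by (simp add: mult.assoc)
    then show "\<bar>t\<bar> * B \<le> 1 / (6 * K)" using K by (simp add: pos_le_divide_eq)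
  qed
  have constr: "AE x in lborel. lo x \<le> w x + t * \<psi> x \<and> w x + t * \<psi> x \<le> hi x" if t: "\<bar>t\<bar> \<le> t0" for t
    using w(4)
  proof eventually_elim
    case (elim x)
    have small: "\<bar>t * \<psi> x\<bar> \<le> \<bar>w x - \<tau>\<bar>" if \<tau>: "cs \<tau> = 0" for \<tau>
    proof -
      have "\<bar>t * \<psi> x\<bar> = \<bar>t\<bar> * \<bar>\<phi> x\<bar> * \<bar>\<kappa> (w x)\<bar>" by (simp add: \<psi>_def abs_mult)
      also have "\<dots> \<le> \<bar>t\<bar> * B * (L * \<bar>w x - \<tau>\<bar>)"
        using B Lip[OF \<tau>] by (intro mult_mono mult_left_mono) auto
      also have "\<dots> = (\<bar>t\<bar> * B * L) * \<bar>w x - \<tau>\<bar>" by simp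
      also have "\<dots> \<le> 1 * \<bar>w x - \<tau>\<bar>" using tb(1)[OF t] by (intro mult_right_mono) auto
      finally show ?thesis by simp
    qed
    show ?case using small[OF lo_turning[of x]] small[OF hi_turning[of x]] elim by (simp add: abs_if split: if_splits)
  qed
  obtain M where M: "0 < M" "\<And>x. norm x \<le> R \<Longrightarrow> \<bar>V x\<bar> \<le> M" "\<And>s. \<bar>s\<bar> \<le> 1 \<Longrightarrow> \<bar>f s\<bar> \<le> M"
    by (rule local_bound[of R]) (rule that, assumption+)
  have quot: "\<bar>(P x (w x + t * \<psi> x) - P x (w x)) / t\<bar> \<le> (2 * M * (2 * K * B)) * indicator (cball 0 R) x"
    if t: "\<bar>t\<bar> \<le> t0" "t \<noteq> 0" for t x
  proof (cases "norm x \<le> R")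
    case True
    have "\<bar>t * \<phi> x\<bar> \<le> \<bar>t\<bar> * B" unfolding abs_mult using B by (intro mult_left_mono) auto
    then have 1: "\<bar>t * \<phi> x\<bar> \<le> 1 / (6 * K)" using tb(2)[OF t(1)] by linarith
    have "\<bar>sn (w x + (t * \<phi> x) * \<kappa> (w x)) - sn (w x)\<bar> \<le> 2 * K * \<bar>t * \<phi> x\<bar>"
      by (rule variation_estimate[OF K(2) K(1) 1])
    also have "\<dots> \<le> 2 * K * (\<bar>t\<bar> * B)" using K \<open>\<bar>t * \<phi> x\<bar> \<le> \<bar>t\<bar> * B\<close> by (intro mult_left_mono) auto
    finally have 2: "\<bar>sn (w x + t * \<psi> x) - sn (w x)\<bar> \<le> 2 * K * (\<bar>t\<bar> * B)" by (simp add: \<psi>_def mult.assoc)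
    have "\<bar>P x (w x + t * \<psi> x) - P x (w x)\<bar> \<le> 2 * M * \<bar>sn (w x + t * \<psi> x) - sn (w x)\<bar>"
      unfolding P_def by (rule Q_Lipschitz[OF M(2)[OF True] M(3) sn_le sn_le])
    also have "\<dots> \<le> 2 * M * (2 * K * (\<bar>t\<bar> * B))" using 2 M by (intro mult_left_mono) auto
    finally have "\<bar>P x (w x + t * \<psi> x) - P x (w x)\<bar> \<le> (2 * M * (2 * K * B)) * \<bar>t\<bar>" by (simp add: mult_ac)
    then show ?thesis using True t(2) by (simp add: abs_divide pos_divide_le_eq)
  next
    case False
    then show ?thesis using \<psi>0[of x] by simp
  qed
  define D where "D x = \<phi> x * ((V x * sn (w x) - f (sn (w x))) * \<kappa> (w x) / cs (w x))" for x
  have Dm [measurable]: "D \<in> borel_measurable borel" unfolding D_def[abs_def] by measurable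
  have bi: "integrable lborel (\<lambda>x::'a. (2 * M * (2 * K * B)) * indicator (cball 0 R) x)"
    by (rule Bochner_Integration.integrable_mult_right[OF integrable_indicator_cball])
  have qlim: "(\<lambda>n. (P x (w x + t n * \<psi> x) - P x (w x)) / t n) \<longlonglongrightarrow> D x"
    if t: "t \<longlonglongrightarrow> 0" "\<And>n. t n \<noteq> 0" for t :: "nat \<Rightarrow> real" and x
  proof -
    have "((\<lambda>t. P x (w x + t * (\<phi> x * \<kappa> (w x)))) has_real_derivative D x) (at 0)"
      unfolding D_def by (rule DERIV_P_variation[OF K(2)])
    then have "((\<lambda>t. (P x (w x + t * \<psi> x) - P x (w x)) / t) \<longlongrightarrow> D x) (at 0)"
      by (simp add: DERIV_def \<psi>_def)
    then show ?thesis
      by (rule filterlim_compose) (use t in \<open>auto simp: filterlim_at\<close>)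
  qed
  define \<tau> where "\<tau> n = t0 * inverse (real (Suc n))" for n
  have \<tau>: "0 < \<tau> n" "\<tau> n \<le> t0" for n using t0 by (auto simp: \<tau>_def mult_le_cancel_left2 inverse_le_1_iff)
  have \<tau>0: "\<tau> \<longlonglongrightarrow> 0"
    unfolding \<tau>_def using tendsto_mult[OF tendsto_const[of t0] LIMSEQ_inverse_real_of_nat] by simp
  have Pm: "(\<lambda>x. (P x (w x + t * \<psi> x) - P x (w x)) / t) \<in> borel_measurable lborel" for t
  proof -
    have "\<psi> \<in> borel_measurable borel" unfolding \<psi>_def[abs_def] by measurable
    then have "(\<lambda>x. w x + t * \<psi> x) \<in> borel_measurable borel" by measurable
    from measurable_P[OF this] measurable_P[OF w(6)] show ?thesis by simp
  qed
  have iD: "integrable lborel D"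
  proof (rule integrable_dominated_convergence[OF _ _ bi])
    show "AE x in lborel. (\<lambda>n. (P x (w x + \<tau> n * \<psi> x) - P x (w x)) / \<tau> n) \<longlonglongrightarrow> D x"
      using \<tau>(1) by (intro AE_I2 qlim \<tau>0) (metis less_irrefl)
    show "AE x in lborel. norm ((P x (w x + \<tau> n * \<psi> x) - P x (w x)) / \<tau> n) \<le> (2 * M * (2 * K * B)) * indicator (cball 0 R) x" for n
      using quot[of "\<tau> n"] \<tau>[of n] by (intro AE_I2) simp
  qed (use Pm in auto)
  have one: "0 \<le> e * ((\<integral>x. g x \<bullet> \<gamma> x \<partial>lborel) + (\<integral>x. D x \<partial>lborel))" if e: "e = 1 \<or> e = -1" for e :: real
  proof -
    let ?t = "\<lambda>n. e * \<tau> n"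
    have ae: "\<bar>e\<bar> = 1" using e by auto
    have ta: "\<bar>?t n\<bar> \<le> t0" "?t n \<noteq> 0" for n
      unfolding abs_mult ae using ae \<tau>[of n] by (simp, fastforce)
    have t0': "?t \<longlonglongrightarrow> 0" using tendsto_mult[OF tendsto_const[of e] \<tau>0] by simp
    have lim: "(\<lambda>n. \<integral>x. (P x (w x + ?t n * \<psi> x) - P x (w x)) / ?t n \<partial>lborel) \<longlonglongrightarrow> (\<integral>x. D x \<partial>lborel)"
    proof (rule integral_dominated_convergence[OF _ _ bi])
      show "AE x in lborel. (\<lambda>n. (P x (w x + ?t n * \<psi> x) - P x (w x)) / ?t n) \<longlonglongrightarrow> D x"
        by (intro AE_I2 qlim t0' ta)
      show "AE x in lborel. norm ((P x (w x + ?t n * \<psi> x) - P x (w x)) / ?t n) \<le> (2 * M * (2 * K * B)) * indicator (cball 0 R) x" for n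
        using quot[OF ta[of n]] by (intro AE_I2) simp
    qed (use Pm in auto)
    have ineq: "0 \<le> e * ((\<integral>x. g x \<bullet> \<gamma> x \<partial>lborel) + (\<integral>x. (P x (w x + ?t n * \<psi> x) - P x (w x)) / ?t n \<partial>lborel)) + \<tau> n * sq_norm \<gamma> / 2" for n
    proof -
      note p = perturbation[OF w(1) sobolev_scale[OF sob, of "?t n"] _ constr[OF ta(1)]]
      have z: "?t n * \<psi> x = 0" if "R \<le> norm x" for x using \<psi>0[OF that] by simp
      have "J w g \<le> J (\<lambda>x. w x + ?t n * \<psi> x) (\<lambda>x. g x + ?t n *\<^sub>R \<gamma> x)"
        by (rule w(2)[OF p(1)[OF z]])
      also have "\<dots> = J w g + ?t n * (\<integral>x. g x \<bullet> \<gamma> x \<partial>lborel) + (?t n)\<^sup>2 * sq_norm \<gamma> / 2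
          + ?t n * (\<integral>x. (P x (w x + ?t n * \<psi> x) - P x (w x)) / ?t n \<partial>lborel)"
      proof -
        have "(\<integral>x. (P x (w x + ?t n * \<psi> x) - P x (w x)) / ?t n \<partial>lborel) = (\<integral>x. P x (w x + ?t n * \<psi> x) - P x (w x) \<partial>lborel) / ?t n"
          by simp
        then have "?t n * (\<integral>x. (P x (w x + ?t n * \<psi> x) - P x (w x)) / ?t n \<partial>lborel) = (\<integral>x. P x (w x + ?t n * \<psi> x) - P x (w x) \<partial>lborel)"
          using ta(2)[of n] by simp
        then show ?thesis using p(3)[OF z] sq_norm_scaleR[of "?t n" \<gamma>] by simp
      qed
      finally show ?thesis by (rule signed_increment[OF e \<tau>(1)])
    qed
    have "(\<lambda>n. e * ((\<integral>x. g x \<bullet> \<gamma> x \<partial>lborel) + (\<integral>x. (P x (w x + ?t n * \<psi> x) - P x (w x)) / ?t n \<partial>lborel)) + \<tau> n * sq_norm \<gamma> / 2)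
       \<longlonglongrightarrow> e * ((\<integral>x. g x \<bullet> \<gamma> x \<partial>lborel) + (\<integral>x. D x \<partial>lborel)) + 0 * sq_norm \<gamma> / 2"
      by (intro tendsto_intros lim \<tau>0) auto
    from LIMSEQ_le_const[OF this] ineq show ?thesis by auto
  qed
  have g\<gamma>: "g x \<bullet> \<gamma> x = \<kappa> (w x) * (\<Phi> x \<bullet> g x) + \<phi> x * \<kappa>' (w x) * (norm (g x))\<^sup>2" for x
    by (simp add: \<gamma>_def inner_add_right inner_commute power2_norm_eq_inner)
  show "integrable lborel (\<lambda>x. \<kappa> (w x) * (\<Phi> x \<bullet> g x) + \<phi> x * \<kappa>' (w x) * (norm (g x))\<^sup>2)"
    using sq_integrable_inner[OF w(8) sobolev_sq_integrable(2)[OF sob]] unfolding g\<gamma> .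
  show "integrable lborel (\<lambda>x. \<phi> x * ((V x * sn (w x) - f (sn (w x))) * \<kappa> (w x) / cs (w x)))"
    using iD unfolding D_def[abs_def] .
  have "(\<integral>x. g x \<bullet> \<gamma> x \<partial>lborel) + (\<integral>x. D x \<partial>lborel) = 0" using one[of 1] one[of "-1"] by simp
  then show "(\<integral>x. \<kappa> (w x) * (\<Phi> x \<bullet> g x) + \<phi> x * \<kappa>' (w x) * (norm (g x))\<^sup>2 \<partial>lborel)
      + (\<integral>x. \<phi> x * ((V x * sn (w x) - f (sn (w x))) * \<kappa> (w x) / cs (w x)) \<partial>lborel) = 0"
    unfolding g\<gamma> D_def .
qed

end

section \<open>Cutoff functions and the comparison principle\<close>

definition plateau :: "real \<Rightarrow> real" where "plateau t = (max 0 (1 - (max 0 (t - 1))\<^sup>2))\<^sup>2"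
definition plateau' :: "real \<Rightarrow> real" where
  "plateau' t = - 4 * max 0 (1 - (max 0 (t - 1))\<^sup>2) * max 0 (t - 1)"

lemma DERIV_max0_square: "((\<lambda>t::real. (max 0 t)\<^sup>2) has_real_derivative 2 * max 0 t) (at t)"
  using DERIV_max0_power[of 0 t] by (simp add: numeral_2_eq_2)

lemma DERIV_plateau: "(plateau has_real_derivative plateau' t) (at t)"
proof -
  have "((\<lambda>t::real. t - 1) has_real_derivative 1) (at t)"
    using DERIV_diff[OF DERIV_ident DERIV_const] by simp
  from DERIV_chain2[OF DERIV_max0_square this]
  have 1: "((\<lambda>t::real. (max 0 (t - 1))\<^sup>2) has_real_derivative 2 * max 0 (t - 1)) (at t)" by simp
  have "((\<lambda>t::real. 1 - (max 0 (t - 1))\<^sup>2) has_real_derivative 0 - 2 * max 0 (t - 1)) (at t)"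
    by (rule DERIV_diff[OF DERIV_const 1])
  from DERIV_chain2[OF DERIV_max0_square this]
  show ?thesis by (simp add: plateau_def[abs_def] plateau'_def mult.assoc)
qed

lemma continuous_plateau': "continuous_on UNIV plateau'"
  unfolding plateau'_def[abs_def] by (intro continuous_intros)

lemma plateau_simps: "t \<le> 1 \<Longrightarrow> plateau t = 1" "t \<le> 1 \<Longrightarrow> plateau' t = 0" "0 \<le> plateau t" "plateau t \<le> 1"
  "2 \<le> t \<Longrightarrow> plateau t = 0" "2 \<le> t \<Longrightarrow> plateau' t = 0" "\<bar>plateau' t\<bar> \<le> 4"
proof -
  show "t \<le> 1 \<Longrightarrow> plateau t = 1" "t \<le> 1 \<Longrightarrow> plateau' t = 0" "0 \<le> plateau t"
    by (simp_all add: plateau_def plateau'_def max_def)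
  have m: "0 \<le> max 0 (1 - (max 0 (t - 1))\<^sup>2)" "max 0 (1 - (max 0 (t - 1))\<^sup>2) \<le> 1" by simp_all
  show "plateau t \<le> 1" unfolding plateau_def by (rule power_le_one[OF m])
  have big: "max 0 (1 - (max 0 (t - 1))\<^sup>2) = 0" if "2 \<le> t"
  proof -
    have "1\<^sup>2 \<le> (max 0 (t - 1))\<^sup>2" using that by (intro power_mono) auto
    then show ?thesis by simp
  qed
  show "2 \<le> t \<Longrightarrow> plateau t = 0" "2 \<le> t \<Longrightarrow> plateau' t = 0"
    using big by (simp_all add: plateau_def plateau'_def)
  show "\<bar>plateau' t\<bar> \<le> 4"
  proof (cases "2 \<le> t")
    case True then show ?thesis using big by (simp add: plateau'_def)
  next
    case False
    then have "max 0 (1 - (max 0 (t - 1))\<^sup>2) * max 0 (t - 1) \<le> 1 * 1" using m by (intro mult_mono) auto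
    moreover have "0 \<le> max 0 (1 - (max 0 (t - 1))\<^sup>2) * max 0 (t - 1)" by (intro mult_nonneg_nonneg) auto
    ultimately show ?thesis unfolding plateau'_def by (simp only: mult.assoc abs_mult) simp
  qed
qed

lemma C1_norm_square: "C1 (\<lambda>x. (norm (x - a))\<^sup>2) (\<lambda>x. 2 *\<^sub>R (x - a))"
  unfolding C1_def power2_norm_eq_inner
  by (auto intro!: continuous_intros derivative_eq_intros simp: inner_commute)

text \<open>The gradient bound does not depend on R, so these cutoffs can exhaust the space while
  the error terms stay under one integrable majorant.\<close>

lemma cutoff_exists:
  fixes R :: real
  assumes R: "1 \<le> R"
  obtains \<omega> :: "'a::euclidean_space \<Rightarrow> real" and X where "C1c \<omega> X" "\<And>x. norm x \<le> R \<Longrightarrow> \<omega> x = 1"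
    "\<And>x. norm x \<le> R \<Longrightarrow> X x = 0" "\<And>x. 0 \<le> \<omega> x" "\<And>x. \<omega> x \<le> 1" "\<And>x. norm (X x) \<le> 16"
proof -
  define \<omega> :: "'a \<Rightarrow> real" where "\<omega> x = plateau (1 / R\<^sup>2 * (norm (x - 0))\<^sup>2)" for x
  define X :: "'a \<Rightarrow> 'a" where "X x = plateau' (1 / R\<^sup>2 * (norm (x - 0))\<^sup>2) *\<^sub>R ((1 / R\<^sup>2) *\<^sub>R (2 *\<^sub>R (x - 0)))" for x
  have C: "C1 \<omega> X"
    unfolding \<omega>_def[abs_def] X_def[abs_def]
    by (rule C1_comp[OF C1_scale[OF C1_norm_square] DERIV_plateau continuous_plateau'])
  have in1: "1 / R\<^sup>2 * (norm (x - 0))\<^sup>2 \<le> 1" if "norm x \<le> R" for x :: 'a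
    using power_mono[OF that, of 2] R by (simp add: divide_le_eq)
  have out2: "2 \<le> 1 / R\<^sup>2 * (norm (x - 0))\<^sup>2" if "2 * R \<le> norm x" for x :: 'a
  proof -
    have "(2 * R)\<^sup>2 \<le> (norm x)\<^sup>2" using that R by (intro power_mono) auto
    then have "2 * R\<^sup>2 \<le> (norm x)\<^sup>2" using zero_le_power2[of R] unfolding power_mult_distrib power2_eq_square[of 2] by linarith
    then show ?thesis using R by (simp add: le_divide_eq)
  qed
  show ?thesis
  proof (rule that[of \<omega> X])
    show "C1c \<omega> X"
      unfolding C1c_def
    proof (intro conjI exI[of _ "2 * R"] allI impI C)
      fix x :: 'a assume "2 * R \<le> norm x"
      from out2[OF this] show "\<omega> x = 0" "X x = 0" by (simp_all only: \<omega>_def X_def plateau_simps) simp_all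
    qed
    show "\<omega> x = 1" "X x = 0" if "norm x \<le> R" for x
      using in1[OF that] by (simp_all only: \<omega>_def X_def plateau_simps) simp_all
    show "0 \<le> \<omega> x" "\<omega> x \<le> 1" for x by (simp_all only: \<omega>_def plateau_simps)
    show "norm (X x) \<le> 16" for x
    proof (cases "norm x \<le> 2 * R")
      case True
      have "norm (X x) = \<bar>plateau' (1 / R\<^sup>2 * (norm (x - 0))\<^sup>2)\<bar> * (1 / R\<^sup>2 * (2 * norm x))" by (simp add: X_def abs_mult)
      also have "\<dots> \<le> 4 * (1 / R\<^sup>2 * (2 * (2 * R)))"
        using True R by (intro mult_mono plateau_simps(7) mult_left_mono) auto
      also have "\<dots> = 16 / R" using R by (simp add: power2_eq_square)
      also have "\<dots> \<le> 16" using R by (simp add: divide_le_eq)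
      finally show ?thesis .
    next
      case False
      then have "X x = 0" using out2[of x] by (simp only: X_def plateau_simps) simp
      then show ?thesis by simp
    qed
  qed
qed

context layered_film
begin

text \<open>The energy of \<open>w\<close> is compared with that of \<open>w\<close> pushed to the barrier \<open>\<tau> + e y\<close>; \<open>D\<close> plays
  the role of \<open>\<Delta>y\<close>, which may be singular.\<close>

lemma comparison:
  assumes min: "minimiser w g" and y: "C1c y Y" "\<And>x. 0 \<le> y x"
    and e: "e = 1 \<or> e = -1"
    and H1: "\<And>x v. 0 < y x \<Longrightarrow> lo x \<le> v \<Longrightarrow> v \<le> hi x \<Longrightarrow> y x \<le> e * (v - \<tau>) \<or> (x \<in> Z \<and> 0 \<le> e * (v - \<tau>))"
    and H2: "\<And>x. x \<in> Z \<Longrightarrow> 0 < y x \<Longrightarrow> lo x \<le> \<tau> + e * y x \<and> \<tau> + e * y x \<le> hi x"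
    and H3: "\<And>\<psi> h. sobolev \<psi> h \<Longrightarrow> (\<And>x. 0 \<le> \<psi> x \<and> \<psi> x \<le> y x) \<Longrightarrow> (\<And>x. \<psi> x = 0 \<Longrightarrow> h x = 0)
        \<Longrightarrow> (AE x in lborel. \<psi> x \<noteq> 0 \<longrightarrow> x \<in> Z)
        \<Longrightarrow> integrable lborel (\<lambda>x. D x * \<psi> x) \<and> (\<integral>x. Y x \<bullet> h x \<partial>lborel) \<le> - (\<integral>x. D x * \<psi> x \<partial>lborel)"
    and H4: "\<And>x z. x \<in> Z \<Longrightarrow> 0 \<le> z \<Longrightarrow> z < y x \<Longrightarrow> P x (\<tau> + e * y x) - P x (\<tau> + e * z) < D x * (y x - z)"
  shows "AE x in lborel. x \<in> Z \<longrightarrow> 0 < y x \<longrightarrow> y x \<le> e * (w x - \<tau>)"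
proof -
  note w = minimiserD[OF min]
  have ee: "e * e = 1" using e by auto
  obtain R where R: "\<And>x. R \<le> norm x \<Longrightarrow> y x = 0" "\<And>x. R \<le> norm x \<Longrightarrow> Y x = 0"
    by (rule C1c_bound[OF y(1)]) (rule that, assumption+)
  obtain \<omega> :: "'a \<Rightarrow> real" and X where \<omega>: "C1c \<omega> X" "\<And>x. norm x \<le> max 1 R \<Longrightarrow> \<omega> x = 1"
    "\<And>x. norm x \<le> max 1 R \<Longrightarrow> X x = 0" "\<And>x. 0 \<le> \<omega> x" "\<And>x. \<omega> x \<le> 1" "\<And>x. norm (X x) \<le> 16"
    by (rule cutoff_exists[of "max 1 R"]) (simp, rule that, assumption+)
  \<comment> \<open>\<open>u\<close> equals e (w - \<tau>) on the support of y. The cutoff is there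
    because the constant \<tau> is not square integrable.\<close>
  define u where "u x = e * (w x * \<omega> x) - (e * \<tau>) * \<omega> x" for x
  define G where "G x = e *\<^sub>R (w x *\<^sub>R X x + \<omega> x *\<^sub>R g x) - (e * \<tau>) *\<^sub>R X x" for x
  define z where "z x = max 0 (u x)" for x
  \<comment> \<open>The deficit by which w fails to reach the barrier. Adding
    \<open>e * \<psi>\<close> pushes w exactly onto the barrier where it lies below, and changes
    nothing elsewhere.\<close>
  define \<psi> where "\<psi> x = max 0 (y x - z x)" for x
  define h where "h x = (if 0 < y x - z x then Y x - (if 0 \<le> u x then G x else 0) else 0)" for x
  have \<omega>16: "\<bar>\<omega> x\<bar> \<le> 16" for x using \<omega>(4)[of x] \<omega>(5)[of x] by linarith
  have su: "sobolev u G"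
    unfolding u_def[abs_def] G_def[abs_def]
    by (intro sobolev_diff sobolev_scale C1c_sobolev[OF \<omega>(1)] sobolev_mult_C1[OF w(3) C1c_C1[OF \<omega>(1)] \<omega>16 \<omega>(6)])
  have s\<psi>: "sobolev \<psi> h"
    unfolding \<psi>_def[abs_def] h_def[abs_def] z_def[abs_def]
    by (rule sobolev_pos_part[OF sobolev_diff[OF C1c_sobolev[OF y(1)] sobolev_pos_part'[OF su]]])
  have z0: "0 \<le> z x" for x by (simp add: z_def)
  have \<psi>y: "0 \<le> \<psi> x \<and> \<psi> x \<le> y x" for x using z0[of x] y(2)[of x] by (simp add: \<psi>_def)
  have h0: "h x = 0" if "\<psi> x = 0" for x using that by (simp add: \<psi>_def h_def max_def split: if_splits)
  have loc: "u x = e * (w x - \<tau>) \<and> G x = e *\<^sub>R g x" if "0 < y x" for x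
  proof -
    have "norm x \<le> max 1 R" using R(1)[of x] that by (cases "R \<le> norm x") auto
    from \<omega>(2)[OF this] \<omega>(3)[OF this] show ?thesis by (simp add: u_def G_def right_diff_distrib)
  qed
  have main: "\<psi> x \<noteq> 0 \<Longrightarrow> x \<in> Z \<and> 0 \<le> e * (w x - \<tau>) \<and> e * (w x - \<tau>) < y x \<and> \<psi> x = y x - e * (w x - \<tau>)
      \<and> h x = Y x - e *\<^sub>R g x" if c: "lo x \<le> w x \<and> w x \<le> hi x" for x
  proof -
    assume "\<psi> x \<noteq> 0"
    then have zy: "z x < y x" by (simp add: \<psi>_def max_def split: if_splits)
    then have y0: "0 < y x" using z0[of x] by linarith
    note l = loc[OF y0]
    have "\<not> y x \<le> e * (w x - \<tau>)" using zy l unfolding z_def by linarith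
    then have 1: "x \<in> Z" "0 \<le> e * (w x - \<tau>)" using H1[OF y0, of "w x"] c by auto
    then have zz: "z x = e * (w x - \<tau>)" using l by (simp add: z_def)
    have "h x = Y x - e *\<^sub>R g x" using zy 1(2) l by (simp add: h_def)
    moreover have "\<psi> x = y x - e * (w x - \<tau>)" using zy zz by (simp add: \<psi>_def)
    ultimately show "x \<in> Z \<and> 0 \<le> e * (w x - \<tau>) \<and> e * (w x - \<tau>) < y x \<and> \<psi> x = y x - e * (w x - \<tau>)
      \<and> h x = Y x - e *\<^sub>R g x" using 1 zy zz by simp
  qed
  have push: "w x + e * \<psi> x = \<tau> + e * y x" if "\<psi> x = y x - e * (w x - \<tau>)" for x
  proof -
    have "w x + e * \<psi> x = w x + e * y x - (e * e) * (w x - \<tau>)" unfolding that by (simp add: algebra_simps)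
    then show ?thesis by (simp add: ee)
  qed
  have constr: "AE x in lborel. lo x \<le> w x + e * \<psi> x \<and> w x + e * \<psi> x \<le> hi x"
    using w(4)
  proof eventually_elim
    case (elim x)
    show ?case
    proof (cases "\<psi> x = 0")
      case False
      note m = main[OF elim False]
      then have "0 < y x" by linarith
      with H2[of x] m push[of x] show ?thesis by simp
    qed (use elim in simp)
  qed
  have inZ: "AE x in lborel. \<psi> x \<noteq> 0 \<longrightarrow> x \<in> Z"
    using w(4) by eventually_elim (use main in blast)
  have \<psi>R: "e * \<psi> x = 0" if "R \<le> norm x" for x using \<psi>y[of x] R(1)[OF that] by simp
  note p = perturbation[OF w(1) sobolev_scale[OF s\<psi>, of e], where R = R, OF \<psi>R constr]
  have ibp: "integrable lborel (\<lambda>x. D x * \<psi> x)" "(\<integral>x. Y x \<bullet> h x \<partial>lborel) \<le> - (\<integral>x. D x * \<psi> x \<partial>lborel)"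
    using H3[OF s\<psi> \<psi>y h0 inZ] by blast+
  note hs = sobolev_sq_integrable(2)[OF s\<psi>]
  have i1: "integrable lborel (\<lambda>x. g x \<bullet> (e *\<^sub>R h x))" by (rule sq_integrable_inner[OF w(8) sq_integrable_scaleR[OF hs]])
  have i2: "integrable lborel (\<lambda>x. (norm (e *\<^sub>R h x))\<^sup>2)" by (rule sq_integrableD[OF sq_integrable_scaleR[OF hs]])
  have i3: "integrable lborel (\<lambda>x. Y x \<bullet> h x)" by (rule sq_integrable_inner[OF C1c_sq_integrable(2)[OF y(1)] hs])
  \<comment> \<open>Where \<psi> is nonzero, e g = Y - h, so the Dirichlet energy changes by the
    integral of Y h - |h|^2/2. Dropping the square leaves only the gradient of the barrier, to which
    H3 applies.\<close>
  have "(\<integral>x. g x \<bullet> (e *\<^sub>R h x) \<partial>lborel) + sq_norm (\<lambda>x. e *\<^sub>R h x) / 2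
    = (\<integral>x. g x \<bullet> (e *\<^sub>R h x) + (norm (e *\<^sub>R h x))\<^sup>2 / 2 \<partial>lborel)"
    using i1 i2 by (simp add: sq_norm_def)
  also have "\<dots> \<le> (\<integral>x. Y x \<bullet> h x \<partial>lborel)"
  proof (rule integral_mono_AE)
    show "integrable lborel (\<lambda>x. g x \<bullet> (e *\<^sub>R h x) + (norm (e *\<^sub>R h x))\<^sup>2 / 2)" using i1 i2 by simp
    show "AE x in lborel. g x \<bullet> (e *\<^sub>R h x) + (norm (e *\<^sub>R h x))\<^sup>2 / 2 \<le> Y x \<bullet> h x"
      using w(4)
    proof eventually_elim
      case (elim x)
      show ?case
      proof (cases "\<psi> x = 0")
        case True then show ?thesis using h0 by simp
      next
        case False
        have "h x = Y x - e *\<^sub>R g x" using main[OF elim False] by blast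
        then have "e *\<^sub>R g x = Y x - h x" by simp
        then have "g x \<bullet> (e *\<^sub>R h x) = (Y x - h x) \<bullet> h x" by (metis inner_scaleR_left inner_scaleR_right)
        moreover have "(norm (e *\<^sub>R h x))\<^sup>2 = h x \<bullet> h x" using e by (auto simp: power2_norm_eq_inner)
        moreover have "0 \<le> h x \<bullet> h x" by simp
        ultimately show ?thesis unfolding inner_diff_left by linarith
      qed
    qed
  qed (rule i3)
  finally have A: "(\<integral>x. g x \<bullet> (e *\<^sub>R h x) \<partial>lborel) + sq_norm (\<lambda>x. e *\<^sub>R h x) / 2 \<le> - (\<integral>x. D x * \<psi> x \<partial>lborel)"
    using ibp(2) by linarith
  let ?\<Delta> = "\<lambda>x. P x (w x + e * \<psi> x) - P x (w x)"
  have "J w g \<le> J (\<lambda>x. w x + e * \<psi> x) (\<lambda>x. g x + e *\<^sub>R h x)" by (rule w(2)[OF p(1)])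
  then have "0 \<le> - (\<integral>x. D x * \<psi> x \<partial>lborel) + (\<integral>x. ?\<Delta> x \<partial>lborel)" using p(3) A by linarith
  \<comment> \<open>Minimality makes this integral nonpositive, while H4 makes its integrand
    positive wherever \<psi> is nonzero; hence \<psi> vanishes almost everywhere.\<close>
  then have le: "(\<integral>x. D x * \<psi> x - ?\<Delta> x \<partial>lborel) \<le> 0" using ibp(1) p(2) by simp
  have pos: "AE x in lborel. 0 \<le> D x * \<psi> x - ?\<Delta> x \<and> (D x * \<psi> x - ?\<Delta> x = 0 \<longrightarrow> \<psi> x = 0)"
    using w(4)
  proof eventually_elim
    case (elim x)
    show ?case
    proof (cases "\<psi> x = 0")
      case False
      note m = main[OF elim False]
      have "\<tau> + e * (e * (w x - \<tau>)) = w x" using ee by (simp add: mult.assoc[symmetric])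
      then have "?\<Delta> x < D x * \<psi> x" using H4[of x "e * (w x - \<tau>)"] m push[of x] by simp
      then show ?thesis by simp
    qed simp
  qed
  have int: "integrable lborel (\<lambda>x. D x * \<psi> x - ?\<Delta> x)" using ibp(1) p(2) by (rule Bochner_Integration.integrable_diff)
  have nn: "AE x in lborel. 0 \<le> D x * \<psi> x - ?\<Delta> x" using pos by eventually_elim simp
  have "(\<integral>x. D x * \<psi> x - ?\<Delta> x \<partial>lborel) = 0" using le integral_nonneg_AE[OF nn] by linarith
  then have "AE x in lborel. D x * \<psi> x - ?\<Delta> x = 0" using integral_nonneg_eq_0_iff_AE[OF int nn] by blast
  with pos show ?thesis
  proof eventually_elim
    case (elim x)
    then have "\<psi> x = 0" by blast
    then have "y x \<le> z x" by (simp add: \<psi>_def max_def split: if_splits)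
    then show ?case using loc[of x] by (auto simp: z_def)
  qed
qed

end

section \<open>Integration by parts with radial functions\<close>

lemma C1_inner: "C1 (\<lambda>x. (x - a) \<bullet> b) (\<lambda>x. b)"
  unfolding C1_def by (auto intro!: derivative_eq_intros simp: inner_commute)

text \<open>Integration by parts in each basis direction, summed: the factor next to \<psi> is the
  divergence of the field p(x) (x - a).\<close>

lemma sobolev_ibp_radial:
  fixes a :: "'a::euclidean_space"
  assumes s: "sobolev \<psi> h" and p: "C1c p G"
  shows "(\<integral>x. p x * ((x - a) \<bullet> h x) \<partial>lborel) = - (\<integral>x. \<psi> x * (G x \<bullet> (x - a) + real DIM('a) * p x) \<partial>lborel)"
proof -
  define q where "q b x = p x * ((x - a) \<bullet> b)" for b x
  define W where "W b x = p x *\<^sub>R b + ((x - a) \<bullet> b) *\<^sub>R G x" for b x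
  have q: "C1c (q b) (W b)" for b
    unfolding q_def[abs_def] W_def[abs_def] by (rule C1c_mult[OF p C1_inner])
  have ibp: "(\<integral>x. \<psi> x * (W b x \<bullet> b) \<partial>lborel) = - (\<integral>x. (h x \<bullet> b) * q b x \<partial>lborel)" for b
    by (rule sobolev_ibp[OF s q])
  have sq: "sq_integrable (\<lambda>x. v x \<bullet> b)" if "sq_integrable v" for v :: "'a \<Rightarrow> 'a" and b
  proof (rule sq_integrable_bound(1)[OF _ that, of _ "norm b"])
    show "(\<lambda>x. v x \<bullet> b) \<in> borel_measurable lborel" using sq_integrable_measurable_borel[OF that] by simp
    show "AE x in lborel. norm (v x \<bullet> b) \<le> norm b * norm (v x)"
      by (intro AE_I2) (metis Cauchy_Schwarz_ineq2 mult.commute real_norm_def)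
  qed
  note qs = C1c_sq_integrable[OF q]
  have i1: "integrable lborel (\<lambda>x. \<psi> x * (W b x \<bullet> b))" for b
    using sq_integrable_inner[OF sobolev_sq_integrable(1)[OF s] sq[OF qs(2)[of b], of b]] by simp
  have i2: "integrable lborel (\<lambda>x. (h x \<bullet> b) * q b x)" for b
    using sq_integrable_inner[OF sq[OF sobolev_sq_integrable(2)[OF s], of b] qs(1)[of b]] by simp
  have "(\<Sum>b\<in>Basis. (h x \<bullet> b) * q b x) = p x * ((x - a) \<bullet> h x)" for x
    unfolding q_def euclidean_inner[of "x - a" "h x"] sum_distrib_left
    by (intro sum.cong) (auto simp: mult_ac)
  moreover have "(\<Sum>b\<in>Basis. \<psi> x * (W b x \<bullet> b)) = \<psi> x * (G x \<bullet> (x - a) + real DIM('a) * p x)" for x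
  proof -
    have "(\<Sum>b\<in>Basis. W b x \<bullet> b) = (\<Sum>b\<in>Basis. p x + (G x \<bullet> b) * ((x - a) \<bullet> b))"
      by (intro sum.cong) (auto simp: W_def inner_add_left inner_Basis mult.commute)
    also have "\<dots> = G x \<bullet> (x - a) + real DIM('a) * p x"
      unfolding sum.distrib euclidean_inner[of "G x" "x - a"] by simp
    finally show ?thesis by (simp only: sum_distrib_left[symmetric])
  qed
  ultimately have "(\<integral>x. p x * ((x - a) \<bullet> h x) \<partial>lborel) = (\<integral>x. (\<Sum>b\<in>Basis. (h x \<bullet> b) * q b x) \<partial>lborel)"
    "(\<integral>x. \<psi> x * (G x \<bullet> (x - a) + real DIM('a) * p x) \<partial>lborel) = (\<integral>x. (\<Sum>b\<in>Basis. \<psi> x * (W b x \<bullet> b)) \<partial>lborel)"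
    by simp_all
  then show ?thesis using i1 i2 ibp by (simp add: Bochner_Integration.integral_sum sum_negf)
qed

text \<open>Radial functions are written in the squared distance, which is smooth at the centre as
  well, so no condition on Y at 0 is needed.\<close>

lemma C1c_radial:
  fixes a :: "'a::euclidean_space"
  assumes "\<And>t. (Y has_real_derivative Y' t) (at t)" "continuous_on UNIV Y'"
    and "\<And>t. S \<le> t \<Longrightarrow> Y t = 0" "\<And>t. S \<le> t \<Longrightarrow> Y' t = 0"
  shows "C1c (\<lambda>x. Y ((norm (x - a))\<^sup>2)) (\<lambda>x. (2 * Y' ((norm (x - a))\<^sup>2)) *\<^sub>R (x - a))"
  unfolding C1c_def
proof (intro conjI exI[of _ "norm a + max 1 S"] allI impI)
  show "C1 (\<lambda>x. Y ((norm (x - a))\<^sup>2)) (\<lambda>x. (2 * Y' ((norm (x - a))\<^sup>2)) *\<^sub>R (x - a))"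
    using C1_comp[OF C1_norm_square assms(1,2), of a] by (simp add: mult.commute)
  fix x :: 'a assume x: "norm a + max 1 S \<le> norm x"
  then have "max 1 S \<le> norm (x - a)" using norm_triangle_ineq2[of x a] by linarith
  then have "max 1 S * 1 \<le> norm (x - a) * norm (x - a)" by (intro mult_mono) auto
  then have "S \<le> (norm (x - a))\<^sup>2" by (simp add: power2_eq_square)
  then show "Y ((norm (x - a))\<^sup>2) = 0" "(2 * Y' ((norm (x - a))\<^sup>2)) *\<^sub>R (x - a) = 0"
    using assms(3,4) by simp_all
qed

text \<open>\<open>p n\<close> are regularisations of the possibly only Hoelder continuous radial derivative \<open>q\<close>.\<close>

lemma radial_ibp_limit:
  fixes a :: "'a::euclidean_space" and p p' :: "nat \<Rightarrow> real \<Rightarrow> real"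
  defines "\<rho> \<equiv> \<lambda>x. (norm (x - a))\<^sup>2"
  assumes s: "sobolev \<psi> h" and \<psi>: "\<And>x. 0 \<le> \<psi> x \<and> \<psi> x \<le> Y (\<rho> x)" and h0: "\<And>x. \<psi> x = 0 \<Longrightarrow> h x = 0"
    and Z: "AE x in lborel. \<psi> x \<noteq> 0 \<longrightarrow> x \<in> Z"
    and Y: "\<And>t. S \<le> t \<Longrightarrow> Y t = 0" "\<And>t. Y t \<le> 1"
    and p: "\<And>n t. (p n has_real_derivative p' n t) (at t)" "\<And>n. continuous_on UNIV (p' n)"
      "\<And>n t. S \<le> t \<Longrightarrow> p n t = 0" "\<And>n t. S \<le> t \<Longrightarrow> p' n t = 0"
    and lim: "\<And>x. x \<in> Z \<Longrightarrow> 0 < Y (\<rho> x) \<Longrightarrow> (\<lambda>n. p n (\<rho> x)) \<longlonglongrightarrow> q (\<rho> x)"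
      "\<And>x. x \<in> Z \<Longrightarrow> 0 < Y (\<rho> x) \<Longrightarrow> (\<lambda>n. p' n (\<rho> x)) \<longlonglongrightarrow> q' (\<rho> x)"
    and bd: "\<And>n x. x \<in> Z \<Longrightarrow> 0 < Y (\<rho> x) \<Longrightarrow> \<bar>p n (\<rho> x)\<bar> \<le> C"
      "\<And>n x. x \<in> Z \<Longrightarrow> 0 < Y (\<rho> x) \<Longrightarrow> \<bar>p' n (\<rho> x)\<bar> * Y (\<rho> x) \<le> C"
    and qm [measurable]: "q \<in> borel_measurable borel" "q' \<in> borel_measurable borel"
  shows "integrable lborel (\<lambda>x. (4 * \<rho> x * q' (\<rho> x) + 2 * real DIM('a) * q (\<rho> x)) * \<psi> x)
    \<and> (\<integral>x. ((2 * q (\<rho> x)) *\<^sub>R (x - a)) \<bullet> h x \<partial>lborel)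
      = - (\<integral>x. (4 * \<rho> x * q' (\<rho> x) + 2 * real DIM('a) * q (\<rho> x)) * \<psi> x \<partial>lborel)"
proof -
  have \<rho>m [measurable]: "\<rho> \<in> borel_measurable borel" unfolding \<rho>_def by measurable
  have [measurable]: "\<psi> \<in> borel_measurable borel" "h \<in> borel_measurable borel"
    using s by (auto simp: sobolev_def sq_integrable_def)
  have \<rho>0: "0 \<le> \<rho> x" for x by (simp add: \<rho>_def)
  have supp: "\<rho> x < S" "x \<in> cball a (S + 1)" "0 < Y (\<rho> x)" if "\<psi> x \<noteq> 0" for x
  proof -
    show Yp: "0 < Y (\<rho> x)" using \<psi>[of x] that by linarith
    then show \<rho>S: "\<rho> x < S" using Y(1)[of "\<rho> x"] by (cases "S \<le> \<rho> x") auto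
    have "norm (x - a) \<le> 1 \<or> norm (x - a) \<le> \<rho> x"
      unfolding \<rho>_def power2_eq_square using mult_right_mono[of 1 "norm (x - a)" "norm (x - a)"] by linarith
    then have "norm (x - a) \<le> S + 1" using \<rho>S \<rho>0[of x] by linarith
    then show "x \<in> cball a (S + 1)" by (simp add: dist_norm norm_minus_commute)
  qed
  have pc: "continuous_on UNIV (p n)" for n
    using p(1) by (meson DERIV_isCont continuous_at_imp_continuous_on)
  have [measurable]: "p n \<in> borel_measurable borel" "p' n \<in> borel_measurable borel" for n
    using pc p(2) by (auto intro: borel_measurable_continuous_onI)
  have Cc: "C1c (\<lambda>x. 2 * p n (\<rho> x)) (\<lambda>x. (4 * p' n (\<rho> x)) *\<^sub>R (x - a))" for n
  proof -
    have "C1c (\<lambda>x. p n (\<rho> x)) (\<lambda>x. (2 * p' n (\<rho> x)) *\<^sub>R (x - a))"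
      unfolding \<rho>_def by (rule C1c_radial[of "p n" "p' n" S a, OF p(1)[of n] p(2)[of n] p(3)[of _ n] p(4)[of _ n]])
    from C1c_scale[OF this, of 2] show ?thesis by (simp only: scaleR_scaleR) (simp add: mult.assoc[symmetric])
  qed
  \<comment> \<open>With q and q' the first two derivatives of Y, the field in \<open>?a\<close> is
    the gradient of Y(\<rho>), and the factor of \<psi> in \<open>?b\<close> is its Laplacian 4
    \<rho> Y'' + 2 N Y', N being the dimension.\<close>
  let ?A = "\<lambda>n x. 2 * p n (\<rho> x) * ((x - a) \<bullet> h x)"
  let ?B = "\<lambda>n x. \<psi> x * (4 * \<rho> x * p' n (\<rho> x) + 2 * real DIM('a) * p n (\<rho> x))"
  let ?a = "\<lambda>x. ((2 * q (\<rho> x)) *\<^sub>R (x - a)) \<bullet> h x"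
  let ?b = "\<lambda>x. (4 * \<rho> x * q' (\<rho> x) + 2 * real DIM('a) * q (\<rho> x)) * \<psi> x"
  have AB: "(\<integral>x. ?A n x \<partial>lborel) = - (\<integral>x. ?B n x \<partial>lborel)" for n
    using sobolev_ibp_radial[OF s Cc[of n], of a]
    by (simp add: \<rho>_def power2_norm_eq_inner[symmetric] mult_ac)
  have Alim: "(\<lambda>n. \<integral>x. ?A n x \<partial>lborel) \<longlonglongrightarrow> (\<integral>x. ?a x \<partial>lborel)"
  proof (rule integral_dominated_convergence)
    show "integrable lborel (\<lambda>x. 2 * \<bar>C\<bar> * (\<bar>S\<bar> * indicator (cball a (S + 1)) x + (norm (h x))\<^sup>2))"
      using integrable_indicator_cball[of a "S + 1"] sq_integrableD[OF sobolev_sq_integrable(2)[OF s]]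
      by (intro Bochner_Integration.integrable_mult_right Bochner_Integration.integrable_add) simp_all
    show "AE x in lborel. (\<lambda>n. ?A n x) \<longlonglongrightarrow> ?a x"
      using Z
    proof eventually_elim
      case (elim x)
      show ?case
      proof (cases "\<psi> x = 0")
        case False
        have "(\<lambda>n. 2 * p n (\<rho> x) * ((x - a) \<bullet> h x)) \<longlonglongrightarrow> 2 * q (\<rho> x) * ((x - a) \<bullet> h x)"
          using elim False supp(3)[OF False] by (intro tendsto_mult tendsto_const lim(1)) auto
        then show ?thesis by simp
      qed (simp add: h0)
    qed
    show "AE x in lborel. norm (?A n x) \<le> 2 * \<bar>C\<bar> * (\<bar>S\<bar> * indicator (cball a (S + 1)) x + (norm (h x))\<^sup>2)" for n
      using Z
    proof eventually_elim
      case (elim x)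
      show ?case
      proof (cases "\<psi> x = 0")
        case True
        then show ?thesis using h0[of x] by (simp add: indicator_def)
      next
        case False
        have S: "\<bar>S\<bar> = S" using supp(1)[OF False] \<rho>0[of x] by linarith
        have "\<bar>p n (\<rho> x)\<bar> \<le> \<bar>C\<bar>" using bd(1)[of x n] elim False supp(3)[OF False] by linarith
        moreover have "\<bar>(x - a) \<bullet> h x\<bar> \<le> S + (norm (h x))\<^sup>2"
          using abs_inner_le_AMGM[of 1 "x - a" "h x"] supp(1)[OF False] by (simp add: \<rho>_def)
        ultimately have "\<bar>p n (\<rho> x)\<bar> * \<bar>(x - a) \<bullet> h x\<bar> \<le> \<bar>C\<bar> * (S + (norm (h x))\<^sup>2)"
          by (intro mult_mono) auto
        then show ?thesis using supp(2)[OF False] by (simp add: abs_mult S)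
      qed
    qed
  qed measurable
  have dom: "integrable lborel (\<lambda>x. (4 * \<bar>S\<bar> + 2 * real DIM('a)) * \<bar>C\<bar> * indicator (cball a (S + 1)) x)"
    by (rule Bochner_Integration.integrable_mult_right[OF integrable_indicator_cball])
  have Blim: "AE x in lborel. (\<lambda>n. ?B n x) \<longlonglongrightarrow> ?b x"
    using Z
  proof eventually_elim
    case (elim x)
    show ?case
    proof (cases "\<psi> x = 0")
      case False
      have "(\<lambda>n. ?B n x) \<longlonglongrightarrow> \<psi> x * (4 * \<rho> x * q' (\<rho> x) + 2 * real DIM('a) * q (\<rho> x))"
        using elim False supp(3)[OF False] by (intro tendsto_mult tendsto_add tendsto_const lim) auto
      then show ?thesis by (simp add: mult.commute)
    qed simp
  qed
  \<comment> \<open>The derivatives \<open>p' n\<close> need not be bounded uniformly in n. What is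
    bounded is their product with Y, and Y dominates \<psi>.\<close>
  have Bdom: "AE x in lborel. norm (?B n x) \<le> (4 * \<bar>S\<bar> + 2 * real DIM('a)) * \<bar>C\<bar> * indicator (cball a (S + 1)) x" for n
    using Z
  proof eventually_elim
    case (elim x)
    show ?case
    proof (cases "\<psi> x = 0")
      case True
      then show ?thesis by (simp add: indicator_def)
    next
      case False
      have xz: "x \<in> Z" using elim False by blast
      have S: "\<bar>S\<bar> = S" using supp(1)[OF False] \<rho>0[of x] by linarith
      have 1: "\<bar>p n (\<rho> x)\<bar> \<le> \<bar>C\<bar>" using bd(1)[OF xz supp(3)[OF False], of n] by linarith
      have "\<psi> x * \<bar>p' n (\<rho> x)\<bar> \<le> \<bar>p' n (\<rho> x)\<bar> * Y (\<rho> x)"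
        using \<psi>[of x] by (subst mult.commute, intro mult_left_mono) auto
      then have 2: "\<psi> x * \<bar>p' n (\<rho> x)\<bar> \<le> \<bar>C\<bar>" using bd(2)[OF xz supp(3)[OF False], of n] by linarith
      have \<psi>1: "0 \<le> \<psi> x" "\<psi> x \<le> 1" using \<psi>[of x] Y(2)[of "\<rho> x"] by linarith+
      have "norm (?B n x) \<le> \<bar>4 * \<rho> x * (\<psi> x * p' n (\<rho> x))\<bar> + \<bar>2 * real DIM('a) * (\<psi> x * p n (\<rho> x))\<bar>"
        using abs_triangle_ineq[of "4 * \<rho> x * (\<psi> x * p' n (\<rho> x))" "2 * real DIM('a) * (\<psi> x * p n (\<rho> x))"]
        by (simp add: algebra_simps)
      also have "\<dots> = 4 * \<rho> x * (\<psi> x * \<bar>p' n (\<rho> x)\<bar>) + 2 * real DIM('a) * (\<psi> x * \<bar>p n (\<rho> x)\<bar>)"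
        using \<psi>1 \<rho>0[of x] by (simp add: abs_mult)
      also have "\<dots> \<le> 4 * S * \<bar>C\<bar> + 2 * real DIM('a) * (1 * \<bar>C\<bar>)"
        using 1 2 \<psi>1 \<rho>0[of x] supp(1)[OF False] by (intro add_mono mult_mono) auto
      finally show ?thesis using supp(2)[OF False] by (simp add: algebra_simps S)
    qed
  qed
  have i: "integrable lborel ?b"
    by (rule integrable_dominated_convergence[OF _ _ dom Blim Bdom]) measurable
  have "(\<lambda>n. - (\<integral>x. ?B n x \<partial>lborel)) \<longlonglongrightarrow> - (\<integral>x. ?b x \<partial>lborel)"
    by (intro tendsto_minus integral_dominated_convergence[OF _ _ dom Blim Bdom]) measurable
  then have "(\<integral>x. ?a x \<partial>lborel) = - (\<integral>x. ?b x \<partial>lborel)"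
    using Alim LIMSEQ_unique unfolding AB by blast
  with i show ?thesis by blast
qed

lemma DERIV_threehalf:
  "((\<lambda>r::real. max 0 r * sqrt (max 0 r)) has_real_derivative 3/2 * sqrt (max 0 r)) (at r)"
proof -
  consider "r > 0" | "r < 0" | "r = 0" by linarith
  then show ?thesis
  proof cases
    case 1
    have "((\<lambda>r::real. r * sqrt r) has_real_derivative 1 * sqrt r + (inverse (sqrt r) / 2) * r) (at r)"
      by (rule DERIV_mult[OF DERIV_ident DERIV_real_sqrt[OF 1]])
    moreover have "1 * sqrt r + (inverse (sqrt r) / 2) * r = 3/2 * sqrt r"
      using 1 real_div_sqrt[of r] by (simp add: inverse_eq_divide)
    ultimately have "((\<lambda>r::real. r * sqrt r) has_real_derivative 3/2 * sqrt r) (at r)" by simp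
    then have "((\<lambda>r::real. max 0 r * sqrt (max 0 r)) has_real_derivative 3/2 * sqrt r) (at r)"
      by (rule has_field_derivative_transform_within_open[of _ _ _ "{0<..}"]) (use 1 in auto)
    then show ?thesis using 1 by simp
  next
    case 2
    have "((\<lambda>t::real. 0) has_real_derivative 0) (at r)" by simp
    then have "((\<lambda>r::real. max 0 r * sqrt (max 0 r)) has_real_derivative 0) (at r)"
      by (rule has_field_derivative_transform_within_open[of _ _ _ "{..<0}"]) (use 2 in auto)
    then show ?thesis using 2 by simp
  next
    case 3
    have "((\<lambda>h. (max 0 h * sqrt (max 0 h)) / h) \<longlongrightarrow> 0) (at (0::real))"
    proof (rule tendsto_0_le[where K = 1])
      have "((\<lambda>h. sqrt \<bar>h\<bar>) \<longlongrightarrow> sqrt \<bar>0\<bar>) (at (0::real))" by (intro tendsto_intros)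
      then show "((\<lambda>h. sqrt \<bar>h\<bar>) \<longlongrightarrow> 0) (at (0::real))" by simp
      show "\<forall>\<^sub>F h in at (0::real). norm (max 0 h * sqrt (max 0 h) / h) \<le> norm (sqrt \<bar>h\<bar>) * 1"
        by (intro always_eventually allI) (auto simp: max_def)
    qed
    then show ?thesis using 3 by (simp add: DERIV_def)
  qed
qed

section \<open>Concentric layers and barriers at their interfaces\<close>

lemma inverse_sqrt_cancel: "0 < u \<Longrightarrow> inverse (sqrt u) * (u * sqrt u) = u"
  by simp

text \<open>All radii enter squared. Core and exterior satisfy \<open>good\<close>: there V exceeds
  f(1), so the potential decreases when |u| leaves 1. In the shells only the bound b is available.
  The first condition in \<open>thin\<close> keeps the first order part of the Laplacian of the
  barrier below half of its main part, the second keeps the height of the barrier, taken over two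
  shell widths, below \<pi>/4.\<close>

locale shells = film V f F C\<^sub>F
  for V :: "'a::euclidean_space \<Rightarrow> real" and f F :: "real \<Rightarrow> real" and C\<^sub>F :: real +
  fixes x\<^sub>0 :: 'a and T b :: real and m :: nat
  assumes T: "1 < T" and m: "0 < m"
    and good: "\<And>x. (norm (x - x\<^sub>0))\<^sup>2 \<le> 1 \<or> T \<le> (norm (x - x\<^sub>0))\<^sup>2 \<Longrightarrow> f 1 + 1 \<le> V x"
    and b: "1 \<le> b" and V_le: "\<And>x. (norm (x - x\<^sub>0))\<^sup>2 \<le> T \<Longrightarrow> \<bar>V x\<bar> \<le> b"
    and f_le: "\<And>s. \<bar>s\<bar> \<le> 1 \<Longrightarrow> \<bar>f s\<bar> \<le> b"
    and thin: "real DIM('a) * ((T - 1) / real m) \<le> 1/2"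
      "8/3 * b^3 * (2 * ((T - 1) / real m) * sqrt (2 * ((T - 1) / real m))) \<le> pi / 4"
begin

definition \<rho> :: "'a \<Rightarrow> real" where "\<rho> x = (norm (x - x\<^sub>0))\<^sup>2"
definition ell :: real where "ell = (T - 1) / real m"
text \<open>Index -1 is the core, 0 to m - 1 are the shells, of equal width \<open>ell\<close> in
  squared radius, and m is the exterior; clamping the floor handles the two ends.\<close>

definition layer :: "'a \<Rightarrow> int" where "layer x = max (-1) (min (int m) \<lfloor>(\<rho> x - 1) / ell\<rfloor>)"
text \<open>The offset gives the exterior the interval [-\<pi>/4, \<pi>/4] around 0, as decay at
  infinity demands; each layer inwards lies one interval lower. Adjacent intervals share an
  endpoint, so w is forced through a turning value at each interface.\<close>

definition lo :: "'a \<Rightarrow> real" where "lo x = of_int (layer x - int m - 1) * (pi / 2) + pi / 4"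

lemma ell: "0 < ell" "1 + real m * ell = T" "real DIM('a) * ell \<le> 1/2"
  using T m thin by (simp_all add: ell_def)

lemma \<rho>_nonneg: "0 \<le> \<rho> x" by (simp add: \<rho>_def)

lemma measurable_\<rho> [measurable]: "\<rho> \<in> borel_measurable borel"
  unfolding \<rho>_def[abs_def] by measurable

lemma layer_bounds: "-1 \<le> layer x" "layer x \<le> int m" using m by (auto simp: layer_def)

lemma layer_ge: "j < m \<Longrightarrow> 1 + (real j + 1) * ell \<le> \<rho> x \<Longrightarrow> int j + 1 \<le> layer x"
proof -
  assume j: "j < m" and "1 + (real j + 1) * ell \<le> \<rho> x"
  then have "real_of_int (int j + 1) \<le> (\<rho> x - 1) / ell" using ell(1) by (simp add: pos_le_divide_eq)
  then have "int j + 1 \<le> \<lfloor>(\<rho> x - 1) / ell\<rfloor>" by (simp only: le_floor_iff)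
  then show "int j + 1 \<le> layer x" using j by (auto simp: layer_def)
qed

lemma layer_le: "\<rho> x < 1 + real j * ell \<Longrightarrow> layer x \<le> int j - 1"
proof -
  assume "\<rho> x < 1 + real j * ell"
  then have "(\<rho> x - 1) / ell < real_of_int (int j)" using ell(1) by (simp add: pos_divide_less_eq)
  then have "\<lfloor>(\<rho> x - 1) / ell\<rfloor> < int j" by (simp only: floor_less_iff)
  then show "layer x \<le> int j - 1" by (auto simp: layer_def)
qed

lemma layer_core: "layer x = -1 \<longleftrightarrow> \<rho> x < 1"
proof
  assume "\<rho> x < 1" then show "layer x = -1" using layer_le[of x 0] layer_bounds(1)[of x] by simp
next
  assume l: "layer x = -1"
  define k where "k = \<lfloor>(\<rho> x - 1) / ell\<rfloor>"
  have "max (-1) (min (int m) k) = -1" using l by (simp add: layer_def k_def)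
  then have "k < 0" using m by (auto simp: min_def max_def split: if_splits)
  then have "\<lfloor>(\<rho> x - 1) / ell\<rfloor> < 0" unfolding k_def .
  then have "(\<rho> x - 1) / ell < 0" unfolding floor_less_iff by simp
  then show "\<rho> x < 1" using ell(1) by (simp add: divide_less_0_iff)
qed

lemma layer_far: "layer x = int m \<longleftrightarrow> T \<le> \<rho> x"
proof
  assume "T \<le> \<rho> x"
  then have "1 + (real (m - 1) + 1) * ell \<le> \<rho> x" using m ell(2) by (simp add: of_nat_diff)
  from layer_ge[OF _ this] show "layer x = int m" using m layer_bounds(2)[of x] by simp
next
  assume l: "layer x = int m"
  show "T \<le> \<rho> x"
  proof (rule ccontr)
    assume "\<not> T \<le> \<rho> x"
    then have "\<rho> x < 1 + real m * ell" using ell(2) by simp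
    from layer_le[OF this] l show False by simp
  qed
qed

lemma layer_shell:
  assumes "layer x = int j" "j < m"
  shows "1 + real j * ell \<le> \<rho> x" "\<rho> x < 1 + (real j + 1) * ell" "\<rho> x < T" "1 \<le> \<rho> x"
proof -
  show 1: "1 + real j * ell \<le> \<rho> x"
    using layer_le[of x j] assms by (cases "1 + real j * ell \<le> \<rho> x") auto
  show "\<rho> x < 1 + (real j + 1) * ell"
    using layer_ge[of j x] assms by (cases "\<rho> x < 1 + (real j + 1) * ell") auto
  show "\<rho> x < T" using layer_far[of x] assms by (cases "T \<le> \<rho> x") auto
  show "1 \<le> \<rho> x" using layer_core[of x] assms by (cases "\<rho> x < 1") auto
qed

lemma lo_of_layer: "lo x = real_of_int (layer x) * (pi / 2) - real m * (pi / 2) - pi / 4"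
  by (simp add: lo_def algebra_simps)

sublocale layered_film V f F C\<^sub>F lo "norm x\<^sub>0 + T" "(real m + 2) * pi"
proof
  have "lo = (\<lambda>x. (max (-1) (min (real m) (of_int \<lfloor>(\<rho> x - 1) / ell\<rfloor>)) - real m - 1) * (pi / 2) + pi / 4)"
    unfolding lo_def[abs_def] layer_def by (simp add: of_int_max of_int_min)
  moreover have "(\<lambda>x. real_of_int \<lfloor>(\<rho> x - 1) / ell\<rfloor>) \<in> borel_measurable borel" by measurable
  ultimately show "lo \<in> borel_measurable borel" by simp
  show "cs (lo x) = 0" for x unfolding cs_eq_0_iff lo_def by blast
  show "lo x = - (pi / 4)" if x: "norm x\<^sub>0 + T \<le> norm x" for x
  proof -
    have "T \<le> norm (x - x\<^sub>0)" using norm_triangle_ineq2[of x x\<^sub>0] x by linarith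
    then have "1 * T \<le> norm (x - x\<^sub>0) * norm (x - x\<^sub>0)" using T by (intro mult_mono) auto
    then have "layer x = int m" unfolding layer_far \<rho>_def by (simp add: power2_eq_square)
    then show ?thesis by (simp add: lo_def)
  qed
  show "\<bar>lo x\<bar> \<le> (real m + 2) * pi" for x
  proof -
    have "\<bar>real_of_int (layer x - int m - 1)\<bar> \<le> real m + 2"
      using layer_bounds[of x] by linarith
    then have "\<bar>real_of_int (layer x - int m - 1) * (pi / 2)\<bar> \<le> (real m + 2) * (pi / 2)"
      unfolding abs_mult using pi_gt_zero by (intro mult_mono) auto
    then have "\<bar>lo x\<bar> \<le> (real m + 2) * (pi / 2) + pi / 4"
      using pi_gt_zero unfolding lo_def by linarith
    also have "\<dots> \<le> (real m + 2) * (pi / 2) + (real m + 2) * (pi / 2)"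
    proof -
      have "2 * (pi / 2) \<le> (real m + 2) * (pi / 2)" using pi_gt_zero by (intro mult_right_mono) auto
      then show ?thesis using pi_gt_zero by linarith
    qed
    finally show ?thesis by (simp add: algebra_simps)
  qed
qed

text \<open>Chosen so that \<gamma> r^(3/2) = 8/3 q^3 for q = b sqrt r, the hypothesis of
  \<open>turning_estimates\<close>. The Lipschitz constant 2b of the potential times the rate 3/(2q)
  is then 3 / sqrt r, from which b has cancelled.\<close>

abbreviation "\<gamma> \<equiv> 8/3 * b^3"

lemma \<gamma>_pos: "0 < \<gamma>" using b by simp

text \<open>On the shell this is \<gamma> r^(3/2) with r = e (t - a), measured from the interface at
  squared radius a. The cutoff begins only beyond one width, in the adjacent layer, where the
  constraint alone already keeps w farther from the turning value than the barrier is high.\<close>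

definition bar :: "real \<Rightarrow> real \<Rightarrow> real \<Rightarrow> real" where
  "bar e a t = \<gamma> * ((max 0 (e * (t - a)) * sqrt (max 0 (e * (t - a)))) * plateau (((t - a) / ell)\<^sup>2))"

definition bar' :: "real \<Rightarrow> real \<Rightarrow> real \<Rightarrow> real" where
  "bar' e a t = \<gamma> * ((3/2 * sqrt (max 0 (e * (t - a))) * e) * plateau (((t - a) / ell)\<^sup>2)
     + (plateau' (((t - a) / ell)\<^sup>2) * (2 * ((t - a) / ell) * (1 / ell))) * (max 0 (e * (t - a)) * sqrt (max 0 (e * (t - a)))))"

lemma DERIV_plateau_arg:
  "((\<lambda>t. plateau (((t - a) / ell)\<^sup>2)) has_real_derivative
     plateau' (((t - a) / ell)\<^sup>2) * (2 * ((t - a) / ell) * (1 / ell))) (at t)"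
proof -
  have 1: "((\<lambda>t. (t - a) / ell) has_real_derivative 1 / ell) (at t)"
    by (rule DERIV_cdivide) (use DERIV_diff[OF DERIV_ident DERIV_const] in simp)
  have "((\<lambda>t. ((t - a) / ell)\<^sup>2) has_real_derivative 2 * ((t - a) / ell) * (1 / ell)) (at t)"
    using DERIV_power[OF 1, of 2] by (simp add: mult_ac)
  from DERIV_chain2[OF DERIV_plateau this] show ?thesis .
qed

lemma DERIV_bar: "(bar e a has_real_derivative bar' e a t) (at t)"
proof -
  have "((\<lambda>t. e * (t - a)) has_real_derivative e) (at t)"
    using DERIV_cmult[OF DERIV_diff[OF DERIV_ident DERIV_const], of e] by simp
  from DERIV_cmult[OF DERIV_mult[OF DERIV_chain2[OF DERIV_threehalf this] DERIV_plateau_arg], of \<gamma>]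
  show ?thesis unfolding bar_def[abs_def] bar'_def .
qed

lemma continuous_bar': "continuous_on UNIV (bar' e a)"
  unfolding bar'_def[abs_def]
  by (intro continuous_intros continuous_on_compose2[OF continuous_plateau']
      continuous_on_compose2[OF DERIV_continuous_on[of UNIV plateau plateau', OF has_field_derivative_at_within[OF DERIV_plateau]]])
     (use ell(1) in auto)

lemma plateau_outside:
  assumes "2 * ell \<le> \<bar>t - a\<bar>" shows "plateau (((t - a) / ell)\<^sup>2) = 0" "plateau' (((t - a) / ell)\<^sup>2) = 0"
proof -
  have "2 \<le> \<bar>(t - a) / ell\<bar>" using assms ell(1) by (simp add: pos_le_divide_eq)
  then have "2\<^sup>2 \<le> \<bar>(t - a) / ell\<bar>\<^sup>2" by (intro power_mono) auto
  then have "2 \<le> ((t - a) / ell)\<^sup>2" unfolding power2_abs by simp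
  then show "plateau (((t - a) / ell)\<^sup>2) = 0" "plateau' (((t - a) / ell)\<^sup>2) = 0"
    by (simp_all only: plateau_simps)
qed

lemma plateau_inside:
  assumes "\<bar>t - a\<bar> \<le> ell" shows "plateau (((t - a) / ell)\<^sup>2) = 1" "plateau' (((t - a) / ell)\<^sup>2) = 0"
proof -
  have "\<bar>(t - a) / ell\<bar> \<le> 1" using assms ell(1) by simp
  then have "((t - a) / ell)\<^sup>2 \<le> 1" by (simp only: abs_square_le_1)
  then show "plateau (((t - a) / ell)\<^sup>2) = 1" "plateau' (((t - a) / ell)\<^sup>2) = 0"
    by (simp_all only: plateau_simps)
qed

lemma bar_bounds:
  assumes e: "e = 1 \<or> e = -1"
  shows "0 \<le> bar e a t" "bar e a t \<le> pi / 4" "0 < bar e a t \<Longrightarrow> 0 < e * (t - a) \<and> e * (t - a) < 2 * ell"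
    "0 < e * (t - a) \<Longrightarrow> e * (t - a) \<le> ell \<Longrightarrow> bar e a t = \<gamma> * (e * (t - a) * sqrt (e * (t - a)))"
proof -
  have ae: "\<bar>t - a\<bar> = \<bar>e * (t - a)\<bar>" using e by auto
  show n: "0 \<le> bar e a t" unfolding bar_def using b plateau_simps(3) by (intro mult_nonneg_nonneg) auto
  show p: "0 < e * (t - a) \<and> e * (t - a) < 2 * ell" if "0 < bar e a t"
  proof (rule ccontr)
    assume n: "\<not> (0 < e * (t - a) \<and> e * (t - a) < 2 * ell)"
    then have "bar e a t = 0"
    proof (cases "0 < e * (t - a)")
      case True
      then have "2 * ell \<le> \<bar>t - a\<bar>" using n ae by linarith
      from plateau_outside[OF this] show ?thesis by (simp add: bar_def)
    qed (simp add: bar_def max_def)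
    then show False using that by simp
  qed
  show "bar e a t \<le> pi / 4"
  proof (cases "0 < bar e a t")
    case True
    note r = p[OF True]
    have "(max 0 (e * (t - a)) * sqrt (max 0 (e * (t - a)))) * plateau (((t - a) / ell)\<^sup>2) \<le> (2 * ell * sqrt (2 * ell)) * 1"
      using r plateau_simps(3,4) by (intro mult_mono) auto
    then have "bar e a t \<le> \<gamma> * (2 * ell * sqrt (2 * ell))"
      unfolding bar_def using b by (intro mult_left_mono) auto
    then show ?thesis using thin(2) by (simp add: ell_def)
  next
    case False
    then have "bar e a t \<le> 0" by simp
    then show ?thesis using pi_gt_zero by linarith
  qed
  show "bar e a t = \<gamma> * (e * (t - a) * sqrt (e * (t - a)))" if "0 < e * (t - a)" "e * (t - a) \<le> ell"
  proof -
    have "\<bar>t - a\<bar> \<le> ell" using that ae by linarith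
    from plateau_inside[OF this] show ?thesis using that(1) by (simp add: bar_def max_def)
  qed
qed

lemma bar_outside: "a + 2 * ell \<le> t \<Longrightarrow> bar e a t = 0" "a + 2 * ell \<le> t \<Longrightarrow> bar' e a t = 0"
  using plateau_outside[of t a] ell(1) by (simp_all add: bar_def bar'_def)

text \<open>\<open>q\<close> and \<open>q'\<close> are the first and second derivative of the barrier \<open>\<gamma> r\<^bsup>3/2\<^esup>\<close>;
  \<open>sqrt (sqrt (r\<^sup>2 + \<delta>\<^sup>2))\<close> smooths \<open>sqrt r\<close>.\<close>

lemma shell_ibp:
  fixes e a :: real
  defines "q \<equiv> \<lambda>t. \<gamma> * (3/2 * e) * sqrt (max 0 (e * (t - a)))"
    and "q' \<equiv> \<lambda>t. \<gamma> * (3/4) / sqrt (max 0 (e * (t - a)))"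
  assumes e: "e = 1 \<or> e = -1" and s: "sobolev \<psi> h" and \<psi>: "\<And>x. 0 \<le> \<psi> x \<and> \<psi> x \<le> bar e a (\<rho> x)"
    and h0: "\<And>x. \<psi> x = 0 \<Longrightarrow> h x = 0" and Z: "AE x in lborel. \<psi> x \<noteq> 0 \<longrightarrow> x \<in> Z"
    and zone: "\<And>x. x \<in> Z \<Longrightarrow> 0 < bar e a (\<rho> x) \<Longrightarrow> e * (\<rho> x - a) \<le> ell"
  shows "integrable lborel (\<lambda>x. (4 * \<rho> x * q' (\<rho> x) + 2 * real DIM('a) * q (\<rho> x)) * \<psi> x)"
    "(\<integral>x. ((2 * bar' e a (\<rho> x)) *\<^sub>R (x - x\<^sub>0)) \<bullet> h x \<partial>lborel)
      = - (\<integral>x. (4 * \<rho> x * q' (\<rho> x) + 2 * real DIM('a) * q (\<rho> x)) * \<psi> x \<partial>lborel)"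
proof -
  define \<delta> where "\<delta> n = inverse (real (Suc n))" for n
  have \<delta>: "0 < \<delta> n" "\<delta> n \<le> 1" for n by (auto simp: \<delta>_def inverse_le_1_iff)
  have \<delta>0: "\<delta> \<longlonglongrightarrow> 0" unfolding \<delta>_def by (rule LIMSEQ_inverse_real_of_nat)
  define k where "k n t = sqrt ((t - a)\<^sup>2 + (\<delta> n)\<^sup>2)" for n t
  have kpos: "0 < (t - a)\<^sup>2 + (\<delta> n)\<^sup>2" "0 < k n t" for n t
    using \<delta>(1)[of n] by (auto simp: k_def add_nonneg_pos)
  define \<eta> where "\<eta> n t = sqrt (k n t)" for n t
  define \<eta>' where "\<eta>' n t = inverse (sqrt (k n t)) / 2 * (inverse (k n t) / 2 * (2 * (t - a)))" for n t
  have D\<eta>: "(\<eta> n has_real_derivative \<eta>' n t) (at t)" for n t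
  proof -
    have "((\<lambda>t. t - a) has_real_derivative 1) (at t)" using DERIV_diff[OF DERIV_ident DERIV_const] by simp
    from DERIV_power[OF this, of 2] have "((\<lambda>t. (t - a)\<^sup>2) has_real_derivative 2 * (t - a)) (at t)" by simp
    from DERIV_add[OF this DERIV_const[of "(\<delta> n)\<^sup>2"]]
    have "((\<lambda>t. (t - a)\<^sup>2 + (\<delta> n)\<^sup>2) has_real_derivative 2 * (t - a)) (at t)" by simp
    from DERIV_chain2[OF DERIV_real_sqrt[OF kpos(1)] this]
    have "(k n has_real_derivative inverse (k n t) / 2 * (2 * (t - a))) (at t)" unfolding k_def[abs_def] k_def .
    from DERIV_chain2[OF DERIV_real_sqrt[OF kpos(2)] this]
    show ?thesis unfolding \<eta>_def[abs_def] \<eta>'_def .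
  qed
  have c\<eta>: "continuous_on UNIV (\<eta> n)" "continuous_on UNIV (\<eta>' n)" for n
  proof -
    have ck: "continuous_on UNIV (k n)" unfolding k_def[abs_def] by (intro continuous_intros)
    have nz: "k n t \<noteq> 0" for t using kpos(2)[of n t] by linarith
    show "continuous_on UNIV (\<eta> n)" unfolding \<eta>_def[abs_def] by (intro continuous_intros ck)
    show "continuous_on UNIV (\<eta>' n)" unfolding \<eta>'_def[abs_def]
      by (intro continuous_intros ck) (use nz in simp_all)
  qed
  have cp: "continuous_on UNIV (\<lambda>t. plateau (((t - a) / ell)\<^sup>2))" "continuous_on UNIV (\<lambda>t. plateau' (((t - a) / ell)\<^sup>2))"
    using ell(1) by (auto intro!: continuous_intros continuous_on_compose2[OF continuous_plateau']
      continuous_on_compose2[OF DERIV_continuous_on[of UNIV plateau plateau', OF has_field_derivative_at_within[OF DERIV_plateau]]])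
  define p where "p n t = \<gamma> * (3/2 * e) * (\<eta> n t * plateau (((t - a) / ell)\<^sup>2))" for n t
  define p' where "p' n t = \<gamma> * (3/2 * e) * (\<eta>' n t * plateau (((t - a) / ell)\<^sup>2)
     + (plateau' (((t - a) / ell)\<^sup>2) * (2 * ((t - a) / ell) * (1 / ell))) * \<eta> n t)" for n t
  have in_zone: "0 < e * (\<rho> x - a) \<and> e * (\<rho> x - a) \<le> ell \<and> p n (\<rho> x) = \<gamma> * (3/2 * e) * \<eta> n (\<rho> x)
     \<and> p' n (\<rho> x) = \<gamma> * (3/2 * e) * \<eta>' n (\<rho> x)" if "x \<in> Z" "0 < bar e a (\<rho> x)" for x n
  proof -
    have r: "0 < e * (\<rho> x - a)" "e * (\<rho> x - a) \<le> ell" using bar_bounds(3)[OF e that(2)] zone[OF that] by auto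
    then have "\<bar>\<rho> x - a\<bar> \<le> ell" using e by auto
    from plateau_inside[OF this] r show ?thesis by (simp add: p_def p'_def)
  qed
  have abs_r: "(\<rho> x - a)\<^sup>2 = (e * (\<rho> x - a))\<^sup>2" for x using e by (auto simp: power2_commute)
  have klim: "(\<lambda>n. k n (\<rho> x)) \<longlonglongrightarrow> e * (\<rho> x - a)" if "0 < e * (\<rho> x - a)" for x
  proof -
    have "(\<lambda>n. k n (\<rho> x)) \<longlonglongrightarrow> sqrt ((\<rho> x - a)\<^sup>2 + 0\<^sup>2)"
      unfolding k_def by (intro tendsto_intros \<delta>0)
    then show ?thesis unfolding abs_r using that by simp
  qed
  have k_ge: "e * (\<rho> x - a) \<le> k n (\<rho> x)" for x n
    unfolding k_def abs_r by (rule real_le_rsqrt) simp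
  have ee: "e * e = 1" using e by auto
  \<comment> \<open>A common bound: the first summand majorises the regularised first derivative,
    the second the product of the second derivative with the barrier.\<close>
  define C where "C = \<gamma> * (3/2) * sqrt (sqrt (ell\<^sup>2 + 1)) + \<gamma> * (\<gamma> * ell)"
  have C1: "0 \<le> \<gamma> * (3/2) * sqrt (sqrt (ell\<^sup>2 + 1))" "0 \<le> \<gamma> * (\<gamma> * ell)"
    using b ell(1) by (simp_all add: mult_nonneg_nonneg)
  have ae: "\<bar>e\<bar> = 1" using e by auto
  have main: "integrable lborel (\<lambda>x. (4 * (norm (x - x\<^sub>0))\<^sup>2 * q' ((norm (x - x\<^sub>0))\<^sup>2) + 2 * real DIM('a) * q ((norm (x - x\<^sub>0))\<^sup>2)) * \<psi> x)
    \<and> (\<integral>x. ((2 * q ((norm (x - x\<^sub>0))\<^sup>2)) *\<^sub>R (x - x\<^sub>0)) \<bullet> h x \<partial>lborel)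
      = - (\<integral>x. (4 * (norm (x - x\<^sub>0))\<^sup>2 * q' ((norm (x - x\<^sub>0))\<^sup>2) + 2 * real DIM('a) * q ((norm (x - x\<^sub>0))\<^sup>2)) * \<psi> x \<partial>lborel)"
  proof (rule radial_ibp_limit[where a = x\<^sub>0 and Y = "bar e a" and S = "a + 2 * ell" and p = p and p' = p' and Z = Z and C = C,
        OF s _ h0 Z], fold \<rho>_def)
    show "0 \<le> \<psi> x \<and> \<psi> x \<le> bar e a (\<rho> x)" for x by (rule \<psi>)
    show "bar e a t = 0" if "a + 2 * ell \<le> t" for t by (rule bar_outside(1)[OF that])
    show "bar e a t \<le> 1" for t using bar_bounds(2)[OF e, of a t] pi_less_4 by linarith
    show "(p n has_real_derivative p' n t) (at t)" for n t
      unfolding p_def[abs_def] p'_def by (rule DERIV_cmult[OF DERIV_mult[OF D\<eta> DERIV_plateau_arg]])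
    show "continuous_on UNIV (p' n)" for n
      unfolding p'_def[abs_def] using ell(1) by (intro continuous_intros c\<eta> cp) auto
    show "p n t = 0" "p' n t = 0" if "a + 2 * ell \<le> t" for n t
      using plateau_outside[of t a] that ell(1) by (simp_all add: p_def p'_def)
    show "(\<lambda>n. p n (\<rho> x)) \<longlonglongrightarrow> q (\<rho> x)" if x: "x \<in> Z" "0 < bar e a (\<rho> x)" for x
    proof -
      have r: "0 < e * (\<rho> x - a)" using in_zone[OF x] by blast
      have "(\<lambda>n. \<gamma> * (3/2 * e) * \<eta> n (\<rho> x)) \<longlonglongrightarrow> \<gamma> * (3/2 * e) * sqrt (e * (\<rho> x - a))"
        unfolding \<eta>_def by (intro tendsto_mult[OF tendsto_const] tendsto_real_sqrt klim[OF r])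
      then show ?thesis using in_zone[OF x] r by (simp add: q_def max_def)
    qed
    show "(\<lambda>n. p' n (\<rho> x)) \<longlonglongrightarrow> q' (\<rho> x)" if x: "x \<in> Z" "0 < bar e a (\<rho> x)" for x
    proof -
      have r: "0 < e * (\<rho> x - a)" using in_zone[OF x] by blast
      let ?r = "e * (\<rho> x - a)"
      have "(\<lambda>n. \<gamma> * (3/2 * e) * \<eta>' n (\<rho> x)) \<longlonglongrightarrow> \<gamma> * (3/2 * e) * (inverse (sqrt ?r) / 2 * (inverse ?r / 2 * (2 * (\<rho> x - a))))"
        unfolding \<eta>'_def using r by (intro tendsto_intros klim) auto
      also have "\<gamma> * (3/2 * e) * (inverse (sqrt ?r) / 2 * (inverse ?r / 2 * (2 * (\<rho> x - a))))
          = \<gamma> * (3/4) * (inverse (sqrt ?r) * (inverse ?r * ?r))" by simp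
      also have "\<dots> = q' (\<rho> x)"
      proof -
        have i: "inverse ?r * ?r = 1" by (rule left_inverse) (use r in linarith)
        have m: "max 0 ?r = ?r" using r by (intro max.absorb2) linarith
        show ?thesis unfolding q'_def m i by (simp only: divide_inverse mult_1_right)
      qed
      finally show ?thesis using in_zone[OF x] by simp
    qed
    show "\<bar>p n (\<rho> x)\<bar> \<le> C" if x: "x \<in> Z" "0 < bar e a (\<rho> x)" for n x
    proof -
      have r: "0 < e * (\<rho> x - a)" "e * (\<rho> x - a) \<le> ell" using in_zone[OF x] by blast+
      have "(\<rho> x - a)\<^sup>2 \<le> ell\<^sup>2" unfolding abs_r using r by (intro power_mono) auto
      moreover have "(\<delta> n)\<^sup>2 \<le> 1" using \<delta>[of n] by (simp add: power_le_one)
      ultimately have "\<eta> n (\<rho> x) \<le> sqrt (sqrt (ell\<^sup>2 + 1))"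
        unfolding \<eta>_def k_def by (intro real_sqrt_le_mono) simp
      moreover have "0 \<le> \<eta> n (\<rho> x)" using kpos(2)[of n "\<rho> x"] by (simp add: \<eta>_def)
      moreover have "\<bar>p n (\<rho> x)\<bar> = \<gamma> * (3/2) * \<bar>\<eta> n (\<rho> x)\<bar>"
        using in_zone[OF x, of n] ae b by (simp add: abs_mult)
      ultimately have "\<bar>p n (\<rho> x)\<bar> \<le> \<gamma> * (3/2) * sqrt (sqrt (ell\<^sup>2 + 1))"
        using b by (simp only: abs_of_nonneg) (intro mult_left_mono, simp_all)
      then show ?thesis using C1 unfolding C_def by linarith
    qed
    show "\<bar>p' n (\<rho> x)\<bar> * bar e a (\<rho> x) \<le> C" if x: "x \<in> Z" "0 < bar e a (\<rho> x)" for n x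
    proof -
      let ?r = "e * (\<rho> x - a)"
      have r: "0 < ?r" "?r \<le> ell" using in_zone[OF x] by blast+
      have kr: "?r \<le> k n (\<rho> x)" by (rule k_ge)
      \<comment> \<open>The factor r^(3/2) of the barrier absorbs the r^(-1/2) of its second
        derivative and leaves r, which is at most \<open>ell\<close>.\<close>
      have B: "bar e a (\<rho> x) = \<gamma> * (?r * sqrt ?r)" by (rule bar_bounds(4)[OF e r])
      have "\<bar>\<rho> x - a\<bar> = ?r" using e r by auto
      then have "\<bar>p' n (\<rho> x)\<bar> = \<gamma> * (3/4) * (inverse (sqrt (k n (\<rho> x))) * (inverse (k n (\<rho> x)) * ?r))"
        using in_zone[OF x, of n] ae b kpos(2)[of n "\<rho> x"] by (simp add: abs_mult \<eta>'_def)
      also have "\<dots> \<le> \<gamma> * (3/4) * (inverse (sqrt ?r) * (inverse ?r * ?r))"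
        using kr r b by (intro mult_left_mono mult_mono le_imp_inverse_le mult_right_mono) auto
      also have "\<dots> = \<gamma> * (3/4) * inverse (sqrt ?r)"
        unfolding left_inverse[OF less_imp_neq[OF r(1), THEN not_sym]] by (simp only: mult_1_right)
      finally have "\<bar>p' n (\<rho> x)\<bar> * bar e a (\<rho> x) \<le> \<gamma> * (3/4) * inverse (sqrt ?r) * (\<gamma> * (?r * sqrt ?r))"
        unfolding B using r b by (intro mult_right_mono) auto
      also have "\<dots> = 3/4 * (\<gamma> * (\<gamma> * (inverse (sqrt ?r) * (?r * sqrt ?r))))" by (simp only: mult_ac)
      also have "inverse (sqrt ?r) * (?r * sqrt ?r) = ?r" by (rule inverse_sqrt_cancel[OF r(1)])
      also have "3/4 * (\<gamma> * (\<gamma> * ?r)) \<le> \<gamma> * (\<gamma> * ell)"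
      proof -
        have g0: "0 \<le> \<gamma>" using b by simp
        have "\<gamma> * (\<gamma> * ?r) \<le> \<gamma> * (\<gamma> * ell)" by (intro mult_left_mono r(2) g0)
        moreover have "0 \<le> \<gamma> * (\<gamma> * ?r)" by (intro mult_nonneg_nonneg g0 less_imp_le[OF r(1)])
        ultimately show ?thesis by linarith
      qed
      finally show ?thesis using C1 unfolding C_def by linarith
    qed
    show "q \<in> borel_measurable borel" "q' \<in> borel_measurable borel"
      unfolding q_def q'_def by measurable
  qed
  show "integrable lborel (\<lambda>x. (4 * \<rho> x * q' (\<rho> x) + 2 * real DIM('a) * q (\<rho> x)) * \<psi> x)"
    using main unfolding \<rho>_def by blast
  have "(\<integral>x. ((2 * bar' e a (\<rho> x)) *\<^sub>R (x - x\<^sub>0)) \<bullet> h x \<partial>lborel) = (\<integral>x. ((2 * q (\<rho> x)) *\<^sub>R (x - x\<^sub>0)) \<bullet> h x \<partial>lborel)"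
  proof (rule integral_cong_AE)
    have [measurable]: "h \<in> borel_measurable borel" using s by (simp add: sobolev_def sq_integrable_def)
    have [measurable]: "bar' e a \<in> borel_measurable borel" by (rule borel_measurable_continuous_onI[OF continuous_bar'])
    have [measurable]: "q \<in> borel_measurable borel" unfolding q_def by measurable
    show "(\<lambda>x. ((2 * bar' e a (\<rho> x)) *\<^sub>R (x - x\<^sub>0)) \<bullet> h x) \<in> borel_measurable lborel"
      "(\<lambda>x. ((2 * q (\<rho> x)) *\<^sub>R (x - x\<^sub>0)) \<bullet> h x) \<in> borel_measurable lborel" by measurable
    show "AE x in lborel. ((2 * bar' e a (\<rho> x)) *\<^sub>R (x - x\<^sub>0)) \<bullet> h x = ((2 * q (\<rho> x)) *\<^sub>R (x - x\<^sub>0)) \<bullet> h x"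
      using Z
    proof eventually_elim
      case (elim x)
      show ?case
      proof (cases "\<psi> x = 0")
        case False
        then have xz: "x \<in> Z" "0 < bar e a (\<rho> x)" using elim \<psi>[of x] by auto
        have r: "0 < e * (\<rho> x - a)" "e * (\<rho> x - a) \<le> ell" using in_zone[OF xz] by blast+
        then have "\<bar>\<rho> x - a\<bar> \<le> ell" using e by auto
        from plateau_inside[OF this] have "bar' e a (\<rho> x) = q (\<rho> x)" by (simp add: bar'_def q_def)
        then show ?thesis by simp
      qed (simp add: h0)
    qed
  qed
  then show "(\<integral>x. ((2 * bar' e a (\<rho> x)) *\<^sub>R (x - x\<^sub>0)) \<bullet> h x \<partial>lborel)
      = - (\<integral>x. (4 * \<rho> x * q' (\<rho> x) + 2 * real DIM('a) * q (\<rho> x)) * \<psi> x \<partial>lborel)"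
    using main unfolding \<rho>_def by simp
qed

definition tau :: "int \<Rightarrow> real" where "tau i = of_int i * (pi / 2) - real m * (pi / 2) - pi / 4"

lemma cs_tau: "cs (tau i) = 0"
proof -
  have "tau i = of_int (i - int m - 1) * (pi / 2) + pi / 4" by (simp add: tau_def algebra_simps)
  then show ?thesis using cs_eq_0_iff by blast
qed

lemma lo_tau: "lo x = tau (layer x)" by (simp add: lo_of_layer tau_def)
lemma tau_add: "tau (i + 1) = tau i + pi / 2" by (simp add: tau_def algebra_simps)
lemma hi_tau: "hi x = tau (layer x + 1)" by (simp add: hi_def lo_tau tau_add)
lemma tau_mono: "i \<le> k \<Longrightarrow> tau i \<le> tau k"
  unfolding tau_def using pi_gt_zero by (simp add: mult_right_mono)

lemma layer_ge': "j \<le> m \<Longrightarrow> 1 + real j * ell \<le> \<rho> x \<Longrightarrow> int j \<le> layer x"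
proof -
  assume j: "j \<le> m" and "1 + real j * ell \<le> \<rho> x"
  then have "real_of_int (int j) \<le> (\<rho> x - 1) / ell" using ell(1) by (simp add: pos_le_divide_eq)
  then have "int j \<le> \<lfloor>(\<rho> x - 1) / ell\<rfloor>" by (simp only: le_floor_iff)
  then show "int j \<le> layer x" using j by (auto simp: layer_def)
qed

text \<open>Evenness of F, which stems from oddness of f, makes the potential depend on |sn| only.
  Turning values with sn = 1 and with sn = -1 are therefore alike, and one barrier serves
  both.\<close>

lemma P_abs: "P x v = Q x \<bar>sn v\<bar>" by (simp add: P_def Q_abs)

text \<open>For \<open>e = 1\<close> the barrier rises outwards from the inner sphere of the shell,
  for \<open>e = -1\<close> inwards from the outer one. It works for every sign of the force,
  because its Laplacian, of order r^(-1/2), exceeds the largest possible slope of the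
  potential.\<close>

lemma shell_no_touch:
  assumes min: "minimiser w g" and j: "j < m"
    and e: "e = 1 \<and> a = 1 + real j * ell \<and> \<tau> = tau (int j)
      \<or> e = -1 \<and> a = 1 + (real j + 1) * ell \<and> \<tau> = tau (int j + 1)"
  shows "AE x in lborel. layer x = int j \<longrightarrow> 0 < e * (\<rho> x - a) \<longrightarrow> w x \<noteq> \<tau>"
proof -
  have e1: "e = 1 \<or> e = -1" using e by blast
  have \<tau>: "cs \<tau> = 0" using e cs_tau by blast
  define Z where "Z = {x. layer x = int j}"
  define q where "q t = \<gamma> * (3/2 * e) * sqrt (max 0 (e * (t - a)))" for t
  define q' where "q' t = \<gamma> * (3/4) / sqrt (max 0 (e * (t - a)))" for t
  define D where "D x = 4 * \<rho> x * q' (\<rho> x) + 2 * real DIM('a) * q (\<rho> x)" for x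
  have zone: "e * (\<rho> x - a) \<le> ell" if "x \<in> Z" for x
  proof -
    have "1 + real j * ell \<le> \<rho> x" "\<rho> x < 1 + (real j + 1) * ell"
      using layer_shell(1,2)[OF _ j, of x] that by (simp_all add: Z_def)
    then show ?thesis using e by (auto simp: algebra_simps)
  qed
  have "AE x in lborel. x \<in> Z \<longrightarrow> 0 < bar e a (\<rho> x) \<longrightarrow> bar e a (\<rho> x) \<le> e * (w x - \<tau>)"
  proof (rule comparison[OF min _ _ e1, where D = D and Y = "\<lambda>x. (2 * bar' e a (\<rho> x)) *\<^sub>R (x - x\<^sub>0)"])
    show "C1c (\<lambda>x. bar e a (\<rho> x)) (\<lambda>x. (2 * bar' e a (\<rho> x)) *\<^sub>R (x - x\<^sub>0))"
      unfolding \<rho>_def by (rule C1c_radial[OF DERIV_bar continuous_bar' bar_outside])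
    show "0 \<le> bar e a (\<rho> x)" for x by (rule bar_bounds(1)[OF e1])
    fix x v assume y0: "0 < bar e a (\<rho> x)" and v: "lo x \<le> v" "v \<le> hi x"
    have r: "0 < e * (\<rho> x - a)" "e * (\<rho> x - a) < 2 * ell" using bar_bounds(3)[OF e1 y0] by auto
    have y4: "bar e a (\<rho> x) \<le> pi / 2" using bar_bounds(2)[OF e1, of a "\<rho> x"] pi_gt_zero by linarith
    \<comment> \<open>Beyond the shell the next interval already lies at distance at least \<pi>/2
      from \<tau>, more than the height of the barrier. Only points of the shell itself have to be
      compared.\<close>
    show "bar e a (\<rho> x) \<le> e * (v - \<tau>) \<or> x \<in> Z \<and> 0 \<le> e * (v - \<tau>)"
      using e
    proof
      assume e: "e = 1 \<and> a = 1 + real j * ell \<and> \<tau> = tau (int j)"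
      have l: "int j \<le> layer x" using layer_ge'[of j x] j r(1) e by simp
      show ?thesis
      proof (cases "layer x = int j")
        case True
        then show ?thesis using v(1) e by (simp add: Z_def lo_tau)
      next
        case False
        then have "tau (int j + 1) \<le> lo x" unfolding lo_tau using l by (intro tau_mono) simp
        then have "pi / 2 \<le> e * (v - \<tau>)" using v(1) e by (simp add: tau_add)
        then show ?thesis using y4 by linarith
      qed
    next
      assume e: "e = -1 \<and> a = 1 + (real j + 1) * ell \<and> \<tau> = tau (int j + 1)"
      have "\<rho> x < 1 + real (j + 1) * ell" using r(1) e by (simp add: algebra_simps)
      from layer_le[OF this] have l: "layer x \<le> int j" by simp
      show ?thesis
      proof (cases "layer x = int j")
        case True
        then show ?thesis using v(2) e by (simp add: Z_def hi_tau)
      next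
        case False
        then have "hi x \<le> tau (int j)" unfolding hi_tau using l by (intro tau_mono) simp
        then have "pi / 2 \<le> e * (v - \<tau>)" using v(2) e by (simp add: tau_add)
        then show ?thesis using y4 by linarith
      qed
    qed
  next
    fix x assume x: "x \<in> Z" and y0: "0 < bar e a (\<rho> x)"
    have "bar e a (\<rho> x) \<le> pi / 2" using bar_bounds(2)[OF e1, of a "\<rho> x"] pi_gt_zero by linarith
    then show "lo x \<le> \<tau> + e * bar e a (\<rho> x) \<and> \<tau> + e * bar e a (\<rho> x) \<le> hi x"
      using e x y0 by (auto simp: Z_def lo_tau hi_tau tau_add)
  next
    fix \<psi> h assume s: "sobolev \<psi> h" "\<And>x. 0 \<le> \<psi> x \<and> \<psi> x \<le> bar e a (\<rho> x)" "\<And>x. \<psi> x = 0 \<Longrightarrow> h x = 0"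
      "AE x in lborel. \<psi> x \<noteq> 0 \<longrightarrow> x \<in> Z"
    note i = shell_ibp[OF e1 s zone]
    show "integrable lborel (\<lambda>x. D x * \<psi> x) \<and>
        (\<integral>x. ((2 * bar' e a (\<rho> x)) *\<^sub>R (x - x\<^sub>0)) \<bullet> h x \<partial>lborel) \<le> - (\<integral>x. D x * \<psi> x \<partial>lborel)"
      unfolding D_def q_def q'_def using i by simp
  next
    fix x z assume x: "x \<in> Z" and z: "0 \<le> z" "z < bar e a (\<rho> x)"
    let ?y = "bar e a (\<rho> x)" and ?r = "e * (\<rho> x - a)"
    have y0: "0 < ?y" using z by linarith
    have r: "0 < ?r" "?r \<le> ell" using bar_bounds(3)[OF e1 y0] zone[OF x] by auto
    have y: "?y = \<gamma> * (?r * sqrt ?r)" by (rule bar_bounds(4)[OF e1 r])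
    have y4: "?y \<le> pi / 4" by (rule bar_bounds(2)[OF e1])
    have q0: "0 < b * sqrt ?r" using b r by simp
    have "(sqrt ?r)^3 = ?r * sqrt ?r" using r(1) by (simp add: power3_eq_cube)
    then have "8/3 * (b * sqrt ?r)^3 \<le> ?y" unfolding y power_mult_distrib by simp
    note est = turning_estimates[OF \<tau> e1 z y4]
    have d: "\<bar>sn (\<tau> + e * z)\<bar> - \<bar>sn (\<tau> + e * ?y)\<bar> \<le> 3/2 * (?y - z) / (b * sqrt ?r)"
      by (rule est(2)[OF q0 \<open>8/3 * (b * sqrt ?r)^3 \<le> ?y\<close>])
    have \<rho>T: "\<rho> x < T" "1 \<le> \<rho> x" using layer_shell(3,4)[OF _ j, of x] x by (simp_all add: Z_def)
    have "P x (\<tau> + e * ?y) - P x (\<tau> + e * z) \<le> 2 * b * \<bar>\<bar>sn (\<tau> + e * ?y)\<bar> - \<bar>sn (\<tau> + e * z)\<bar>\<bar>"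
      using Q_Lipschitz[of x b "\<bar>sn (\<tau> + e * ?y)\<bar>" "\<bar>sn (\<tau> + e * z)\<bar>"] V_le[of x] \<rho>T f_le sn_le
      unfolding P_abs \<rho>_def[symmetric] by (simp add: abs_le_iff)
    also have "\<bar>\<bar>sn (\<tau> + e * ?y)\<bar> - \<bar>sn (\<tau> + e * z)\<bar>\<bar> = \<bar>sn (\<tau> + e * z)\<bar> - \<bar>sn (\<tau> + e * ?y)\<bar>"
      using est(1) z(2) by linarith
    also have "2 * b * (\<bar>sn (\<tau> + e * z)\<bar> - \<bar>sn (\<tau> + e * ?y)\<bar>) \<le> 2 * b * (3/2 * (?y - z) / (b * sqrt ?r))"
      using d b by (intro mult_left_mono) auto
    also have "\<dots> = (3 / sqrt ?r) * (?y - z)" using b by simp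
    finally have 1: "P x (\<tau> + e * ?y) - P x (\<tau> + e * z) \<le> (3 / sqrt ?r) * (?y - z)" .
    have m: "max 0 ?r = ?r" using r(1) by (intro max.absorb2) linarith
    have sr: "0 < sqrt ?r" using r(1) by simp
    have srr: "sqrt ?r = ?r / sqrt ?r" using r(1) by (simp add: real_div_sqrt)
    have "real DIM('a) * ?r \<le> real DIM('a) * ell" by (rule mult_left_mono[OF r(2)]) simp
    then have "real DIM('a) * ?r \<le> 1/2" using ell(3) by linarith
    \<comment> \<open>Since \<rho> \<ge> 1 and the shell is thin, the first order term, which is
      harmful for \<open>e = -1\<close>, uses up at most half. With \<gamma> \<ge> 8/3 the Laplacian
      is at least 4 / sqrt r, against a slope of at most 3 / sqrt r.\<close>
    then have "1/2 \<le> \<rho> x - real DIM('a) * ?r" using \<rho>T by linarith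
    then have "3 * \<gamma> * (1/2) \<le> 3 * \<gamma> * (\<rho> x - real DIM('a) * ?r)" using b by (intro mult_left_mono) auto
    moreover have "8 / 3 * 1 \<le> \<gamma>" using one_le_power[OF b, of 3] by linarith
    ultimately have "3 < 3 * \<gamma> * (\<rho> x - real DIM('a) * ?r)" by linarith
    then have "3 / sqrt ?r < 3 * \<gamma> * (\<rho> x - real DIM('a) * ?r) / sqrt ?r" using sr by (rule divide_strict_right_mono)
    also have "\<dots> = 3 * \<gamma> * \<rho> x / sqrt ?r - 3 * \<gamma> * real DIM('a) * (?r / sqrt ?r)"
      by (simp add: right_diff_distrib diff_divide_distrib)
    also have "\<dots> = 3 * \<gamma> * \<rho> x / sqrt ?r - 3 * \<gamma> * real DIM('a) * sqrt ?r" by (simp only: srr[symmetric])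
    also have "\<dots> \<le> D x"
    proof -
      have "- (3 * \<gamma> * real DIM('a) * sqrt ?r) \<le> e * (3 * \<gamma> * real DIM('a) * sqrt ?r)"
      proof -
        have "0 \<le> 3 * \<gamma> * real DIM('a) * sqrt ?r" using b sr by (intro mult_nonneg_nonneg) auto
        then show ?thesis using e1 by auto
      qed
      moreover have "D x = 3 * \<gamma> * \<rho> x / sqrt ?r + e * (3 * \<gamma> * real DIM('a) * sqrt ?r)"
        unfolding D_def q_def q'_def m by simp
      ultimately show ?thesis by linarith
    qed
    finally have "3 / sqrt ?r < D x" .
    then have "(3 / sqrt ?r) * (?y - z) < D x * (?y - z)" using z by (intro mult_strict_right_mono) auto
    then show "P x (\<tau> + e * ?y) - P x (\<tau> + e * z) < D x * (?y - z)" using 1 by linarith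
  qed
  then show ?thesis
  proof eventually_elim
    case (elim x)
    show ?case
    proof (intro impI)
      assume l: "layer x = int j" and r: "0 < e * (\<rho> x - a)"
      have x: "x \<in> Z" using l by (simp add: Z_def)
      have "bar e a (\<rho> x) = \<gamma> * (e * (\<rho> x - a) * sqrt (e * (\<rho> x - a)))"
        by (rule bar_bounds(4)[OF e1 r zone[OF x]])
      moreover have "0 < \<gamma> * (e * (\<rho> x - a) * sqrt (e * (\<rho> x - a)))"
        by (intro mult_pos_pos \<gamma>_pos r) (use r in simp)
      ultimately have "0 < e * (w x - \<tau>)" using elim x by linarith
      then show "w x \<noteq> \<tau>" by auto
    qed
  qed
qed

text \<open>Near s = 1 the function \<open>Q x\<close> has slope at least 1/2 when V \<ge> f(1) + 1,
  and |sn| falls at least at unit rate away from a turning value. So the potential drops at rate at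
  least 1/2, and any bump low enough for this and with Laplacian above -1/2 is a barrier.\<close>

lemma good_no_touch:
  fixes e :: real
  assumes min: "minimiser w g" and t: "t1 < t2" "0 < t2"
    and region: "\<And>x. t1 < \<rho> x \<Longrightarrow> \<rho> x < t2 \<Longrightarrow> layer x = k \<and> f 1 + 1 \<le> V x"
    and e: "e = 1 \<and> \<tau> = tau k \<or> e = -1 \<and> \<tau> = tau (k + 1)"
  shows "AE x in lborel. t1 < \<rho> x \<longrightarrow> \<rho> x < t2 \<longrightarrow> w x \<noteq> \<tau>"
proof -
  have e1: "e = 1 \<or> e = -1" using e by blast
  have \<tau>: "cs \<tau> = 0" using e cs_tau by blast
  have "isCont (\<lambda>s. (f 1 + 1) * s - f s) 1"
    using f_continuous by (intro continuous_intros) (simp add: continuous_on_eq_continuous_at)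
  then obtain d where d: "0 < d" "\<And>s. \<bar>s - 1\<bar> < d \<Longrightarrow> \<bar>((f 1 + 1) * s - f s) - ((f 1 + 1) * 1 - f 1)\<bar> < 1/2"
    unfolding continuous_at_eps_delta dist_real_def by (metis half_gt_zero zero_less_one)
  define s0 where "s0 = max 0 (1 - d / 2)"
  have s0: "0 \<le> s0" "s0 < 1" using d(1) by (auto simp: s0_def)
  have half: "1/2 \<le> V x * s - f s" if "s0 \<le> s" "s \<le> 1" "f 1 + 1 \<le> V x" for s x
  proof -
    have "\<bar>s - 1\<bar> < d" using that d(1) unfolding s0_def by (simp add: abs_if)
    from d(2)[OF this] have "1/2 \<le> (f 1 + 1) * s - f s" by (simp add: abs_if split: if_splits)
    moreover have "(f 1 + 1) * s \<le> V x * s" using that s0 by (intro mult_right_mono) auto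
    ultimately show ?thesis by linarith
  qed
  obtain y0 where y0: "0 < y0" "y0 \<le> pi / 4"
    and near: "\<And>\<tau> e y. cs \<tau> = 0 \<Longrightarrow> e = 1 \<or> e = -1 \<Longrightarrow> 0 \<le> y \<Longrightarrow> y \<le> y0 \<Longrightarrow> s0 \<le> \<bar>sn (\<tau> + e * y)\<bar>"
    by (rule turning_near[OF s0(2)]) (rule that, assumption+)
  define L where "L = t2 - t1"
  have L: "0 < L" using t by (simp add: L_def)
  \<comment> \<open>\<epsilon> K bounds the negative part of the Laplacian 4 \<rho> Y'' + 2 N Y' of
    the bump: 4 t2 times 6 L^4 from the second derivative, and 2 N times 3 L^5 from the first, N
    being the dimension.\<close>
  define K where "K = 24 * t2 * L^4 + 6 * real DIM('a) * L^5"
  have K: "0 \<le> K" using t(2) L by (simp add: K_def)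
  define \<epsilon> where "\<epsilon> = min (y0 / (L^6 + 1)) (1 / (4 * (K + 1)))"
  have \<epsilon>: "0 < \<epsilon>" "\<epsilon> * L^6 \<le> y0" "\<epsilon> * K < 1/2"
  proof -
    show e0: "0 < \<epsilon>" unfolding \<epsilon>_def using y0 L K by (simp add: add_nonneg_pos)
    have "\<epsilon> * (L^6 + 1) \<le> y0 / (L^6 + 1) * (L^6 + 1)" using L by (intro mult_right_mono) (auto simp: \<epsilon>_def)
    also have "\<dots> = y0" using L by (simp add: add_nonneg_eq_0_iff)
    finally show "\<epsilon> * L^6 \<le> y0" using e0 by (simp add: distrib_left)
    have "\<epsilon> * (K + 1) \<le> 1 / (4 * (K + 1)) * (K + 1)" using K by (intro mult_right_mono) (auto simp: \<epsilon>_def)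
    also have "\<dots> = 1/4" using K by simp
    finally show "\<epsilon> * K < 1/2" using e0 by (simp add: distrib_left)
  qed
  define u where "u s = (s - t1) * (t2 - s)" for s
  define Y where "Y s = \<epsilon> * (max 0 (u s))^3" for s
  define Y' where "Y' s = \<epsilon> * (3 * (max 0 (u s))\<^sup>2 * (t1 + t2 - 2 * s))" for s
  define Y'' where "Y'' s = \<epsilon> * (3 * ((2 * max 0 (u s) * (t1 + t2 - 2 * s)) * (t1 + t2 - 2 * s) + (-2) * (max 0 (u s))\<^sup>2))" for s
  have Du: "(u has_real_derivative t1 + t2 - 2 * s) (at s)" for s
    unfolding u_def[abs_def] by (auto intro!: derivative_eq_intros)
  have DY: "(Y has_real_derivative Y' s) (at s)" for s
  proof -
    have "((\<lambda>t. (max 0 t)^3) has_real_derivative 3 * (max 0 r)\<^sup>2) (at r)" for r :: real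
      using DERIV_max0_power[of 1 r] by (simp add: eval_nat_numeral)
    from DERIV_cmult[OF DERIV_chain2[OF this Du], of \<epsilon>] show ?thesis
      unfolding Y_def[abs_def] Y'_def .
  qed
  have DY': "(Y' has_real_derivative Y'' s) (at s)" for s
  proof -
    have l: "((\<lambda>s. t1 + t2 - 2 * s) has_real_derivative -2) (at s)" by (auto intro!: derivative_eq_intros)
    from DERIV_cmult[OF DERIV_cmult[OF DERIV_mult[OF DERIV_chain2[OF DERIV_max0_square Du[of s]] l], of 3], of \<epsilon>]
    show ?thesis unfolding Y'_def[abs_def] Y''_def by (simp only: mult.assoc)
  qed
  have cu: "continuous_on UNIV u" unfolding u_def[abs_def] by (intro continuous_intros)
  have cY': "continuous_on UNIV Y'" and cY'': "continuous_on UNIV Y''"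
    unfolding Y'_def[abs_def] Y''_def[abs_def] by (intro continuous_intros cu)+
  have out: "max 0 (u s) = 0" if "t2 \<le> s" for s
  proof -
    have "u s \<le> 0" unfolding u_def using that t by (intro mult_nonneg_nonpos) auto
    then show ?thesis by simp
  qed
  have inside: "t1 < s \<and> s < t2" if "0 < Y s" for s
  proof (rule ccontr)
    assume n: "\<not> (t1 < s \<and> s < t2)"
    have "u s \<le> 0"
    proof (cases "t1 < s")
      case True then show ?thesis unfolding u_def using n by (intro mult_nonneg_nonpos) auto
    next
      case False then show ?thesis unfolding u_def using t by (intro mult_nonpos_nonneg) auto
    qed
    then have "Y s = 0" by (simp add: Y_def)
    then show False using that by simp
  qed
  have ub: "0 < u s" "u s \<le> L\<^sup>2" "\<bar>t1 + t2 - 2 * s\<bar> \<le> L" if "t1 < s" "s < t2" for s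
  proof -
    show "0 < u s" unfolding u_def using that by simp
    have "(s - t1) * (t2 - s) \<le> L * L" unfolding L_def using that by (intro mult_mono) auto
    then show "u s \<le> L\<^sup>2" by (simp add: u_def power2_eq_square)
    show "\<bar>t1 + t2 - 2 * s\<bar> \<le> L" unfolding L_def using that by (simp add: abs_if)
  qed
  have u2: "(u s)\<^sup>2 \<le> L^4" "(u s)^3 \<le> L^6" if "t1 < s" "s < t2" for s
    using power_mono[OF ub(2)[OF that] less_imp_le[OF ub(1)[OF that]], of 2]
      power_mono[OF ub(2)[OF that] less_imp_le[OF ub(1)[OF that]], of 3] by (simp_all add: power_mult[symmetric])
  have Y0: "0 \<le> Y s" for s using \<epsilon>(1) by (simp add: Y_def)
  have Yy0: "Y s \<le> y0" for s
  proof (cases "0 < Y s")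
    case True
    note i = inside[OF True]
    have "Y s = \<epsilon> * (u s)^3" using ub(1)[of s] i by (simp add: Y_def)
    also have "\<dots> \<le> \<epsilon> * L^6" using u2(2)[of s] i \<epsilon>(1) by (intro mult_left_mono) auto
    finally show ?thesis using \<epsilon>(2) by linarith
  next
    case False then show ?thesis using y0 by linarith
  qed
  have Y1: "Y s \<le> 1" for s using Yy0[of s] y0(2) pi_less_4 by linarith
  have Y'b: "\<bar>Y' s\<bar> \<le> \<epsilon> * (3 * L^4 * L)" if "t1 < s" "s < t2" for s
  proof -
    have "\<bar>Y' s\<bar> = \<epsilon> * (3 * (u s)\<^sup>2 * \<bar>t1 + t2 - 2 * s\<bar>)"
      using ub(1)[OF that] \<epsilon>(1) by (simp add: Y'_def abs_mult)
    also have "\<dots> \<le> \<epsilon> * (3 * L^4 * L)"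
      using u2(1)[OF that] ub(3)[OF that] \<epsilon>(1) L by (intro mult_left_mono mult_mono) auto
    finally show ?thesis .
  qed
  \<comment> \<open>The term containing the square of t1 + t2 - 2 s is nonnegative; only the
    curvature -2 of \<open>u\<close> contributes to the lower bound.\<close>
  have Y''lower: "- (\<epsilon> * (6 * L^4)) \<le> Y'' s" if "t1 < s" "s < t2" for s
  proof -
    have "0 \<le> (2 * u s * (t1 + t2 - 2 * s)) * (t1 + t2 - 2 * s)"
      using ub(1)[OF that] by (simp add: mult.assoc)
    then have "\<epsilon> * (3 * (-2 * L^4)) \<le> \<epsilon> * (3 * ((2 * u s * (t1 + t2 - 2 * s)) * (t1 + t2 - 2 * s) + (-2) * (u s)\<^sup>2))"
      using u2(1)[OF that] \<epsilon>(1) by (intro mult_left_mono) auto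
    then show ?thesis using ub(1)[OF that] by (simp add: Y''_def)
  qed
  have "bounded (Y'' ` {t1..t2})"
    by (intro compact_imp_bounded compact_continuous_image continuous_on_subset[OF cY'']) auto
  then obtain B where B: "\<forall>r\<in>Y'' ` {t1..t2}. norm r \<le> B" unfolding bounded_iff by blast
  define C where "C = max B (\<epsilon> * (3 * L^4 * L))"
  define Z where "Z = {x. t1 < \<rho> x \<and> \<rho> x < t2}"
  define D where "D x = 4 * \<rho> x * Y'' (\<rho> x) + 2 * real DIM('a) * Y' (\<rho> x)" for x
  have "AE x in lborel. x \<in> Z \<longrightarrow> 0 < Y (\<rho> x) \<longrightarrow> Y (\<rho> x) \<le> e * (w x - \<tau>)"
  proof (rule comparison[OF min _ _ e1, where D = D and Y = "\<lambda>x. (2 * Y' (\<rho> x)) *\<^sub>R (x - x\<^sub>0)"])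
    show "C1c (\<lambda>x. Y (\<rho> x)) (\<lambda>x. (2 * Y' (\<rho> x)) *\<^sub>R (x - x\<^sub>0))"
      unfolding \<rho>_def by (rule C1c_radial[OF DY cY', of t2]) (simp_all add: Y_def Y'_def out)
    show "0 \<le> Y (\<rho> x)" for x by (rule Y0)
    fix x v assume p: "0 < Y (\<rho> x)" and v: "lo x \<le> v" "v \<le> hi x"
    have x: "x \<in> Z" using inside[OF p] by (simp add: Z_def)
    then have l: "layer x = k" using region[of x] by (simp add: Z_def)
    have "0 \<le> e * (v - \<tau>)" using e v l by (auto simp: lo_tau hi_tau)
    then show "Y (\<rho> x) \<le> e * (v - \<tau>) \<or> x \<in> Z \<and> 0 \<le> e * (v - \<tau>)" using x by blast
  next
    fix x assume x: "x \<in> Z" and p: "0 < Y (\<rho> x)"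
    then have l: "layer x = k" using region[of x] by (simp add: Z_def)
    have "Y (\<rho> x) \<le> pi / 2" using Yy0[of "\<rho> x"] y0(2) pi_gt_zero by linarith
    then show "lo x \<le> \<tau> + e * Y (\<rho> x) \<and> \<tau> + e * Y (\<rho> x) \<le> hi x"
      using e l p by (auto simp: lo_tau hi_tau tau_add)
  next
    fix \<psi> h assume s: "sobolev \<psi> h" "\<And>x. 0 \<le> \<psi> x \<and> \<psi> x \<le> Y (\<rho> x)" "\<And>x. \<psi> x = 0 \<Longrightarrow> h x = 0"
      "AE x in lborel. \<psi> x \<noteq> 0 \<longrightarrow> x \<in> Z"
    have "integrable lborel (\<lambda>x. (4 * (norm (x - x\<^sub>0))\<^sup>2 * Y'' ((norm (x - x\<^sub>0))\<^sup>2) + 2 * real DIM('a) * Y' ((norm (x - x\<^sub>0))\<^sup>2)) * \<psi> x)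
      \<and> (\<integral>x. ((2 * Y' ((norm (x - x\<^sub>0))\<^sup>2)) *\<^sub>R (x - x\<^sub>0)) \<bullet> h x \<partial>lborel)
      = - (\<integral>x. (4 * (norm (x - x\<^sub>0))\<^sup>2 * Y'' ((norm (x - x\<^sub>0))\<^sup>2) + 2 * real DIM('a) * Y' ((norm (x - x\<^sub>0))\<^sup>2)) * \<psi> x \<partial>lborel)"
    proof (rule radial_ibp_limit[where a = x\<^sub>0 and Y = Y and S = t2 and p = "\<lambda>_. Y'" and p' = "\<lambda>_. Y''" and Z = Z and C = C,
        OF s(1) _ s(3,4)], fold \<rho>_def)
      show "0 \<le> \<psi> x \<and> \<psi> x \<le> Y (\<rho> x)" for x by (rule s(2))
      show "Y s = 0" "Y' s = 0" "Y'' s = 0" if "t2 \<le> s" for s using out[OF that] by (simp_all add: Y_def Y'_def Y''_def)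
      show "\<bar>Y' (\<rho> x)\<bar> \<le> C" if "x \<in> Z" for x
        using Y'b[of "\<rho> x"] that by (simp add: Z_def C_def le_max_iff_disj)
      show "\<bar>Y'' (\<rho> x)\<bar> * Y (\<rho> x) \<le> C" if "x \<in> Z" for x
      proof -
        have "\<rho> x \<in> {t1..t2}" using that by (simp add: Z_def)
        then have 1: "\<bar>Y'' (\<rho> x)\<bar> \<le> B" using B by auto
        have "\<bar>Y'' (\<rho> x)\<bar> * Y (\<rho> x) \<le> \<bar>Y'' (\<rho> x)\<bar> * 1" using Y1 by (intro mult_left_mono) auto
        then show ?thesis using 1 by (simp add: C_def le_max_iff_disj)
      qed
      show "Y' \<in> borel_measurable borel" "Y'' \<in> borel_measurable borel"
        using cY' cY'' by (auto intro: borel_measurable_continuous_onI)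
    qed (use Y1 DY' cY'' in auto)
    then show "integrable lborel (\<lambda>x. D x * \<psi> x) \<and>
        (\<integral>x. ((2 * Y' (\<rho> x)) *\<^sub>R (x - x\<^sub>0)) \<bullet> h x \<partial>lborel) \<le> - (\<integral>x. D x * \<psi> x \<partial>lborel)"
      unfolding D_def \<rho>_def by simp
  next
    fix x z assume x: "x \<in> Z" and z: "0 \<le> z" "z < Y (\<rho> x)"
    let ?y = "Y (\<rho> x)"
    have i: "t1 < \<rho> x" "\<rho> x < t2" using x by (auto simp: Z_def)
    have Vx: "f 1 + 1 \<le> V x" using region[OF i] by blast
    have y4: "?y \<le> pi / 4" using Yy0[of "\<rho> x"] y0(2) by linarith
    let ?sy = "\<bar>sn (\<tau> + e * ?y)\<bar>" and ?sz = "\<bar>sn (\<tau> + e * z)\<bar>"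
    have est: "?y - z \<le> ?sz - ?sy" by (rule turning_estimates(1)[OF \<tau> e1 z y4])
    have sy: "s0 \<le> ?sy" by (rule near[OF \<tau> e1]) (use z Yy0[of "\<rho> x"] in auto)
    have lin: "A - B \<le> - 1/2 * d" if "A - 1/2 * p \<le> B - 1/2 * r" "d \<le> r - p" for A B p r d :: real
      using that by linarith
    have mono: "Q x ?sy - 1/2 * ?sy \<le> Q x ?sz - 1/2 * ?sz"
    proof (rule DERIV_nonneg_imp_nondecreasing[where f = "\<lambda>s. Q x s - 1/2 * s"])
      show "?sy \<le> ?sz" using est z by linarith
      fix s assume "?sy \<le> s" "s \<le> ?sz"
      then have s: "s0 \<le> s" "s \<le> 1" using sy sn_le[of "\<tau> + e * z"] by linarith+
      have "((\<lambda>s. Q x s - 1/2 * s) has_real_derivative (V x * s - f s) - 1/2) (at s)"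
        by (intro DERIV_diff DERIV_Q DERIV_cmult_Id)
      moreover have "0 \<le> (V x * s - f s) - 1/2" using half[OF s Vx] by linarith
      ultimately show "\<exists>y. ((\<lambda>s. Q x s - 1/2 * s) has_real_derivative y) (at s) \<and> 0 \<le> y" by blast
    qed
    have 1: "P x (\<tau> + e * ?y) - P x (\<tau> + e * z) \<le> - 1/2 * (?y - z)" unfolding P_abs by (rule lin[OF mono est])
    have "- (\<epsilon> * K) \<le> D x"
    proof -
      have "4 * \<rho> x * - (\<epsilon> * (6 * L^4)) \<le> 4 * \<rho> x * Y'' (\<rho> x)"
        using Y''lower[OF i] \<rho>_nonneg[of x] by (intro mult_left_mono) auto
      moreover have "4 * \<rho> x * (\<epsilon> * (6 * L^4)) \<le> 4 * t2 * (\<epsilon> * (6 * L^4))"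
        using i \<epsilon>(1) L by (intro mult_right_mono) auto
      moreover have "2 * real DIM('a) * \<bar>Y' (\<rho> x)\<bar> \<le> 2 * real DIM('a) * (\<epsilon> * (3 * L^4 * L))"
        using Y'b[OF i] by (intro mult_left_mono) auto
      moreover have "- (2 * real DIM('a) * \<bar>Y' (\<rho> x)\<bar>) \<le> 2 * real DIM('a) * Y' (\<rho> x)"
        using mult_left_mono[of "- \<bar>Y' (\<rho> x)\<bar>" "Y' (\<rho> x)" "2 * real DIM('a)"] by simp
      moreover have "\<epsilon> * K = 4 * t2 * (\<epsilon> * (6 * L^4)) + 2 * real DIM('a) * (\<epsilon> * (3 * L^4 * L))"
        by (simp add: K_def algebra_simps eval_nat_numeral)
      ultimately show ?thesis unfolding D_def by linarith
    qed
    then have "- 1/2 < D x" using \<epsilon>(3) by linarith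
    then have "- 1/2 * (?y - z) < D x * (?y - z)" using z by (intro mult_strict_right_mono) auto
    then show "P x (\<tau> + e * ?y) - P x (\<tau> + e * z) < D x * (?y - z)" using 1 by linarith
  qed
  then show ?thesis
  proof eventually_elim
    case (elim x)
    show ?case
    proof (intro impI)
      assume i: "t1 < \<rho> x" "\<rho> x < t2"
      have "0 < Y (\<rho> x)" using ub(1)[OF i] \<epsilon>(1) by (simp add: Y_def)
      then have "0 < e * (w x - \<tau>)" using elim i by (simp add: Z_def)
      then show "w x \<noteq> \<tau>" by auto
    qed
  qed
qed

lemma AE_off_sphere: "AE x in lborel. \<rho> x \<noteq> t"
proof -
  have "{x. \<rho> x = t} \<subseteq> sphere x\<^sub>0 (sqrt t)"
    by (auto simp: \<rho>_def dist_norm norm_minus_commute)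
  then have "negligible {x. \<rho> x = t}" by (rule negligible_subset[OF negligible_sphere])
  then have "{x. \<rho> x = t} \<in> null_sets (completion lborel)" by (simp add: negligible_iff_null_sets)
  then have "AE x in completion lborel. x \<notin> {x. \<rho> x = t}" by (rule AE_not_in)
  then show ?thesis by (simp add: AE_completion_iff)
qed

text \<open>Within its closed interval w can meet turning values only at the two ends. Each end is
  excluded by a one-sided barrier in the open layer, and the interfaces left over are spheres, hence
  null sets.\<close>

theorem minimiser_avoids_turning:
  assumes min: "minimiser w g"
  shows "AE x in lborel. cs (w x) \<noteq> 0"
proof -
  have shell: "AE x in lborel. \<forall>j. j < m \<longrightarrow> layer x = int j \<longrightarrow>
      (0 < \<rho> x - (1 + real j * ell) \<longrightarrow> w x \<noteq> tau (int j)) \<and>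
      (0 < (1 + (real j + 1) * ell) - \<rho> x \<longrightarrow> w x \<noteq> tau (int j + 1))"
    unfolding AE_all_countable
  proof
    fix j
    show "AE x in lborel. j < m \<longrightarrow> layer x = int j \<longrightarrow>
      (0 < \<rho> x - (1 + real j * ell) \<longrightarrow> w x \<noteq> tau (int j)) \<and>
      (0 < (1 + (real j + 1) * ell) - \<rho> x \<longrightarrow> w x \<noteq> tau (int j + 1))"
    proof (cases "j < m")
      case True
      have "AE x in lborel. layer x = int j \<longrightarrow> 0 < 1 * (\<rho> x - (1 + real j * ell)) \<longrightarrow> w x \<noteq> tau (int j)"
        by (rule shell_no_touch[OF min True]) simp
      moreover have "AE x in lborel. layer x = int j \<longrightarrow> 0 < - 1 * (\<rho> x - (1 + (real j + 1) * ell)) \<longrightarrow> w x \<noteq> tau (int j + 1)"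
        by (rule shell_no_touch[OF min True]) simp
      ultimately show ?thesis by eventually_elim simp
    qed simp
  qed
  have core: "AE x in lborel. \<rho> x < 1 \<longrightarrow> w x \<noteq> tau (-1) \<and> w x \<noteq> tau 0"
  proof -
    \<comment> \<open>The lower end -1 lies below all values of \<rho>, so the bump stays positive
      at the centre of the core and vanishes only at its boundary.\<close>
    have reg: "layer x = -1 \<and> f 1 + 1 \<le> V x" if "-1 < \<rho> x" "\<rho> x < 1" for x
      using that layer_core[of x] good[of x] by (simp add: \<rho>_def)
    have "AE x in lborel. -1 < \<rho> x \<longrightarrow> \<rho> x < 1 \<longrightarrow> w x \<noteq> tau (-1)"
      by (rule good_no_touch[OF min _ _ reg, where e = 1]) auto
    moreover have "AE x in lborel. -1 < \<rho> x \<longrightarrow> \<rho> x < 1 \<longrightarrow> w x \<noteq> tau (-1 + 1)"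
      by (rule good_no_touch[OF min _ _ reg, where e = "-1"]) auto
    ultimately show ?thesis
    proof eventually_elim
      case (elim x)
      then show ?case using \<rho>_nonneg[of x] by simp
    qed
  qed
  \<comment> \<open>Barriers have compact support, so the exterior is exhausted by bounded annuli;
    both turning values are excluded on each of them.\<close>
  have ext: "AE x in lborel. \<forall>n. T < \<rho> x \<longrightarrow> \<rho> x < T + real (Suc n) \<longrightarrow> w x \<noteq> tau (int m) \<and> w x \<noteq> tau (int m + 1)"
    unfolding AE_all_countable
  proof
    fix n
    have reg: "layer x = int m \<and> f 1 + 1 \<le> V x" if "T < \<rho> x" "\<rho> x < T + real (Suc n)" for x
      using that layer_far[of x] good[of x] by (simp add: \<rho>_def)
    have "AE x in lborel. T < \<rho> x \<longrightarrow> \<rho> x < T + real (Suc n) \<longrightarrow> w x \<noteq> tau (int m)"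
      by (rule good_no_touch[OF min _ _ reg, where e = 1]) (use T in auto)
    moreover have "AE x in lborel. T < \<rho> x \<longrightarrow> \<rho> x < T + real (Suc n) \<longrightarrow> w x \<noteq> tau (int m + 1)"
      by (rule good_no_touch[OF min _ _ reg, where e = "-1"]) (use T in auto)
    ultimately show "AE x in lborel. T < \<rho> x \<longrightarrow> \<rho> x < T + real (Suc n) \<longrightarrow> w x \<noteq> tau (int m) \<and> w x \<noteq> tau (int m + 1)"
      by eventually_elim simp
  qed
  have spheres: "AE x in lborel. \<forall>j::nat. \<rho> x \<noteq> 1 + real j * ell"
    unfolding AE_all_countable using AE_off_sphere by blast
  show ?thesis
    using minimiserD(4)[OF min] shell core ext spheres
  proof eventually_elim
    case (elim x)
    have "w x \<noteq> tau (layer x) \<and> w x \<noteq> tau (layer x + 1)"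
    proof -
      consider "layer x = -1" | "layer x = int m" | "0 \<le> layer x" "layer x < int m"
        using layer_bounds[of x] by linarith
      then show ?thesis
      proof cases
        case 1
        then show ?thesis using elim(3) layer_core[of x] by simp
      next
        case 2
        have "T \<le> \<rho> x" using 2 layer_far by blast
        moreover have "\<rho> x \<noteq> T" using elim(5) ell(2) by metis
        ultimately have "T < \<rho> x" by simp
        obtain n where "\<rho> x - T < real n" using reals_Archimedean2 by blast
        then have "\<rho> x < T + real (Suc n)" by simp
        with elim(4)[rule_format, of n] \<open>T < \<rho> x\<close> show ?thesis unfolding 2 by blast
      next
        case 3
        define j where "j = nat (layer x)"
        have j: "layer x = int j" "j < m" using 3 by (auto simp: j_def)
        have "0 < \<rho> x - (1 + real j * ell)" using layer_shell(1)[OF j] elim(5)[rule_format, of j] by simp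
        moreover have "0 < (1 + (real j + 1) * ell) - \<rho> x" using layer_shell(2)[OF j] by simp
        ultimately show ?thesis using elim(2) j by simp
      qed
    qed
    then have "lo x < w x" "w x < lo x + pi / 2"
      using elim(1) unfolding lo_tau hi_tau tau_add by auto
    then show ?case by (rule cs_nonzero_between[OF lo_turning])
  qed
qed

end

section \<open>From the constrained minimiser to the weak equation\<close>

lemma damp_bounds:
  assumes e: "0 < e"
  shows "\<bar>damp e w\<bar> \<le> \<bar>cs w\<bar>" "\<bar>damp e w\<bar> \<le> 1 / e * \<bar>cs w\<bar>^3"
    "damp e w / cs w = (cs w)\<^sup>2 / ((cs w)\<^sup>2 + e)" "0 \<le> (cs w)\<^sup>2 / ((cs w)\<^sup>2 + e)" "(cs w)\<^sup>2 / ((cs w)\<^sup>2 + e) \<le> 1"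
    "0 \<le> ((cs w)\<^sup>2 + 3 * e) / ((cs w)\<^sup>2 + e)\<^sup>2" "((cs w)\<^sup>2 + 3 * e) / ((cs w)\<^sup>2 + e)\<^sup>2 \<le> 3 / e"
    "cs w \<noteq> 0 \<Longrightarrow> ((cs w)\<^sup>2 + 3 * e) / ((cs w)\<^sup>2 + e)\<^sup>2 \<le> 3 / (cs w)\<^sup>2"
proof -
  have p: "0 < (cs w)\<^sup>2 + e" using e by (simp add: add_nonneg_pos)
  show r0: "0 \<le> (cs w)\<^sup>2 / ((cs w)\<^sup>2 + e)" using p by (simp add: divide_nonneg_pos)
  show r1: "(cs w)\<^sup>2 / ((cs w)\<^sup>2 + e) \<le> 1" using p e by (simp add: divide_le_eq)
  have d: "damp e w = cs w * ((cs w)\<^sup>2 / ((cs w)\<^sup>2 + e))" by (simp add: damp_def power3_eq_cube power2_eq_square)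
  show "\<bar>damp e w\<bar> \<le> \<bar>cs w\<bar>"
    unfolding d abs_mult abs_of_nonneg[OF r0] using mult_left_mono[OF r1, of "\<bar>cs w\<bar>"] by simp
  have "\<bar>damp e w\<bar> = \<bar>cs w\<bar>^3 / ((cs w)\<^sup>2 + e)" using p by (simp add: damp_def power_abs)
  also have "\<dots> \<le> \<bar>cs w\<bar>^3 / e" using e p by (intro divide_left_mono) auto
  finally show "\<bar>damp e w\<bar> \<le> 1 / e * \<bar>cs w\<bar>^3" by simp
  show "damp e w / cs w = (cs w)\<^sup>2 / ((cs w)\<^sup>2 + e)" unfolding d by simp
  show "0 \<le> ((cs w)\<^sup>2 + 3 * e) / ((cs w)\<^sup>2 + e)\<^sup>2" using e by (simp add: divide_nonneg_nonneg)
  have le: "((cs w)\<^sup>2 + 3 * e) / ((cs w)\<^sup>2 + e)\<^sup>2 \<le> 3 / ((cs w)\<^sup>2 + e)"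
  proof -
    have "((cs w)\<^sup>2 + 3 * e) / ((cs w)\<^sup>2 + e)\<^sup>2 \<le> (3 * ((cs w)\<^sup>2 + e)) / ((cs w)\<^sup>2 + e)\<^sup>2"
      by (intro divide_right_mono) auto
    also have "\<dots> = 3 / ((cs w)\<^sup>2 + e)"
    proof -
      have "(3 * d) / d\<^sup>2 = 3 / d" if "0 < d" for d :: real using that by (simp add: power2_eq_square)
      from this[OF p] show ?thesis .
    qed
    finally show ?thesis .
  qed
  have "3 / ((cs w)\<^sup>2 + e) \<le> 3 / e" using e p by (intro divide_left_mono) auto
  with le show "((cs w)\<^sup>2 + 3 * e) / ((cs w)\<^sup>2 + e)\<^sup>2 \<le> 3 / e" by linarith
  assume "cs w \<noteq> 0"
  then have "3 / ((cs w)\<^sup>2 + e) \<le> 3 / (cs w)\<^sup>2" using e p by (intro divide_left_mono) auto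
  with le show "((cs w)\<^sup>2 + 3 * e) / ((cs w)\<^sup>2 + e)\<^sup>2 \<le> 3 / (cs w)\<^sup>2" by linarith
qed

lemma tendsto_damp_ratio:
  assumes e: "(e \<longlongrightarrow> 0) G" and c: "cs w \<noteq> 0"
  shows "((\<lambda>n. (cs w)\<^sup>2 / ((cs w)\<^sup>2 + e n)) \<longlongrightarrow> 1) G"
    "((\<lambda>n. ((cs w)\<^sup>2 + 3 * e n) / ((cs w)\<^sup>2 + e n)\<^sup>2) \<longlongrightarrow> 1 / (cs w)\<^sup>2) G"
    "((\<lambda>n. damp (e n) w) \<longlongrightarrow> cs w) G"
proof -
  have "((\<lambda>n. (cs w)\<^sup>2 / ((cs w)\<^sup>2 + e n)) \<longlongrightarrow> (cs w)\<^sup>2 / ((cs w)\<^sup>2 + 0)) G"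
    using c by (intro tendsto_intros e) auto
  then show "((\<lambda>n. (cs w)\<^sup>2 / ((cs w)\<^sup>2 + e n)) \<longlongrightarrow> 1) G" using c by simp
  have "((\<lambda>n. ((cs w)\<^sup>2 + 3 * e n) / ((cs w)\<^sup>2 + e n)\<^sup>2) \<longlongrightarrow> ((cs w)\<^sup>2 + 3 * 0) / ((cs w)\<^sup>2 + 0)\<^sup>2) G"
    using c by (intro tendsto_intros e) auto
  then show "((\<lambda>n. ((cs w)\<^sup>2 + 3 * e n) / ((cs w)\<^sup>2 + e n)\<^sup>2) \<longlongrightarrow> 1 / (cs w)\<^sup>2) G" using c by (simp add: power2_eq_square)
  have "((\<lambda>n. (cs w)^3 / ((cs w)\<^sup>2 + e n)) \<longlongrightarrow> (cs w)^3 / ((cs w)\<^sup>2 + 0)) G"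
    using c by (intro tendsto_intros e) auto
  then show "((\<lambda>n. damp (e n) w) \<longlongrightarrow> cs w) G" using c by (simp add: damp_def power3_eq_cube power2_eq_square)
qed

lemma continuous_damp: "0 < e \<Longrightarrow> continuous_on UNIV (damp e)"
  using DERIV_damp(1) by (meson DERIV_isCont continuous_at_imp_continuous_on)

context layered_film
begin

lemma minimiser_integrable:
  assumes min: "minimiser w g"
  shows "integrable lborel (\<lambda>x. (sn (w x))\<^sup>2)" "integrable lborel (\<lambda>x. F (sn (w x)))"
    "integrable lborel (\<lambda>x. V x * (sn (w x))\<^sup>2)"
    "J w g = (sq_norm g + (\<integral>x. V x * (sn (w x))\<^sup>2 \<partial>lborel)) / 2 - (\<integral>x. F (sn (w x)) \<partial>lborel)"
proof -
  note w = minimiserD[OF min]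
  note [measurable] = w(6)
  have I: "integrable lborel (\<lambda>x. indicator (cball 0 R1) x + 4 * (w x)\<^sup>2)"
    using integrable_indicator_cball[of "0::'a" R1] sq_integrableD[OF w(9)] by simp
  show 1: "integrable lborel (\<lambda>x. (sn (w x))\<^sup>2)"
  proof (rule Bochner_Integration.integrable_bound[OF I])
    show "AE x in lborel. norm ((sn (w x))\<^sup>2) \<le> norm (indicator (cball 0 R1) x + 4 * (w x)\<^sup>2)"
      using w(4)
    proof eventually_elim
      case (elim x)
      have s1: "(sn (w x))\<^sup>2 \<le> 1" using sn_le[of "w x"] by (simp add: abs_square_le_1)
      show ?case
      proof (cases "norm x \<le> R1")
        case True
        then have "(sn (w x))\<^sup>2 \<le> indicator (cball 0 R1) x + 4 * (w x)\<^sup>2" using s1 by (simp add: add_increasing2)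
        then show ?thesis by simp
      next
        case False
        then show ?thesis using P_far(3)[of x "w x"] elim by simp
      qed
    qed
  qed measurable
  have I2: "integrable lborel (\<lambda>x. C\<^sub>F * (sn (w x))\<^sup>2)" using 1 by simp
  show 2: "integrable lborel (\<lambda>x. F (sn (w x)))"
    by (rule Bochner_Integration.integrable_bound[OF I2])
       (use F_nonneg F_le[OF sn_le] CF_nonneg in \<open>auto intro!: AE_I2\<close>)
  have eq: "V x * (sn (w x))\<^sup>2 = 2 * (P x (w x) + F (sn (w x)))" for x by (simp add: P_def Q_def)
  show 3: "integrable lborel (\<lambda>x. V x * (sn (w x))\<^sup>2)" unfolding eq using w(5) 2 by simp
  have "(\<integral>x. P x (w x) \<partial>lborel) = (\<integral>x. V x * (sn (w x))\<^sup>2 / 2 - F (sn (w x)) \<partial>lborel)"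
    by (simp add: P_def Q_def)
  also have "\<dots> = (\<integral>x. V x * (sn (w x))\<^sup>2 \<partial>lborel) / 2 - (\<integral>x. F (sn (w x)) \<partial>lborel)"
    using 2 3 by simp
  finally show "J w g = (sq_norm g + (\<integral>x. V x * (sn (w x))\<^sup>2 \<partial>lborel)) / 2 - (\<integral>x. F (sn (w x)) \<partial>lborel)"
    unfolding J_def by simp
qed

text \<open>Testing with (a regularisation of) \<open>u = sin \<theta>\<close> itself: since
  \<open>1 - 2 u\<^sup>2 = 2 cos\<^sup>2 \<theta> - 1\<close>, the resulting identity controls \<open>|\<nabla>u|\<^sup>2\<close> by \<open>|\<nabla>w|\<^sup>2\<close>.\<close>

lemma gradient_energy_finite:
  assumes min: "minimiser w g" and c0: "AE x in lborel. cs (w x) \<noteq> 0"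
  shows "integrable lborel (\<lambda>x. (norm (g x))\<^sup>2 / (cs (w x))\<^sup>2)"
proof -
  note w = minimiserD[OF min] and mi = minimiser_integrable[OF min]
  note [measurable] = w(6,7)
  have g2: "integrable lborel (\<lambda>x. (norm (g x))\<^sup>2)" by (rule sq_integrableD[OF w(8)])
  \<comment> \<open>A bound for the integrals of \<open>?A\<close>, the same for every cutoff and
    regularisation. The number 16 is the gradient bound of the cutoffs, and 17 = 16 + 1; the term
    with f is dropped by its sign.\<close>
  define B where "B = (\<integral>x. 17 * (norm (g x))\<^sup>2 + 16 * (sn (w x))\<^sup>2 + \<bar>V x * (sn (w x))\<^sup>2\<bar> \<partial>lborel)"
  have Bi: "integrable lborel (\<lambda>x. 17 * (norm (g x))\<^sup>2 + 16 * (sn (w x))\<^sup>2 + \<bar>V x * (sn (w x))\<^sup>2\<bar>)"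
    using g2 mi by simp
  define e where "e n = inverse (real (Suc n))" for n
  have e: "0 < e n" for n by (simp add: e_def)
  have e0: "e \<longlonglongrightarrow> 0" unfolding e_def by (rule LIMSEQ_inverse_real_of_nat)
  let ?r = "\<lambda>n x. (cs (w x))\<^sup>2 / ((cs (w x))\<^sup>2 + e n)"
  let ?k = "\<lambda>n x. ((cs (w x))\<^sup>2 + 3 * e n) / ((cs (w x))\<^sup>2 + e n)\<^sup>2"
  have "\<exists>\<omega> :: 'a \<Rightarrow> real. \<exists>X. C1c \<omega> X \<and> (\<forall>x. norm x \<le> real (Suc n) \<longrightarrow> \<omega> x = 1) \<and>
      (\<forall>x. 0 \<le> \<omega> x) \<and> (\<forall>x. \<omega> x \<le> 1) \<and> (\<forall>x. norm (X x) \<le> 16)" for n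
    by (rule cutoff_exists[of "real (Suc n)", where 'a = 'a]) (simp, blast)
  then obtain \<omega> :: "nat \<Rightarrow> 'a \<Rightarrow> real" and X where
    \<omega>: "\<And>n. C1c (\<omega> n) (X n)" "\<And>n x. norm x \<le> real (Suc n) \<Longrightarrow> \<omega> n x = 1" "\<And>n x. 0 \<le> \<omega> n x" "\<And>n x. \<omega> n x \<le> 1" "\<And>n x. norm (X n x) \<le> 16"
    by metis
  let ?A = "\<lambda>n x. \<omega> n x * ((sn (w x))\<^sup>2 * ?k n x) * (norm (g x))\<^sup>2"
  have A: "integrable lborel (?A n) \<and> (\<integral>x. ?A n x \<partial>lborel) \<le> B" for n
  proof -
    define \<kappa> where "\<kappa> t = sn t * damp (e n) t" for t
    define \<kappa>' where "\<kappa>' t = (cs t)\<^sup>2 / ((cs t)\<^sup>2 + e n) - (sn t)\<^sup>2 * ((cs t)\<^sup>2 + 3 * e n) / ((cs t)\<^sup>2 + e n)\<^sup>2" for t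
    have nz: "(cs t)\<^sup>2 + e n \<noteq> 0" for t using e[of n] by (smt (verit) zero_le_power2)
    have \<kappa>c: "continuous_on UNIV \<kappa>'"
      unfolding \<kappa>'_def[abs_def] by (intro continuous_intros continuous_cs continuous_sn) (use nz in auto)
    have D\<kappa>: "(\<kappa> has_real_derivative \<kappa>' t) (at t)" for t
      unfolding \<kappa>_def[abs_def] \<kappa>'_def by (rule DERIV_damp(2)[OF e])
    have \<kappa>b: "\<bar>\<kappa>' t\<bar> \<le> 1 + 3 / e n" for t
    proof -
      have "\<bar>(sn t)\<^sup>2 * (((cs t)\<^sup>2 + 3 * e n) / ((cs t)\<^sup>2 + e n)\<^sup>2)\<bar> \<le> 1 * (3 / e n)"
        unfolding abs_mult using damp_bounds(6,7)[OF e[of n], of t] sn_le[of t]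
        by (intro mult_mono) (auto simp: abs_square_le_1)
      then show ?thesis using damp_bounds(4,5)[OF e[of n], of t] unfolding \<kappa>'_def times_divide_eq_right[symmetric] by linarith
    qed
    have \<kappa>K: "\<bar>\<kappa> t\<bar> \<le> 1 / e n * \<bar>cs t\<bar>^3" for t
    proof -
      have "\<bar>\<kappa> t\<bar> \<le> 1 * (1 / e n * \<bar>cs t\<bar>^3)"
        unfolding \<kappa>_def abs_mult using damp_bounds(2)[OF e[of n], of t] sn_le[of t] by (intro mult_mono) auto
      then show ?thesis by simp
    qed
    have \<kappa>s: "\<bar>\<kappa> t\<bar> \<le> \<bar>sn t\<bar>" for t
    proof -
      have "\<bar>damp (e n) t\<bar> \<le> 1" using damp_bounds(1)[OF e[of n], of t] cs_le[of t] by linarith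
      then show ?thesis unfolding \<kappa>_def abs_mult using mult_left_mono[of "\<bar>damp (e n) t\<bar>" 1 "\<bar>sn t\<bar>"] by simp
    qed
    have K0: "0 < 1 / e n" using e[of n] by simp
    note EL = euler_lagrange[OF min \<omega>(1)[of n] D\<kappa> \<kappa>c \<kappa>b K0 \<kappa>K]
    have kc: "\<kappa> t / cs t = sn t * ((cs t)\<^sup>2 / ((cs t)\<^sup>2 + e n))" for t
      unfolding \<kappa>_def using damp_bounds(3)[OF e[of n], of t] by (simp only: times_divide_eq_right[symmetric])
    let ?E1 = "\<lambda>x. \<kappa> (w x) * (X n x \<bullet> g x) + \<omega> n x * \<kappa>' (w x) * (norm (g x))\<^sup>2"
    let ?E2 = "\<lambda>x. \<omega> n x * ((V x * sn (w x) - f (sn (w x))) * \<kappa> (w x) / cs (w x))"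
    let ?L = "\<lambda>x. \<omega> n x * ?r n x * (norm (g x))\<^sup>2 + \<kappa> (w x) * (X n x \<bullet> g x)"
    have [measurable]: "\<omega> n \<in> borel_measurable borel" "X n \<in> borel_measurable borel"
      using C1_continuous[OF C1c_C1[OF \<omega>(1)[of n]]] C1_continuous_grad[OF C1c_C1[OF \<omega>(1)[of n]]]
      by (auto intro: borel_measurable_continuous_onI)
    have "continuous_on UNIV \<kappa>" using D\<kappa> by (meson DERIV_isCont continuous_at_imp_continuous_on)
    then have [measurable]: "\<kappa> \<in> borel_measurable borel" by (rule borel_measurable_continuous_onI)
    have Lb: "\<bar>?L x\<bar> \<le> 17 * (norm (g x))\<^sup>2 + 16 * (sn (w x))\<^sup>2" for x
    proof -
      have "\<omega> n x * ?r n x \<le> 1 * 1" using \<omega>(3,4) damp_bounds(4,5)[OF e[of n], of "w x"] by (intro mult_mono) auto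
      moreover have "0 \<le> \<omega> n x * ?r n x" using \<omega>(3) damp_bounds(4)[OF e[of n], of "w x"] by (intro mult_nonneg_nonneg) auto
      ultimately have 1: "\<bar>\<omega> n x * ?r n x * (norm (g x))\<^sup>2\<bar> \<le> 1 * (norm (g x))\<^sup>2"
        unfolding abs_mult[of "\<omega> n x * ?r n x"] by (intro mult_mono) (simp_all only: abs_of_nonneg abs_power2 power2_abs abs_norm_cancel abs_ge_zero zero_le_power2 order_refl zero_le_one mult_1_right)
      have "\<bar>X n x \<bullet> g x\<bar> \<le> 16 * norm (g x)"
        using Cauchy_Schwarz_ineq2[of "X n x" "g x"] mult_right_mono[OF \<omega>(5)[of n x] norm_ge_zero[of "g x"]] by linarith
      then have "\<bar>\<kappa> (w x) * (X n x \<bullet> g x)\<bar> \<le> \<bar>sn (w x)\<bar> * (16 * norm (g x))"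
        unfolding abs_mult using \<kappa>s by (intro mult_mono) auto
      also have "\<dots> \<le> 16 * ((sn (w x))\<^sup>2 + (norm (g x))\<^sup>2)"
        using abs_inner_le_AMGM[of 1 "\<bar>sn (w x)\<bar>" "norm (g x)"] by simp
      finally have 2: "\<bar>\<kappa> (w x) * (X n x \<bullet> g x)\<bar> \<le> 16 * ((sn (w x))\<^sup>2 + (norm (g x))\<^sup>2)" .
      have "1 * (norm (g x))\<^sup>2 + 16 * ((sn (w x))\<^sup>2 + (norm (g x))\<^sup>2) = 17 * (norm (g x))\<^sup>2 + 16 * (sn (w x))\<^sup>2" by simp
      with order_trans[OF abs_triangle_ineq add_mono[OF 1 2]] show ?thesis by (simp only:)
    qed
    have Li: "integrable lborel ?L"
    proof (rule Bochner_Integration.integrable_bound)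
      show "integrable lborel (\<lambda>x. 17 * (norm (g x))\<^sup>2 + 16 * (sn (w x))\<^sup>2)" using g2 mi by simp
      show "AE x in lborel. norm (?L x) \<le> norm (17 * (norm (g x))\<^sup>2 + 16 * (sn (w x))\<^sup>2)"
        using Lb by (intro AE_I2) (simp add: abs_of_nonneg)
    qed measurable
    \<comment> \<open>The derivative of \<open>sn * damp\<close> is \<open>?r - sn^2 * ?k\<close>.
      The first part is at most 1 and stays in \<open>?L\<close>; the second carries the singular
      quantity to be estimated.\<close>
    have eq: "?A n x = ?L x - ?E1 x" for x
      unfolding \<kappa>'_def by (simp add: algebra_simps)
    have i: "integrable lborel (?A n)" unfolding eq using Li EL(1) by (rule Bochner_Integration.integrable_diff)
    have "(\<integral>x. ?A n x \<partial>lborel) = (\<integral>x. ?L x \<partial>lborel) - (\<integral>x. ?E1 x \<partial>lborel)"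
      unfolding eq using Li EL(1) by (rule Bochner_Integration.integral_diff)
    also have "\<dots> = (\<integral>x. ?L x \<partial>lborel) + (\<integral>x. ?E2 x \<partial>lborel)" using EL(3) by linarith
    also have "\<dots> = (\<integral>x. ?L x + ?E2 x \<partial>lborel)" using Li EL(2) by simp
    also have "\<dots> \<le> B"
      unfolding B_def
    proof (rule integral_mono[OF _ Bi])
      show "integrable lborel (\<lambda>x. ?L x + ?E2 x)" using Li EL(2) by simp
      fix x
      have "?E2 x = (\<omega> n x * ?r n x) * (V x * (sn (w x))\<^sup>2) - (\<omega> n x * ?r n x) * (sn (w x) * f (sn (w x)))"
      proof -
        have "a * ((v * s - h) * (s * r)) = (a * r) * (v * s\<^sup>2) - (a * r) * (s * h)" for a v s h r :: real
          by (simp add: algebra_simps power2_eq_square)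
        then show ?thesis unfolding times_divide_eq_right[symmetric, of _ "\<kappa> (w x)"] kc .
      qed
      moreover have o1: "0 \<le> \<omega> n x * ?r n x"
        by (intro mult_nonneg_nonneg \<omega>(3) damp_bounds(4)[OF e[of n]])
      moreover have o2: "\<omega> n x * ?r n x \<le> 1 * 1"
        by (intro mult_mono \<omega>(4) damp_bounds(4,5)[OF e[of n]]) simp
      moreover have "0 \<le> (\<omega> n x * ?r n x) * (sn (w x) * f (sn (w x)))" by (rule mult_nonneg_nonneg[OF o1 f_sign])
      moreover have "(\<omega> n x * ?r n x) * (V x * (sn (w x))\<^sup>2) \<le> 1 * \<bar>V x * (sn (w x))\<^sup>2\<bar>"
      proof -
        have "(\<omega> n x * ?r n x) * (V x * (sn (w x))\<^sup>2) \<le> (\<omega> n x * ?r n x) * \<bar>V x * (sn (w x))\<^sup>2\<bar>"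
          using o1 by (intro mult_left_mono) auto
        also have "\<dots> \<le> 1 * \<bar>V x * (sn (w x))\<^sup>2\<bar>" using o2 by (intro mult_right_mono) auto
        finally show ?thesis .
      qed
      moreover have "?L x \<le> 17 * (norm (g x))\<^sup>2 + 16 * (sn (w x))\<^sup>2" using Lb[of x] by linarith
      ultimately show "?L x + ?E2 x \<le> 17 * (norm (g x))\<^sup>2 + 16 * (sn (w x))\<^sup>2 + \<bar>V x * (sn (w x))\<^sup>2\<bar>" by linarith
    qed
    finally show ?thesis using i by blast
  qed
  have lim: "AE x in lborel. (\<lambda>n. ?A n x) \<longlonglongrightarrow> (sn (w x))\<^sup>2 * (1 / (cs (w x))\<^sup>2) * (norm (g x))\<^sup>2"
    using c0
  proof eventually_elim
    case (elim x)
    obtain N where N: "norm x \<le> real N" using real_arch_simple by blast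
    have "\<omega> n x = 1" if "n \<ge> N" for n using \<omega>(2)[of x n] N that by simp
    then have "\<forall>\<^sub>F n in sequentially. \<omega> n x = 1" unfolding eventually_sequentially by blast
    then have "(\<lambda>n. \<omega> n x) \<longlonglongrightarrow> 1" by (rule tendsto_eventually)
    then have "(\<lambda>n. ?A n x) \<longlonglongrightarrow> 1 * ((sn (w x))\<^sup>2 * (1 / (cs (w x))\<^sup>2)) * (norm (g x))\<^sup>2"
      by (intro tendsto_mult tendsto_const tendsto_damp_ratio(2)[OF e0 elim])
    then show ?case by simp
  qed
  have nn: "AE x in lborel. - 0 \<le> ?A n x" for n
    unfolding minus_zero by (intro AE_I2 mult_nonneg_nonneg \<omega>(3) damp_bounds(6)[OF e[of n]] zero_le_power2)
  have "integrable lborel (\<lambda>x. (sn (w x))\<^sup>2 * (1 / (cs (w x))\<^sup>2) * (norm (g x))\<^sup>2)"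
  proof (rule Fatou_lower_bound(1)[of ?A _ "\<lambda>_. 0" "\<lambda>_. B" B])
    show "integrable lborel (?A n)" for n using A by blast
    show "(\<integral>x. ?A n x \<partial>lborel) \<le> B" for n using A by blast
    show "AE x in lborel. - 0 \<le> ?A n x" for n by (rule nn)
  qed (use lim in \<open>simp_all\<close>)
  \<comment> \<open>The limit controls only sn^2/cs^2 times |g|^2; adding |g|^2 itself completes it,
    because sn^2/cs^2 + 1 = 1/cs^2.\<close>
  then have I: "integrable lborel (\<lambda>x. (sn (w x))\<^sup>2 * (1 / (cs (w x))\<^sup>2) * (norm (g x))\<^sup>2 + (norm (g x))\<^sup>2)"
    using g2 by (rule Bochner_Integration.integrable_add)
  have eq: "AE x in lborel. (sn (w x))\<^sup>2 * (1 / (cs (w x))\<^sup>2) * (norm (g x))\<^sup>2 + (norm (g x))\<^sup>2 = (norm (g x))\<^sup>2 / (cs (w x))\<^sup>2"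
    using c0
  proof eventually_elim
    case (elim x)
    have "(sn (w x))\<^sup>2 * (1 / (cs (w x))\<^sup>2) * (norm (g x))\<^sup>2 + (norm (g x))\<^sup>2
      = ((sn (w x))\<^sup>2 + (cs (w x))\<^sup>2) * ((norm (g x))\<^sup>2 / (cs (w x))\<^sup>2)"
    proof -
      have "S * (1 / C) * G + G = (S + C) * (G / C)" if "C \<noteq> 0" for S C G :: real
        using that by (simp add: field_simps)
      from this[of "(cs (w x))\<^sup>2"] elim show ?thesis by simp
    qed
    then show ?case by (simp add: sn_cs)
  qed
  show ?thesis
    by (rule integrable_cong_AE[THEN iffD1, OF _ _ eq I]) measurable
qed

text \<open>The Euler-Lagrange identity for \<open>damp (e n)\<close>, in the limit where it becomes
  \<open>cs\<close>. Its derivative is at most 3/cs^2 in absolute value, so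
  \<open>gradient_energy_finite\<close> supplies the majorant. Division by \<open>cs\<close> then
  turns the derivative of \<open>P\<close> into V u - f(u).\<close>

theorem minimiser_weak_equation:
  assumes min: "minimiser w g" and c0: "AE x in lborel. cs (w x) \<noteq> 0" and \<phi>: "C1c \<phi> \<Phi>"
  shows "integrable lborel (\<lambda>x. cs (w x) * (\<Phi> x \<bullet> g x) - \<phi> x * sn (w x) * ((norm (g x))\<^sup>2 / (cs (w x))\<^sup>2))"
    "integrable lborel (\<lambda>x. \<phi> x * (V x * sn (w x)))" "integrable lborel (\<lambda>x. \<phi> x * f (sn (w x)))"
    "(\<integral>x. cs (w x) * (\<Phi> x \<bullet> g x) - \<phi> x * sn (w x) * ((norm (g x))\<^sup>2 / (cs (w x))\<^sup>2) \<partial>lborel)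
      + (\<integral>x. \<phi> x * (V x * sn (w x)) \<partial>lborel) = (\<integral>x. \<phi> x * f (sn (w x)) \<partial>lborel)"
proof -
  note w = minimiserD[OF min]
  note [measurable] = w(6,7)
  have ge: "integrable lborel (\<lambda>x. (norm (g x))\<^sup>2 / (cs (w x))\<^sup>2)" by (rule gradient_energy_finite[OF min c0])
  obtain B where B: "\<And>x. \<bar>\<phi> x\<bar> \<le> B" "\<And>x. norm (\<Phi> x) \<le> B" "0 \<le> B" by (rule C1c_bounded[OF \<phi>]) (rule that, assumption+)
  obtain R where R: "\<And>x. R \<le> norm x \<Longrightarrow> \<phi> x = 0" "\<And>x. R \<le> norm x \<Longrightarrow> \<Phi> x = 0"
    by (rule C1c_bound[OF \<phi>]) (rule that, assumption+)
  obtain M where M: "0 < M" "\<And>x. norm x \<le> R \<Longrightarrow> \<bar>V x\<bar> \<le> M" "\<And>s. \<bar>s\<bar> \<le> 1 \<Longrightarrow> \<bar>f s\<bar> \<le> M"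
    by (rule local_bound[of R]) (rule that, assumption+)
  have [measurable]: "\<phi> \<in> borel_measurable borel" "\<Phi> \<in> borel_measurable borel"
    using C1_continuous[OF C1c_C1[OF \<phi>]] C1_continuous_grad[OF C1c_C1[OF \<phi>]]
    by (auto intro: borel_measurable_continuous_onI)
  have BM: "integrable lborel (\<lambda>x::'a. B * M * indicator (cball 0 R) x)"
    by (rule Bochner_Integration.integrable_mult_right[OF integrable_indicator_cball])
  have V1: "\<bar>\<phi> x * (V x * sn (w x))\<bar> \<le> B * M * indicator (cball 0 R) x" for x
  proof (cases "norm x \<le> R")
    case True
    have "\<bar>V x * sn (w x)\<bar> \<le> M * 1" unfolding abs_mult using M(1,2) True sn_le by (intro mult_mono) auto
    then have "\<bar>\<phi> x\<bar> * \<bar>V x * sn (w x)\<bar> \<le> B * M" using B(1,3) by (intro mult_mono) auto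
    then show ?thesis using True by (simp add: abs_mult)
  qed (use R(1)[of x] in simp)
  have f1: "\<bar>\<phi> x * f (sn (w x))\<bar> \<le> B * M * indicator (cball 0 R) x" for x
  proof (cases "norm x \<le> R")
    case True
    have "\<bar>\<phi> x\<bar> * \<bar>f (sn (w x))\<bar> \<le> B * M" using B(1,3) M(3)[OF sn_le] by (intro mult_mono) auto
    then show ?thesis using True by (simp add: abs_mult)
  qed (use R(1)[of x] in simp)
  show iV: "integrable lborel (\<lambda>x. \<phi> x * (V x * sn (w x)))"
    by (rule Bochner_Integration.integrable_bound[OF BM])
       (measurable, intro AE_I2, use V1 in \<open>metis abs_ge_self order_trans real_norm_def\<close>)
  show if': "integrable lborel (\<lambda>x. \<phi> x * f (sn (w x)))"
    by (rule Bochner_Integration.integrable_bound[OF BM])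
       (measurable, intro AE_I2, use f1 in \<open>metis abs_ge_self order_trans real_norm_def\<close>)
  have \<Phi>g: "integrable lborel (\<lambda>x. \<Phi> x \<bullet> g x)" by (rule sq_integrable_inner[OF C1c_sq_integrable(2)[OF \<phi>] w(8)])
  define e where "e n = inverse (real (Suc n))" for n
  have e: "0 < e n" for n by (simp add: e_def)
  have e0: "e \<longlonglongrightarrow> 0" unfolding e_def by (rule LIMSEQ_inverse_real_of_nat)
  define \<kappa>' where "\<kappa>' n t = - sn t * ((cs t)\<^sup>2 + 3 * e n) / ((cs t)\<^sup>2 + e n)\<^sup>2" for n t
  have nz: "(cs t)\<^sup>2 + e n \<noteq> 0" for t n using e[of n] by (smt (verit) zero_le_power2)
  have \<kappa>c: "continuous_on UNIV (\<kappa>' n)" for n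
    unfolding \<kappa>'_def[abs_def] by (intro continuous_intros continuous_cs continuous_sn) (use nz in auto)
  have \<kappa>'a: "\<bar>\<kappa>' n t\<bar> \<le> ((cs t)\<^sup>2 + 3 * e n) / ((cs t)\<^sup>2 + e n)\<^sup>2" for n t
  proof -
    have "\<bar>\<kappa>' n t\<bar> = \<bar>sn t\<bar> * (((cs t)\<^sup>2 + 3 * e n) / ((cs t)\<^sup>2 + e n)\<^sup>2)"
      using damp_bounds(6)[OF e[of n], of t] e[of n] by (simp add: \<kappa>'_def abs_mult)
    also have "\<dots> \<le> 1 * (((cs t)\<^sup>2 + 3 * e n) / ((cs t)\<^sup>2 + e n)\<^sup>2)"
      using damp_bounds(6)[OF e[of n], of t] sn_le[of t] by (intro mult_right_mono)
    finally show ?thesis by simp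
  qed
  have \<kappa>b: "\<bar>\<kappa>' n t\<bar> \<le> 3 / e n" for n t
    using \<kappa>'a[of n t] damp_bounds(7)[OF e[of n], of t] by linarith
  have K0: "0 < 1 / e n" for n using e[of n] by simp
  have D\<kappa>: "(damp (e n) has_real_derivative \<kappa>' n t) (at t)" for n t
    unfolding \<kappa>'_def by (rule DERIV_damp(1)[OF e])
  note EL = euler_lagrange[OF min \<phi> D\<kappa> \<kappa>c \<kappa>b K0 damp_bounds(2)[OF e]]
  let ?E1 = "\<lambda>n x. damp (e n) (w x) * (\<Phi> x \<bullet> g x) + \<phi> x * \<kappa>' n (w x) * (norm (g x))\<^sup>2"
  let ?E2 = "\<lambda>n x. \<phi> x * ((V x * sn (w x) - f (sn (w x))) * damp (e n) (w x) / cs (w x))"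
  let ?L1 = "\<lambda>x. cs (w x) * (\<Phi> x \<bullet> g x) - \<phi> x * sn (w x) * ((norm (g x))\<^sup>2 / (cs (w x))\<^sup>2)"
  let ?L2 = "\<lambda>x. \<phi> x * (V x * sn (w x)) - \<phi> x * f (sn (w x))"
  have [measurable]: "damp (e n) \<in> borel_measurable borel" "\<kappa>' n \<in> borel_measurable borel" for n
    using continuous_damp[OF e] \<kappa>c by (auto intro: borel_measurable_continuous_onI)
  have l1: "AE x in lborel. (\<lambda>n. ?E1 n x) \<longlonglongrightarrow> ?L1 x"
    using c0
  proof eventually_elim
    case (elim x)
    have "(\<lambda>n. \<kappa>' n (w x)) \<longlonglongrightarrow> - sn (w x) * (1 / (cs (w x))\<^sup>2)"
      unfolding \<kappa>'_def times_divide_eq_right[symmetric]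
      by (intro tendsto_mult tendsto_const tendsto_damp_ratio(2)[OF e0 elim])
    then have "(\<lambda>n. ?E1 n x) \<longlonglongrightarrow> cs (w x) * (\<Phi> x \<bullet> g x) + \<phi> x * (- sn (w x) * (1 / (cs (w x))\<^sup>2)) * (norm (g x))\<^sup>2"
      by (intro tendsto_add tendsto_mult tendsto_const tendsto_damp_ratio(3)[OF e0 elim])
    then show ?case by simp
  qed
  have d1i: "integrable lborel (\<lambda>x. \<bar>\<Phi> x \<bullet> g x\<bar> + B * 3 * ((norm (g x))\<^sup>2 / (cs (w x))\<^sup>2))"
    by (intro Bochner_Integration.integrable_add Bochner_Integration.integrable_mult_right integrable_abs \<Phi>g ge)
  have d1: "AE x in lborel. norm (?E1 n x) \<le> \<bar>\<Phi> x \<bullet> g x\<bar> + B * 3 * ((norm (g x))\<^sup>2 / (cs (w x))\<^sup>2)" for n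
    using c0
  proof eventually_elim
    case (elim x)
    have "\<bar>damp (e n) (w x)\<bar> \<le> 1" using damp_bounds(1)[OF e[of n], of "w x"] cs_le[of "w x"] by linarith
    then have 1: "\<bar>damp (e n) (w x) * (\<Phi> x \<bullet> g x)\<bar> \<le> 1 * \<bar>\<Phi> x \<bullet> g x\<bar>" unfolding abs_mult by (intro mult_right_mono) auto
    have "\<bar>\<kappa>' n (w x)\<bar> \<le> 3 / (cs (w x))\<^sup>2" using \<kappa>'a[of n "w x"] damp_bounds(8)[OF e[of n] elim] by linarith
    then have "\<bar>\<phi> x\<bar> * \<bar>\<kappa>' n (w x)\<bar> * (norm (g x))\<^sup>2 \<le> B * (3 / (cs (w x))\<^sup>2) * (norm (g x))\<^sup>2"
      using B(1,3) by (intro mult_right_mono mult_mono) auto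
    then have "\<bar>\<phi> x * \<kappa>' n (w x) * (norm (g x))\<^sup>2\<bar> \<le> B * 3 * ((norm (g x))\<^sup>2 / (cs (w x))\<^sup>2)" by (simp add: abs_mult)
    then show ?case using 1 unfolding real_norm_def by linarith
  qed
  have l2: "AE x in lborel. (\<lambda>n. ?E2 n x) \<longlonglongrightarrow> ?L2 x"
    using c0
  proof eventually_elim
    case (elim x)
    have "(\<lambda>n. \<phi> x * ((V x * sn (w x) - f (sn (w x))) * ((cs (w x))\<^sup>2 / ((cs (w x))\<^sup>2 + e n)))) \<longlonglongrightarrow>
      \<phi> x * ((V x * sn (w x) - f (sn (w x))) * 1)"
      by (intro tendsto_mult tendsto_const tendsto_damp_ratio(1)[OF e0 elim])
    then show ?case
      unfolding times_divide_eq_right[symmetric] damp_bounds(3)[OF e] by (simp add: right_diff_distrib)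
  qed
  have d2i: "integrable lborel (\<lambda>x::'a. 2 * (B * M * indicator (cball 0 R) x))" using BM by simp
  have d2: "AE x in lborel. norm (?E2 n x) \<le> 2 * (B * M * indicator (cball 0 R) x)" for n
  proof (rule AE_I2)
    fix x
    let ?r = "(cs (w x))\<^sup>2 / ((cs (w x))\<^sup>2 + e n)"
    have E: "?E2 n x = ?L2 x * ?r"
      unfolding times_divide_eq_right[symmetric] damp_bounds(3)[OF e] by (simp add: algebra_simps)
    have 1: "\<bar>?L2 x\<bar> \<le> 2 * (B * M * indicator (cball 0 R) x)" using V1[of x] f1[of x] by linarith
    have "\<bar>?r\<bar> \<le> 1" using damp_bounds(4,5)[OF e[of n], of "w x"] by linarith
    then have "\<bar>?L2 x * ?r\<bar> \<le> \<bar>?L2 x\<bar> * 1" unfolding abs_mult[of "?L2 x"] by (intro mult_left_mono) auto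
    then have "\<bar>?L2 x * ?r\<bar> \<le> \<bar>?L2 x\<bar>" by (simp only: mult_1_right)
    then show "norm (?E2 n x) \<le> 2 * (B * M * indicator (cball 0 R) x)" unfolding E real_norm_def using 1 by (rule order_trans)
  qed
  show i1: "integrable lborel ?L1" by (rule integrable_dominated_convergence[OF _ _ d1i l1 d1]) measurable
  have t1: "(\<lambda>n. \<integral>x. ?E1 n x \<partial>lborel) \<longlonglongrightarrow> (\<integral>x. ?L1 x \<partial>lborel)"
    by (rule integral_dominated_convergence[OF _ _ d1i l1 d1]) measurable
  have t2: "(\<lambda>n. \<integral>x. ?E2 n x \<partial>lborel) \<longlonglongrightarrow> (\<integral>x. ?L2 x \<partial>lborel)"
    by (rule integral_dominated_convergence[OF _ _ d2i l2 d2]) measurable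
  have "(\<lambda>n. (\<integral>x. ?E1 n x \<partial>lborel) + (\<integral>x. ?E2 n x \<partial>lborel)) \<longlonglongrightarrow> (\<integral>x. ?L1 x \<partial>lborel) + (\<integral>x. ?L2 x \<partial>lborel)"
    by (rule tendsto_add[OF t1 t2])
  moreover have "(\<integral>x. ?E1 n x \<partial>lborel) + (\<integral>x. ?E2 n x \<partial>lborel) = 0" for n by (rule EL(3))
  ultimately have "(\<integral>x. ?L1 x \<partial>lborel) + (\<integral>x. ?L2 x \<partial>lborel) = 0" by (simp add: LIMSEQ_const_iff)
  moreover have "(\<integral>x. ?L2 x \<partial>lborel) = (\<integral>x. \<phi> x * (V x * sn (w x)) \<partial>lborel) - (\<integral>x. \<phi> x * f (sn (w x)) \<partial>lborel)"
    using iV if' by simp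
  ultimately show "(\<integral>x. ?L1 x \<partial>lborel) + (\<integral>x. \<phi> x * (V x * sn (w x)) \<partial>lborel) = (\<integral>x. \<phi> x * f (sn (w x)) \<partial>lborel)"
    by linarith
qed

text \<open>\<open>sn\<close> has unbounded slope, so the chain rule does not apply to it directly.
  Subtracting s^(2n+1)/(2n+1) truncates the slope: 1 - s^(2n) over cs equals cs times a finite
  geometric sum, hence is bounded by n, and it tends to 1/cs from below in absolute value.\<close>

lemma minimiser_sobolev_sn:
  assumes min: "minimiser w g" and c0: "AE x in lborel. cs (w x) \<noteq> 0"
  shows "sobolev (\<lambda>x. sn (w x)) (\<lambda>x. (1 / cs (w x)) *\<^sub>R g x)"
proof -
  note w = minimiserD[OF min]
  note [measurable] = w(6,7)
  define S where "S n t = sn t - (sn t)^(2 * n + 1) / real (2 * n + 1)" for n t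
  define S' where "S' n t = cs t * (\<Sum>k<n. (sn t)^(2 * k))" for n t
  have DS: "(S n has_real_derivative S' n t) (at t)" for n t
  proof -
    have "((\<lambda>w. (\<lambda>\<theta>. sin \<theta> - (sin \<theta>)^(2 * n + 1) / real (2 * n + 1)) (angle w)) has_real_derivative
       (\<lambda>\<theta>. cos \<theta> * (\<Sum>k<n. (sin \<theta>)^(2 * k))) (angle t)) (at t)"
    proof (rule DERIV_comp_angle)
      fix \<theta> :: real
      have "((\<lambda>\<theta>. (sin \<theta>)^(2 * n + 1)) has_real_derivative real (2 * n + 1) * (cos \<theta> * (sin \<theta>)^(2 * n))) (at \<theta>)"
        by (rule DERIV_cong[OF DERIV_power[OF DERIV_sin]]) simp
      from DERIV_diff[OF DERIV_sin DERIV_cdivide[OF this, of "real (2 * n + 1)"]]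
      have "((\<lambda>\<theta>. sin \<theta> - (sin \<theta>)^(2 * n + 1) / real (2 * n + 1)) has_real_derivative cos \<theta> - cos \<theta> * (sin \<theta>)^(2 * n)) (at \<theta>)"
        by simp
      moreover have "cos \<theta> - cos \<theta> * (sin \<theta>)^(2 * n) = (cos \<theta>)\<^sup>2 * (cos \<theta> * (\<Sum>k<n. (sin \<theta>)^(2 * k)))"
      proof -
        have "1 - (sin \<theta>)^(2 * n) = (1 - (sin \<theta>)\<^sup>2) * (\<Sum>k<n. ((sin \<theta>)\<^sup>2)^k)"
          unfolding power_mult by (rule one_diff_power_eq)
        also have "\<dots> = (cos \<theta>)\<^sup>2 * (\<Sum>k<n. (sin \<theta>)^(2 * k))" by (simp add: cos_squared_eq power_mult)
        finally have "cos \<theta> * (1 - (sin \<theta>)^(2 * n)) = cos \<theta> * ((cos \<theta>)\<^sup>2 * (\<Sum>k<n. (sin \<theta>)^(2 * k)))" by simp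
        then show ?thesis by (simp add: right_diff_distrib mult.left_commute)
      qed
      ultimately show "((\<lambda>\<theta>. sin \<theta> - (sin \<theta>)^(2 * n + 1) / real (2 * n + 1)) has_real_derivative
         (cos \<theta>)\<^sup>2 * (cos \<theta> * (\<Sum>k<n. (sin \<theta>)^(2 * k)))) (at \<theta>)" by simp
    qed (intro continuous_intros)
    then show ?thesis by (simp add: S_def[abs_def] S'_def sn_def cs_def)
  qed
  have S'c: "continuous_on UNIV (S' n)" for n
    unfolding S'_def[abs_def] by (intro continuous_intros continuous_cs continuous_sn)
  have S'b: "\<bar>S' n t\<bar> \<le> real n" for n t
  proof -
    have "\<bar>\<Sum>k<n. (sn t)^(2 * k)\<bar> \<le> (\<Sum>k<n. \<bar>(sn t)^(2 * k)\<bar>)" by (rule sum_abs)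
    also have "\<dots> \<le> (\<Sum>k<n. 1)" by (intro sum_mono) (simp add: power_abs sn_le power_le_one)
    finally have "\<bar>cs t\<bar> * \<bar>\<Sum>k<n. (sn t)^(2 * k)\<bar> \<le> 1 * real n" using cs_le[of t] by (intro mult_mono) auto
    then show ?thesis by (simp add: S'_def abs_mult)
  qed
  have S'eq: "S' n t = (1 - (sn t)^(2 * n)) / cs t" if "cs t \<noteq> 0" for n t
  proof -
    have "1 - (sn t)^(2 * n) = (1 - (sn t)\<^sup>2) * (\<Sum>k<n. ((sn t)\<^sup>2)^k)"
      unfolding power_mult by (rule one_diff_power_eq)
    also have "1 - (sn t)\<^sup>2 = (cs t)\<^sup>2" using sn_cs[of t] by linarith
    finally show ?thesis using that by (simp add: S'_def power_mult power2_eq_square)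
  qed
  have sn2: "sq_integrable (\<lambda>x. sn (w x))"
    unfolding sq_integrable_def using minimiser_integrable(1)[OF min] by simp
  have gc: "sq_integrable (\<lambda>x. (1 / cs (w x)) *\<^sub>R g x)"
    unfolding sq_integrable_def using gradient_energy_finite[OF min c0] by (simp add: power_divide)
  show ?thesis
  proof (rule sobolev_limit[where v = "\<lambda>n x. S n (w x)" and h = "\<lambda>n x. S' n (w x) *\<^sub>R g x", OF _ sn2 gc])
    show "sobolev (\<lambda>x. S n (w x)) (\<lambda>x. S' n (w x) *\<^sub>R g x)" for n
    proof (rule sobolev_comp[OF w(3) DS S'c _ S'b])
      have "sn 0 = 0" using sn_minus[of 0] by simp
      then show "S n 0 = 0" by (simp add: S_def)
    qed
    have sb: "norm (S n t - sn t) \<le> \<bar>sn t\<bar> / real (2 * n + 1)" for n t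
    proof -
      have "\<bar>sn t\<bar>^(2 * n) \<le> 1" by (rule power_le_one) (simp_all add: sn_le)
      then have "\<bar>sn t\<bar> * \<bar>sn t\<bar>^(2 * n) \<le> \<bar>sn t\<bar> * 1" by (intro mult_left_mono) auto
      then have "\<bar>(sn t)^(2 * n + 1)\<bar> \<le> \<bar>sn t\<bar>" by (simp add: power_abs abs_mult)
      then have "\<bar>(sn t)^(2 * n + 1)\<bar> / real (2 * n + 1) \<le> \<bar>sn t\<bar> / real (2 * n + 1)" by (intro divide_right_mono) auto
      moreover have "norm (S n t - sn t) = \<bar>(sn t)^(2 * n + 1)\<bar> / real (2 * n + 1)"
        unfolding S_def real_norm_def by (simp add: abs_divide)
      ultimately show ?thesis by linarith
    qed
    show "(\<lambda>n. sq_norm (\<lambda>x. S n (w x) - sn (w x))) \<longlonglongrightarrow> 0"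
    proof (rule sq_norm_dominated[OF _ sn2, where C = 1])
      show "(\<lambda>x. S n (w x) - sn (w x)) \<in> borel_measurable lborel" for n unfolding S_def by measurable
      have "(\<lambda>n. S n t - sn t) \<longlonglongrightarrow> 0" for t
      proof (rule Lim_null_comparison)
        show "\<forall>\<^sub>F n in sequentially. norm (S n t - sn t) \<le> \<bar>sn t\<bar> / real (2 * n + 1)" using sb by (intro always_eventually allI)
        have "filterlim (\<lambda>n. real (2 * n + 1)) at_top sequentially"
          by (rule filterlim_at_top_mono[OF filterlim_real_sequentially]) (auto intro!: always_eventually)
        then show "(\<lambda>n. \<bar>sn t\<bar> / real (2 * n + 1)) \<longlonglongrightarrow> 0"
          by (intro tendsto_divide_0[OF tendsto_const] filterlim_at_top_imp_at_infinity)
      qed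
      then show "AE x in lborel. (\<lambda>n. S n (w x) - sn (w x)) \<longlonglongrightarrow> 0" by simp
      have "\<bar>sn t\<bar> / real (2 * n + 1) \<le> 1 * norm (sn t)" for t n
        using mult_left_mono[of 1 "real (2 * n + 1)" "\<bar>sn t\<bar>"] by (simp add: divide_le_eq)
      then show "AE x in lborel. norm (S n (w x) - sn (w x)) \<le> 1 * norm (sn (w x))" for n
        using sb order_trans by (intro AE_I2) blast
    qed
    show "(\<lambda>n. sq_norm (\<lambda>x. S' n (w x) *\<^sub>R g x - (1 / cs (w x)) *\<^sub>R g x)) \<longlonglongrightarrow> 0"
    proof (rule sq_norm_dominated[OF _ gc, where C = 1])
      have [measurable]: "S' n \<in> borel_measurable borel" for n by (rule borel_measurable_continuous_onI[OF S'c])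
      show "(\<lambda>x. S' n (w x) *\<^sub>R g x - (1 / cs (w x)) *\<^sub>R g x) \<in> borel_measurable lborel" for n by measurable
      have eq: "S' n t *\<^sub>R v - (1 / cs t) *\<^sub>R v = - ((sn t)^(2 * n) *\<^sub>R ((1 / cs t) *\<^sub>R v))" if "cs t \<noteq> 0" for n t and v :: 'a
        unfolding S'eq[OF that] by (simp add: diff_divide_distrib scaleR_diff_left)
      show "AE x in lborel. (\<lambda>n. S' n (w x) *\<^sub>R g x - (1 / cs (w x)) *\<^sub>R g x) \<longlonglongrightarrow> 0"
        using c0
      proof eventually_elim
        case (elim x)
        have "(sn (w x))\<^sup>2 < 1" using sn_cs[of "w x"] elim by (smt (verit) zero_less_power2)
        then have "(\<lambda>n. ((sn (w x))\<^sup>2)^n) \<longlonglongrightarrow> 0" by (intro LIMSEQ_power_zero) simp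
        then have "(\<lambda>n. (sn (w x))^(2 * n)) \<longlonglongrightarrow> 0" by (simp add: power_mult)
        from tendsto_minus[OF tendsto_scaleR[OF this tendsto_const[of "(1 / cs (w x)) *\<^sub>R g x"]]]
        show ?case unfolding eq[OF elim] by simp
      qed
      show "AE x in lborel. norm (S' n (w x) *\<^sub>R g x - (1 / cs (w x)) *\<^sub>R g x) \<le> 1 * norm ((1 / cs (w x)) *\<^sub>R g x)" for n
        using c0
      proof eventually_elim
        case (elim x)
        have "\<bar>sn (w x)\<bar>^(2 * n) \<le> 1" by (rule power_le_one) (simp_all add: sn_le)
        then have "\<bar>(sn (w x))^(2 * n)\<bar> * norm ((1 / cs (w x)) *\<^sub>R g x) \<le> 1 * norm ((1 / cs (w x)) *\<^sub>R g x)"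
          unfolding power_abs by (intro mult_right_mono) auto
        then show ?case unfolding eq[OF elim] norm_minus_cancel norm_scaleR[of "(sn (w x))^(2 * n)"] .
      qed
    qed
  qed
qed

end

section \<open>Growth of the energy with the number of shells\<close>

context film
begin

text \<open>The potential depends on w through \<open>sn\<close> alone, so the bound is uniform over
  all w and does not see the layers; it can be fixed before the number of shells.\<close>

lemma P_integral_lower:
  obtains B where "\<And>w. w \<in> borel_measurable borel \<Longrightarrow> integrable lborel (\<lambda>x. P x (w x)) \<Longrightarrow> - B \<le> (\<integral>x. P x (w x) \<partial>lborel)"
proof -
  have "\<forall>\<^sub>F x in at_infinity. 2 * C\<^sub>F \<le> V x" using V_top by (simp add: filterlim_at_top)
  then obtain R where R: "\<And>x. R \<le> norm x \<Longrightarrow> 2 * C\<^sub>F \<le> V x" unfolding eventually_at_infinity by blast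
  obtain M where M: "0 < M" "\<And>x. norm x \<le> R \<Longrightarrow> \<bar>V x\<bar> \<le> M" "\<And>s. \<bar>s\<bar> \<le> 1 \<Longrightarrow> \<bar>f s\<bar> \<le> M"
    by (rule local_bound[of R]) (rule that, assumption+)
  have lb: "- ((M + C\<^sub>F) * indicator (cball 0 R) x) \<le> P x v" for x v
  proof (cases "norm x \<le> R")
    case True
    have "\<bar>P x v\<bar> \<le> M + C\<^sub>F" unfolding P_def by (rule Q_bound[OF M(2)[OF True] sn_le])
    then show ?thesis using True by simp
  next
    case False
    have "(2 * C\<^sub>F) * (sn v)\<^sup>2 \<le> V x * (sn v)\<^sup>2" using R[of x] False by (intro mult_right_mono) auto
    moreover have "F (sn v) \<le> C\<^sub>F * (sn v)\<^sup>2" by (intro F_le sn_le)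
    ultimately have "0 \<le> P x v" unfolding P_def Q_def by (simp add: algebra_simps)
    then show ?thesis using False by simp
  qed
  have i: "integrable lborel (\<lambda>x::'a. - ((M + C\<^sub>F) * indicator (cball 0 R) x))"
    by (intro Bochner_Integration.integrable_minus Bochner_Integration.integrable_mult_right integrable_indicator_cball)
  show ?thesis
  proof (rule that[of "- integral\<^sup>L lborel (\<lambda>x::'a. - ((M + C\<^sub>F) * indicator (cball 0 R) x))"])
    fix w :: "'a \<Rightarrow> real" assume "integrable lborel (\<lambda>x. P x (w x))"
    from integral_mono[OF i this lb]
    show "- (- integral\<^sup>L lborel (\<lambda>x::'a. - ((M + C\<^sub>F) * indicator (cball 0 R) x))) \<le> (\<integral>x. P x (w x) \<partial>lborel)" by simp
  qed
qed

end

text \<open>A C1 weight in the squared radius, supported between the core and the exterior. It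
  weighs a radial test field that is independent of the number of shells.\<close>

definition probe :: "real \<Rightarrow> real \<Rightarrow> real" where "probe T t = (max 0 ((t - 1) * (T - t)))\<^sup>2"
definition probe' :: "real \<Rightarrow> real \<Rightarrow> real" where "probe' T t = 2 * max 0 ((t - 1) * (T - t)) * (1 + T - 2 * t)"

lemma DERIV_probe: "(probe T has_real_derivative probe' T t) (at t)"
proof -
  have "((\<lambda>t. (t - 1) * (T - t)) has_real_derivative 1 + T - 2 * t) (at t)"
    by (auto intro!: derivative_eq_intros)
  from DERIV_chain2[OF DERIV_max0_square this] show ?thesis by (simp add: probe_def[abs_def] probe'_def)
qed

lemma continuous_probe: "continuous_on UNIV (probe T)" "continuous_on UNIV (probe' T)"
  unfolding probe_def[abs_def] probe'_def[abs_def] by (intro continuous_intros)+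

lemma probe_outside:
  assumes "1 < T" "\<not> (1 < t \<and> t < T)" shows "probe T t = 0" "probe' T t = 0"
proof -
  have "(t - 1) * (T - t) \<le> 0"
  proof (cases "t \<le> 1")
    case True
    then show ?thesis using assms by (intro mult_nonpos_nonneg) auto
  next
    case False
    then show ?thesis using assms by (intro mult_nonneg_nonpos) auto
  qed
  then show "probe T t = 0" "probe' T t = 0" by (simp_all add: probe_def probe'_def)
qed

lemma C1c_probe:
  assumes "1 < T"
  shows "C1c (\<lambda>x. probe T ((norm (x - a))\<^sup>2)) (\<lambda>x. (2 * probe' T ((norm (x - a))\<^sup>2)) *\<^sub>R (x - a))"
  by (rule C1c_radial[OF DERIV_probe continuous_probe(2), of T]) (use probe_outside[OF assms] in auto)

definition probe_mass :: "'a::euclidean_space \<Rightarrow> real \<Rightarrow> real" where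
  "probe_mass a T = (\<integral>x. probe T ((norm (x - a))\<^sup>2) * (norm (x - a))\<^sup>2 \<partial>lborel)"

text \<open>The divergence of the radial test field with weight \<open>probe T\<close>, centred at
  a.\<close>

definition probe_div :: "'a::euclidean_space \<Rightarrow> real \<Rightarrow> 'a \<Rightarrow> real" where
  "probe_div a T x = 2 * probe' T ((norm (x - a))\<^sup>2) * (norm (x - a))\<^sup>2 + real DIM('a) * probe T ((norm (x - a))\<^sup>2)"

lemma probe_support:
  assumes "1 < T" "norm a + T \<le> norm x"
  shows "\<not> (norm (x - a))\<^sup>2 < T"
proof -
  have "T \<le> norm (x - a)" using norm_triangle_ineq2[of x a] assms by linarith
  then have "1 * T \<le> norm (x - a) * norm (x - a)" using assms by (intro mult_mono) auto
  then show ?thesis by (simp add: power2_eq_square)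
qed

lemma probe_integrable:
  fixes a :: "'a::euclidean_space"
  assumes T: "1 < T"
  shows "integrable lborel (\<lambda>x. probe T ((norm (x - a))\<^sup>2) * (norm (x - a))\<^sup>2)" "integrable lborel (probe_div a T)"
    "sq_integrable (\<lambda>x. probe T ((norm (x - a))\<^sup>2) *\<^sub>R (x - a))"
proof -
  have c: "continuous_on UNIV (\<lambda>x. probe T ((norm (x - a))\<^sup>2))" "continuous_on UNIV (\<lambda>x. probe' T ((norm (x - a))\<^sup>2))"
    by (intro continuous_on_compose2[OF continuous_probe(1)] continuous_on_compose2[OF continuous_probe(2)] continuous_intros; simp)+
  have z: "probe T ((norm (x - a))\<^sup>2) = 0" "probe' T ((norm (x - a))\<^sup>2) = 0" if "norm a + T \<le> norm x" for x
    using probe_outside[OF T] probe_support[OF T that] by blast+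
  show "integrable lborel (\<lambda>x. probe T ((norm (x - a))\<^sup>2) * (norm (x - a))\<^sup>2)"
    by (rule continuous_compact_support(1)[where R = "norm a + T"]) (intro continuous_intros c, simp add: z)
  show "integrable lborel (probe_div a T)"
    unfolding probe_div_def[abs_def]
    by (rule continuous_compact_support(1)[where R = "norm a + T"]) (intro continuous_intros c, simp add: z)
  show "sq_integrable (\<lambda>x. probe T ((norm (x - a))\<^sup>2) *\<^sub>R (x - a))"
    by (rule continuous_compact_support_sq_integrable[where R = "norm a + T"]) (intro continuous_intros c, simp add: z)
qed

lemma probe_mass_pos:
  fixes a :: "'a::euclidean_space"
  assumes T: "1 < T"
  shows "0 < probe_mass a T"
proof -
  have nn: "0 \<le> probe T ((norm (x - a))\<^sup>2) * (norm (x - a))\<^sup>2" for x by (simp add: probe_def)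
  have "0 \<le> probe_mass a T" unfolding probe_mass_def using nn by (intro integral_nonneg_AE AE_I2) auto
  moreover have "probe_mass a T \<noteq> 0"
  proof
    assume "probe_mass a T = 0"
    then have "AE x in lborel. probe T ((norm (x - a))\<^sup>2) * (norm (x - a))\<^sup>2 = 0"
      unfolding probe_mass_def using nn by (subst (asm) integral_nonneg_eq_0_iff_AE[OF probe_integrable(1)[OF T]]) auto
    then have ae: "AE x in completion lborel. x \<notin> {x. 1 < (norm (x - a))\<^sup>2 \<and> (norm (x - a))\<^sup>2 < T}"
      unfolding AE_completion_iff
    proof eventually_elim
      case (elim x)
      show ?case
      proof
        assume "x \<in> {x. 1 < (norm (x - a))\<^sup>2 \<and> (norm (x - a))\<^sup>2 < T}"
        then have "1 < (norm (x - a))\<^sup>2" "(norm (x - a))\<^sup>2 < T" by auto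
        then have "0 < probe T ((norm (x - a))\<^sup>2) * (norm (x - a))\<^sup>2"
          unfolding probe_def by (intro mult_pos_pos zero_less_power) (auto simp: less_max_iff_disj)
        then show False using elim by simp
      qed
    qed
    have op: "open {x. 1 < (norm (x - a))\<^sup>2 \<and> (norm (x - a))\<^sup>2 < T}"
      by (intro open_Collect_conj open_Collect_less continuous_intros)
    obtain b :: 'a where b: "b \<in> Basis" using nonempty_Basis by blast
    define r where "r = sqrt ((1 + T) / 2)"
    have "r\<^sup>2 = (1 + T) / 2" using T by (simp add: r_def)
    then have "a + r *\<^sub>R b \<in> {x. 1 < (norm (x - a))\<^sup>2 \<and> (norm (x - a))\<^sup>2 < T}" using T b by (simp add: power_mult_distrib)
    then have "\<not> negligible {x. 1 < (norm (x - a))\<^sup>2 \<and> (norm (x - a))\<^sup>2 < T}" using open_not_negligible[OF op] by blast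
    moreover have "negligible {x. 1 < (norm (x - a))\<^sup>2 \<and> (norm (x - a))\<^sup>2 < T}"
    proof -
      have "{x. 1 < (norm (x - a))\<^sup>2 \<and> (norm (x - a))\<^sup>2 < T} \<in> sets lebesgue"
        using borel_open[OF op] by (simp add: sets_completionI_sets)
      then have "{x. 1 < (norm (x - a))\<^sup>2 \<and> (norm (x - a))\<^sup>2 < T} \<in> null_sets (completion lborel)"
        using ae by (subst AE_iff_null_sets) auto
      then show ?thesis by (simp add: negligible_iff_null_sets)
    qed
    ultimately show False by blast
  qed
  ultimately show ?thesis by simp
qed

context shells
begin

definition slope :: real where "slope = (pi / 2) / ell"
text \<open>Interpolates the turning values at the interfaces linearly in the squared radius. In
  every shell a competitor differs from it by at most \<pi>/2, while its slope is proportional to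
  m.\<close>

definition lin :: "real \<Rightarrow> real" where "lin t = tau 0 + (t - 1) * slope"
definition lin_cut :: "real \<Rightarrow> real \<Rightarrow> real" where "lin_cut c t = plateau (t / (2 * T)) * (lin t + c)"
definition lin_cut' :: "real \<Rightarrow> real \<Rightarrow> real" where
  "lin_cut' c t = (plateau' (t / (2 * T)) * (1 / (2 * T))) * (lin t + c) + slope * plateau (t / (2 * T))"

lemma slope_pos: "0 < slope" using ell(1) by (simp add: slope_def)

lemma slope_eq: "slope = (pi / 2) * real m / (T - 1)" using m T by (simp add: slope_def ell_def)

lemma lin_tau: "lin (1 + real j * ell) = tau (int j)"
  using ell(1) by (simp add: lin_def slope_def tau_def)

lemma lin_mono: "s \<le> t \<Longrightarrow> lin s \<le> lin t"
  unfolding lin_def using slope_pos by (simp add: mult_right_mono)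

lemma lin_shell:
  assumes "layer x = int j" "j < m" shows "tau (int j) \<le> lin (\<rho> x)" "lin (\<rho> x) \<le> tau (int j + 1)"
proof -
  show "tau (int j) \<le> lin (\<rho> x)"
    unfolding lin_tau[symmetric] by (rule lin_mono[OF layer_shell(1)[OF assms]])
  have "lin (\<rho> x) \<le> lin (1 + (real j + 1) * ell)" using layer_shell(2)[OF assms] by (intro lin_mono) simp
  also have "\<dots> = tau (int j + 1)" using lin_tau[of "Suc j"] by (simp add: add.commute)
  finally show "lin (\<rho> x) \<le> tau (int j + 1)" .
qed

lemma C1c_lin_cut: "C1c (\<lambda>x. lin_cut c (\<rho> x)) (\<lambda>x. (2 * lin_cut' c (\<rho> x)) *\<^sub>R (x - x\<^sub>0))"
  unfolding \<rho>_def
proof (rule C1c_radial[of "lin_cut c" "lin_cut' c" "4 * T"])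
  fix t
  have 1: "((\<lambda>t. t / (2 * T)) has_real_derivative 1 / (2 * T)) (at t)" by (rule DERIV_cdivide[OF DERIV_ident])
  have 2: "((\<lambda>t. lin t + c) has_real_derivative slope) (at t)"
    unfolding lin_def by (auto intro!: derivative_eq_intros)
  show "(lin_cut c has_real_derivative lin_cut' c t) (at t)"
    unfolding lin_cut_def[abs_def] lin_cut'_def by (rule DERIV_mult[OF DERIV_chain2[OF DERIV_plateau 1] 2])
next
  have p: "continuous_on UNIV plateau"
    by (rule DERIV_continuous_on[OF has_field_derivative_at_within[OF DERIV_plateau]])
  have d: "continuous_on UNIV (\<lambda>t. t / (2 * T))" by (rule continuous_on_divide[OF continuous_on_id continuous_on_const]) (use T in simp)
  have p1: "continuous_on UNIV (\<lambda>t. plateau (t / (2 * T)))" by (rule continuous_on_compose2[OF p d]) simp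
  have p2: "continuous_on UNIV (\<lambda>t. plateau' (t / (2 * T)))" by (rule continuous_on_compose2[OF continuous_plateau' d]) simp
  show "continuous_on UNIV (lin_cut' c)"
    unfolding lin_cut'_def[abs_def] lin_def by (intro continuous_intros p1 p2)
next
  fix t assume "4 * T \<le> t"
  then have "2 \<le> t / (2 * T)" using T by (simp add: pos_le_divide_eq)
  then show "lin_cut c t = 0" "lin_cut' c t = 0" by (simp_all add: lin_cut_def lin_cut'_def plateau_simps)
qed

lemma lin_cut_near: "t \<le> 2 * T \<Longrightarrow> lin_cut c t = lin t + c" "t \<le> 2 * T \<Longrightarrow> lin_cut' c t = slope"
proof -
  assume "t \<le> 2 * T"
  then have "t / (2 * T) \<le> 1" using T by simp
  then show "lin_cut c t = lin t + c" "lin_cut' c t = slope" by (simp_all add: lin_cut_def lin_cut'_def plateau_simps)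
qed

lemma lin_far: "2 * T \<le> t \<Longrightarrow> 0 \<le> lin t"
proof -
  assume t: "2 * T \<le> t"
  have "lin (2 * T) = tau 0 + 2 * ((T - 1) * slope) + slope" unfolding lin_def by (simp add: algebra_simps)
  also have "(T - 1) * slope = real m * (pi / 2)" using T by (simp add: slope_eq field_simps)
  also have "tau 0 + 2 * (real m * (pi / 2)) + slope = real m * (pi / 2) - pi / 4 + slope" by (simp add: tau_def)
  finally have "lin (2 * T) = real m * (pi / 2) - pi / 4 + slope" .
  moreover have "1 * (pi / 2) \<le> real m * (pi / 2)" using m by (intro mult_right_mono) auto
  ultimately have "0 \<le> lin (2 * T)" using slope_pos pi_gt_zero by linarith
  then show "0 \<le> lin t" using lin_mono[OF t] by linarith
qed

text \<open>The competitor is \<open>lin\<close> clamped to the interval from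
  \<open>tau (-1)\<close> to 0: constant deep in the core, linear across the shells, and 0 far out.
  A difference of positive parts of two cut-off affine functions realises the clamping inside the
  Sobolev space.\<close>

lemma admissible_exists: "\<exists>w g. admissible w g"
proof -
  define c where "c = - tau (-1)"
  have tm: "tau (int m) = - (pi / 4)" by (simp add: tau_def)
  have c: "- c = tau (-1)" "tau (-1) \<le> tau 0" "tau 0 \<le> tau (int m)" by (simp_all add: c_def tau_mono)
  define w where "w x = max 0 (- lin_cut c (\<rho> x)) - max 0 (- lin_cut 0 (\<rho> x))" for x
  have s: "sobolev (\<lambda>x. - lin_cut d (\<rho> x)) (\<lambda>x. - ((2 * lin_cut' d (\<rho> x)) *\<^sub>R (x - x\<^sub>0)))" for d
    using sobolev_scale[OF C1c_sobolev[OF C1c_lin_cut[of d]], of "-1"] by simp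
  obtain g where sw: "sobolev w g"
    using sobolev_diff[OF sobolev_pos_part[OF s[of c]] sobolev_pos_part[OF s[of 0]]] unfolding w_def[abs_def] by blast
  have near: "w x = max 0 (- lin (\<rho> x) - c) - max 0 (- lin (\<rho> x))" if "\<rho> x \<le> 2 * T" for x
    unfolding w_def lin_cut_near(1)[OF that] by (simp add: algebra_simps)
  have c0: "0 \<le> c" using c tm pi_gt_zero by linarith
  have far: "w x = 0" if "2 * T \<le> \<rho> x" for x
  proof -
    have "0 \<le> lin_cut d (\<rho> x)" if "0 \<le> d" for d
      unfolding lin_cut_def using lin_far[OF \<open>2 * T \<le> \<rho> x\<close>] that plateau_simps(3) by (intro mult_nonneg_nonneg) auto
    from this[of c] this[of 0] c0 show ?thesis by (simp add: w_def)
  qed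
  have constr: "lo x \<le> w x \<and> w x \<le> hi x" for x
  proof -
    consider "layer x = -1" | "layer x = int m" "\<rho> x \<le> 2 * T" | "layer x = int m" "2 * T \<le> \<rho> x" | "0 \<le> layer x" "layer x < int m"
      using layer_bounds[of x] by linarith
    then show ?thesis
    proof cases
      case 1
      then have r: "\<rho> x < 1" using layer_core by blast
      then have n: "w x = max 0 (- lin (\<rho> x) - c) - max 0 (- lin (\<rho> x))" using T by (intro near) simp
      have l: "lin (\<rho> x) \<le> tau 0" using lin_mono[of "\<rho> x" 1] r lin_tau[of 0] by simp
      have "lo x = - c" "hi x = tau 0" using 1 c(1) by (simp_all add: lo_tau hi_tau)
      then show ?thesis using n l c tm pi_gt_zero by (intro conjI; linarith)
    next
      case 2
      have "T \<le> \<rho> x" using 2 layer_far by blast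
      then have "tau (int m) \<le> lin (\<rho> x)" using lin_mono[of T "\<rho> x"] lin_tau[of m] ell(2) by simp
      moreover have "lo x = tau (int m)" "hi x = tau (int m) + pi / 2" using 2 by (simp_all add: lo_tau hi_def)
      ultimately show ?thesis using near[OF 2(2)] c tm pi_gt_zero by (intro conjI; linarith)
    next
      case 3
      then show ?thesis using far[OF 3(2)] tm pi_gt_zero by (simp add: lo_tau hi_def)
    next
      case 4
      define j where "j = nat (layer x)"
      have j: "layer x = int j" "j < m" using 4 by (auto simp: j_def)
      have "\<rho> x \<le> 2 * T" using layer_shell(3)[OF j] T by linarith
      note n = near[OF this]
      have "tau 0 \<le> tau (int j)" "tau (int j + 1) \<le> tau (int m)" using j(2) by (auto intro!: tau_mono)
      then have "w x = lin (\<rho> x)" using n lin_shell[OF j] c tm pi_gt_zero by linarith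
      then show ?thesis using lin_shell[OF j] j(1) by (simp add: lo_tau hi_tau)
    qed
  qed
  have wm: "w \<in> borel_measurable borel" using sw by (simp add: sobolev_def sq_integrable_def)
  have sn0: "sn 0 = 0" using sn_minus[of 0] by simp
  have F0: "F 0 = 0" using F_le[of 0] F_nonneg[of 0] by simp
  define R where "R = norm x\<^sub>0 + 2 * T"
  have w0: "w x = 0" if "\<not> norm x \<le> R" for x
  proof (rule far)
    have "2 * T \<le> norm (x - x\<^sub>0)" using norm_triangle_ineq2[of x x\<^sub>0] that unfolding R_def by linarith
    then have "1 * (2 * T) \<le> norm (x - x\<^sub>0) * norm (x - x\<^sub>0)" using T by (intro mult_mono) auto
    then show "2 * T \<le> \<rho> x" by (simp add: \<rho>_def power2_eq_square)
  qed
  obtain M where M: "0 < M" "\<And>x. norm x \<le> R \<Longrightarrow> \<bar>V x\<bar> \<le> M" "\<And>s. \<bar>s\<bar> \<le> 1 \<Longrightarrow> \<bar>f s\<bar> \<le> M"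
    by (rule local_bound[of R]) (rule that, assumption+)
  have Pb: "\<bar>P x (w x)\<bar> \<le> (M + C\<^sub>F) * indicator (cball 0 R) x" for x
  proof (cases "norm x \<le> R")
    case True
    have "\<bar>P x (w x)\<bar> \<le> M + C\<^sub>F" unfolding P_def by (rule Q_bound[OF M(2)[OF True] sn_le])
    then show ?thesis using True by simp
  next
    case False
    then show ?thesis using w0[OF False] sn0 F0 by (simp add: P_def Q_def)
  qed
  have "integrable lborel (\<lambda>x. P x (w x))"
  proof (rule Bochner_Integration.integrable_bound)
    show "integrable lborel (\<lambda>x::'a. (M + C\<^sub>F) * indicator (cball 0 R) x)"
      by (rule Bochner_Integration.integrable_mult_right[OF integrable_indicator_cball])
    show "(\<lambda>x. P x (w x)) \<in> borel_measurable lborel" using measurable_P[OF wm] by simp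
    show "AE x in lborel. norm (P x (w x)) \<le> norm ((M + C\<^sub>F) * indicator (cball 0 R) x)"
      using Pb by (intro AE_I2) (metis abs_ge_self order_trans real_norm_def)
  qed
  then have "admissible w g" unfolding admissible_def using sw constr by simp
  then show ?thesis by blast
qed

lemma minimiser_ex: "\<exists>w g. minimiser w g"
  using admissible_exists minimiser_exists unfolding minimiser_def by metis

text \<open>The gradient is paired with the radial test field. Replacing w by \<open>lin\<close>
  costs, after integration by parts, at most \<pi>/2 times the integral of the absolute divergence,
  a number independent of m; \<open>lin\<close> itself contributes a term proportional to its slope,
  hence to m. Young's inequality turns the pairing into a bound for
  \<open>sq_norm g\<close>.\<close>

lemma sq_norm_gradient_lower:
  assumes adm: "admissible w g"
  shows "2 * slope * probe_mass x\<^sub>0 T - pi / 2 * (\<integral>x. \<bar>probe_div x\<^sub>0 T x\<bar> \<partial>lborel)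
     - sq_norm (\<lambda>x. probe T ((norm (x - x\<^sub>0))\<^sup>2) *\<^sub>R (x - x\<^sub>0)) \<le> sq_norm g"
proof -
  have sw: "sobolev w g" and cw: "AE x in lborel. lo x \<le> w x \<and> w x \<le> hi x" using adm by (auto simp: admissible_def)
  let ?G = "\<lambda>x. (2 * lin_cut' 0 (\<rho> x)) *\<^sub>R (x - x\<^sub>0)" and ?p = "\<lambda>x. probe T (\<rho> x)"
  let ?F = "\<lambda>x. probe T (\<rho> x) *\<^sub>R (x - x\<^sub>0)"
  have s: "sobolev (\<lambda>x. w x - lin_cut 0 (\<rho> x)) (\<lambda>x. g x - ?G x)"
    by (rule sobolev_diff[OF sw C1c_sobolev[OF C1c_lin_cut]])
  have F: "sq_integrable ?F" unfolding \<rho>_def by (rule probe_integrable(3)[OF T])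
  note gs = sobolev_sq_integrable(2)[OF sw] and Gs = C1c_sq_integrable(2)[OF C1c_lin_cut[of 0]]
  have ibp: "(\<integral>x. ?p x * ((x - x\<^sub>0) \<bullet> (g x - ?G x)) \<partial>lborel) = - (\<integral>x. (w x - lin_cut 0 (\<rho> x)) * probe_div x\<^sub>0 T x \<partial>lborel)"
    using sobolev_ibp_radial[OF s C1c_probe[OF T, of x\<^sub>0], of x\<^sub>0]
    unfolding \<rho>_def probe_div_def by (simp add: power2_norm_eq_inner[symmetric])
  have kz: "1 < \<rho> x \<and> \<rho> x < T" if "probe_div x\<^sub>0 T x \<noteq> 0" for x
  proof (rule ccontr)
    assume "\<not> (1 < \<rho> x \<and> \<rho> x < T)"
    from probe_outside[OF T this] have "probe_div x\<^sub>0 T x = 0" unfolding probe_div_def \<rho>_def[symmetric] by simp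
    with that show False by simp
  qed
  have bound: "AE x in lborel. \<bar>(w x - lin_cut 0 (\<rho> x)) * probe_div x\<^sub>0 T x\<bar> \<le> pi / 2 * \<bar>probe_div x\<^sub>0 T x\<bar>"
    using cw
  proof eventually_elim
    case (elim x)
    show ?case
    proof (cases "probe_div x\<^sub>0 T x = 0")
      case False
      note r = kz[OF False]
      have "0 \<le> layer x" "layer x < int m"
        using layer_core[of x] layer_far[of x] layer_bounds[of x] r by linarith+
      then obtain j where j: "layer x = int j" "j < m" by (metis nonneg_int_cases of_nat_less_iff)
      have "\<bar>w x - lin (\<rho> x)\<bar> \<le> pi / 2"
        using lin_shell[OF j] elim unfolding lo_tau hi_tau tau_add j(1) by linarith
      moreover have "lin_cut 0 (\<rho> x) = lin (\<rho> x)" using lin_cut_near(1)[of "\<rho> x" 0] r T by simp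
      ultimately show ?thesis unfolding abs_mult by (intro mult_right_mono) auto
    qed simp
  qed
  have ki: "integrable lborel (\<lambda>x. pi / 2 * \<bar>probe_div x\<^sub>0 T x\<bar>)" using probe_integrable(2)[OF T, of x\<^sub>0] by simp
  have "\<bar>\<integral>x. (w x - lin_cut 0 (\<rho> x)) * probe_div x\<^sub>0 T x \<partial>lborel\<bar> \<le> (\<integral>x. pi / 2 * \<bar>probe_div x\<^sub>0 T x\<bar> \<partial>lborel)"
  proof -
    have m: "(\<lambda>x. (w x - lin_cut 0 (\<rho> x)) * probe_div x\<^sub>0 T x) \<in> borel_measurable lborel"
      using sobolev_measurable(1)[OF s] borel_measurable_integrable[OF probe_integrable(2)[OF T, of x\<^sub>0]] by simp
    have i: "integrable lborel (\<lambda>x. (w x - lin_cut 0 (\<rho> x)) * probe_div x\<^sub>0 T x)"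
      by (rule Bochner_Integration.integrable_bound[OF ki m]) (use bound in \<open>eventually_elim, simp\<close>)
    have "\<bar>\<integral>x. (w x - lin_cut 0 (\<rho> x)) * probe_div x\<^sub>0 T x \<partial>lborel\<bar> \<le> (\<integral>x. \<bar>(w x - lin_cut 0 (\<rho> x)) * probe_div x\<^sub>0 T x\<bar> \<partial>lborel)"
      by simp
    also have "\<dots> \<le> (\<integral>x. pi / 2 * \<bar>probe_div x\<^sub>0 T x\<bar> \<partial>lborel)"
      using i ki bound by (intro integral_mono_AE) auto
    finally show ?thesis .
  qed
  then have 1: "\<bar>\<integral>x. (w x - lin_cut 0 (\<rho> x)) * probe_div x\<^sub>0 T x \<partial>lborel\<bar> \<le> pi / 2 * (\<integral>x. \<bar>probe_div x\<^sub>0 T x\<bar> \<partial>lborel)" by simp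
  have FG: "?F x \<bullet> ?G x = 2 * slope * (probe T (\<rho> x) * \<rho> x)" for x
  proof (cases "1 < \<rho> x \<and> \<rho> x < T")
    case True
    then have "lin_cut' 0 (\<rho> x) = slope" using T by (intro lin_cut_near(2)) simp
    moreover have "(x - x\<^sub>0) \<bullet> (x - x\<^sub>0) = \<rho> x" by (simp add: \<rho>_def power2_norm_eq_inner)
    ultimately show ?thesis by simp
  next
    case False
    then show ?thesis using probe_outside(1)[OF T False] by simp
  qed
  have "(\<integral>x. ?F x \<bullet> g x \<partial>lborel) = (\<integral>x. ?F x \<bullet> (g x - ?G x) \<partial>lborel) + (\<integral>x. ?F x \<bullet> ?G x \<partial>lborel)"
    using sq_integrable_inner[OF F gs] sq_integrable_inner[OF F Gs] by (simp add: inner_diff_right)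
  also have "(\<integral>x. ?F x \<bullet> (g x - ?G x) \<partial>lborel) = - (\<integral>x. (w x - lin_cut 0 (\<rho> x)) * probe_div x\<^sub>0 T x \<partial>lborel)"
    using ibp by simp
  also have "(\<integral>x. ?F x \<bullet> ?G x \<partial>lborel) = 2 * slope * probe_mass x\<^sub>0 T"
    unfolding FG probe_mass_def by (simp add: \<rho>_def)
  finally have "2 * slope * probe_mass x\<^sub>0 T - pi / 2 * (\<integral>x. \<bar>probe_div x\<^sub>0 T x\<bar> \<partial>lborel) \<le> (\<integral>x. ?F x \<bullet> g x \<partial>lborel)"
    using 1 by linarith
  also have "\<dots> \<le> 1 * sq_norm ?F + sq_norm g / 1"
    using sq_norm_inner_le[OF F gs, of 1] by linarith
  finally show ?thesis unfolding \<rho>_def by simp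
qed

lemma J_lower:
  assumes B: "\<And>w. w \<in> borel_measurable borel \<Longrightarrow> integrable lborel (\<lambda>x. P x (w x)) \<Longrightarrow> - B \<le> (\<integral>x. P x (w x) \<partial>lborel)"
    and adm: "admissible w g"
  shows "slope * probe_mass x\<^sub>0 T - pi / 4 * (\<integral>x. \<bar>probe_div x\<^sub>0 T x\<bar> \<partial>lborel)
     - sq_norm (\<lambda>x. probe T ((norm (x - x\<^sub>0))\<^sup>2) *\<^sub>R (x - x\<^sub>0)) / 2 - B \<le> J w g"
proof -
  have "- B \<le> (\<integral>x. P x (w x) \<partial>lborel)"
    using adm by (intro B) (auto simp: admissible_def sobolev_def sq_integrable_def)
  with sq_norm_gradient_lower[OF adm] show ?thesis unfolding J_def by linarith
qed

end

section \<open>Uniqueness of weak gradients\<close>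

text \<open>Derivatives of the standard flat function exp (-1/t) are linear combinations of members
  of this family, so the family is closed under differentiation up to linear combinations.\<close>

definition flat :: "nat \<Rightarrow> real \<Rightarrow> real" where
  "flat j t = (if 0 < t then inverse t ^ j * exp (- inverse t) else 0)"

lemma tendsto_flat_0: "(flat j \<longlongrightarrow> 0) (at 0)"
proof (rule filterlim_split_at)
  have "\<forall>\<^sub>F t::real in at_left 0. 0 = flat j t"
    unfolding eventually_at_filter by (rule always_eventually) (auto simp: flat_def)
  then show "(flat j \<longlongrightarrow> 0) (at_left 0)" by (rule Lim_transform_eventually[OF tendsto_const])
next
  have "((\<lambda>t::real. inverse t ^ j / exp (inverse t)) \<longlongrightarrow> 0) (at_right 0)"
    by (rule filterlim_compose[OF tendsto_power_div_exp_0 filterlim_inverse_at_top_right])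
  moreover have "\<forall>\<^sub>F t::real in at_right 0. inverse t ^ j / exp (inverse t) = flat j t"
    unfolding eventually_at_filter by (rule always_eventually) (auto simp: flat_def exp_minus divide_inverse)
  ultimately show "(flat j \<longlongrightarrow> 0) (at_right 0)" by (rule Lim_transform_eventually)
qed

lemma DERIV_flat: "(flat j has_real_derivative flat (j + 2) t - real j * flat (j + 1) t) (at t)"
proof -
  consider "t < 0" | "t = 0" | "0 < t" by linarith
  then show ?thesis
  proof cases
    case 1
    have "((\<lambda>_. 0) has_real_derivative 0) (at t)" by simp
    then have "(flat j has_real_derivative 0) (at t)"
      by (rule has_field_derivative_transform_within_open[where S = "{..<0}"]) (use 1 in \<open>auto simp: flat_def\<close>)
    then show ?thesis using 1 by (simp add: flat_def)
  next
    case 2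
    have "\<forall>\<^sub>F h::real in at 0. flat (j + 1) h = (flat j (0 + h) - flat j 0) / h"
      unfolding eventually_at_filter by (rule always_eventually) (auto simp: flat_def field_simps)
    from Lim_transform_eventually[OF tendsto_flat_0 this] show ?thesis using 2 by (simp add: DERIV_def flat_def)
  next
    case 3
    have "((\<lambda>t. inverse t ^ j * exp (- inverse t)) has_real_derivative
        (real j * inverse t ^ (j - 1) * (- (inverse t * inverse t))) * exp (- inverse t)
          + (exp (- inverse t) * (inverse t * inverse t)) * inverse t ^ j) (at t)"
      using 3 by (auto intro!: derivative_eq_intros simp: power2_eq_square)
    moreover have "(real j * inverse t ^ (j - 1) * (- (inverse t * inverse t))) * exp (- inverse t)
          + (exp (- inverse t) * (inverse t * inverse t)) * inverse t ^ j = flat (j + 2) t - real j * flat (j + 1) t"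
      using 3 by (cases j) (simp_all add: flat_def algebra_simps)
    ultimately have "((\<lambda>t. inverse t ^ j * exp (- inverse t)) has_real_derivative flat (j + 2) t - real j * flat (j + 1) t) (at t)" by simp
    then show ?thesis
      by (rule has_field_derivative_transform_within_open[where S = "{0<..}"]) (use 3 in \<open>auto simp: flat_def\<close>)
  qed
qed

lemma flat_0_bounds: "0 \<le> flat 0 t" "flat 0 t \<le> 1" "t \<le> 0 \<Longrightarrow> flat 0 t = 0"
  by (auto simp: flat_def)

lemma flat_0_tendsto: "(\<lambda>n. flat 0 (real (Suc n) * t)) \<longlonglongrightarrow> (if 0 < t then 1 else 0)"
proof (cases "0 < t")
  case True
  have "(\<lambda>n. inverse (real (Suc n)) * inverse t) \<longlonglongrightarrow> 0 * inverse t"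
    by (intro tendsto_mult LIMSEQ_inverse_real_of_nat tendsto_const)
  then have "(\<lambda>n. exp (- (inverse (real (Suc n)) * inverse t))) \<longlonglongrightarrow> exp (- (0 * inverse t))"
    by (intro tendsto_exp tendsto_minus)
  moreover have "flat 0 (real (Suc n) * t) = exp (- (inverse (real (Suc n)) * inverse t))" for n
    using True by (simp add: flat_def)
  ultimately show ?thesis using True by simp
next
  case False
  then have "flat 0 (real (Suc n) * t) = 0" for n by (intro flat_0_bounds(3)) (auto intro: mult_nonneg_nonpos)
  then show ?thesis using False by simp
qed

text \<open>A class closed under partial derivatives. All \<open>Ck\<close> then follow by one
  induction on the order, without computing higher derivatives.\<close>

inductive flat_smooth :: "(real ^ 'n \<Rightarrow> real) \<Rightarrow> bool" where
  const: "flat_smooth (\<lambda>_. c)"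
| coord: "flat_smooth (\<lambda>x. x $ i)"
| add: "flat_smooth p \<Longrightarrow> flat_smooth q \<Longrightarrow> flat_smooth (\<lambda>x. p x + q x)"
| mult: "flat_smooth p \<Longrightarrow> flat_smooth q \<Longrightarrow> flat_smooth (\<lambda>x. p x * q x)"
| flat: "flat_smooth p \<Longrightarrow> flat_smooth (\<lambda>x. flat j (p x))"

lemma flat_smooth_derivative:
  assumes "flat_smooth p"
  shows "\<exists>D. (\<forall>x. (p has_derivative D x) (at x)) \<and> (\<forall>v. flat_smooth (\<lambda>x. D x v))"
  using assms
proof induction
  case (const c)
  show ?case by (rule exI[of _ "\<lambda>_ _. 0"]) (auto intro: flat_smooth.const)
next
  case (coord i)
  show ?case
    by (rule exI[of _ "\<lambda>x v. v $ i"])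
      (auto intro!: flat_smooth.const bounded_linear.has_derivative[OF bounded_linear_vec_nth] has_derivative_ident)
next
  case (add p q)
  then obtain D D' where "\<forall>x. (p has_derivative D x) (at x)" "\<forall>v. flat_smooth (\<lambda>x. D x v)"
    "\<forall>x. (q has_derivative D' x) (at x)" "\<forall>v. flat_smooth (\<lambda>x. D' x v)" by blast
  then show ?case
    by (intro exI[of _ "\<lambda>x v. D x v + D' x v"] conjI allI flat_smooth.add has_derivative_add) auto
next
  case (mult p q)
  then obtain D D' where "\<forall>x. (p has_derivative D x) (at x)" "\<forall>v. flat_smooth (\<lambda>x. D x v)"
    "\<forall>x. (q has_derivative D' x) (at x)" "\<forall>v. flat_smooth (\<lambda>x. D' x v)" by blast
  with mult.hyps show ?case
    by (intro exI[of _ "\<lambda>x v. p x * D' x v + D x v * q x"] conjI allI flat_smooth.add flat_smooth.mult has_derivative_mult) auto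
next
  case (flat p j)
  then obtain D where D: "\<forall>x. (p has_derivative D x) (at x)" "\<forall>v. flat_smooth (\<lambda>x. D x v)" by blast
  have "((\<lambda>x. flat j (p x)) has_derivative (\<lambda>v. (flat (j + 2) (p x) + (- real j) * flat (j + 1) (p x)) * D x v)) (at x)" for x
    using has_derivative_compose[OF D(1)[rule_format, of x] DERIV_flat[of j "p x", unfolded has_field_derivative_def]]
    by simp
  with D(2) flat.hyps show ?case
    by (intro exI[of _ "\<lambda>x v. (flat (j + 2) (p x) + (- real j) * flat (j + 1) (p x)) * D x v"] conjI allI
        flat_smooth.add flat_smooth.mult flat_smooth.const flat_smooth.flat) auto
qed

lemma flat_smooth_Ck: "flat_smooth p \<Longrightarrow> Ck m p"
proof (induction m arbitrary: p)
  case 0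
  then show ?case
    using flat_smooth_derivative[OF 0]
    by (auto simp: continuous_on_eq_continuous_at intro: has_derivative_continuous)
next
  case (Suc m)
  obtain D where D: "\<forall>x. (p has_derivative D x) (at x)" "\<forall>v. flat_smooth (\<lambda>x. D x v)"
    using flat_smooth_derivative[OF Suc.prems] by blast
  have "grad p x $ i = D x (axis i 1)" for x i
    using frechet_derivative_at[OF D(1)[rule_format, of x]] by (simp add: grad_def)
  then show ?case using D Suc.IH by (auto simp: differentiable_def)
qed

lemma flat_smooth_prod:
  assumes "finite I" "\<And>i. i \<in> I \<Longrightarrow> flat_smooth (p i)" shows "flat_smooth (\<lambda>x. \<Prod>i\<in>I. p i x)"
  using assms by (induction I rule: finite_induct) (auto intro: flat_smooth.const flat_smooth.mult)

text \<open>Steepening with n, these test functions converge pointwise to the indicator of the open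
  box, which lets integrals over boxes be computed from the definition of a weak gradient.\<close>

definition box_bump :: "real ^ 'n \<Rightarrow> real ^ 'n \<Rightarrow> nat \<Rightarrow> real ^ 'n \<Rightarrow> real" where
  "box_bump l u n x = (\<Prod>i\<in>UNIV. flat 0 (real (Suc n) * (x $ i + - l $ i)) * flat 0 (real (Suc n) * (u $ i + (-1) * x $ i)))"

lemma box_bump_bounds: "0 \<le> box_bump l u n x" "box_bump l u n x \<le> 1"
  unfolding box_bump_def by (auto intro!: prod_nonneg prod_le_1 mult_nonneg_nonneg mult_le_one flat_0_bounds)

lemma box_bump_outside: "x \<notin> cbox l u \<Longrightarrow> box_bump l u n x = 0"
proof -
  assume "x \<notin> cbox l u"
  then obtain i where "x $ i < l $ i \<or> u $ i < x $ i" by (auto simp: mem_box_cart not_le)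
  then have "flat 0 (real (Suc n) * (x $ i + - l $ i)) * flat 0 (real (Suc n) * (u $ i + (-1) * x $ i)) = 0"
    by (auto intro!: flat_0_bounds(3) mult_nonneg_nonpos)
  then show ?thesis unfolding box_bump_def by (intro prod_zero) auto
qed

lemma box_bump_test: "box_bump l u n \<in> test_functions"
proof -
  have "flat_smooth (box_bump l u n)"
    unfolding box_bump_def[abs_def]
    by (intro flat_smooth_prod flat_smooth.intros finite_class.finite_UNIV)
  moreover have "compact (closure {x. box_bump l u n x \<noteq> 0})"
  proof -
    have "{x. box_bump l u n x \<noteq> 0} \<subseteq> cbox l u" using box_bump_outside by blast
    then have "closure {x. box_bump l u n x \<noteq> 0} \<subseteq> cbox l u" by (intro closure_minimal closed_cbox)
    then show ?thesis by (meson bounded_subset bounded_cbox closed_closure compact_eq_bounded_closed)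
  qed
  ultimately show ?thesis by (simp add: test_functions_def flat_smooth_Ck)
qed

lemma box_bump_tendsto: "(\<lambda>n. box_bump l u n x) \<longlonglongrightarrow> indicator (box l u) x"
proof -
  have "(\<lambda>n. box_bump l u n x) \<longlonglongrightarrow> (\<Prod>i\<in>UNIV. (if 0 < x $ i + - l $ i then 1 else 0) * (if 0 < u $ i + (-1) * x $ i then 1 else 0))"
    unfolding box_bump_def by (intro tendsto_prod tendsto_mult flat_0_tendsto)
  also have "(\<Prod>i\<in>UNIV. (if 0 < x $ i + - l $ i then 1 else 0) * (if 0 < u $ i + (-1) * x $ i then 1 else (0::real))) = indicator (box l u) x"
  proof (cases "x \<in> box l u")
    case True
    then show ?thesis by (auto simp: mem_box_cart intro!: prod.neutral)
  next
    case False
    then obtain i where "\<not> (l $ i < x $ i \<and> x $ i < u $ i)" by (auto simp: mem_box_cart)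
    then show ?thesis using False by (auto intro!: prod_zero bexI[of _ i])
  qed
  finally show ?thesis .
qed

text \<open>Open boxes are stable under intersection and generate the Borel sets, so the vanishing
  extends to all Borel sets; the hypothesis on the total integral is what complements need.\<close>

lemma AE_zero_if_zero_on_boxes:
  fixes h :: "'a::euclidean_space \<Rightarrow> real"
  assumes h: "integrable lborel h" and total: "(\<integral>x. h x \<partial>lborel) = 0"
    and boxes: "\<And>l u. set_lebesgue_integral lborel (box l u) h = 0"
  shows "AE x in lborel. h x = 0"
proof (rule density_unique_real[OF h])
  have si: "set_integrable lborel A h" if "A \<in> sets lborel" for A
    unfolding set_integrable_def using integrable_mult_indicator[OF that h] .
  show "set_lebesgue_integral lborel A h = set_lebesgue_integral lborel A (\<lambda>_. 0)" if "A \<in> sets lborel" for A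
  proof -
    let ?E = "range (\<lambda>(a, b). box a b :: 'a set)"
    have E: "Int_stable ?E" "?E \<subseteq> Pow UNIV" by (auto simp: Int_stable_def box_Int_box)
    have eq: "sets (lborel :: 'a measure) = sigma_sets UNIV ?E" by (simp add: borel_eq_box)
    have "A \<in> sigma_sets UNIV ?E" using that unfolding eq .
    with E have "set_lebesgue_integral lborel A h = 0"
    proof (induction rule: sigma_sets_induct_disjoint)
      case (basic A)
      then show ?case using boxes by auto
    next
      case empty
      show ?case by (simp add: set_lebesgue_integral_def)
    next
      case (compl A)
      have A: "A \<in> sets lborel" using compl(1) eq by blast
      have "(\<integral>x. indicator (UNIV - A) x *\<^sub>R h x \<partial>lborel) = (\<integral>x. h x - indicator A x *\<^sub>R h x \<partial>lborel)"
        by (rule Bochner_Integration.integral_cong) (auto simp: indicator_def)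
      also have "\<dots> = (\<integral>x. h x \<partial>lborel) - (\<integral>x. indicator A x *\<^sub>R h x \<partial>lborel)"
        by (rule Bochner_Integration.integral_diff[OF h integrable_mult_indicator[OF A h]])
      finally show ?case using compl(2) total by (simp add: set_lebesgue_integral_def)
    next
      case (union A)
      have A: "A i \<in> sets lborel" for i using union(2) eq by blast
      have "set_lebesgue_integral lborel (\<Union>i. A i) h = (\<Sum>i. set_lebesgue_integral lborel (A i) h)"
        by (rule lebesgue_integral_countable_add[OF A _ si])
          (use union(1) A in \<open>auto simp: disjoint_family_on_def\<close>)
      then show ?case using union(3) by simp
    qed
    then show ?thesis by (simp add: set_lebesgue_integral_def)
  qed
qed simp

lemma AE_zero_if_zero_on_boxes_lebesgue:
  fixes h :: "'a::euclidean_space \<Rightarrow> real"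
  assumes h: "integrable lebesgue h" and total: "(\<integral>x. h x \<partial>lebesgue) = 0"
    and boxes: "\<And>l u. (\<integral>x. indicator (box l u) x * h x \<partial>lebesgue) = 0"
  shows "AE x in lebesgue. h x = 0"
proof -
  obtain h' where h': "h' \<in> borel_measurable lborel" "AE x in lborel. h x = h' x"
    using completion_ex_borel_measurable_real[OF borel_measurable_integrable[OF h]] by blast
  have ae: "AE x in lebesgue. h x = h' x" using h'(2) by (rule AE_completion)
  have m: "h \<in> borel_measurable lebesgue" "h' \<in> borel_measurable lebesgue"
    using h borel_measurable_integrable measurable_completion[OF h'(1)] by auto
  have "integrable lebesgue h'" using integrable_cong_AE[OF m ae] h by simp
  then have i: "integrable lborel h'" by (simp add: integrable_completion[OF h'(1)])
  have t: "(\<integral>x. h' x \<partial>lborel) = 0"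
    using integral_cong_AE[OF m ae] total by (simp add: integral_completion[OF h'(1)])
  have b: "set_lebesgue_integral lborel (box l u) h' = 0" for l u
  proof -
    have mb: "(\<lambda>x. indicator (box l u) x * h' x) \<in> borel_measurable lborel" using h'(1) by measurable
    have "(\<integral>x. indicator (box l u) x * h' x \<partial>lebesgue) = (\<integral>x. indicator (box l u) x * h x \<partial>lebesgue)"
      by (rule integral_cong_AE) (use m ae in \<open>auto intro!: borel_measurable_times borel_measurable_indicator\<close>)
    then show ?thesis using boxes[of l u] integral_completion[OF mb] by (simp add: set_lebesgue_integral_def)
  qed
  have "AE x in lborel. h' x = 0" by (rule AE_zero_if_zero_on_boxes[OF i t b])
  then have "AE x in lebesgue. h' x = 0" by (rule AE_completion)
  with ae show ?thesis by eventually_elim simp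
qed

lemma has_weak_gradient_set_integrable:
  "has_weak_gradient u g \<Longrightarrow> set_integrable lebesgue (cbox a b) g"
  by (simp add: has_weak_gradient_def locally_integrable_def)

lemma has_weak_gradient_ibp:
  "has_weak_gradient u g \<Longrightarrow> \<phi> \<in> test_functions \<Longrightarrow> (\<integral>x. g x $ i * \<phi> x \<partial>lebesgue) = - (\<integral>x. u x * (grad \<phi> x $ i) \<partial>lebesgue)"
  by (simp add: has_weak_gradient_def)

text \<open>Both gradients are first multiplied by the indicator of the closed box to become
  integrable. This does not affect products with the bumps, which vanish outside, and the bumps
  converge under domination.\<close>

lemma weak_gradient_box:
  fixes u :: "real ^ 'n \<Rightarrow> real"
  assumes g: "has_weak_gradient u g" "has_weak_gradient u g'"
  shows "(\<integral>x. indicator (box a b) x * (g x $ i - g' x $ i) \<partial>lebesgue) = 0"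
proof -
  define k :: "real ^ 'n \<Rightarrow> real" where "k = (\<lambda>x. indicator (cbox a b) x * (g x $ i))"
  define k' :: "real ^ 'n \<Rightarrow> real" where "k' = (\<lambda>x. indicator (cbox a b) x * (g' x $ i))"
  have comp: "integrable lebesgue (\<lambda>x. indicator (cbox a b) x * (h x $ i))" if "has_weak_gradient u h" for h
  proof -
    have "integrable lebesgue (\<lambda>x. indicator (cbox a b) x *\<^sub>R h x)"
      using has_weak_gradient_set_integrable[OF that] unfolding set_integrable_def .
    from integrable_bounded_linear[OF bounded_linear_vec_nth this, of i] show ?thesis by simp
  qed
  have k: "integrable lebesgue k" "integrable lebesgue k'" using comp g by (auto simp: k_def k'_def)
  let ?b = "box_bump a b"
  have mb: "?b n \<in> borel_measurable lebesgue" for n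
  proof -
    have "continuous_on UNIV (?b n)" using box_bump_test[of a b n] by (auto simp: test_functions_def dest: spec[of _ 0])
    then have "?b n \<in> borel_measurable borel" by (rule borel_measurable_continuous_onI)
    then show ?thesis by (intro measurable_completion) simp
  qed
  have kb: "integrable lebesgue (\<lambda>x. q x * ?b n x)" if "integrable lebesgue q" for q n
    by (rule Bochner_Integration.integrable_bound[OF that])
      (use that mb box_bump_bounds[of a b n] in \<open>auto intro!: borel_measurable_times AE_I2 mult_left_le simp: abs_mult\<close>)
  have z: "(\<integral>x. (k x - k' x) * ?b n x \<partial>lebesgue) = 0" for n
  proof -
    have e: "indicator (cbox a b) x * t * ?b n x = t * ?b n x" for x t using box_bump_outside[of x a b n] by (cases "x \<in> cbox a b") auto
    have "(\<integral>x. (k x - k' x) * ?b n x \<partial>lebesgue) = (\<integral>x. k x * ?b n x \<partial>lebesgue) - (\<integral>x. k' x * ?b n x \<partial>lebesgue)"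
      unfolding left_diff_distrib by (rule Bochner_Integration.integral_diff[OF kb[OF k(1)] kb[OF k(2)]])
    also have "\<dots> = (\<integral>x. g x $ i * ?b n x \<partial>lebesgue) - (\<integral>x. g' x $ i * ?b n x \<partial>lebesgue)"
      unfolding k_def k'_def e ..
    also have "\<dots> = 0" by (simp only: has_weak_gradient_ibp[OF g(1) box_bump_test] has_weak_gradient_ibp[OF g(2) box_bump_test] diff_self)
    finally show ?thesis .
  qed
  have d: "integrable lebesgue (\<lambda>x. k x - k' x)" using k by simp
  have "(\<lambda>n. \<integral>x. (k x - k' x) * ?b n x \<partial>lebesgue) \<longlonglongrightarrow> (\<integral>x. (k x - k' x) * indicator (box a b) x \<partial>lebesgue)"
  proof (rule integral_dominated_convergence)
    show "integrable lebesgue (\<lambda>x. \<bar>k x - k' x\<bar>)" using d by simp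
    show "(\<lambda>x. (k x - k' x) * indicator (box a b) x) \<in> borel_measurable lebesgue"
      using borel_measurable_integrable[OF d] by (intro borel_measurable_times borel_measurable_indicator) auto
    show "(\<lambda>x. (k x - k' x) * ?b n x) \<in> borel_measurable lebesgue" for n
      using borel_measurable_integrable[OF d] mb by (intro borel_measurable_times)
    show "AE x in lebesgue. (\<lambda>n. (k x - k' x) * ?b n x) \<longlonglongrightarrow> (k x - k' x) * indicator (box a b) x"
      by (intro AE_I2 tendsto_mult tendsto_const box_bump_tendsto)
    show "AE x in lebesgue. norm ((k x - k' x) * ?b n x) \<le> \<bar>k x - k' x\<bar>" for n
      using box_bump_bounds[of a b n] by (auto intro!: AE_I2 mult_left_le simp: abs_mult)
  qed
  then have "(\<integral>x. (k x - k' x) * indicator (box a b) x \<partial>lebesgue) = 0" unfolding z using LIMSEQ_unique tendsto_const by blast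
  moreover have "(k x - k' x) * indicator (box a b) x = indicator (box a b) x * (g x $ i - g' x $ i)" for x
    using box_subset_cbox[of a b] by (auto simp: k_def k'_def indicator_def)
  ultimately show ?thesis by simp
qed

text \<open>Since \<open>weak_grad\<close> is an arbitrary choice, it has to be identified with the
  gradient constructed here. Weak gradients are only locally integrable, so the argument runs on
  growing boxes; the intersection of a test box with such a box is again a box.\<close>

lemma weak_gradient_unique:
  fixes u :: "real ^ 'n \<Rightarrow> real"
  assumes g: "has_weak_gradient u g" "has_weak_gradient u g'"
  shows "AE x in lebesgue. g x = g' x"
proof -
  let ?B = "\<lambda>n::nat. box (- (real n *\<^sub>R One)) (real n *\<^sub>R One) :: (real ^ 'n) set"
  have "AE x in lebesgue. indicator (?B n) x * (g x $ i - g' x $ i) = 0" for n i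
  proof (rule AE_zero_if_zero_on_boxes_lebesgue)
    have comp: "integrable lebesgue (\<lambda>x. indicator (?B n) x * (h x $ i))" if "has_weak_gradient u h" for h
    proof -
      have "set_integrable lebesgue (cbox (- (real n *\<^sub>R One)) (real n *\<^sub>R One)) h"
        by (rule has_weak_gradient_set_integrable[OF that])
      then have "set_integrable lebesgue (?B n) h" by (rule set_integrable_subset) (auto intro: box_subset_cbox[THEN subsetD])
      then have "integrable lebesgue (\<lambda>x. indicator (?B n) x *\<^sub>R h x)" unfolding set_integrable_def .
      from integrable_bounded_linear[OF bounded_linear_vec_nth this, of i] show ?thesis by simp
    qed
    show "integrable lebesgue (\<lambda>x. indicator (?B n) x * (g x $ i - g' x $ i))"
      unfolding right_diff_distrib by (rule Bochner_Integration.integrable_diff[OF comp[OF g(1)] comp[OF g(2)]])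
    show "(\<integral>x. indicator (?B n) x * (g x $ i - g' x $ i) \<partial>lebesgue) = 0" by (rule weak_gradient_box[OF g])
    show "(\<integral>x. indicator (box l r) x * (indicator (?B n) x * (g x $ i - g' x $ i)) \<partial>lebesgue) = 0" for l r
    proof -
      obtain l' r' where "box l r \<inter> ?B n = box l' r'" unfolding box_Int_box by blast
      then have "indicator (box l r) x * (indicator (?B n) x * t) = indicator (box l' r') x * t" for x and t :: real
        unfolding mult.assoc[symmetric] indicator_inter_arith[symmetric] by simp
      then show ?thesis by (simp only: weak_gradient_box[OF g])
    qed
  qed
  then have "AE x in lebesgue. \<forall>n i. indicator (?B n) x * (g x $ i - g' x $ i) = 0"
    unfolding AE_all_countable by blast
  then show ?thesis
  proof eventually_elim
    case (elim x)
    have "x \<in> (\<Union>n. ?B n)" using UN_box_eq_UNIV by blast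
    then obtain n where "x \<in> ?B n" by blast
    then have "g x $ i - g' x $ i = 0" for i using elim[rule_format, of n i] by simp
    then show ?case by (simp add: vec_eq_iff)
  qed
qed

lemma test_function_C1c:
  assumes "\<phi> \<in> test_functions" shows "C1c \<phi> (grad \<phi>)"
proof -
  have C: "Ck (Suc 0) \<phi>" and cpt: "compact (closure {x. \<phi> x \<noteq> 0})" using assms by (auto simp: test_functions_def simp del: Ck.simps)
  have D: "(\<phi> has_derivative frechet_derivative \<phi> (at x)) (at x)" for x
    using C by (simp add: frechet_derivative_works[symmetric])
  have e: "frechet_derivative \<phi> (at x) = (\<lambda>h. grad \<phi> x \<bullet> h)" for x
  proof
    fix h
    have l: "linear (frechet_derivative \<phi> (at x))" using has_derivative_bounded_linear[OF D] bounded_linear.linear by blast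
    have "frechet_derivative \<phi> (at x) h = frechet_derivative \<phi> (at x) (\<Sum>i\<in>UNIV. h $ i *\<^sub>R axis i 1)"
      using basis_expansion[of h] by (simp add: scalar_mult_eq_scaleR)
    also have "\<dots> = (\<Sum>i\<in>UNIV. h $ i * frechet_derivative \<phi> (at x) (axis i 1))"
      by (simp add: linear_sum[OF l] linear_scale[OF l])
    also have "\<dots> = grad \<phi> x \<bullet> h" by (simp add: grad_def inner_vec_def mult.commute)
    finally show "frechet_derivative \<phi> (at x) h = grad \<phi> x \<bullet> h" .
  qed
  have "continuous_on UNIV (\<lambda>x. \<chi> i. grad \<phi> x $ i)"
    by (rule continuous_on_vec_lambda) (use C in auto)
  then have c: "continuous_on UNIV (grad \<phi>)" by simp
  obtain R where R: "\<And>x. x \<in> closure {x. \<phi> x \<noteq> 0} \<Longrightarrow> norm x \<le> R"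
    using compact_imp_bounded[OF cpt] unfolding bounded_iff by blast
  \<comment> \<open>One unit beyond R the point lies in the open complement of the closed support.
    There \<phi> vanishes in a neighbourhood, so the gradient is 0 as well.\<close>
  have z: "\<phi> x = 0 \<and> grad \<phi> x = 0" if "R + 1 \<le> norm x" for x
  proof -
    have x: "x \<in> - closure {x. \<phi> x \<noteq> 0}" using R[of x] that by auto
    have s: "\<phi> y = 0" if "y \<in> - closure {x. \<phi> x \<noteq> 0}" for y using that closure_subset[of "{x. \<phi> x \<noteq> 0}"] by auto
    have "(\<phi> has_derivative (\<lambda>_. 0)) (at x)"
    proof (rule has_derivative_transform_within_open)
      show "((\<lambda>_. 0::real) has_derivative (\<lambda>_. 0)) (at x)" by (rule has_derivative_const)
      show "open (- closure {x. \<phi> x \<noteq> 0})" by (rule open_Compl[OF closed_closure])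
      show "0 = \<phi> y" if "y \<in> - closure {x. \<phi> x \<noteq> 0}" for y using s[OF that] by simp
    qed (rule x)
    from has_derivative_unique[OF D[of x, unfolded e] this] have "(\<lambda>h. grad \<phi> x \<bullet> h) = (\<lambda>_. 0)" .
    then have "grad \<phi> x \<bullet> grad \<phi> x = 0" by (rule fun_cong)
    then show ?thesis using s[OF x] by simp
  qed
  show ?thesis unfolding C1c_def C1_def using D[unfolded e] c z by (intro conjI allI exI[of _ "R + 1"] impI) auto
qed

lemma sq_integrable_L2: "sq_integrable h \<Longrightarrow> h \<in> L2"
  unfolding sq_integrable_def L2_def
  by (auto intro!: measurable_completion simp: integrable_completion)

lemma L2_locally_integrable:
  assumes "sq_integrable h" shows "locally_integrable h"
  unfolding locally_integrable_def
proof (intro allI impI)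
  fix K :: "(real ^ 'a) set" assume K: "compact K"
  have h: "h \<in> borel_measurable lebesgue" "integrable lebesgue (\<lambda>x. (norm (h x))\<^sup>2)"
    using sq_integrable_L2[OF assms] by (auto simp: L2_def)
  have s: "K \<in> lmeasurable" using K by (rule lmeasurable_compact)
  show "set_integrable lebesgue K h" unfolding set_integrable_def
  proof (rule Bochner_Integration.integrable_bound)
    show "integrable lebesgue (\<lambda>x. indicator K x + (norm (h x))\<^sup>2)"
      using s h(2) by (intro Bochner_Integration.integrable_add) (auto simp: fmeasurable_def intro!: integrable_real_indicator)
    show "(\<lambda>x. indicator K x *\<^sub>R h x) \<in> borel_measurable lebesgue"
      using s h(1) by (intro borel_measurable_scaleR borel_measurable_indicator) auto
    have "t \<le> 1 + t\<^sup>2" for t :: real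
    proof -
      have "0 \<le> (t - 1/2)\<^sup>2" by simp
      then show ?thesis by (simp add: power2_eq_square algebra_simps)
    qed
    then show "AE x in lebesgue. norm (indicator K x *\<^sub>R h x) \<le> norm (indicator K x + (norm (h x))\<^sup>2)"
      by (auto simp: indicator_def)
  qed
qed

lemma sobolev_weak_gradient:
  assumes s: "sobolev w g" shows "has_weak_gradient w g"
  unfolding has_weak_gradient_def
proof (intro conjI ballI allI)
  note sq = sobolev_sq_integrable[OF s]
  show "locally_integrable w" "locally_integrable g" using sq L2_locally_integrable by blast+
  fix \<phi> :: "real ^ 'a \<Rightarrow> real" and i assume "\<phi> \<in> test_functions"
  then have C: "C1c \<phi> (grad \<phi>)" by (rule test_function_C1c)
  have c: "\<phi> \<in> borel_measurable borel" "grad \<phi> \<in> borel_measurable borel"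
    using C1_continuous[OF C1c_C1[OF C]] C1_continuous_grad[OF C1c_C1[OF C]] by (auto intro: borel_measurable_continuous_onI)
  have m: "w \<in> borel_measurable borel" "g \<in> borel_measurable borel" using sq by (auto simp: sq_integrable_def)
  have "(\<integral>x. w x * (grad \<phi> x \<bullet> axis i 1) \<partial>lebesgue) = (\<integral>x. w x * (grad \<phi> x \<bullet> axis i 1) \<partial>lborel)"
    by (rule integral_completion) (use m c in measurable)
  also have "\<dots> = - (\<integral>x. (g x \<bullet> axis i 1) * \<phi> x \<partial>lborel)" by (rule sobolev_ibp[OF s C])
  also have "(\<integral>x. (g x \<bullet> axis i 1) * \<phi> x \<partial>lborel) = (\<integral>x. (g x \<bullet> axis i 1) * \<phi> x \<partial>lebesgue)"
    by (rule integral_completion[symmetric]) (use m c in measurable)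
  finally show "(LINT x|lebesgue. w x * (grad \<phi> x $ i)) = - (LINT x|lebesgue. (g x $ i) * \<phi> x)"
    by (simp add: inner_axis)
qed

lemma sobolev_H1: assumes "sobolev w g" shows "w \<in> H1"
  unfolding H1_def
  using sobolev_weak_gradient[OF assms] sobolev_sq_integrable[OF assms, THEN sq_integrable_L2] by auto

lemma weak_grad_sobolev: assumes "sobolev w g" shows "AE x in lebesgue. weak_grad w x = g x"
proof (rule weak_gradient_unique)
  show "has_weak_gradient w (weak_grad w)"
    unfolding weak_grad_def by (rule someI[of "has_weak_gradient w", OF sobolev_weak_gradient[OF assms]])
qed (rule sobolev_weak_gradient[OF assms])

section \<open>From minimisers to weak solutions\<close>

text \<open>The bridge from Borel functions to the completed measure. Functions built from
  \<open>weak_grad\<close> are known only up to null sets and get their measurability from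
  completeness.\<close>

lemma AE_lborel_lebesgue_integral:
  fixes p q :: "'a::euclidean_space \<Rightarrow> real"
  assumes p: "p \<in> borel_measurable lborel" and ae: "AE x in lebesgue. q x = p x"
  shows "(\<integral>x. q x \<partial>lebesgue) = (\<integral>x. p x \<partial>lborel)" "integrable lborel p \<Longrightarrow> integrable lebesgue q"
proof -
  have q: "q \<in> borel_measurable lebesgue"
  proof (rule measurableI)
    fix A :: "real set" assume "A \<in> sets borel"
    then have "p -` A \<inter> space lborel \<in> sets lborel" using p by (rule measurable_sets[rotated])
    then have A: "p -` A \<in> sets lebesgue" by (simp add: sets_completionI_sets)
    have "q -` A \<in> sets lebesgue"
      by (rule completion.in_sets_AE[OF _ A]) (use ae in \<open>eventually_elim, simp\<close>, simp)
    then show "q -` A \<inter> space lebesgue \<in> sets lebesgue" by simp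
  qed simp
  have p': "p \<in> borel_measurable lebesgue" using p by (rule measurable_completion)
  show "(\<integral>x. q x \<partial>lebesgue) = (\<integral>x. p x \<partial>lborel)"
    using integral_cong_AE[OF q p' ae] integral_completion[OF p] by simp
  show "integrable lebesgue q" if "integrable lborel p"
    using integrable_cong_AE[OF q p' ae] integrable_completion[OF p] that by simp
qed

text \<open>Undoes both changes of variables. For u = a sn(w) and k = 1/a^2, the coefficient 1 - k
  u^2 is cs^2 and the gradient of u is a g / cs, so the weak identity scales by a and the energy by
  a^2.\<close>

lemma minimiser_weak_solution:
  fixes V :: "real ^ 'n \<Rightarrow> real"
  assumes lf: "layered_film V f F C\<^sub>F lo R\<^sub>0 B\<^sub>0"
    and min: "layered_film.minimiser V F lo w g" and c0: "AE x in lborel. cs (w x) \<noteq> 0"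
    and a: "0 < a" and f\<^sub>0: "\<And>s. f\<^sub>0 (a * s) = a * f s" and F\<^sub>0: "\<And>s. primitive f\<^sub>0 (a * s) = a\<^sup>2 * F s"
  defines "u \<equiv> \<lambda>x. a * sn (w x)"
  shows "weak_solution (1 / a\<^sup>2) V f\<^sub>0 u" "energy (1 / a\<^sup>2) V f\<^sub>0 u = a\<^sup>2 * obstacle_problem.J (film.P V F) w g"
proof -
  interpret layered_film V f F C\<^sub>F lo R\<^sub>0 B\<^sub>0 by (rule lf)
  note wm [measurable] = minimiserD(6,7)[OF min]
  note mi = minimiser_integrable[OF min] and ge = gradient_energy_finite[OF min c0]
  have [measurable]: "V \<in> borel_measurable borel" "F \<in> borel_measurable borel" "f \<in> borel_measurable borel"
    by (rule borel_measurable_continuous_onI[OF V_continuous], rule borel_measurable_continuous_onI[OF F_continuous],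
        rule borel_measurable_continuous_onI[OF f_continuous])
  have s: "sobolev u (\<lambda>x. a *\<^sub>R ((1 / cs (w x)) *\<^sub>R g x))"
    unfolding u_def by (rule sobolev_scale[OF minimiser_sobolev_sn[OF min c0]])
  have c0': "AE x in lebesgue. cs (w x) \<noteq> 0" using c0 by (rule AE_completion)
  have G: "AE x in lebesgue. weak_grad u x = (a / cs (w x)) *\<^sub>R g x \<and> cs (w x) \<noteq> 0"
    using weak_grad_sobolev[OF s] c0' by eventually_elim simp
  have ku: "1 - 1 / a\<^sup>2 * (u x)\<^sup>2 = (cs (w x))\<^sup>2" for x
    using sn_cs[of "w x"] a by (simp add: u_def power_mult_distrib algebra_simps)
  have u2: "(u x)\<^sup>2 = a\<^sup>2 * (sn (w x))\<^sup>2" for x by (simp add: u_def power_mult_distrib)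
  have E: "u \<in> E_space V"
  proof -
    have "integrable lebesgue (\<lambda>x. V x * (u x)\<^sup>2)"
    proof (rule AE_lborel_lebesgue_integral(2)[where p = "\<lambda>x. a\<^sup>2 * (V x * (sn (w x))\<^sup>2)"])
      show "integrable lborel (\<lambda>x. a\<^sup>2 * (V x * (sn (w x))\<^sup>2))" using mi(3) by simp
      show "AE x in lebesgue. V x * (u x)\<^sup>2 = a\<^sup>2 * (V x * (sn (w x))\<^sup>2)" by (simp add: u2)
    qed measurable
    then show ?thesis using sobolev_H1[OF s] by (simp add: E_space_def)
  qed
  have Q: "integrable lebesgue (\<lambda>x. (u x)\<^sup>2 * (norm (weak_grad u x))\<^sup>2)"
  proof (rule AE_lborel_lebesgue_integral(2)[where p = "\<lambda>x. a\<^sup>2 * a\<^sup>2 * ((sn (w x))\<^sup>2 * ((norm (g x))\<^sup>2 / (cs (w x))\<^sup>2))"])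
    have "integrable lborel (\<lambda>x. (sn (w x))\<^sup>2 * ((norm (g x))\<^sup>2 / (cs (w x))\<^sup>2))"
    proof (rule Bochner_Integration.integrable_bound[OF ge])
      have "norm ((sn t)\<^sup>2 * r) \<le> norm r" for t r
        using sn_le[of t] by (simp add: abs_mult mult_left_le_one_le abs_square_le_1)
      then show "AE x in lborel. norm ((sn (w x))\<^sup>2 * ((norm (g x))\<^sup>2 / (cs (w x))\<^sup>2)) \<le> norm ((norm (g x))\<^sup>2 / (cs (w x))\<^sup>2)"
        by (rule AE_I2)
    qed measurable
    then show "integrable lborel (\<lambda>x. a\<^sup>2 * a\<^sup>2 * ((sn (w x))\<^sup>2 * ((norm (g x))\<^sup>2 / (cs (w x))\<^sup>2)))"
      by (rule Bochner_Integration.integrable_mult_right)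
    show "AE x in lebesgue. (u x)\<^sup>2 * (norm (weak_grad u x))\<^sup>2 = a\<^sup>2 * a\<^sup>2 * ((sn (w x))\<^sup>2 * ((norm (g x))\<^sup>2 / (cs (w x))\<^sup>2))"
      using G by eventually_elim (simp add: u2 power_mult_distrib power_divide)
  qed measurable
  show "weak_solution (1 / a\<^sup>2) V f\<^sub>0 u"
    unfolding weak_solution_def
  proof (intro conjI E Q ballI)
    fix \<phi> :: "real ^ 'n \<Rightarrow> real" assume "\<phi> \<in> test_functions"
    then have C: "C1c \<phi> (grad \<phi>)" by (rule test_function_C1c)
    note we = minimiser_weak_equation[OF min c0 C]
    have [measurable]: "\<phi> \<in> borel_measurable borel" "grad \<phi> \<in> borel_measurable borel"
      using C1_continuous[OF C1c_C1[OF C]] C1_continuous_grad[OF C1c_C1[OF C]] by (auto intro: borel_measurable_continuous_onI)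
    let ?l = "\<lambda>x. a * ((cs (w x) * (grad \<phi> x \<bullet> g x) - \<phi> x * sn (w x) * ((norm (g x))\<^sup>2 / (cs (w x))\<^sup>2)) + \<phi> x * (V x * sn (w x)))"
    let ?r = "\<lambda>x. a * (\<phi> x * f (sn (w x)))"
    have lm: "?l \<in> borel_measurable lborel" "?r \<in> borel_measurable lborel" by measurable
    have li: "integrable lborel ?l" "integrable lborel ?r"
      by (intro Bochner_Integration.integrable_mult_right Bochner_Integration.integrable_add we)+
    have l: "AE x in lebesgue. (1 - 1 / a\<^sup>2 * (u x)\<^sup>2) * (weak_grad u x \<bullet> grad \<phi> x)
          - 1 / a\<^sup>2 * u x * (norm (weak_grad u x))\<^sup>2 * \<phi> x + V x * u x * \<phi> x = ?l x"
      using G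
    proof eventually_elim
      case (elim x)
      have 1: "(1 - 1 / a\<^sup>2 * (u x)\<^sup>2) * (weak_grad u x \<bullet> grad \<phi> x) = a * (cs (w x) * (grad \<phi> x \<bullet> g x))"
        unfolding ku using elim by (simp add: power2_eq_square inner_commute)
      have 2: "1 / a\<^sup>2 * u x * (norm (weak_grad u x))\<^sup>2 * \<phi> x = a * (\<phi> x * sn (w x) * ((norm (g x))\<^sup>2 / (cs (w x))\<^sup>2))"
        using elim a by (simp add: u_def power_mult_distrib power_divide)
      show ?case unfolding 1 2 by (simp add: u_def algebra_simps)
    qed
    have r: "AE x in lebesgue. f\<^sub>0 (u x) * \<phi> x = ?r x" by (simp add: u_def f\<^sub>0)
    show "integrable lebesgue (\<lambda>x. (1 - 1 / a\<^sup>2 * (u x)\<^sup>2) * (weak_grad u x \<bullet> grad \<phi> x)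
          - 1 / a\<^sup>2 * u x * (norm (weak_grad u x))\<^sup>2 * \<phi> x + V x * u x * \<phi> x)"
      by (rule AE_lborel_lebesgue_integral(2)[OF lm(1) l li(1)])
    show "integrable lebesgue (\<lambda>x. f\<^sub>0 (u x) * \<phi> x)"
      by (rule AE_lborel_lebesgue_integral(2)[OF lm(2) r li(2)])
    have "(\<integral>x. ?l x \<partial>lborel) = (\<integral>x. ?r x \<partial>lborel)"
      using we by (simp only: Bochner_Integration.integral_mult_right_zero Bochner_Integration.integral_add)
    then show "(LINT x|lebesgue. (1 - 1 / a\<^sup>2 * (u x)\<^sup>2) * (weak_grad u x \<bullet> grad \<phi> x)
          - 1 / a\<^sup>2 * u x * (norm (weak_grad u x))\<^sup>2 * \<phi> x + V x * u x * \<phi> x) = (LINT x|lebesgue. f\<^sub>0 (u x) * \<phi> x)"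
      unfolding AE_lborel_lebesgue_integral(1)[OF lm(1) l] AE_lborel_lebesgue_integral(1)[OF lm(2) r] .
  qed
  have g2: "integrable lborel (\<lambda>x. (norm (g x))\<^sup>2)" using sq_integrableD[OF minimiserD(8)[OF min]] .
  have "(LINT x|lebesgue. (1 - 1 / a\<^sup>2 * (u x)\<^sup>2) * (norm (weak_grad u x))\<^sup>2 + V x * (u x)\<^sup>2)
      = (\<integral>x. a\<^sup>2 * ((norm (g x))\<^sup>2 + V x * (sn (w x))\<^sup>2) \<partial>lborel)"
  proof (rule AE_lborel_lebesgue_integral(1))
    show "AE x in lebesgue. (1 - 1 / a\<^sup>2 * (u x)\<^sup>2) * (norm (weak_grad u x))\<^sup>2 + V x * (u x)\<^sup>2
        = a\<^sup>2 * ((norm (g x))\<^sup>2 + V x * (sn (w x))\<^sup>2)"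
      using G unfolding ku by eventually_elim (simp add: u2 power_mult_distrib power_divide algebra_simps)
  qed measurable
  also have "\<dots> = a\<^sup>2 * (sq_norm g + (\<integral>x. V x * (sn (w x))\<^sup>2 \<partial>lborel))"
    using g2 mi(3) by (simp add: sq_norm_def)
  finally have 1: "(LINT x|lebesgue. (1 - 1 / a\<^sup>2 * (u x)\<^sup>2) * (norm (weak_grad u x))\<^sup>2 + V x * (u x)\<^sup>2)
      = a\<^sup>2 * (sq_norm g + (\<integral>x. V x * (sn (w x))\<^sup>2 \<partial>lborel))" .
  have "(LINT x|lebesgue. primitive f\<^sub>0 (u x)) = (\<integral>x. a\<^sup>2 * F (sn (w x)) \<partial>lborel)"
  proof (rule AE_lborel_lebesgue_integral(1))
    show "AE x in lebesgue. primitive f\<^sub>0 (u x) = a\<^sup>2 * F (sn (w x))" by (simp add: u_def F\<^sub>0)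
  qed measurable
  then have 2: "(LINT x|lebesgue. primitive f\<^sub>0 (u x)) = a\<^sup>2 * (\<integral>x. F (sn (w x)) \<partial>lborel)" by simp
  show "energy (1 / a\<^sup>2) V f\<^sub>0 u = a\<^sup>2 * J w g"
    unfolding energy_def 1 2 mi(4) by (simp add: algebra_simps)
qed

lemma DERIV_primitive:
  assumes "continuous_on UNIV f" shows "(primitive f has_real_derivative f t) (at t)"
proof -
  define c where "c = \<bar>t\<bar> + 1"
  have c: "- c \<le> 0" "0 \<le> c" "- c < t" "t < c" by (auto simp: c_def)
  have "((\<lambda>u. LBINT y=ereal 0..ereal u. f y) has_vector_derivative f t) (at t within {- c..c})"
    by (rule interval_integral_FTC2) (use c continuous_on_subset[OF assms] in auto)
  then have "(primitive f has_vector_derivative f t) (at t within {- c..c})" by (simp only: primitive_def[abs_def])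
  moreover have "at t within {- c..c} = at t" using c by (intro at_within_interior) simp
  ultimately show ?thesis by (simp add: has_real_derivative_iff_has_vector_derivative)
qed

lemma even_primitive:
  assumes D: "\<And>s. (F has_real_derivative f s) (at s)" and odd: "\<And>s. f (- s) = - f s"
  shows "F (- s) = F (s::real)"
proof -
  have "((\<lambda>s. F (- s) - F s) has_real_derivative 0) (at t)" for t
  proof -
    have "((\<lambda>s. - s) has_real_derivative - 1) (at t)" by (rule DERIV_minus[OF DERIV_ident])
    from DERIV_diff[OF DERIV_chain2[OF D[of "- t"] this] D[of t]] show ?thesis by (simp add: odd)
  qed
  then have "\<forall>t. ((\<lambda>s. F (- s) - F s) has_real_derivative 0) (at t)" by (rule allI)
  from DERIV_isconst_all[OF this, of s 0] show ?thesis by simp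
qed

text \<open>\<open>2 F \<le> s f\<close> says that \<open>F(s) / s\<^sup>2\<close> is nondecreasing on \<open>s > 0\<close>.\<close>

lemma quadratic_upper_bound:
  assumes D: "\<And>s. (F has_real_derivative f s) (at s)" and even: "\<And>s. F (- s) = F s" and F0: "F 0 = 0"
    and AR: "\<And>s. 2 * F s \<le> s * f s" and s: "\<bar>s\<bar> \<le> (1::real)"
  shows "F s \<le> F 1 * s\<^sup>2"
proof -
  have pos: "F t \<le> F 1 * t\<^sup>2" if t: "0 < t" "t \<le> 1" for t
  proof -
    have "F t / t\<^sup>2 \<le> F 1 / 1\<^sup>2"
    proof (rule DERIV_nonneg_imp_nondecreasing[OF t(2)])
      fix r assume "t \<le> r" "r \<le> 1"
      then have r: "0 < r" using t by simp
      have "((\<lambda>r. F r / r\<^sup>2) has_real_derivative (f r * r\<^sup>2 - F r * (2 * r)) / (r\<^sup>2 * r\<^sup>2)) (at r)"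
        using r by (auto intro!: derivative_eq_intros D)
      moreover have "0 \<le> f r * r\<^sup>2 - F r * (2 * r)"
      proof -
        have "0 \<le> r * (r * f r - 2 * F r)" using r AR[of r] by simp
        then show ?thesis by (simp add: power2_eq_square algebra_simps)
      qed
      ultimately show "\<exists>y. ((\<lambda>r. F r / r\<^sup>2) has_real_derivative y) (at r) \<and> 0 \<le> y"
        by (intro exI conjI) (assumption, simp)
    qed
    then show ?thesis using t by (simp add: pos_divide_le_eq)
  qed
  consider "s = 0" | "0 < s" | "0 < - s" by linarith
  then show ?thesis
  proof cases
    case 1
    then show ?thesis by (simp add: F0)
  next
    case 2
    then show ?thesis using s by (intro pos) auto
  next
    case 3
    then have "F (- s) \<le> F 1 * (- s)\<^sup>2" using s by (intro pos) auto
    then show ?thesis by (simp add: even)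
  qed
qed

text \<open>The bound B is a hypothesis, so that one and the same constant serves every m; the lower
  bound then depends on m in a single term, linearly.\<close>

lemma shells_solution:
  fixes V :: "real ^ 'n \<Rightarrow> real"
  assumes sh: "shells V f F C\<^sub>F x\<^sub>0 T b m"
    and a: "0 < a" and f\<^sub>0: "\<And>s. f\<^sub>0 (a * s) = a * f s" and F\<^sub>0: "\<And>s. primitive f\<^sub>0 (a * s) = a\<^sup>2 * F s"
    and B: "\<And>w. w \<in> borel_measurable borel \<Longrightarrow> integrable lborel (\<lambda>x. film.P V F x (w x)) \<Longrightarrow>
      - B \<le> (\<integral>x. film.P V F x (w x) \<partial>lborel)"
  shows "\<exists>u. weak_solution (1 / a\<^sup>2) V f\<^sub>0 u \<and>
    a\<^sup>2 * (pi / 2 * real m / (T - 1) * probe_mass x\<^sub>0 T - pi / 4 * (\<integral>x. \<bar>probe_div x\<^sub>0 T x\<bar> \<partial>lborel)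
     - sq_norm (\<lambda>x. probe T ((norm (x - x\<^sub>0))\<^sup>2) *\<^sub>R (x - x\<^sub>0)) / 2 - B) \<le> energy (1 / a\<^sup>2) V f\<^sub>0 u"
proof -
  interpret shells V f F C\<^sub>F x\<^sub>0 T b m by (rule sh)
  obtain w g where min: "minimiser w g" using minimiser_ex by (elim exE)
  note ws = minimiser_weak_solution[OF layered_film_axioms min minimiser_avoids_turning[OF min] a f\<^sub>0 F\<^sub>0]
  have "a\<^sup>2 * (pi / 2 * real m / (T - 1) * probe_mass x\<^sub>0 T - pi / 4 * (\<integral>x. \<bar>probe_div x\<^sub>0 T x\<bar> \<partial>lborel)
     - sq_norm (\<lambda>x. probe T ((norm (x - x\<^sub>0))\<^sup>2) *\<^sub>R (x - x\<^sub>0)) / 2 - B) \<le> a\<^sup>2 * J w g"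
    unfolding slope_eq[symmetric] by (intro mult_left_mono J_lower[OF B minimiserD(1)[OF min]]) auto
  then show ?thesis using ws by (intro exI[of _ "\<lambda>x. a * sn (w x)"]) simp
qed

theorem theorem1p5:
  fixes V :: "real ^ 'n \<Rightarrow> real" and f :: "real \<Rightarrow> real" and k :: real
  assumes "CARD('n) \<ge> 3" and "k > 0"
    and "cond_V V"
    and "cond_f2 CARD('n) f" and "cond_f3 f"
    and "\<And>s. f (- s) = - f s"
  shows "\<exists>u :: nat \<Rightarrow> real ^ 'n \<Rightarrow> real.
           (\<forall>n. weak_solution k V f (u n)) \<and>
           filterlim (\<lambda>n. energy k V f (u n)) at_top sequentially"
proof -
  \<comment> \<open>The value of |u| at which 1 - k u^2 vanishes; dividing by it reduces the problem
    to k = 1.\<close>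
  define a where "a = 1 / sqrt k"
  have a: "0 < a" and k: "k = 1 / a\<^sup>2" using assms(2) by (simp_all add: a_def power_divide)
  obtain \<mu> where \<mu>: "8/3 < \<mu>" "\<And>s. s \<noteq> 0 \<Longrightarrow> 0 < \<mu> * primitive f s" "\<And>s. s \<noteq> 0 \<Longrightarrow> \<mu> * primitive f s \<le> s * f s"
    using assms(5) unfolding cond_f3_def by auto
  have fc: "continuous_on UNIV f" using assms(4) by (simp add: cond_f2_def)
  define h where "h s = f (a * s) / a" for s
  define H where "H s = primitive f (a * s) / a\<^sup>2" for s
  have p0: "primitive f 0 = 0" by (simp add: primitive_def)
  have p_pos: "0 < primitive f s" if "s \<noteq> 0" for s using \<mu>(2)[OF that] \<mu>(1) by (simp add: zero_less_mult_iff)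
  have DH: "(H has_real_derivative h s) (at s)" for s
  proof -
    have "((\<lambda>s. a * s) has_real_derivative a) (at s)" by (auto intro!: derivative_eq_intros)
    from DERIV_cdivide[OF DERIV_chain2[OF DERIV_primitive[OF fc] this], of "a\<^sup>2"]
    show ?thesis using a by (simp add: H_def[abs_def] h_def power2_eq_square)
  qed
  have h_odd: "h (- s) = - h s" for s by (simp add: h_def assms(6))
  have H_even: "H (- s) = H s" for s by (rule even_primitive[OF DH h_odd])
  have H0: "H 0 = 0" by (simp add: H_def p0)
  have H_nonneg: "0 \<le> H s" for s
    using p_pos[of "a * s"] p0 a by (cases "s = 0") (auto simp: H_def)
  \<comment> \<open>This consequence of positivity and \<mu> > 2 is used twice: it gives the
    quadratic bound on H in [-1,1] and the sign condition \<open>0 \<le> s * h s\<close>.\<close>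
  have AR: "2 * H s \<le> s * h s" for s
  proof (cases "s = 0")
    case False
    then have s: "a * s \<noteq> 0" using a by simp
    have "2 * primitive f (a * s) \<le> \<mu> * primitive f (a * s)"
      using p_pos[OF s] \<mu>(1) by (intro mult_right_mono) auto
    also have "\<dots> \<le> a * s * f (a * s)" by (rule \<mu>(3)[OF s])
    finally have "2 * primitive f (a * s) / a\<^sup>2 \<le> a * s * f (a * s) / a\<^sup>2" by (rule divide_right_mono) simp
    then show ?thesis using a by (simp add: H_def h_def power2_eq_square)
  qed (simp add: H0)
  interpret film V h H "H 1"
  proof
    show "continuous_on UNIV V" "filterlim V at_top at_infinity" using assms(3) by (auto simp: cond_V_def)
    have "continuous_on UNIV (\<lambda>s. a * s)" by (intro continuous_intros)
    from continuous_on_compose2[OF fc this] show "continuous_on UNIV h"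
      unfolding h_def[abs_def] using a by (intro continuous_on_divide continuous_on_const) auto
    show "h (- s) = - h s" for s by (rule h_odd)
    show "(H has_real_derivative h s) (at s)" for s by (rule DH)
    show "H (- s) = H s" for s by (rule H_even)
    show "0 \<le> H s" for s by (rule H_nonneg)
    show "\<bar>s\<bar> \<le> 1 \<Longrightarrow> H s \<le> H 1 * s\<^sup>2" for s by (rule quadratic_upper_bound[OF DH H_even H0 AR])
    show "0 \<le> s * h s" for s using AR[of s] H_nonneg[of s] by linarith
  qed
  have "\<forall>\<^sub>F x in at_infinity. h 1 + 1 \<le> V x" using V_top by (simp add: filterlim_at_top)
  then obtain R\<^sub>1 where R\<^sub>1: "\<And>x. R\<^sub>1 \<le> norm x \<Longrightarrow> h 1 + 1 \<le> V x" unfolding eventually_at_infinity by blast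
  define R where "R = max 0 R\<^sub>1"
  have R: "0 \<le> R" by (simp add: R_def)
  have VR: "h 1 + 1 \<le> V x" if "R \<le> norm x" for x using R\<^sub>1[of x] that by (simp add: R_def)
  define x\<^sub>0 :: "real ^ 'n" where "x\<^sub>0 = (R + 2) *\<^sub>R axis undefined 1"
  have n0: "norm x\<^sub>0 = R + 2" using R by (simp add: x\<^sub>0_def)
  \<comment> \<open>V may fall below the required level only inside the ball of radius R about 0.
    The centre has norm R + 2, so the unit core stays outside that ball; a point at distance 2R + 3
    or more from the centre has norm at least R + 1. Thus core and exterior are good, and the shells
    take the rest.\<close>
  define T where "T = (2 * R + 3)\<^sup>2"
  have T: "1 < T" using R one_less_power[of "2 * R + 3" 2] by (simp add: T_def)
  obtain M where M: "\<And>x. norm x \<le> norm x\<^sub>0 + T \<Longrightarrow> \<bar>V x\<bar> \<le> M" "\<And>s. \<bar>s\<bar> \<le> 1 \<Longrightarrow> \<bar>h s\<bar> \<le> M"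
    by (rule local_bound[of "norm x\<^sub>0 + T"]) (rule that, assumption+)
  define b where "b = max 1 M"
  obtain B where B: "\<And>w. w \<in> borel_measurable borel \<Longrightarrow> integrable lborel (\<lambda>x. P x (w x)) \<Longrightarrow> - B \<le> (\<integral>x. P x (w x) \<partial>lborel)"
    by (rule P_integral_lower) (rule that, assumption+)
  \<comment> \<open>The geometry, T and b are fixed by now; both thinness conditions hold for all
    large m because the shell width tends to 0.\<close>
  have t0: "(\<lambda>m. (T - 1) / real m) \<longlonglongrightarrow> 0" by (rule lim_const_over_n)
  have "(\<lambda>m. real DIM(real ^ 'n) * ((T - 1) / real m)) \<longlonglongrightarrow> real DIM(real ^ 'n) * 0"
    by (intro tendsto_mult tendsto_const t0)
  then have "\<forall>\<^sub>F m in sequentially. real DIM(real ^ 'n) * ((T - 1) / real m) < 1 / 2" by (rule order_tendstoD(2)) simp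
  moreover have "(\<lambda>m. 8/3 * b^3 * (2 * ((T - 1) / real m) * sqrt (2 * ((T - 1) / real m)))) \<longlonglongrightarrow> 8/3 * b^3 * (2 * 0 * sqrt (2 * 0))"
    by (intro tendsto_mult tendsto_real_sqrt tendsto_const t0)
  then have "\<forall>\<^sub>F m in sequentially. 8/3 * b^3 * (2 * ((T - 1) / real m) * sqrt (2 * ((T - 1) / real m))) < pi / 4"
    by (rule order_tendstoD(2)) simp
  ultimately have "\<forall>\<^sub>F m in sequentially. shells V h H (H 1) x\<^sub>0 T b m"
    using eventually_gt_at_top[of 0]
  proof eventually_elim
    case (elim m)
    show ?case
    proof
      show "1 < T" "0 < m" "1 \<le> b" using T elim by (auto simp: b_def)
      show "real DIM(real ^ 'n) * ((T - 1) / real m) \<le> 1/2" "8/3 * b^3 * (2 * ((T - 1) / real m) * sqrt (2 * ((T - 1) / real m))) \<le> pi / 4"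
        using elim by linarith+
      show "\<bar>h s\<bar> \<le> b" if "\<bar>s\<bar> \<le> 1" for s using M(2)[OF that] by (simp add: b_def)
      show "\<bar>V x\<bar> \<le> b" if "(norm (x - x\<^sub>0))\<^sup>2 \<le> T" for x
      proof -
        have "T * 1 \<le> T * T" using T by (intro mult_left_mono) auto
        then have "(norm (x - x\<^sub>0))\<^sup>2 \<le> T\<^sup>2" using that by (simp add: power2_eq_square)
        then have "norm (x - x\<^sub>0) \<le> T" by (rule power2_le_imp_le) (use T in linarith)
        then have "norm x \<le> norm x\<^sub>0 + T" using norm_triangle_ineq2[of x x\<^sub>0] by linarith
        from M(1)[OF this] show ?thesis by (simp add: b_def)
      qed
      show "h 1 + 1 \<le> V x" if "(norm (x - x\<^sub>0))\<^sup>2 \<le> 1 \<or> T \<le> (norm (x - x\<^sub>0))\<^sup>2" for x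
      proof (rule VR)
        from that show "R \<le> norm x"
        proof
          assume "(norm (x - x\<^sub>0))\<^sup>2 \<le> 1"
          then have "norm (x - x\<^sub>0) \<le> 1" by (simp add: abs_square_le_1)
          then show ?thesis using norm_triangle_ineq2[of x\<^sub>0 x] n0 R by (simp add: norm_minus_commute)
        next
          assume "T \<le> (norm (x - x\<^sub>0))\<^sup>2"
          then have "2 * R + 3 \<le> norm (x - x\<^sub>0)" unfolding T_def by (rule power2_le_imp_le) simp
          then show ?thesis using norm_triangle_ineq4[of x x\<^sub>0] n0 R by linarith
        qed
      qed
    qed
  qed
  then obtain m\<^sub>0 where m\<^sub>0: "\<And>m. m\<^sub>0 \<le> m \<Longrightarrow> shells V h H (H 1) x\<^sub>0 T b m" unfolding eventually_sequentially by blast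
  define L where "L m = a\<^sup>2 * (pi / 2 * real m / (T - 1) * probe_mass x\<^sub>0 T - pi / 4 * (\<integral>x. \<bar>probe_div x\<^sub>0 T x\<bar> \<partial>lborel)
     - sq_norm (\<lambda>x. probe T ((norm (x - x\<^sub>0))\<^sup>2) *\<^sub>R (x - x\<^sub>0)) / 2 - B)" for m
  have "\<exists>u. weak_solution k V f u \<and> L (m\<^sub>0 + n) \<le> energy k V f u" for n
    unfolding k L_def
  proof (rule shells_solution[OF m\<^sub>0 a])
    show "m\<^sub>0 \<le> m\<^sub>0 + n" by simp
    show "f (a * s) = a * h s" "primitive f (a * s) = a\<^sup>2 * H s" for s using a by (simp_all add: h_def H_def)
  qed (rule B)
  then obtain u where u: "\<And>n. weak_solution k V f (u n)" "\<And>n. L (m\<^sub>0 + n) \<le> energy k V f (u n)" by metis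
  have L: "filterlim (\<lambda>n. L (m\<^sub>0 + n)) at_top sequentially"
  proof -
    \<comment> \<open>The lower bound is affine in the number of shells; its slope c is positive
      because the probe has positive mass.\<close>
    define c where "c = a\<^sup>2 * (pi / 2 / (T - 1) * probe_mass x\<^sub>0 T)"
    have c: "0 < c" unfolding c_def using a T probe_mass_pos[OF T, of x\<^sub>0] by simp
    have e: "L m = L 0 + c * real m" for m by (simp add: L_def c_def algebra_simps)
    have "filterlim (\<lambda>m. L 0 + c * real m) at_top sequentially"
      by (rule filterlim_tendsto_add_at_top[OF tendsto_const filterlim_tendsto_pos_mult_at_top[OF tendsto_const c filterlim_real_sequentially]])
    then have "filterlim L at_top sequentially" by (simp add: e[symmetric])
    then show ?thesis by (rule filterlim_compose) (simp add: filterlim_add_const_nat_at_top add.commute[of m\<^sub>0])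
  qed
  have "filterlim (\<lambda>n. energy k V f (u n)) at_top sequentially"
    by (rule filterlim_at_top_mono[OF L]) (use u(2) in \<open>simp add: always_eventually\<close>)
  with u(1) show ?thesis by blast
qed

end
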